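(* Let $d\ge2$ and $d-2\le s<d$, and suppose $\{\omega_{N,d}\}_{N\in\mathbb{N}}$ is a well-separated sequence of $N$-point configurations on $\mathbb{S}^d$. Then there exists a positive constant $c_{s,d}$, depending on the separation constant, such that: (a) If $(s,d)\neq(0,2)$, then for all $N\in\mathbb{N}$ $$P_s(\omega_{N,d})\le I_{s,d}N-c_{s,d}N^{s/d}.$$ (b) If $d=2$ and $s=0$, then for all $N\ge 2$ $$P_0(\omega_{N,2})\le I_{0,2}N+c_{0,2}\Big(-\tfrac12+D(N)\Big)\log N,$$ where $D(N)$ is defined by $E_0(\omega_{N,2})=I_{0,2}N^2-D(N)N\log N$. In particular, (a) and (b) hold when $\omega_{N,d}=\{x_1,\dots,x_N\}$ consists of the first $N$ points of a greedy $s$-energy sequence with $s$ in the prescribed range. Moreover, for greedy $0$-energy sequences on $\mathbb{S}^2$ there are positive constants $C_1,C_2$ with $C_1\le D(N)\le\frac12+\frac{C_2}{\log N}$ for $N\ge2$, so that for some positive constant $c'_{0,2}$, $P_0(\omega_{N,2})\le I_{0,2}N+c'_{0,2}$.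
   Context: $\mathbb{S}^d=\{x\in\mathbb{R}^{d+1}:\|x\|=1\}$ with $\|\cdot\|$ the Euclidean norm; $\sigma$ is the normalized uniform (surface) probability measure on $\mathbb{S}^d$. The Riesz $s$-kernel is $K_s(x,y)=\frac1s\|x-y\|^{-s}$ for $s\ne0$ and $K_0(x,y)=-\log\|x-y\|$ (with value $+\infty$ on the diagonal when $s\ge0$). For $\omega_{N,d}=\{x_1,\dots,x_N\}\subset\mathbb{S}^d$: the energy is $E_s(\omega_{N,d})=\sum_{i\neq j}K_s(x_i,x_j)$ (sum over ordered pairs) and the polarization is $P_s(\omega_{N,d})=\min_{x\in\mathbb{S}^d}\sum_{j=1}^N K_s(x,x_j)$. For $s<d$, $I_{s,d}=\int_{\mathbb{S}^d}\int_{\mathbb{S}^d}K_s(x,y)\,d\sigma(x)\,d\sigma(y)$. A sequence of $N$-point configurations $\{\omega_{N,d}\}_{N\in\mathbb{N}}$ on $\mathbb{S}^d$ is well-separated if there is a constant $c>0$ (the separation constant) such that $\min_{i\neq j}\|x_i-x_j\|\ge cN^{-1/d}$ for the points of $\omega_{N,d}$, for all $N$. A greedy $s$-energy sequence $\{x_n\}_{n\ge1}$ is obtained by taking an arbitrary $x_1\in\mathbb{S}^d$ and, for each $N\ge1$, choosing $x_{N+1}$ to be any minimizer of $x\mapsto\sum_{i=1}^N K_s(x,x_i)$ over $\mathbb{S}^d$. *)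

theory Defs
  imports "HOL-Probability.Probability"
begin

text \<open>
  The normalized surface measure on the unit sphere, as a Borel measure on the ambient space that
  is concentrated on \<^term>\<open>sphere 0 1\<close>: the image of the uniform distribution on the unit ball
  under the radial projection \<open>x \<mapsto> x / \<parallel>x\<parallel>\<close>, which is \<^const>\<open>sgn\<close>. The exceptional
  point 0, where \<^term>\<open>sgn 0 = 0\<close>, has measure zero. Since Lebesgue measure and the ball are rotation
  invariant, so is the image measure.
\<close>

definition sphere_measure :: "'a::euclidean_space measure" where
  "sphere_measure = distr (uniform_measure lborel (ball 0 1)) borel sgn"

lemma measurable_sgn_euclidean [measurable]:
  "(sgn :: 'a::euclidean_space \<Rightarrow> 'a) \<in> borel_measurable borel"
  unfolding sgn_div_norm by measurable

lemma sets_sphere_measure [simp, measurable_cong]: "sets sphere_measure = sets borel"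
  by (simp add: sphere_measure_def)

lemma prob_space_uniform_ball:
  "prob_space (uniform_measure lborel (ball (0::'a::euclidean_space) 1))"
proof (rule prob_space_uniform_measure)
  show "emeasure lborel (ball (0::'a) 1) \<noteq> 0"
    using content_ball_pos[of 1 "0::'a"] by (auto simp: measure_def)
  show "emeasure lborel (ball (0::'a) 1) \<noteq> \<infinity>"
    using emeasure_lborel_ball_finite[of "0::'a" 1] by simp
qed

lemma prob_space_sphere_measure: "prob_space (sphere_measure :: 'a::euclidean_space measure)"
  unfolding sphere_measure_def
  by (intro prob_space.prob_space_distr prob_space_uniform_ball) simp

lemma AE_sphere_measure: "AE x in (sphere_measure :: 'a::euclidean_space measure). x \<in> sphere 0 1"
proof -
  have "AE x in lborel. x \<noteq> (0::'a)"
    by (rule AE_lborel_singleton)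
  hence "AE x in uniform_measure lborel (ball (0::'a) 1). x \<noteq> 0"
    by (intro AE_uniform_measureI) auto
  thus ?thesis
    unfolding sphere_measure_def by (subst AE_distr_iff) (auto simp: norm_sgn)
qed

definition riesz_kernel :: "real \<Rightarrow> 'a::euclidean_space \<Rightarrow> 'a \<Rightarrow> ereal" where
  "riesz_kernel s x y =
     (if s \<ge> 0 \<and> x = y then \<infinity>
      else if s = 0 then ereal (- ln (norm (x - y)))
      else ereal (1 / s * norm (x - y) powr (- s)))"

text \<open>
  \<open>N\<close>-point configurations are families \<open>x 1, \<dots>, x N\<close>; values of \<open>x\<close> outside \<open>{1..N}\<close> are irrelevant.
\<close>

definition riesz_energy :: "real \<Rightarrow> nat \<Rightarrow> (nat \<Rightarrow> 'a::euclidean_space) \<Rightarrow> ereal" where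
  "riesz_energy s N x = (\<Sum>i\<in>{1..N}. \<Sum>j\<in>{1..N} - {i}. riesz_kernel s (x i) (x j))"

definition riesz_potential :: "real \<Rightarrow> nat \<Rightarrow> (nat \<Rightarrow> 'a::euclidean_space) \<Rightarrow> 'a \<Rightarrow> ereal" where
  "riesz_potential s N x p = (\<Sum>j=1..N. riesz_kernel s p (x j))"

text \<open>
  The infimum is a minimum: the potential is lower semicontinuous and the sphere is compact.
\<close>

definition polarization :: "real \<Rightarrow> nat \<Rightarrow> (nat \<Rightarrow> 'a::euclidean_space) \<Rightarrow> ereal" where
  "polarization s N x = (INF p\<in>sphere 0 1. riesz_potential s N x p)"

text \<open>
  The energy integral of the surface measure, for the sphere in the type argument. On the diagonal
  \<^const>\<open>real_of_ereal\<close> replaces the value \<open>\<infinity>\<close> of the kernel by 0; points are null sets of the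
  surface measure (in dimension at least 2).
\<close>

definition riesz_integral :: "'a::euclidean_space itself \<Rightarrow> real \<Rightarrow> real" where
  "riesz_integral _ s =
     (\<integral>x. (\<integral>y. real_of_ereal (riesz_kernel s x (y::'a)) \<partial>sphere_measure) \<partial>sphere_measure)"

text \<open>
  \<open>\<omega> N\<close> is the \<open>N\<close>-th configuration of the sequence, and \<open>c\<close> is a separation constant for it;
  \<open>d\<close> is the dimension of the sphere.
\<close>

definition well_separated :: "nat \<Rightarrow> real \<Rightarrow> (nat \<Rightarrow> nat \<Rightarrow> 'a::euclidean_space) \<Rightarrow> bool" where
  "well_separated d c \<omega> \<longleftrightarrow> c > 0 \<and>
     (\<forall>N\<ge>1. (\<forall>i\<in>{1..N}. \<omega> N i \<in> sphere 0 1) \<and>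
            (\<forall>i\<in>{1..N}. \<forall>j\<in>{1..N}. i \<noteq> j \<longrightarrow>
               norm (\<omega> N i - \<omega> N j) \<ge> c * real N powr (- 1 / real d)))"

definition greedy_sequence :: "real \<Rightarrow> (nat \<Rightarrow> 'a::euclidean_space) \<Rightarrow> bool" where
  "greedy_sequence s x \<longleftrightarrow> x 1 \<in> sphere 0 1 \<and>
     (\<forall>N\<ge>1. is_arg_min (riesz_potential s N x) (\<lambda>p. p \<in> sphere 0 1) (x (N + 1)))"

end

theory Submission
  imports Defs "HOL-Analysis.Generalised_Binomial_Theorem"
begin

text \<open>
  For \<open>s \<ge> d - 2\<close> the kernel is subharmonic away from its pole, so its value at the centre of a small cap that avoids the
  pole is at most a weighted mean over the cap. Put such weights, of mass \<open>m\<close> and height at most \<open>M\<close>, on disjoint caps of radius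
  comparable to \<open>N powr (- 1 / d)\<close> around the points, and integrate the potential against the positive measure
  \<open>M * \<sigma>\<close> minus the sum of the weights. The weights see at least \<open>m\<close> times the energy plus a self-interaction of
  order \<open>m * N powr (1 + s / d)\<close>, which improves the trivial bound \<open>P \<le> I * N\<close> for the minimum \<open>P\<close> of the potential. The
  energy is bounded below by comparison with a positive definite kernel.

  Greedy points are separated by a minimum principle: for \<open>s = d - 2\<close> on a cap, and for \<open>s > d - 2\<close> after extending the
  potential to one more variable by replacing \<open>2 - 2 * (x \<bullet> y)\<close> with \<open>2 * cosh \<eta> - 2 * (x \<bullet> y)\<close>. For \<open>d = 2\<close>, \<open>s = 0\<close> the
  gap \<open>I * N\<^sup>2 - E\<close> of a greedy sequence grows by \<open>I + 2 * (I * N - P)\<close> in each step, and the polarization bound forces it to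
  grow like \<open>N * log N\<close> once it is positive; positivity for small \<open>N\<close> needs explicit constants.
\<close>

section \<open>Invariance of the surface measure and the size of caps\<close>

text \<open>With caps of radius \<open>r = \<epsilon> * N powr (- 1 / d)\<close> the weights carry a
  fraction \<delta> of the mass of \<open>M * \<sigma>\<close> that is at least a constant times
  \<open>\<epsilon> ^ d\<close>, uniformly in N. The integrated inequality reads \<open>P * (1 -
  \<delta>) \<le> I * N - \<delta> * (k (r\<^sup>2) + E / N)\<close>, so everything rests on whether
  the self-interaction \<open>k (r\<^sup>2)\<close> exceeds the energy deficit
  \<open>(I * N\<^sup>2 - E) / N\<close>. For s > 0 both are of order \<open>N powr (s / d)\<close>,
  but the former carries the factor \<open>\<epsilon> powr (- s) / s\<close>, and a small \<epsilon>
  decides. For d = 2, s = 0 shrinking \<epsilon> adds only a constant to \<open>ln N / 2\<close>;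
  the coefficient 1/2 - D(N) survives, which is why that case is separate.

  There I = 1/2 - ln 2 is negative, so the gap of a greedy sequence may drop in each step and the
  trivial bound says nothing about its sign. A quantitative cap inequality has to give
  \<open>I * N - P \<ge> 1 / 10\<close> whenever the gap is small; doubled, this just beats the loss
  of at most 7/36.\<close>

lemma emeasure_orthogonal_image_open:
  fixes g :: "'a::euclidean_space \<Rightarrow> 'a"
  assumes g: "orthogonal_transformation g" and U: "open U"
  shows "emeasure lborel (g ` U) = emeasure lborel U"
proof -
  define K where "K = {(x, r). 0 < r \<and> ball x r \<subseteq> U}"
  have ex: "\<exists>i. i \<in> K \<and> x \<in> ball (fst i) (snd i) \<and> snd i < e" if xU: "x \<in> U" and e: "0 < e" for x e
  proof -
    obtain r where r: "r > 0" "ball x r \<subseteq> U"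
      by (rule openE[OF U xU])
    then have "ball x (min r (e/2)) \<subseteq> U" by auto
    with r xU e show ?thesis
      by (intro exI[of _ "(x, min r (e/2))"]) (auto simp: K_def)
  qed
  \<comment> \<open>Vitali covering: disjoint balls, indexed by centre and radius, exhaust
    \<open>U\<close> up to a negligible set. An orthogonal map carries each ball to a ball of the
    same radius and keeps null sets null, so volumes can be compared ball by ball.\<close>
  obtain C where C: "countable C" "C \<subseteq> K"
    "pairwise (\<lambda>i j. disjnt (ball (fst i) (snd i)) (ball (fst j) (snd j))) C"
    "negligible (U - (\<Union>i \<in> C. ball (fst i) (snd i)))"
    by (rule Vitali_covering_theorem_balls[OF ex]) (assumption | erule (3) that)+
  define V where "V = (\<Union>i \<in> C. ball (fst i) (snd i))"
  have VU: "V \<subseteq> U" using C(2) unfolding V_def K_def by fastforce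
  have oV: "open V" unfolding V_def by (intro open_UN ballI open_ball)
  have lin: "linear g" by (rule orthogonal_transformation_linear[OF g])
  have inj: "inj g" by (rule orthogonal_transformation_inj[OF g])
  have opn: "open (g ` W)" if "open W" for W
    using that open_surjective_linear_image[OF that lin orthogonal_transformation_surj[OF g]] by simp
  have ball: "g ` ball x r = ball (g x) r" for x r
    by (rule image_orthogonal_transformation_ball[OF g])
  have emball: "emeasure lborel (ball (g x) r) = emeasure lborel (ball x r)" for x r
    by (cases "r \<ge> 0") (simp_all add: emeasure_ball ball_empty)
  have null: "emeasure lborel A = emeasure lborel B" if "open A" "open B" "B \<subseteq> A" "negligible (A - B)" for A B :: "'a set"
  proof -
    have "A - B \<in> null_sets lebesgue" using that(4) by (simp add: negligible_iff_null_sets)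
    moreover have "A - B \<in> sets lborel" using that by auto
    ultimately have "A - B \<in> null_sets lborel"
      by (metis null_sets_completion_iff)
    then have "emeasure lborel (B \<union> (A - B)) = emeasure lborel B"
      using that by (intro emeasure_Un_null_set) auto
    moreover have "B \<union> (A - B) = A" using that by auto
    ultimately show ?thesis by simp
  qed
  have neg: "negligible (g ` U - g ` V)"
  proof -
    have "negligible (U - V)" unfolding V_def by (rule C(4))
    moreover have "g differentiable_on (U - V)"
      by (rule bounded_linear_imp_differentiable_on[OF lin[unfolded linear_conv_bounded_linear]])
    ultimately have "negligible (g ` (U - V))"
      by (intro negligible_differentiable_image_negligible[OF order_refl])
    moreover have "g ` U - g ` V = g ` (U - V)"
      by (rule image_set_diff[OF inj, symmetric])
    ultimately show ?thesis by simp
  qed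
  have dj: "disjoint_family_on (\<lambda>i. ball (fst i) (snd i)) C"
    using C(3) by (auto simp: disjoint_family_on_def pairwise_def disjnt_def)
  have dj': "disjoint_family_on (\<lambda>i. ball (g (fst i)) (snd i)) C"
    unfolding disjoint_family_on_def
  proof (intro ballI impI)
    fix p q assume "p \<in> C" "q \<in> C" "p \<noteq> q"
    then have "ball (fst p) (snd p) \<inter> ball (fst q) (snd q) = {}"
      using dj unfolding disjoint_family_on_def by blast
    then show "ball (g (fst p)) (snd p) \<inter> ball (g (fst q)) (snd q) = {}"
      unfolding ball[symmetric] image_Int[OF inj, symmetric] by simp
  qed
  have "emeasure lborel (g ` U) = emeasure lborel (g ` V)"
    by (rule null) (use opn U oV neg VU in auto)
  also have "g ` V = (\<Union>i \<in> C. ball (g (fst i)) (snd i))"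
    unfolding V_def image_UN ball ..
  also have "emeasure lborel \<dots> = (\<integral>\<^sup>+i. emeasure lborel (ball (g (fst i)) (snd i)) \<partial>count_space C)"
    by (rule emeasure_UN_countable) (use C(1) dj' in auto)
  also have "\<dots> = (\<integral>\<^sup>+i. emeasure lborel (ball (fst i) (snd i)) \<partial>count_space C)"
    by (simp only: emball)
  also have "\<dots> = emeasure lborel V"
    unfolding V_def using C(1) dj by (subst emeasure_UN_countable) auto
  also have "\<dots> = emeasure lborel U"
    by (rule null[symmetric]) (use U oV C(4)[folded V_def] VU in auto)
  finally show ?thesis .
qed

lemma borel_measurable_orthogonal:
  fixes f :: "'a::euclidean_space \<Rightarrow> 'a"
  assumes "orthogonal_transformation f"
  shows "f \<in> borel_measurable borel"
  by (intro borel_measurable_continuous_onI linear_continuous_on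
      linear_conv_bounded_linear[THEN iffD1] orthogonal_transformation_linear assms)

text \<open>Lebesgue measure is determined by its values on open boxes, and the preimage of a box is
  an open set obtained by applying the inverse map.\<close>

lemma lborel_distr_orthogonal:
  fixes f :: "'a::euclidean_space \<Rightarrow> 'a"
  assumes f: "orthogonal_transformation f"
  shows "distr lborel borel f = lborel"
proof (rule sym, rule lborel_eqI)
  note [measurable] = borel_measurable_orthogonal[OF f]
  fix l u :: 'a assume lu: "\<And>b. b \<in> Basis \<Longrightarrow> l \<bullet> b \<le> u \<bullet> b"
  have "emeasure (distr lborel borel f) (box l u) = emeasure lborel (f -` box l u)"
    by (subst emeasure_distr) auto
  also have "f -` box l u = inv f ` box l u"
    using orthogonal_transformation_bij[OF f] by (simp add: bij_vimage_eq_inv_image)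
  also have "emeasure lborel \<dots> = emeasure lborel (box l u)"
    by (intro emeasure_orthogonal_image_open orthogonal_transformation_inv f) auto
  also have "\<dots> = (\<Prod>b\<in>Basis. (u - l) \<bullet> b)" using lu by (simp add: emeasure_lborel_box_eq)
  finally show "emeasure (distr lborel borel f) (box l u) = (\<Prod>b\<in>Basis. (u - l) \<bullet> b)" .
qed simp

lemma space_sphere_measure [simp]: "space sphere_measure = UNIV"
  using sets_eq_imp_space_eq[OF sets_sphere_measure] by simp

lemma ball_fmeasurable: "ball (a::'a::euclidean_space) r \<in> fmeasurable lborel"
  using emeasure_lborel_ball_finite[of a r] by (auto simp: fmeasurable_def)

lemma measure_sphere_measure:
  fixes A :: "'a::euclidean_space set"
  assumes "A \<in> sets borel"
  shows "measure sphere_measure A = measure lborel (ball 0 1 \<inter> sgn -` A) / measure lborel (ball (0::'a) 1)"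
proof -
  have s: "sgn -` A \<in> sets borel"
    using measurable_sets[OF measurable_sgn_euclidean assms] by simp
  have "measure sphere_measure A = measure (uniform_measure lborel (ball 0 1)) (sgn -` A)"
    unfolding sphere_measure_def using assms by (subst measure_distr) auto
  also have "\<dots> = measure lborel (ball 0 1 \<inter> sgn -` A) / measure lborel (ball (0::'a) 1)"
    using s emeasure_lborel_ball_finite[of "0::'a" 1] content_ball_pos[of 1 "0::'a"]
    by (intro measure_uniform_measure) (auto simp: measure_def)
  finally show ?thesis .
qed

lemma distr_sphere_measure_orthogonal:
  fixes f :: "'a::euclidean_space \<Rightarrow> 'a"
  assumes f: "orthogonal_transformation f"
  shows "distr sphere_measure borel f = sphere_measure"
proof (rule measure_eqI)
  note [measurable] = borel_measurable_orthogonal[OF f]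
  fix A :: "'a set" assume "A \<in> sets (distr sphere_measure borel f)"
  then have A[measurable]: "A \<in> sets borel" by simp
  have s: "sgn -` A \<in> sets borel"
    using measurable_sets[OF measurable_sgn_euclidean A] by simp
  have fA: "f -` A \<in> sets borel"
    using measurable_sets[OF borel_measurable_orthogonal[OF f] A] by simp
  have sgn_f: "sgn (f w) = f (sgn w)" for w
    using f by (simp add: sgn_div_norm orthogonal_transformation_norm orthogonal_transformation_scaleR)
  have "ball 0 1 \<inter> sgn -` (f -` A) = f -` (ball 0 1 \<inter> sgn -` A)"
    using f by (auto simp: sgn_f orthogonal_transformation_norm)
  then have "measure lborel (ball 0 1 \<inter> sgn -` (f -` A)) = measure (distr lborel borel f) (ball 0 1 \<inter> sgn -` A)"
    using s by (subst measure_distr) auto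
  then have *: "measure sphere_measure (f -` A) = measure sphere_measure A"
    using A fA f by (simp add: measure_sphere_measure lborel_distr_orthogonal)
  interpret prob_space "sphere_measure :: 'a measure" by (rule prob_space_sphere_measure)
  show "emeasure (distr sphere_measure borel f) A = emeasure sphere_measure A"
    using * fA by (subst emeasure_distr) (auto simp: emeasure_eq_measure)
qed simp

lemma integral_sphere_orthogonal:
  fixes g :: "'a::euclidean_space \<Rightarrow> real" and f :: "'a \<Rightarrow> 'a"
  assumes "orthogonal_transformation f" "g \<in> borel_measurable borel"
  shows "(\<integral>z. g (f z) \<partial>sphere_measure) = (\<integral>z. g z \<partial>sphere_measure)"
  using assms borel_measurable_orthogonal[OF assms(1)] distr_sphere_measure_orthogonal[OF assms(1)]
    integral_distr[of f sphere_measure borel g] by (simp cong: measurable_cong_sets)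

lemma integrable_sphere_orthogonal:
  fixes g :: "'a::euclidean_space \<Rightarrow> real" and f :: "'a \<Rightarrow> 'a"
  assumes "orthogonal_transformation f" "g \<in> borel_measurable borel"
  shows "integrable sphere_measure (\<lambda>z. g (f z)) \<longleftrightarrow> integrable sphere_measure g"
  using assms borel_measurable_orthogonal[OF assms(1)] distr_sphere_measure_orthogonal[OF assms(1)]
    integrable_distr_eq[of f sphere_measure borel g] by (simp cong: measurable_cong_sets)

text \<open>Some orthogonal map takes \<open>y\<close> to \<open>x\<close>, and the surface measure
  is invariant under it.\<close>

lemma zonal_integral_eq:
  fixes x y :: "real^'n" and h :: "real \<Rightarrow> real"
  assumes "norm x = 1" "norm y = 1" "h \<in> borel_measurable borel"
  shows "(\<integral>z. h (x \<bullet> z) \<partial>sphere_measure) = (\<integral>z. h (y \<bullet> z) \<partial>sphere_measure)"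
proof -
  obtain f where f: "orthogonal_transformation f" "f y = x"
    using orthogonal_transformation_exists[of y x] assms by auto
  have "(\<integral>z. h (x \<bullet> z) \<partial>sphere_measure) = (\<integral>z. h (x \<bullet> f z) \<partial>sphere_measure)"
    using assms(3)
    by (intro integral_sphere_orthogonal[OF f(1), symmetric] measurable_compose[of "\<lambda>z. x \<bullet> z" _ _ h]) auto
  also have "\<dots> = (\<integral>z. h (y \<bullet> z) \<partial>sphere_measure)"
    using f by (auto simp: orthogonal_transformation_def)
  finally show ?thesis .
qed

text \<open>The cone over a cap of radius r inside the unit ball is covered by about 1/r balls of
  radius 2r centred on the axis, each of volume proportional to \<open>r ^ (d + 1)\<close>. For r
  \<ge> 1 the constant alone exceeds the total mass.\<close>

lemma measure_cap_le:
  assumes d: "DIM('a::euclidean_space) = d + 1"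
  obtains C where "C > 0" "\<And>(x::'a) r. norm x = 1 \<Longrightarrow> r > 0 \<Longrightarrow> measure sphere_measure {z. norm (z - x) < r} \<le> C * r ^ d"
proof -
  define v where "v = measure lborel (ball (0::'a) 1)"
  have v: "v > 0" by (simp add: v_def content_ball_pos)
  have cb: "measure lborel (ball (a::'a) r) = r ^ (d + 1) * v" if "r \<ge> 0" for a r
    using that content_ball_conv_unit_ball[of r a] d by (simp add: v_def)
  interpret prob_space "sphere_measure :: 'a measure" by (rule prob_space_sphere_measure)
  have main: "measure sphere_measure {z. norm (z - x) < r} \<le> 2 ^ (d + 2) * r ^ d" if x: "norm (x::'a) = 1" and r: "r > 0" for x r
  proof (cases "r \<ge> 1")
    case True
    have "measure sphere_measure {z. norm (z - x) < r} \<le> 1" by simp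
    also have "(1::real) \<le> 2 ^ (d + 2) * r ^ d"
      using mult_mono[of 1 "(2::real) ^ (d+2)" 1 "r ^ d"] True by (simp add: one_le_power del: power_Suc)
    finally show ?thesis .
  next
    case False
    define A where "A = {z::'a. norm (z - x) < r}"
    have oA: "open A" unfolding A_def by (intro open_Collect_less continuous_intros)
    define K where "K = nat \<lfloor>1 / r\<rfloor>"
    have sub: "ball 0 1 \<inter> sgn -` A \<subseteq> (\<Union>k\<in>{0..K}. ball ((real k * r) *\<^sub>R x) (2 * r))"
    proof
      fix w assume w: "w \<in> ball 0 1 \<inter> sgn -` A"
      define k where "k = nat \<lfloor>norm w / r\<rfloor>"
      have k1: "real k \<le> norm w / r" "norm w / r < real k + 1"
        using r by (auto simp: k_def)
      have "norm w / r \<le> 1 / r" using w r by (simp add: divide_right_mono)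
      then have "k \<le> K" unfolding k_def K_def by (intro nat_mono floor_mono)
      moreover have "norm (w - (real k * r) *\<^sub>R x) < 2 * r"
      proof -
        have e1: "norm (w - norm w *\<^sub>R x) < r"
        proof (cases "w = 0")
          case False
          have "w - norm w *\<^sub>R x = norm w *\<^sub>R (sgn w - x)"
            using False by (simp add: sgn_div_norm algebra_simps)
          then have "norm (w - norm w *\<^sub>R x) = norm w * norm (sgn w - x)" by simp
          also have "\<dots> \<le> 1 * norm (sgn w - x)"
            using w by (intro mult_right_mono) auto
          also have "\<dots> < r" using w by (auto simp: A_def)
          finally show ?thesis .
        qed (use r in simp)
        have "norm (w - (real k * r) *\<^sub>R x) \<le> norm (w - norm w *\<^sub>R x) + norm (norm w *\<^sub>R x - (real k * r) *\<^sub>R x)"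
          using dist_triangle[of w "(real k * r) *\<^sub>R x" "norm w *\<^sub>R x"] by (simp add: dist_norm)
        also have "norm (norm w *\<^sub>R x - (real k * r) *\<^sub>R x) = \<bar>norm w - real k * r\<bar>"
          using x by (simp flip: scaleR_diff_left)
        also have "\<bar>norm w - real k * r\<bar> \<le> r"
          using k1 r by (auto simp: field_simps abs_if)
        finally show ?thesis using e1 by simp
      qed
      ultimately show "w \<in> (\<Union>k\<in>{0..K}. ball ((real k * r) *\<^sub>R x) (2 * r))"
        by (auto simp: dist_norm norm_minus_commute)
    qed
    have "measure lborel (ball 0 1 \<inter> sgn -` A) \<le> measure lborel (\<Union>k\<in>{0..K}. ball ((real k * r) *\<^sub>R x) (2 * r))"
    proof (rule measure_mono_fmeasurable[OF sub])
      show "ball 0 1 \<inter> sgn -` A \<in> sets lborel"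
        using measurable_sets[OF measurable_sgn_euclidean, of A] oA by auto
      show "(\<Union>k\<in>{0..K}. ball ((real k * r) *\<^sub>R x) (2 * r)) \<in> fmeasurable lborel"
        by (intro fmeasurable.finite_UN ball_fmeasurable) auto
    qed
    also have "\<dots> \<le> (\<Sum>k\<in>{0..K}. measure lborel (ball ((real k * r) *\<^sub>R x) (2 * r)))"
      by (rule measure_UNION_le) auto
    also have "\<dots> = (real K + 1) * ((2 * r) ^ (d + 1) * v)"
      using r by (subst sum.cong[OF refl cb]) auto
    also have "real K \<le> 1 / r" using r by (simp add: K_def)
    also have "1 / r + 1 \<le> 2 / r" using False r by (simp add: field_simps)
    finally have "measure lborel (ball 0 1 \<inter> sgn -` A) \<le> 2 / r * ((2 * r) ^ (d + 1) * v)"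
      using r v by (simp add: mult_right_mono)
    then have "measure lborel (ball 0 1 \<inter> sgn -` A) / v \<le> 2 / r * ((2 * r) ^ (d + 1))"
      by (simp only: pos_divide_le_eq[OF v] mult.assoc)
    also have "\<dots> = 2 ^ (d + 2) * r ^ d" using r by (simp add: field_simps power_mult_distrib)
    finally show ?thesis
      using oA by (simp add: measure_sphere_measure A_def[symmetric] v_def)
  qed
  show ?thesis by (rule that[of "2 ^ (d + 2)"]) (use main in auto)
qed

lemma norm_sgn_diff_le:
  fixes w x :: "'a::real_normed_vector"
  assumes "norm x = 1" "t > 0" "norm (w - t *\<^sub>R x) \<le> \<rho>" "w \<noteq> 0"
  shows "norm (sgn w - x) \<le> 2 * \<rho> / t"
proof -
  have "t *\<^sub>R (sgn w - x) = (t - norm w) *\<^sub>R sgn w + (w - t *\<^sub>R x)"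
    using assms(4) by (simp add: sgn_div_norm algebra_simps)
  then have "norm (t *\<^sub>R (sgn w - x)) \<le> norm ((t - norm w) *\<^sub>R sgn w) + norm (w - t *\<^sub>R x)"
    using norm_triangle_ineq by metis
  also have "norm ((t - norm w) *\<^sub>R sgn w) = \<bar>norm (t *\<^sub>R x) - norm w\<bar>"
    using assms by (simp add: norm_sgn)
  also have "\<dots> \<le> norm (w - t *\<^sub>R x)" by (metis norm_minus_commute norm_triangle_ineq3)
  finally have "t * norm (sgn w - x) \<le> 2 * \<rho>" using assms by simp
  then show ?thesis using assms by (simp add: field_simps)
qed

text \<open>Dual to the upper bound: about 1/r disjoint balls of radius r/8, with centres on the
  axis between 1/2 and 3/4, fit into the cone over the cap, because radial projection at that height
  enlarges distances from the axis only by a bounded factor.\<close>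

lemma measure_cap_ge:
  assumes d: "DIM('a::euclidean_space) = d + 1"
  obtains c where "c > 0" "\<And>(x::'a) r. norm x = 1 \<Longrightarrow> 0 < r \<Longrightarrow> r \<le> 1 \<Longrightarrow> c * r ^ d \<le> measure sphere_measure {z. norm (z - x) < r}"
proof -
  define v where "v = measure lborel (ball (0::'a) 1)"
  have v: "v > 0" by (simp add: v_def content_ball_pos)
  have cb: "measure lborel (ball (a::'a) r) = r ^ (d + 1) * v" if "r \<ge> 0" for a r
    using that content_ball_conv_unit_ball[of r a] d by (simp add: v_def)
  have main: "1 / (2 * 8 ^ (d + 1)) * r ^ d \<le> measure sphere_measure {z. norm (z - x) < r}"
    if x: "norm (x::'a) = 1" and r: "0 < r" "r \<le> 1" for x r
  proof -
    define A where "A = {z::'a. norm (z - x) < r}"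
    have oA: "open A" unfolding A_def by (intro open_Collect_less continuous_intros)
    define \<rho> where "\<rho> = r / 8"
    define K where "K = nat \<lfloor>1 / r\<rfloor>"
    define t where "t k = 1/2 + 2 * \<rho> * real k" for k
    have K: "real K \<le> 1 / r" using r by (simp add: K_def)
    have tk: "1/2 \<le> t k" "t k \<le> 3/4" if "k < K" for k
    proof -
      have "\<rho> * real k \<le> \<rho> * (1 / r)" using that K r by (intro mult_left_mono) (auto simp: \<rho>_def)
      then show "1/2 \<le> t k" "t k \<le> 3/4" using r by (auto simp: t_def \<rho>_def)
    qed
    define B where "B k = ball (t k *\<^sub>R x) \<rho>" for k
    have sub: "(\<Union>k\<in>{..<K}. B k) \<subseteq> ball 0 1 \<inter> sgn -` A"
    proof
      fix w assume "w \<in> (\<Union>k\<in>{..<K}. B k)"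
      then obtain k where k: "k < K" and "w \<in> B k" by auto
      then have w: "norm (w - t k *\<^sub>R x) < \<rho>" by (simp add: B_def dist_norm norm_minus_commute)
      have "norm w \<le> norm (w - t k *\<^sub>R x) + norm (t k *\<^sub>R x)" by (metis add.commute norm_triangle_sub)
      then have w1: "w \<in> ball 0 1" using w tk[OF k] x r by (auto simp: \<rho>_def)
      have "norm (t k *\<^sub>R x) \<le> norm (w - t k *\<^sub>R x) + norm w" by (metis add.commute norm_minus_commute norm_triangle_sub)
      then have "w \<noteq> 0" using w tk[OF k] x r by (auto simp: \<rho>_def)
      have "norm (sgn w - x) \<le> 2 * \<rho> / t k"
        using w tk[OF k] x \<open>w \<noteq> 0\<close> by (intro norm_sgn_diff_le) auto
      also have "\<dots> \<le> 2 * \<rho> / (1/2)" using tk[OF k] r by (intro divide_left_mono) (auto simp: \<rho>_def)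
      also have "\<dots> < r" using r by (simp add: \<rho>_def)
      finally show "w \<in> ball 0 1 \<inter> sgn -` A" using w1 by (simp add: A_def)
    qed
    have Bm: "B k \<in> fmeasurable lborel" for k by (simp add: B_def ball_fmeasurable)
    have dj: "disjoint_family_on B {..<K}"
      unfolding disjoint_family_on_def
    proof safe
      fix k l w assume kl: "k < K" "l < K" "k \<noteq> l" and w: "w \<in> B k" "w \<in> B l"
      have "dist (t k *\<^sub>R x) (t l *\<^sub>R x) < 2 * \<rho>"
        using w dist_triangle2[of "t k *\<^sub>R x" "t l *\<^sub>R x" w] by (auto simp: B_def dist_commute)
      also have "dist (t k *\<^sub>R x) (t l *\<^sub>R x) = 2 * \<rho> * \<bar>real k - real l\<bar>"
      proof -
        have "t k *\<^sub>R x - t l *\<^sub>R x = (2 * \<rho> * (real k - real l)) *\<^sub>R x"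
          by (simp add: t_def algebra_simps)
        then show ?thesis using x r by (simp add: dist_norm abs_mult \<rho>_def)
      qed
      finally have "\<bar>real k - real l\<bar> < 1" using r by (simp add: \<rho>_def)
      then show "w \<in> {}" using kl(3) by linarith
    qed
    have "1 / r < real K + 1" using r by (simp add: K_def)
    moreover have "1 \<le> 1 / r" using r by simp
    then have "K \<ge> 1" unfolding K_def by linarith
    ultimately have "1 / (2 * r) \<le> real K" by (simp add: field_simps)
    then have "1 / (2 * r) * (\<rho> ^ (d + 1) * v) \<le> real K * (\<rho> ^ (d + 1) * v)"
      using v r by (intro mult_right_mono) (auto simp: \<rho>_def)
    also have "\<dots> = (\<Sum>k<K. measure lborel (B k))"
      using r by (simp add: B_def cb \<rho>_def del: power_Suc)
    also have "\<dots> = measure lborel (\<Union>k\<in>{..<K}. B k)"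
      by (rule measure_finite_Union[symmetric])
        (use dj Bm in \<open>auto simp: fmeasurable_def less_top[symmetric]\<close>)
    also have "\<dots> \<le> measure lborel (ball 0 1 \<inter> sgn -` A)"
    proof (rule measure_mono_fmeasurable[OF sub])
      have "ball 0 1 \<inter> sgn -` A \<in> sets lborel"
        using measurable_sets[OF measurable_sgn_euclidean, of A] oA by auto
      then show "ball 0 1 \<inter> sgn -` A \<in> fmeasurable lborel"
        by (auto intro: fmeasurableI2[OF ball_fmeasurable[of 0 1]])
    qed (auto simp: B_def)
    finally have "1 / (2 * r) * \<rho> ^ (d + 1) \<le> measure lborel (ball 0 1 \<inter> sgn -` A) / v"
      by (simp only: pos_le_divide_eq[OF v] mult.assoc)
    also have "\<dots> = measure sphere_measure A" using oA by (simp add: measure_sphere_measure v_def)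
    also have "1 / (2 * r) * \<rho> ^ (d + 1) = 1 / (2 * 8 ^ (d + 1)) * r ^ d"
      using r by (simp add: \<rho>_def power_divide)
    finally show ?thesis by (simp add: A_def)
  qed
  show ?thesis by (rule that[of "1 / (2 * 8 ^ (d + 1))"]) (use main in auto)
qed

section \<open>Rotations and Green's formula for zonal functions\<close>

text \<open>For \<open>i \<noteq> j\<close> this is the rotation by \<theta> in the coordinate plane
  of i and j, written as a perturbation of the identity so that inner products with a fixed vector
  become explicit trigonometric expressions.\<close>

definition rot :: "'n::finite \<Rightarrow> 'n \<Rightarrow> real \<Rightarrow> real^'n \<Rightarrow> real^'n" where
  "rot i j \<theta> z = z + (((cos \<theta> - 1) * z$i - sin \<theta> * z$j) *\<^sub>R axis i 1
                     + (sin \<theta> * z$i + (cos \<theta> - 1) * z$j) *\<^sub>R axis j 1)"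

text \<open>The derivative of \<open>z \<bullet> x\<close> along that rotation, that is, an
  infinitesimal rotation applied to a linear function. The squares of these operators, summed over
  all ordered pairs of coordinates, give twice the spherical Laplacian.\<close>

definition rot_deriv :: "'n::finite \<Rightarrow> 'n \<Rightarrow> real^'n \<Rightarrow> real^'n \<Rightarrow> real" where
  "rot_deriv i j x z = z$i * x$j - z$j * x$i"

lemma inner_rot:
  "rot i j \<theta> z \<bullet> x = z \<bullet> x + (cos \<theta> - 1) * (z$i * x$i + z$j * x$j) + sin \<theta> * rot_deriv i j x z"
  by (simp add: rot_def rot_deriv_def inner_add_left inner_axis' algebra_simps)

lemma rot_nth:
  assumes "i \<noteq> j"
  shows "rot i j \<theta> z $ i = cos \<theta> * z$i - sin \<theta> * z$j" "rot i j \<theta> z $ j = sin \<theta> * z$i + cos \<theta> * z$j"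
  using assms by (simp_all add: rot_def axis_def algebra_simps)

lemma rot_0 [simp]: "rot i j 0 z = z"
  by (simp add: rot_def)

lemma linear_rot: "linear (rot i j \<theta>)"
  by (rule linearI) (simp_all add: rot_def algebra_simps scaleR_add_left scaleR_diff_left)

lemma orthogonal_transformation_rot:
  assumes "i \<noteq> j"
  shows "orthogonal_transformation (rot i j \<theta>)"
  unfolding orthogonal_transformation_def
proof (intro conjI linear_rot allI)
  fix v w :: "real^'a"
  have sc: "sin \<theta> * sin \<theta> + cos \<theta> * cos \<theta> - 1 = 0"
    using sin_cos_squared_add[of \<theta>] by (simp add: power2_eq_square)
  have "rot i j \<theta> v \<bullet> rot i j \<theta> w = rot i j \<theta> w \<bullet> v + (cos \<theta> - 1) * (v$i * rot i j \<theta> w$i + v$j * rot i j \<theta> w$j)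
      + sin \<theta> * (v$i * rot i j \<theta> w$j - v$j * rot i j \<theta> w$i)"
    by (subst inner_rot) (simp add: rot_deriv_def inner_commute)
  also have "\<dots> = v \<bullet> w"
    unfolding inner_rot rot_nth[OF assms] rot_deriv_def inner_commute[of w v] using sc by algebra
  finally show "rot i j \<theta> v \<bullet> rot i j \<theta> w = v \<bullet> w" .
qed

lemma norm_rot: "i \<noteq> j \<Longrightarrow> norm (rot i j \<theta> z) = norm z"
  by (rule orthogonal_transformation_norm[OF orthogonal_transformation_rot])

lemma has_real_derivative_rot_inner:
  assumes "i \<noteq> j"
  shows "((\<lambda>\<theta>. rot i j \<theta> z \<bullet> x) has_real_derivative rot_deriv i j x (rot i j \<theta> z)) (at \<theta>)"
  unfolding inner_rot rot_deriv_def[of i j x "rot i j \<theta> z"] rot_nth[OF assms]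
  by (auto intro!: derivative_eq_intros simp: rot_deriv_def algebra_simps)

lemma has_real_derivative_rot_deriv:
  assumes "i \<noteq> j"
  shows "((\<lambda>\<theta>. rot_deriv i j x (rot i j \<theta> z)) has_real_derivative
      - (rot i j \<theta> z $ i * x$i + rot i j \<theta> z $ j * x$j)) (at \<theta>)"
  unfolding rot_deriv_def rot_nth[OF assms]
  by (auto intro!: derivative_eq_intros simp: algebra_simps)

lemma integrable_sphere_bounded:
  fixes g :: "'a::euclidean_space \<Rightarrow> real"
  assumes "g \<in> borel_measurable borel" "\<And>z. norm z = 1 \<Longrightarrow> \<bar>g z\<bar> \<le> M"
  shows "integrable sphere_measure g"
proof -
  interpret prob_space "sphere_measure :: 'a measure" by (rule prob_space_sphere_measure)
  show ?thesis
    by (rule integrable_const_bound[of _ M])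
      (use assms AE_sphere_measure[where 'a='a] in \<open>auto elim: AE_mp simp: measurable_cong_sets[OF sets_sphere_measure]\<close>)
qed

text \<open>By invariance every difference quotient of \<open>g\<close> along the rotation has
  integral 0. The mean value theorem bounds these quotients by the bound for \<open>Lg\<close>, so
  dominated convergence passes to the limit.\<close>

lemma integral_rot_deriv_eq_0:
  fixes g Lg :: "real^'n \<Rightarrow> real"
  assumes ij: "i \<noteq> j" and [measurable]: "g \<in> borel_measurable borel" "Lg \<in> borel_measurable borel"
    and der: "\<And>z \<theta>. norm z = 1 \<Longrightarrow> ((\<lambda>\<theta>. g (rot i j \<theta> z)) has_real_derivative Lg (rot i j \<theta> z)) (at \<theta>)"
    and bd: "\<And>z. norm z = 1 \<Longrightarrow> \<bar>Lg z\<bar> \<le> M" "\<And>z. norm z = 1 \<Longrightarrow> \<bar>g z\<bar> \<le> M'"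
  shows "(\<integral>z. Lg z \<partial>sphere_measure) = 0"
proof -
  interpret prob_space "sphere_measure :: (real^'n) measure" by (rule prob_space_sphere_measure)
  define h where "h n = 1 / (real n + 1)" for n
  have hp: "h n > 0" for n by (simp add: h_def)
  have h0: "h \<longlonglongrightarrow> 0" unfolding h_def by real_asymp
  note or = orthogonal_transformation_rot[OF ij]
  have [measurable]: "rot i j \<theta> \<in> borel_measurable borel" for \<theta>
    by (rule borel_measurable_orthogonal[OF or])
  define u where "u n z = (g (rot i j (h n) z) - g z) / h n" for n z
  have [measurable]: "u n \<in> borel_measurable borel" for n unfolding u_def by measurable
  have ig: "integrable sphere_measure g"
    by (rule integrable_sphere_bounded[OF _ bd(2)]) auto
  have ig': "integrable sphere_measure (\<lambda>z. g (rot i j \<theta> z))" for \<theta>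
    using ig integrable_sphere_orthogonal[OF or] by simp
  have u0: "(\<integral>z. u n z \<partial>sphere_measure) = 0" for n
    unfolding u_def using ig ig' integral_sphere_orthogonal[OF or, of g] by simp
  have ulim: "(\<lambda>n. u n z) \<longlonglongrightarrow> Lg z" if "norm z = 1" for z
  proof -
    have "((\<lambda>t. (g (rot i j t z) - g z) / t) \<longlongrightarrow> Lg z) (at 0)"
      using der[OF that, of 0] by (simp add: has_field_derivative_iff)
    moreover have "filterlim h (at 0) sequentially"
      using h0 hp by (intro filterlim_atI) (auto simp: less_le)
    ultimately show ?thesis unfolding u_def by (rule filterlim_compose)
  qed
  have ubd: "\<bar>u n z\<bar> \<le> M" if z: "norm z = 1" for n z
  proof -
    obtain t where t: "0 < t" "t < h n" "g (rot i j (h n) z) - g (rot i j 0 z) = (h n - 0) * Lg (rot i j t z)"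
      using MVT2[of 0 "h n" "\<lambda>t. g (rot i j t z)" "\<lambda>t. Lg (rot i j t z)"] hp[of n] der[OF z] by auto
    then have "u n z = Lg (rot i j t z)" using hp[of n] by (simp add: u_def)
    then show ?thesis using bd(1) z by (simp add: norm_rot[OF ij])
  qed
  have "(\<lambda>n. \<integral>z. u n z \<partial>sphere_measure) \<longlonglongrightarrow> (\<integral>z. Lg z \<partial>sphere_measure)"
  proof (rule integral_dominated_convergence[of _ _ _ "\<lambda>_. M"])
    show "AE z in sphere_measure. (\<lambda>n. u n z) \<longlonglongrightarrow> Lg z"
      using AE_sphere_measure[where 'a="real^'n"] by eventually_elim (use ulim in auto)
    show "AE z in sphere_measure. norm (u n z) \<le> M" for n
      using AE_sphere_measure[where 'a="real^'n"] by eventually_elim (use ubd in auto)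
  qed (auto simp: measurable_cong_sets[OF sets_sphere_measure])
  then show ?thesis by (simp add: u0 LIMSEQ_const_iff)
qed

text \<open>Polarized Lagrange identity. For unit z the right-hand side is twice the inner product
  of the tangential gradients of the two linear functions.\<close>

lemma sum_rot_deriv_mult:
  "(\<Sum>i\<in>UNIV. \<Sum>j\<in>UNIV. rot_deriv i j x z * rot_deriv i j y z) = 2 * ((z \<bullet> z) * (x \<bullet> y) - (z \<bullet> x) * (z \<bullet> y))"
proof -
  have "(\<Sum>i\<in>UNIV. \<Sum>j\<in>UNIV. rot_deriv i j x z * rot_deriv i j y z) =
     (\<Sum>i\<in>UNIV. \<Sum>j\<in>UNIV. (z$i * z$i) * (x$j * y$j) + (x$i * y$i) * (z$j * z$j)
        - (z$i * x$i) * (z$j * y$j) - (z$i * y$i) * (z$j * x$j))"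
    by (simp add: rot_deriv_def algebra_simps)
  also have "\<dots> = 2 * ((z \<bullet> z) * (x \<bullet> y) - (z \<bullet> x) * (z \<bullet> y))"
    by (simp add: sum.distrib sum_subtractf inner_vec_def flip: sum_product)
  finally show ?thesis .
qed

lemma sum_offdiag:
  fixes z y :: "real^'n"
  shows "(\<Sum>i\<in>UNIV. \<Sum>j\<in>UNIV. if i = j then 0 else z$i * y$i + z$j * y$j) = 2 * (real CARD('n) - 1) * (z \<bullet> y)"
proof -
  have "(\<Sum>i\<in>UNIV. \<Sum>j\<in>UNIV. if i = j then 0 else z$i * y$i + z$j * y$j)
     = (\<Sum>i\<in>UNIV. \<Sum>j\<in>UNIV. (z$i * y$i + z$j * y$j) - (if j = i then 2 * (z$i * y$i) else 0))"
    by (intro sum.cong) auto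
  also have "\<dots> = (\<Sum>i\<in>UNIV. real CARD('n) * (z$i * y$i) + z \<bullet> y - 2 * (z$i * y$i))"
    by (simp add: sum_subtractf sum.distrib inner_vec_def)
  also have "\<dots> = real CARD('n) * (z \<bullet> y) + real CARD('n) * (z \<bullet> y) - 2 * (z \<bullet> y)"
    by (simp add: sum_subtractf sum.distrib inner_vec_def flip: sum_distrib_left)
  finally show ?thesis by (simp add: algebra_simps)
qed

text \<open>Collects second-order terms over all coordinate planes: \<open>a\<close> goes with the
  product of two gradients, \<open>b\<close> and \<open>c\<close> with the second and first
  derivative of a function of \<open>z \<bullet> y\<close>, whose spherical Laplacian they
  assemble.\<close>

lemma sum_laplace:
  fixes z x y :: "real^'n"
  assumes "norm z = 1"
  shows "(\<Sum>i\<in>UNIV. \<Sum>j\<in>UNIV. if i = j then 0 else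
       a * (rot_deriv i j x z * rot_deriv i j y z) + b * (rot_deriv i j y z * rot_deriv i j y z) - c * (z$i * y$i + z$j * y$j))
     = 2 * (a * ((x \<bullet> y) - (z \<bullet> x) * (z \<bullet> y)) + b * ((y \<bullet> y) - (z \<bullet> y)\<^sup>2) - c * ((real CARD('n) - 1) * (z \<bullet> y)))"
proof -
  have zz: "z \<bullet> z = 1" using assms by (simp add: dot_square_norm)
  have "(\<Sum>i\<in>UNIV. \<Sum>j\<in>UNIV. if i = j then 0 else
       a * (rot_deriv i j x z * rot_deriv i j y z) + b * (rot_deriv i j y z * rot_deriv i j y z) - c * (z$i * y$i + z$j * y$j))
    = (\<Sum>i\<in>UNIV. \<Sum>j\<in>UNIV. a * (rot_deriv i j x z * rot_deriv i j y z) + b * (rot_deriv i j y z * rot_deriv i j y z)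
         - c * (if i = j then 0 else z$i * y$i + z$j * y$j))"
    by (intro sum.cong) (auto simp: rot_deriv_def)
  also have "\<dots> = a * (\<Sum>i\<in>UNIV. \<Sum>j\<in>UNIV. rot_deriv i j x z * rot_deriv i j y z)
       + b * (\<Sum>i\<in>UNIV. \<Sum>j\<in>UNIV. rot_deriv i j y z * rot_deriv i j y z)
       - c * (\<Sum>i\<in>UNIV. \<Sum>j\<in>UNIV. if i = j then 0 else z$i * y$i + z$j * y$j)"
    by (simp only: sum_subtractf sum.distrib sum_distrib_left)
  finally show ?thesis
    by (simp add: sum_rot_deriv_mult sum_offdiag zz power2_eq_square algebra_simps)
qed

text \<open>Inner products of unit vectors stay in [-1, 1], so derivatives within the interval
  suffice; the clamped primitive in \<open>cap_green\<close> has no more than that at its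
  ends.\<close>

lemma has_real_derivative_compose_unit_interval:
  fixes x z :: "real^'n"
  assumes ij: "i \<noteq> j" and "norm z = 1" "norm x = 1"
    and der: "\<And>t. t \<in> {-1..1} \<Longrightarrow> (f has_real_derivative f' t) (at t within {-1..1})"
  shows "((\<lambda>\<theta>. f (rot i j \<theta> z \<bullet> x)) has_real_derivative f' (rot i j \<theta> z \<bullet> x) * rot_deriv i j x (rot i j \<theta> z)) (at \<theta>)"
proof -
  have "rot i j t z \<bullet> x \<in> {-1..1}" for t
    using Cauchy_Schwarz_ineq2[of "rot i j t z" x] assms(2,3) by (auto simp: norm_rot[OF ij] abs_le_iff)
  then have "range (\<lambda>\<theta>. rot i j \<theta> z \<bullet> x) \<subseteq> {-1..1}" "rot i j \<theta> z \<bullet> x \<in> {-1..1}" by auto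
  then show ?thesis
    using DERIV_image_chain[OF has_field_derivative_subset[OF der] has_real_derivative_rot_inner[OF ij]]
    by (simp add: o_def)
qed

text \<open>Green's formula: \<open>F1\<close> stands for the derivative of a zonal profile F, and
  the integrand is the divergence of \<open>f\<close> times the gradient of F. It results from
  applying \<open>integral_rot_deriv_eq_0\<close> to \<open>f * F1 * rot_deriv i j y\<close> in
  every coordinate plane and adding up.\<close>

lemma green_zonal:
  fixes x y :: "real^'n" and f f' F1 F2 :: "real \<Rightarrow> real"
  assumes n: "norm x = 1" "norm y = 1"
    and f: "\<And>t. t \<in> {-1..1} \<Longrightarrow> (f has_real_derivative f' t) (at t within {-1..1})"
    and F: "\<And>t. t \<in> {-1..1} \<Longrightarrow> (F1 has_real_derivative F2 t) (at t within {-1..1})"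
    and cont: "continuous_on {-1..1} f'" "continuous_on {-1..1} F2"
    and [measurable]: "f \<in> borel_measurable borel" "f' \<in> borel_measurable borel"
      "F1 \<in> borel_measurable borel" "F2 \<in> borel_measurable borel"
  shows "(\<integral>z. f' (z \<bullet> x) * F1 (z \<bullet> y) * ((x \<bullet> y) - (z \<bullet> x) * (z \<bullet> y))
       + f (z \<bullet> x) * ((1 - (z \<bullet> y)\<^sup>2) * F2 (z \<bullet> y) - (real CARD('n) - 1) * (z \<bullet> y) * F1 (z \<bullet> y)) \<partial>sphere_measure) = 0"
proof -
  have bd: "\<exists>B. \<forall>t\<in>{-1..1}. \<bar>g t\<bar> \<le> B" if "continuous_on {-1..1::real} g" for g :: "real \<Rightarrow> real"
    using compact_imp_bounded[OF compact_continuous_image[OF that]] by (auto simp: bounded_iff)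
  have "continuous_on {-1..1} f" "continuous_on {-1..1} F1"
    using DERIV_continuous_on[OF f] DERIV_continuous_on[OF F] by auto
  with cont bd obtain B1 B2 B3 B4 where B: "\<And>t. t \<in> {-1..1} \<Longrightarrow> \<bar>f t\<bar> \<le> B1" "\<And>t. t \<in> {-1..1} \<Longrightarrow> \<bar>f' t\<bar> \<le> B2"
    "\<And>t. t \<in> {-1..1} \<Longrightarrow> \<bar>F1 t\<bar> \<le> B3" "\<And>t. t \<in> {-1..1} \<Longrightarrow> \<bar>F2 t\<bar> \<le> B4"
    by meson
  have inn: "z \<bullet> x \<in> {-1..1}" "z \<bullet> y \<in> {-1..1}" if "norm z = 1" for z
    using Cauchy_Schwarz_ineq2[of z x] Cauchy_Schwarz_ineq2[of z y] that n by (auto simp: abs_le_iff)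
  have nth: "\<bar>z $ i\<bar> \<le> 1" if "norm z = 1" for z :: "real^'n" and i
    using component_le_norm_cart[of z i] that by simp
  have B0: "B1 \<ge> 0" "B2 \<ge> 0" "B3 \<ge> 0" "B4 \<ge> 0" using B[of 0] by auto
  have rd: "\<bar>rot_deriv i j w z\<bar> \<le> 2" if "norm z = 1" "norm w = 1" for z w :: "real^'n" and i j
  proof -
    have "\<bar>z$i * w$j\<bar> \<le> 1 * 1" "\<bar>z$j * w$i\<bar> \<le> 1 * 1"
      unfolding abs_mult by (intro mult_mono nth that; simp)+
    then show ?thesis unfolding rot_deriv_def by linarith
  qed
  have ad: "\<bar>z$i * w$i + z$j * w$j\<bar> \<le> 2" if "norm z = 1" "norm w = 1" for z w :: "real^'n" and i j
  proof -
    have "\<bar>z$i * w$i\<bar> \<le> 1 * 1" "\<bar>z$j * w$j\<bar> \<le> 1 * 1"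
      unfolding abs_mult by (intro mult_mono nth that; simp)+
    then show ?thesis by linarith
  qed
  define L where "L i j z = (if i = j then 0 else
       (f' (z \<bullet> x) * F1 (z \<bullet> y)) * (rot_deriv i j x z * rot_deriv i j y z)
     + (f (z \<bullet> x) * F2 (z \<bullet> y)) * (rot_deriv i j y z * rot_deriv i j y z)
     - (f (z \<bullet> x) * F1 (z \<bullet> y)) * (z$i * y$i + z$j * y$j))" for i j :: 'n and z
  have mnth[measurable]: "(\<lambda>z::real^'n. z $ i) \<in> borel_measurable borel" for i
    by (intro borel_measurable_continuous_onI continuous_intros)
  have mr[measurable]: "rot_deriv i j w \<in> borel_measurable borel" for i j and w :: "real^'n"
    unfolding rot_deriv_def by measurable
  have min[measurable]: "(\<lambda>z. z \<bullet> w) \<in> borel_measurable borel" for w :: "real^'n"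
    by (intro borel_measurable_continuous_onI continuous_intros)
  have Lm[measurable]: "L i j \<in> borel_measurable borel" for i j
    unfolding L_def by measurable
  define M where "M = B2 * B3 * (2 * 2) + B1 * B4 * (2 * 2) + B1 * B3 * 2"
  have M0: "M \<ge> 0" using B0 by (simp add: M_def)
  have Lbd: "\<bar>L i j z\<bar> \<le> M" if z: "norm z = 1" for i j z
  proof -
    have "\<bar>(f' (z \<bullet> x) * F1 (z \<bullet> y)) * (rot_deriv i j x z * rot_deriv i j y z)\<bar> \<le> B2 * B3 * (2 * 2)"
      "\<bar>(f (z \<bullet> x) * F2 (z \<bullet> y)) * (rot_deriv i j y z * rot_deriv i j y z)\<bar> \<le> B1 * B4 * (2 * 2)"
      "\<bar>(f (z \<bullet> x) * F1 (z \<bullet> y)) * (z$i * y$i + z$j * y$j)\<bar> \<le> B1 * B3 * 2"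
      unfolding abs_mult[of "_ * _" "_ * _"] abs_mult[of "_ * _" "_ + _"] abs_mult[of "f _"] abs_mult[of "f' _"] abs_mult[of "rot_deriv _ _ _ _"]
      by (intro mult_mono B inn rd ad z n mult_nonneg_nonneg B0; simp)+
    then show ?thesis unfolding L_def M_def using M0 M_def by auto
  qed
  have Lint: "integrable sphere_measure (L i j)" for i j
    by (rule integrable_sphere_bounded[OF Lm Lbd])
  have L0: "(\<integral>z. L i j z \<partial>sphere_measure) = 0" for i j
  proof (cases "i = j")
    case False
    show ?thesis
    proof (rule integral_rot_deriv_eq_0[OF False])
      fix z :: "real^'n" and \<theta> :: real assume z: "norm z = 1"
      show "((\<lambda>\<theta>. f (rot i j \<theta> z \<bullet> x) * F1 (rot i j \<theta> z \<bullet> y) * rot_deriv i j y (rot i j \<theta> z)) has_real_derivative L i j (rot i j \<theta> z)) (at \<theta>)"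
        unfolding L_def
        by (rule derivative_eq_intros has_real_derivative_compose_unit_interval[OF False z n(1) f] refl
            has_real_derivative_compose_unit_interval[OF False z n(2) F] has_real_derivative_rot_deriv[OF False] | assumption)+
          (use False in \<open>simp add: algebra_simps\<close>)
      show "\<bar>L i j z\<bar> \<le> M" by (rule Lbd[OF z])
      show "\<bar>f (z \<bullet> x) * F1 (z \<bullet> y) * rot_deriv i j y z\<bar> \<le> B1 * B3 * 2"
        unfolding abs_mult by (intro mult_mono B inn rd z n mult_nonneg_nonneg B0) simp_all
    qed measurable
  qed (simp add: L_def)
  have "(\<integral>z. (\<Sum>i\<in>UNIV. \<Sum>j\<in>UNIV. L i j z) \<partial>sphere_measure) = 0"
    using Lint by (simp add: L0)
  moreover have "AE z in sphere_measure. (\<Sum>i\<in>UNIV. \<Sum>j\<in>UNIV. L i j z) = 2 * (f' (z \<bullet> x) * F1 (z \<bullet> y) * ((x \<bullet> y) - (z \<bullet> x) * (z \<bullet> y))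
       + f (z \<bullet> x) * ((1 - (z \<bullet> y)\<^sup>2) * F2 (z \<bullet> y) - (real CARD('n) - 1) * (z \<bullet> y) * F1 (z \<bullet> y)))"
    using AE_sphere_measure[where 'a="real^'n"]
  proof eventually_elim
    case (elim z)
    then have z: "norm z = 1" by simp
    show ?case unfolding L_def sum_laplace[OF z] using n by (simp add: dot_square_norm algebra_simps)
  qed
  ultimately have "(\<integral>z. 2 * (f' (z \<bullet> x) * F1 (z \<bullet> y) * ((x \<bullet> y) - (z \<bullet> x) * (z \<bullet> y))
       + f (z \<bullet> x) * ((1 - (z \<bullet> y)\<^sup>2) * F2 (z \<bullet> y) - (real CARD('n) - 1) * (z \<bullet> y) * F1 (z \<bullet> y))) \<partial>sphere_measure) = 0"
    by (subst (asm) integral_cong_AE) (auto simp: measurable_cong_sets[OF sets_sphere_measure])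
  then show ?thesis by (subst (asm) integral_mult_right_zero) simp
qed

lemma local_min_second_derivative_nonneg:
  fixes \<phi> \<phi>' :: "real \<Rightarrow> real"
  assumes min: "\<forall>\<^sub>F t in nhds a. \<phi> a \<le> \<phi> t"
    and d1: "\<forall>\<^sub>F t in nhds a. (\<phi> has_real_derivative \<phi>' t) (at t)"
    and d2: "(\<phi>' has_real_derivative D) (at a)"
  shows "D \<ge> 0"
proof (rule ccontr)
  assume "\<not> D \<ge> 0"
  then obtain e1 where e1: "e1 > 0" "\<And>h. 0 < h \<Longrightarrow> h < e1 \<Longrightarrow> \<phi>' (a + h) < \<phi>' a"
    using DERIV_neg_dec_right[OF d2] by auto
  obtain e2 where e2: "e2 > 0" "\<And>t. dist t a < e2 \<Longrightarrow> \<phi> a \<le> \<phi> t \<and> (\<phi> has_real_derivative \<phi>' t) (at t)"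
    using eventually_conj[OF min d1] unfolding eventually_nhds_metric by auto
  have "\<phi>' a = 0"
    by (rule DERIV_local_min[of \<phi> _ a e2]) (use e2 in \<open>auto simp: dist_real_def abs_minus_commute\<close>)
  define h where "h = min e1 e2 / 2"
  have h: "h > 0" "h < e1" "h < e2" using e1(1) e2(1) by (auto simp: h_def)
  obtain t where t: "a < t" "t < a + h" "\<phi> (a + h) - \<phi> a = (a + h - a) * \<phi>' t"
    using MVT2[of a "a + h" \<phi> \<phi>'] h e2(2) by (auto simp: dist_real_def)
  have "\<phi>' t < 0" using e1(2)[of "t - a"] t h \<open>\<phi>' a = 0\<close> by auto
  then have "\<phi> (a + h) < \<phi> a" using t(3) mult_pos_neg[of h "\<phi>' t"] h by simp
  with e2(2)[of "a + h"] h show False by (auto simp: dist_real_def)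
qed

text \<open>Along each plane rotation through z the sum has a local minimum, so its second
  derivative there is nonnegative; adding over all planes produces the spherical Laplacians. The
  profile may vary with k because in \<open>separation_harmonic\<close> one point carries a linear
  function in place of the kernel.\<close>

lemma sphere_local_min_laplace_nonneg:
  fixes z :: "real^'n" and x :: "'k \<Rightarrow> real^'n"
  assumes fin: "finite K" and z: "norm z = 1" and x: "\<And>k. k \<in> K \<Longrightarrow> norm (x k) = 1"
    and min: "\<forall>\<^sub>F w in nhds z. norm w = 1 \<longrightarrow> (\<Sum>k\<in>K. F k (z \<bullet> x k)) \<le> (\<Sum>k\<in>K. F k (w \<bullet> x k))"
    and d1: "\<And>k. k \<in> K \<Longrightarrow> \<forall>\<^sub>F t in nhds (z \<bullet> x k). (F k has_real_derivative F1 k t) (at t)"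
    and d2: "\<And>k. k \<in> K \<Longrightarrow> (F1 k has_real_derivative F2 k) (at (z \<bullet> x k))"
  shows "0 \<le> (\<Sum>k\<in>K. (1 - (z \<bullet> x k)\<^sup>2) * F2 k - (real CARD('n) - 1) * (z \<bullet> x k) * F1 k (z \<bullet> x k))"
proof -
  define L where "L i j k = F2 k * (rot_deriv i j (x k) z * rot_deriv i j (x k) z)
      - F1 k (z \<bullet> x k) * (z$i * x k$i + z$j * x k$j)" for i j k
  have L: "0 \<le> (\<Sum>k\<in>K. L i j k)" if ij: "i \<noteq> j" for i j
  proof (rule local_min_second_derivative_nonneg)
    have contr: "continuous (at 0) (\<lambda>\<theta>. rot i j \<theta> z)"
      unfolding rot_def by (intro continuous_intros) 
    have lim: "((\<lambda>\<theta>. rot i j \<theta> z) \<longlongrightarrow> z) (nhds 0)"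
      using contr tendsto_at_iff_tendsto_nhds[of "\<lambda>\<theta>. rot i j \<theta> z" 0] by (simp add: continuous_at)
    then have limk: "((\<lambda>\<theta>. rot i j \<theta> z \<bullet> x k) \<longlongrightarrow> z \<bullet> x k) (nhds 0)" for k
      by (intro tendsto_intros)
    show "\<forall>\<^sub>F t in nhds 0. (\<Sum>k\<in>K. F k (rot i j 0 z \<bullet> x k)) \<le> (\<Sum>k\<in>K. F k (rot i j t z \<bullet> x k))"
      using eventually_compose_filterlim[OF min lim] by eventually_elim (use z in \<open>auto simp: norm_rot[OF ij]\<close>)
    have "\<forall>\<^sub>F t in nhds 0. \<forall>k\<in>K. (F k has_real_derivative F1 k (rot i j t z \<bullet> x k)) (at (rot i j t z \<bullet> x k))"
      using fin eventually_compose_filterlim[OF d1 limk] by (simp add: eventually_ball_finite_distrib)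
    then show "\<forall>\<^sub>F t in nhds 0. ((\<lambda>t. \<Sum>k\<in>K. F k (rot i j t z \<bullet> x k)) has_real_derivative
        (\<Sum>k\<in>K. F1 k (rot i j t z \<bullet> x k) * rot_deriv i j (x k) (rot i j t z))) (at t)"
    proof eventually_elim
      case (elim t)
      show ?case
        by (intro DERIV_sum DERIV_chain2[where f="F _"] has_real_derivative_rot_inner[OF ij]) (use elim in auto)
    qed
    have "((\<lambda>t. F1 k (rot i j t z \<bullet> x k) * rot_deriv i j (x k) (rot i j t z)) has_real_derivative L i j k) (at 0)"
      if k: "k \<in> K" for k
    proof -
      have "((\<lambda>t. F1 k (rot i j t z \<bullet> x k)) has_real_derivative F2 k * rot_deriv i j (x k) (rot i j 0 z)) (at 0)"
        by (rule DERIV_chain2[where f="F1 k"]) (use d2[OF k] has_real_derivative_rot_inner[OF ij, of z "x k" 0] in auto)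
      from DERIV_mult'[OF this has_real_derivative_rot_deriv[OF ij, of "x k" z 0]]
      show ?thesis by (rule DERIV_cong) (simp add: L_def algebra_simps)
    qed
    then show "((\<lambda>t. \<Sum>k\<in>K. F1 k (rot i j t z \<bullet> x k) * rot_deriv i j (x k) (rot i j t z)) has_real_derivative (\<Sum>k\<in>K. L i j k)) (at 0)"
      by (intro DERIV_sum) auto
  qed
  have "0 \<le> (\<Sum>i\<in>UNIV. \<Sum>j\<in>UNIV. if i = j then 0 else (\<Sum>k\<in>K. L i j k))"
    by (intro sum_nonneg) (use L in auto)
  also have "\<dots> = (\<Sum>i\<in>UNIV. \<Sum>j\<in>UNIV. \<Sum>k\<in>K. if i = j then 0 else L i j k)"
    by (intro sum.cong) auto
  also have "\<dots> = (\<Sum>k\<in>K. \<Sum>i\<in>UNIV. \<Sum>j\<in>UNIV. if i = j then 0 else L i j k)"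
    by (simp only: sum.swap[of _ K])
  also have "\<dots> = (\<Sum>k\<in>K. 2 * ((1 - (z \<bullet> x k)\<^sup>2) * F2 k - (real CARD('n) - 1) * (z \<bullet> x k) * F1 k (z \<bullet> x k)))"
  proof (rule sum.cong[OF refl])
    fix k assume k: "k \<in> K"
    show "(\<Sum>i\<in>UNIV. \<Sum>j\<in>UNIV. if i = j then 0 else L i j k) = 2 * ((1 - (z \<bullet> x k)\<^sup>2) * F2 k - (real CARD('n) - 1) * (z \<bullet> x k) * F1 k (z \<bullet> x k))"
      using sum_laplace[OF z, of 0 "x k" "x k" "F2 k" "F1 k (z \<bullet> x k)"] x[OF k]
      by (simp add: L_def dot_square_norm algebra_simps cong: if_cong)
  qed
  finally show ?thesis unfolding sum_distrib_left[symmetric] by simp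
qed

section \<open>The Riesz kernel and its weighted means over caps\<close>

lemma measure_sphere_UNIV [simp]: "measure (sphere_measure :: 'a::euclidean_space measure) UNIV = 1"
  using prob_space.prob_space[OF prob_space_sphere_measure[where 'a='a]] by simp

lemma AE_sphereI: "(\<And>z::'a::euclidean_space. norm z = 1 \<Longrightarrow> P z) \<Longrightarrow> AE z in sphere_measure. P z"
  using AE_sphere_measure[where 'a='a] by eventually_elim auto

text \<open>The argument \<open>t\<close> is the squared distance \<open>2 - 2 * (x \<bullet> y)\<close>; the value at \<open>t = 0\<close>, where the Riesz kernel is infinite, is junk.\<close>

definition rk :: "real \<Rightarrow> real \<Rightarrow> real" where
  "rk s t = (if s = 0 then - ln t / 2 else t powr (- s / 2) / s)"

lemma borel_measurable_rk [measurable]: "rk s \<in> borel_measurable borel"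
  unfolding rk_def by measurable

lemma rk_has_real_derivative:
  assumes "t > 0"
  shows "(rk s has_real_derivative - (t powr (- s / 2 - 1)) / 2) (at t)"
proof (cases "s = 0")
  case True
  then have "rk s = (\<lambda>t. - ln t / 2)" by (simp add: rk_def fun_eq_iff)
  with True assms show ?thesis
    by (auto intro!: derivative_eq_intros simp: powr_minus powr_neg_one field_simps)
next
  case False
  then have "rk s = (\<lambda>t. t powr (- s / 2) / s)" by (simp add: rk_def fun_eq_iff)
  with False assms show ?thesis
    by (auto intro!: derivative_eq_intros)
qed

lemma rk_deriv_has_real_derivative:
  assumes "t > 0"
  shows "((\<lambda>t. - (t powr (- s / 2 - 1)) / 2) has_real_derivative (s + 2) / 4 * t powr (- s / 2 - 2)) (at t)"
  using assms by (auto intro!: derivative_eq_intros simp: field_simps)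

lemma rk_affine_has_real_derivative:
  assumes "c - 2 * \<tau> > 0"
  shows "((\<lambda>\<tau>. rk s (c - 2 * \<tau>)) has_real_derivative (c - 2 * \<tau>) powr (- s / 2 - 1)) (at \<tau>)"
    "((\<lambda>\<tau>. (c - 2 * \<tau>) powr (- s / 2 - 1)) has_real_derivative (s + 2) * (c - 2 * \<tau>) powr (- s / 2 - 2)) (at \<tau>)"
proof -
  have "((\<lambda>\<tau>. c - 2 * \<tau>) has_real_derivative - 2) (at \<tau>)"
    by (auto intro!: derivative_eq_intros)
  from DERIV_chain2[OF rk_has_real_derivative[OF assms] this]
  show "((\<lambda>\<tau>. rk s (c - 2 * \<tau>)) has_real_derivative (c - 2 * \<tau>) powr (- s / 2 - 1)) (at \<tau>)" by simp
  show "((\<lambda>\<tau>. (c - 2 * \<tau>) powr (- s / 2 - 1)) has_real_derivative (s + 2) * (c - 2 * \<tau>) powr (- s / 2 - 2)) (at \<tau>)"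
    using assms by (auto intro!: derivative_eq_intros simp: field_simps)
qed

lemma rk_antimono:
  assumes "0 < t" "t \<le> t'"
  shows "rk s t' \<le> rk s t"
proof (rule DERIV_nonpos_imp_nonincreasing[OF assms(2)])
  fix x assume "t \<le> x" "x \<le> t'"
  then show "\<exists>y. DERIV (rk s) x :> y \<and> y \<le> 0"
    using rk_has_real_derivative[of x s] assms by (intro exI[of _ "- (x powr (- s / 2 - 1)) / 2"]) auto
qed

lemma isCont_rk: "t > 0 \<Longrightarrow> isCont (rk s) t"
  using rk_has_real_derivative DERIV_isCont by blast

lemma riesz_kernel_eq:
  assumes "s \<ge> 0"
  shows "riesz_kernel s x y = (if x = y then \<infinity> else ereal (rk s ((norm (x - y))\<^sup>2)))"
proof (cases "x = y")
  case False
  then have n: "norm (x - y) > 0" by simp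
  have "((norm (x - y))\<^sup>2) powr (- s / 2) = norm (x - y) powr (- s)"
    using n powr_powr[of "norm (x - y)" 2 "- s / 2"] by simp
  then show ?thesis
    using False assms n by (simp add: riesz_kernel_def rk_def ln_realpow)
qed (use assms in \<open>simp add: riesz_kernel_def\<close>)

lemma norm_diff_sphere:
  fixes x y :: "'a::real_inner"
  assumes "norm x = 1" "norm y = 1"
  shows "(norm (x - y))\<^sup>2 = 2 - 2 * (x \<bullet> y)"
proof -
  have "x \<bullet> x = 1" "y \<bullet> y = 1" using assms by (simp_all add: dot_square_norm)
  then show ?thesis unfolding power2_norm_eq_inner inner_diff_left inner_diff_right inner_commute[of y x] by simp
qed

lemma inner_sphere_bounds:
  fixes x y :: "'a::real_inner"
  assumes "norm x = 1" "norm y = 1"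
  shows "x \<bullet> y \<in> {-1..1}"
  using Cauchy_Schwarz_ineq2[of x y] assms by (auto simp: abs_le_iff)

lemma inner_sphere_less_1:
  fixes x y :: "'a::real_inner"
  assumes "norm x = 1" "norm y = 1" "x \<noteq> y"
  shows "x \<bullet> y < 1"
  using norm_diff_sphere[OF assms(1,2)] assms(3) zero_less_power2[of "norm (x - y)"] by simp

text \<open>The loss incurred when the kernel is replaced by
  \<open>2 * rk s (t + \<epsilon>) - rk s (t + 2 * \<epsilon>)\<close>. Being a second difference,
  it is nonnegative by convexity.\<close>

definition rk_gap :: "real \<Rightarrow> real \<Rightarrow> real \<Rightarrow> real" where
  "rk_gap s \<epsilon> t = rk s t - 2 * rk s (t + \<epsilon>) + rk s (t + 2 * \<epsilon>)"

text \<open>Two applications of the mean value theorem turn the second difference into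
  \<open>\<epsilon>\<^sup>2\<close> times a value of the second derivative, which is positive and
  decreasing. The upper bound serves for t large compared with \<epsilon>.\<close>

lemma rk_gap_bounds:
  assumes "s \<ge> 0" "t > 0" "\<epsilon> > 0"
  shows "0 \<le> rk_gap s \<epsilon> t" "rk_gap s \<epsilon> t \<le> (s + 2) / 4 * \<epsilon>\<^sup>2 * t powr (- s / 2 - 2)"
proof -
  let ?d1 = "\<lambda>t. - (t powr (- s / 2 - 1)) / 2"
  let ?d2 = "\<lambda>t. (s + 2) / 4 * t powr (- s / 2 - 2)"
  define \<phi> where "\<phi> t = rk s t - rk s (t + \<epsilon>)" for t
  have "(\<phi> has_real_derivative ?d1 z - ?d1 (z + \<epsilon>)) (at z)" if "z \<ge> t" for z
    unfolding \<phi>_def using that assms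
    by (intro DERIV_diff rk_has_real_derivative DERIV_shift[THEN iffD1]) auto
  then obtain \<xi> where \<xi>: "t < \<xi>" "\<phi> (t + \<epsilon>) - \<phi> t = (t + \<epsilon> - t) * (?d1 \<xi> - ?d1 (\<xi> + \<epsilon>))"
    using MVT2[of t "t + \<epsilon>" \<phi> "\<lambda>z. ?d1 z - ?d1 (z + \<epsilon>)"] assms by auto
  obtain \<zeta> where \<zeta>: "\<xi> < \<zeta>" "?d1 (\<xi> + \<epsilon>) - ?d1 \<xi> = (\<xi> + \<epsilon> - \<xi>) * ?d2 \<zeta>"
    using MVT2[of \<xi> "\<xi> + \<epsilon>" ?d1 ?d2] rk_deriv_has_real_derivative \<xi>(1) assms by auto
  have "rk_gap s \<epsilon> t = \<phi> t - \<phi> (t + \<epsilon>)" by (simp add: rk_gap_def \<phi>_def algebra_simps)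
  also have "\<dots> = \<epsilon> * (?d1 (\<xi> + \<epsilon>) - ?d1 \<xi>)" using \<xi>(2) by (simp add: algebra_simps)
  also have "\<dots> = \<epsilon>\<^sup>2 * ?d2 \<zeta>" by (subst \<zeta>(2)) (simp add: power2_eq_square)
  finally have eq: "rk_gap s \<epsilon> t = \<epsilon>\<^sup>2 * ?d2 \<zeta>" .
  show "0 \<le> rk_gap s \<epsilon> t" using assms by (simp add: eq)
  have "\<zeta> powr (- s / 2 - 2) \<le> t powr (- s / 2 - 2)"
    using \<zeta>(1) \<xi>(1) assms by (intro powr_mono2') auto
  then have "\<epsilon>\<^sup>2 * ?d2 \<zeta> \<le> \<epsilon>\<^sup>2 * ?d2 t" using assms by (intro mult_left_mono) auto
  then show "rk_gap s \<epsilon> t \<le> (s + 2) / 4 * \<epsilon>\<^sup>2 * t powr (- s / 2 - 2)" by (simp add: eq algebra_simps)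
qed

text \<open>Near the pole the second-order bound is not integrable over the sphere in the range of s
  treated later. Here first differences of the kernel are used instead, and the free exponent
  \<theta> converts t \<le> \<epsilon> into a power of \<epsilon>; it also absorbs the logarithm
  when s = 0.\<close>

lemma rk_gap_small:
  assumes "s \<ge> 0" "\<theta> > 0"
  obtains C where "C > 0" "\<And>\<epsilon> t. 0 < t \<Longrightarrow> t \<le> \<epsilon> \<Longrightarrow> rk_gap s \<epsilon> t \<le> C * \<epsilon> powr \<theta> * t powr (- s / 2 - \<theta>)"
proof -
  have le: "rk_gap s \<epsilon> t \<le> rk s t - rk s (t + \<epsilon>)" if "0 < t" "t \<le> \<epsilon>" for \<epsilon> t
    using rk_antimono[of "t + \<epsilon>" "t + 2 * \<epsilon>" s] that by (simp add: rk_gap_def)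
  show ?thesis
  proof (cases "s = 0")
    case True
    have "rk_gap s \<epsilon> t \<le> 2 powr \<theta> / \<theta> * \<epsilon> powr \<theta> * t powr (- s / 2 - \<theta>)" if t: "0 < t" "t \<le> \<epsilon>" for \<epsilon> t
    proof -
      have "rk_gap s \<epsilon> t \<le> (ln (t + \<epsilon>) - ln t) / 2" using le[OF t] True by (simp add: rk_def)
      also have "ln (t + \<epsilon>) - ln t = ln ((t + \<epsilon>) / t)" using t by (simp add: ln_div)
      also have "\<dots> \<le> ((t + \<epsilon>) / t) powr \<theta> / \<theta>" using t assms by (intro ln_powr_bound) auto
      also have "((t + \<epsilon>) / t) powr \<theta> \<le> (2 * \<epsilon> / t) powr \<theta>"
        using t assms by (intro powr_mono2) (auto simp: divide_right_mono)
      also have "\<dots> = 2 powr \<theta> * \<epsilon> powr \<theta> * t powr (-\<theta>)"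
        using t by (simp add: powr_divide powr_mult powr_minus field_simps)
      finally have "rk_gap s \<epsilon> t \<le> (2 powr \<theta> * \<epsilon> powr \<theta> * t powr (-\<theta>) / \<theta>) / 2"
        using assms by (simp add: divide_right_mono)
      also have "\<dots> \<le> 2 powr \<theta> * \<epsilon> powr \<theta> * t powr (-\<theta>) / \<theta>"
      proof -
        have half: "X / 2 \<le> X" if "X \<ge> 0" for X :: real using that by simp
        show ?thesis by (rule half) (use assms in simp)
      qed
      finally show ?thesis using True by simp
    qed
    then show ?thesis using assms by (intro that[of "2 powr \<theta> / \<theta>"]) auto
  next
    case False
    with assms have s: "s > 0" by simp
    have "rk_gap s \<epsilon> t \<le> 1 / s * \<epsilon> powr \<theta> * t powr (- s / 2 - \<theta>)" if t: "0 < t" "t \<le> \<epsilon>" for \<epsilon> t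
    proof -
      have "rk_gap s \<epsilon> t \<le> t powr (- s / 2) / s" 
        using le[OF t] s powr_ge_zero[of "t + \<epsilon>" "- s / 2"] unfolding rk_def
        by (smt (verit) divide_nonneg_pos)
      also have "t powr (- s / 2) = t powr \<theta> * t powr (- s / 2 - \<theta>)" using t by (simp flip: powr_add)
      also have "t powr \<theta> * t powr (- s / 2 - \<theta>) \<le> \<epsilon> powr \<theta> * t powr (- s / 2 - \<theta>)"
        using t assms by (intro mult_right_mono powr_mono2) auto
      finally show ?thesis using s by (simp add: divide_right_mono)
    qed
    then show ?thesis using s by (intro that[of "1 / s"]) auto
  qed
qed

section \<open>Cap weights and their mean value inequality\<close>

lemma continuous_on_interval_bounded:
  fixes g :: "real \<Rightarrow> real"
  assumes "continuous_on {a..b} g"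
  obtains B where "B \<ge> 0" "\<And>t. t \<in> {a..b} \<Longrightarrow> \<bar>g t\<bar> \<le> B"
proof -
  obtain B where "\<forall>t\<in>{a..b}. \<bar>g t\<bar> \<le> B"
    using compact_imp_bounded[OF compact_continuous_image[OF assms]] by (auto simp: bounded_iff)
  then show ?thesis by (intro that[of "max B 0"]) (auto simp: le_max_iff_disj)
qed

text \<open>The derivative of the squared cut-off
  \<open>(max 0 (R ^ d - (1 - \<tau>) ^ d))\<^sup>2\<close>, multiplied by a spherical factor of
  exponent \<open>1 - d / 2\<close>. The power d in the cut-off makes the derivative vanish to order
  d - 1 at the centre, enough to offset the singular factor and to keep the weight bounded.\<close>

definition cap_weight :: "nat \<Rightarrow> real \<Rightarrow> real \<Rightarrow> real" where
  "cap_weight d R \<tau> = (1 - \<tau>\<^sup>2) * (1 - \<tau>\<^sup>2) powr (- real d / 2) * (2 * max 0 (R ^ d - (1 - \<tau>) ^ d) * (real d * (1 - \<tau>) ^ (d - 1)))"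

text \<open>Squaring removes the kink of the positive part, so the cut-off can be differentiated
  across the edge of the cap.\<close>

lemma max_0_square_has_real_derivative:
  assumes "(h has_real_derivative h') (at x within S)"
  shows "((\<lambda>x. (max 0 (h x))\<^sup>2) has_real_derivative 2 * max 0 (h x) * h') (at x within S)"
proof -
  have sq: "((\<lambda>t. (max 0 t)\<^sup>2) has_real_derivative 2 * max 0 t) (at t)" for t :: real
  proof (cases t "0::real" rule: linorder_cases)
    case less
    have "((\<lambda>t. 0) has_real_derivative 0) (at t)" by simp
    then have "((\<lambda>t::real. (max 0 t)\<^sup>2) has_real_derivative 0) (at t)"
    proof (rule DERIV_cong_ev[THEN iffD1, rotated -1, OF _ refl _ refl], goal_cases)
      case 1
      then show ?case using eventually_nhds_in_open[of "{..<0}" t] less by (auto elim!: eventually_mono simp: max_def)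
    qed
    with less show ?thesis by simp
  next
    case greater
    have "((\<lambda>t. t\<^sup>2) has_real_derivative 2 * t) (at t)" by (auto intro!: derivative_eq_intros)
    then have "((\<lambda>t::real. (max 0 t)\<^sup>2) has_real_derivative 2 * t) (at t)"
    proof (rule DERIV_cong_ev[THEN iffD1, rotated -1, OF _ refl _ refl], goal_cases)
      case 1
      then show ?case using eventually_nhds_in_open[of "{0<..}" t] greater by (auto elim!: eventually_mono simp: max_def)
    qed
    with greater show ?thesis by simp
  next
    case equal
    have "((\<lambda>h. ((max 0 (0 + h))\<^sup>2 - (max 0 0)\<^sup>2) / h) \<longlongrightarrow> 0) (at (0::real))"
    proof (rule Lim_null_comparison[where g="\<lambda>h. \<bar>h\<bar>"])
      show "\<forall>\<^sub>F h in at (0::real). norm (((max 0 (0 + h))\<^sup>2 - (max 0 0)\<^sup>2) / h) \<le> \<bar>h\<bar>"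
        by (intro always_eventually) (auto simp: max_def power2_eq_square abs_if)
    qed (auto intro!: tendsto_eq_intros)
    then show ?thesis using equal by (simp add: DERIV_def)
  qed
  show ?thesis
    by (rule DERIV_chain2[OF sq assms])
qed

text \<open>Once a power of the shifted squared distance is factored out,
  \<open>s + 2 \<ge> d\<close> leaves at least d times
  \<open>(1 - \<tau>)\<^sup>2 - 2 * \<tau> * \<epsilon>\<close>. The shift \<epsilon> can spoil the
  sign only near the pole, where \<open>(1 - \<tau>)\<^sup>2\<close> is small against it.\<close>

lemma rk_zonal_subharmonic:
  assumes "real d - 2 \<le> s" "\<tau> \<le> \<tau>1" "\<bar>\<tau>\<bar> \<le> 1" "\<tau>1 < 1" "0 < \<epsilon>" "2 * \<epsilon> \<le> (1 - \<tau>1)\<^sup>2"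
  shows "0 \<le> (1 - \<tau>\<^sup>2) * ((s + 2) * (2 + 2 * \<epsilon> - 2 * \<tau>) powr (- s / 2 - 2))
     - real d * \<tau> * (2 + 2 * \<epsilon> - 2 * \<tau>) powr (- s / 2 - 1)"
proof -
  define Q where "Q = 2 + 2 * \<epsilon> - 2 * \<tau>"
  have Q: "Q > 0" using assms by (simp add: Q_def)
  have "Q powr ((- s / 2 - 2) + 1) = Q powr (- s / 2 - 2) * Q" using Q by (simp only: powr_add powr_one)
  moreover have "(- s / 2 - 2) + 1 = - s / 2 - 1" by simp
  ultimately have e: "Q powr (- s / 2 - 1) = Q powr (- s / 2 - 2) * Q" by (simp only:)
  have "\<tau> * \<epsilon> \<le> \<epsilon>" using assms by (simp add: abs_le_iff)
  moreover have "(1 - \<tau>1)\<^sup>2 \<le> (1 - \<tau>)\<^sup>2" using assms by (intro power_mono) auto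
  ultimately have "0 \<le> (1 - \<tau>)\<^sup>2 - 2 * \<tau> * \<epsilon>" using assms by linarith
  then have "0 \<le> real d * ((1 - \<tau>)\<^sup>2 - 2 * \<tau> * \<epsilon>)" by simp
  also have "\<dots> = real d * (1 - \<tau>\<^sup>2) - real d * \<tau> * Q" by (simp add: Q_def power2_eq_square algebra_simps)
  also have "real d * (1 - \<tau>\<^sup>2) \<le> (s + 2) * (1 - \<tau>\<^sup>2)"
    using assms by (intro mult_right_mono) (auto simp: abs_square_le_1)
  finally have "0 \<le> Q powr (- s / 2 - 2) * ((s + 2) * (1 - \<tau>\<^sup>2) - real d * \<tau> * Q)" by simp
  then show ?thesis unfolding Q_def[symmetric] e by (simp add: algebra_simps)
qed

text \<open>For \<open>\<kappa> = 0\<close> the zonal function with derivative \<open>cap_g\<close> has Laplacian \<open>cap_psi = cap_weight\<close> minus a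
  point mass at \<open>\<tau> = 1\<close>, which gives mean value inequalities. The parameter \<open>\<kappa>\<close> removes the singularity, and
  \<open>cap_D\<close> approximates the point mass as \<open>\<kappa> \<rightarrow> 0\<close>.\<close>

context
  fixes d :: nat and R \<kappa> :: real
  assumes d: "d \<ge> 2" and R: "0 < R" "R \<le> 1" and \<kappa>: "\<kappa> > 0"
begin

definition cap_q :: "real \<Rightarrow> real" where
  "cap_q \<tau> = (1 - \<tau> + \<kappa>) * (1 + \<tau>)"

definition cap_g :: "real \<Rightarrow> real" where
  "cap_g \<tau> = cap_q \<tau> powr (- real d / 2) * (max 0 (R ^ d - (1 - \<tau>) ^ d))\<^sup>2"

definition cap_g' :: "real \<Rightarrow> real" where
  "cap_g' \<tau> = cap_q \<tau> powr (- real d / 2) * (2 * max 0 (R ^ d - (1 - \<tau>) ^ d) * (real d * (1 - \<tau>) ^ (d - 1)))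
     - real d / 2 * cap_q \<tau> powr (- real d / 2 - 1) * (\<kappa> - 2 * \<tau>) * (max 0 (R ^ d - (1 - \<tau>) ^ d))\<^sup>2"

definition cap_psi :: "real \<Rightarrow> real" where
  "cap_psi \<tau> = (1 - \<tau>\<^sup>2) * cap_q \<tau> powr (- real d / 2) * (2 * max 0 (R ^ d - (1 - \<tau>) ^ d) * (real d * (1 - \<tau>) ^ (d - 1)))"

definition cap_D :: "real \<Rightarrow> real" where
  "cap_D \<tau> = real d / 2 * \<kappa> * (1 + \<tau>)\<^sup>2 * cap_q \<tau> powr (- real d / 2 - 1) * (max 0 (R ^ d - (1 - \<tau>) ^ d))\<^sup>2"

lemma cap_q_pos: "-1 < \<tau> \<Longrightarrow> \<tau> \<le> 1 \<Longrightarrow> cap_q \<tau> > 0"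
  using \<kappa> by (simp add: cap_q_def)

lemma cap_max_0: "\<tau> \<le> 1 - R \<Longrightarrow> max 0 (R ^ d - (1 - \<tau>) ^ d) = 0"
  using R power_mono[of R "1 - \<tau>" d] by simp

lemma cap_g_0: "\<tau> \<le> 1 - R \<Longrightarrow> cap_g \<tau> = 0" "\<tau> \<le> 1 - R \<Longrightarrow> cap_g' \<tau> = 0"
  by (simp_all add: cap_g_def cap_g'_def cap_max_0)

text \<open>The operator \<open>(1 - \<tau>\<^sup>2) * g' - d * \<tau> * g\<close> has the
  integrating factor \<open>(1 - \<tau>\<^sup>2) powr (d / 2 - 1)\<close>; hence the power of
  \<open>cap_q\<close> in \<open>cap_g\<close>. For \<kappa> > 0 the factor is inexact, and the
  mismatch \<open>(1 - \<tau>\<^sup>2) * (\<kappa> - 2 * \<tau>) + 2 * \<tau> * cap_q \<tau> =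
  \<kappa> * (1 + \<tau>)\<^sup>2\<close> is the source of \<open>cap_D\<close>.\<close>

lemma cap_laplace: "\<bar>\<tau>\<bar> \<le> 1 \<Longrightarrow> (1 - \<tau>\<^sup>2) * cap_g' \<tau> - real d * \<tau> * cap_g \<tau> = cap_psi \<tau> - cap_D \<tau>"
proof (cases "\<tau> \<le> 1 - R")
  case True
  then show ?thesis by (simp add: cap_g_0 cap_psi_def cap_D_def cap_max_0)
next
  case False
  assume "\<bar>\<tau>\<bar> \<le> 1"
  then have q: "cap_q \<tau> > 0" using False R by (intro cap_q_pos) auto
  have e: "cap_q \<tau> powr (- real d / 2) = cap_q \<tau> powr (- real d / 2 - 1) * cap_q \<tau>"
    using q powr_add[of "cap_q \<tau>" "- real d / 2 - 1" 1] by simp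
  have *: "(1 - \<tau>\<^sup>2) * (\<kappa> - 2 * \<tau>) + 2 * \<tau> * cap_q \<tau> = \<kappa> * (1 + \<tau>)\<^sup>2"
    by (simp add: cap_q_def power2_eq_square algebra_simps)
  define p where "p = cap_q \<tau> powr (- real d / 2 - 1)"
  define m where "m = (max 0 (R ^ d - (1 - \<tau>) ^ d))\<^sup>2"
  define b where "b = (2 * max 0 (R ^ d - (1 - \<tau>) ^ d) * (real d * (1 - \<tau>) ^ (d - 1)))"
  define c where "c = real d / 2"
  have c2: "real d = 2 * c" by (simp add: c_def)
  have gen: "X * (p * q * b - c * p * k * m) - 2 * c * t * (p * q * m) = X * (p * q) * b - c * (X * k + 2 * t * q) * p * m"
    for X p q b c k m t :: real by algebra
  have "(1 - \<tau>\<^sup>2) * cap_g' \<tau> - real d * \<tau> * cap_g \<tau> =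
     (1 - \<tau>\<^sup>2) * (p * cap_q \<tau> * b - c * p * (\<kappa> - 2 * \<tau>) * m) - 2 * c * \<tau> * (p * cap_q \<tau> * m)"
    unfolding cap_g'_def cap_g_def e p_def[symmetric] m_def[symmetric] b_def[symmetric] c_def[symmetric] unfolding c2 ..
  also have "\<dots> = (1 - \<tau>\<^sup>2) * (p * cap_q \<tau>) * b - c * (\<kappa> * (1 + \<tau>)\<^sup>2) * p * m"
    unfolding gen * ..
  also have "\<dots> = cap_psi \<tau> - cap_D \<tau>"
    unfolding cap_psi_def cap_D_def e p_def[symmetric] m_def[symmetric] b_def[symmetric] c_def[symmetric] by (simp only: mult.assoc)
  finally show ?thesis .
qed

text \<open>At the end -1 the base of the power vanishes, but R \<le> 1 makes \<open>cap_g\<close>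
  identically 0 near it; elsewhere \<open>cap_q\<close> is positive and the product rule
  applies.\<close>

lemma cap_g_deriv:
  assumes "\<tau> \<in> {-1..1}"
  shows "(cap_g has_real_derivative cap_g' \<tau>) (at \<tau> within {-1..1})"
proof (cases "\<tau> = -1")
  case True
  have "((\<lambda>_. 0) has_real_derivative 0) (at \<tau> within {-1..1})" by simp
  then have "(cap_g has_real_derivative 0) (at \<tau> within {-1..1})"
    by (rule has_field_derivative_transform_within[where d=1])
      (use True R in \<open>auto simp: cap_g_0 dist_real_def\<close>)
  then show ?thesis using True R by (simp add: cap_g_0)
next
  case False
  with assms have q: "cap_q \<tau> > 0" by (intro cap_q_pos) auto
  have dq: "(cap_q has_real_derivative \<kappa> - 2 * \<tau>) (at \<tau> within {-1..1})"
    unfolding cap_q_def[abs_def] by (auto intro!: derivative_eq_intros simp: algebra_simps)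
  have "((\<lambda>\<tau>. R ^ d - (1 - \<tau>) ^ d) has_real_derivative real d * (1 - \<tau>) ^ (d - 1)) (at \<tau> within {-1..1})"
    by (auto intro!: derivative_eq_intros)
  note dm = max_0_square_has_real_derivative[OF this]
  have dp: "((\<lambda>\<tau>. cap_q \<tau> powr (- real d / 2)) has_real_derivative
      (- real d / 2) * cap_q \<tau> powr (- real d / 2 - 1) * (\<kappa> - 2 * \<tau>)) (at \<tau> within {-1..1})"
    using DERIV_chain2[OF has_real_derivative_powr[OF q, of "- real d / 2"] dq] by simp
  show ?thesis
    unfolding cap_g_def[abs_def]
    by (rule DERIV_cong[OF DERIV_mult'[OF dp dm]]) (simp add: cap_g'_def algebra_simps)
qed

lemma cap_measurable [measurable]:
  "cap_g \<in> borel_measurable borel" "cap_g' \<in> borel_measurable borel"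
  "cap_psi \<in> borel_measurable borel" "cap_D \<in> borel_measurable borel"
  unfolding cap_g_def[abs_def] cap_g'_def[abs_def] cap_psi_def[abs_def] cap_D_def[abs_def] cap_q_def[abs_def]
  by measurable

lemma cap_g'_cont: "continuous_on {-1..1} cap_g'"
proof -
  have "continuous_on {1 - R..1} cap_g'"
    unfolding cap_g'_def[abs_def]
    by (intro continuous_intros) (use cap_q_pos R in \<open>force simp: cap_q_def[abs_def] intro!: continuous_intros\<close>)+
  moreover have "continuous_on {-1..1 - R} cap_g'"
    by (rule continuous_on_eq[of _ "\<lambda>_. 0"]) (use R in \<open>auto simp: cap_g_0\<close>)
  ultimately have "continuous_on ({-1..1 - R} \<union> {1 - R..1}) cap_g'"
    by (intro continuous_on_closed_Un) auto
  moreover have "{-1..1 - R} \<union> {1 - R..1} = {-1..1}" using R by auto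
  ultimately show ?thesis by simp
qed

lemma cap_psi_bounds: "\<bar>\<tau>\<bar> \<le> 1 \<Longrightarrow> 0 \<le> cap_psi \<tau>" "\<bar>\<tau>\<bar> \<le> 1 \<Longrightarrow> cap_psi \<tau> \<le> cap_weight d R \<tau>" "\<bar>\<tau>\<bar> \<le> 1 \<Longrightarrow> 0 \<le> cap_D \<tau>"
proof -
  assume t: "\<bar>\<tau>\<bar> \<le> 1"
  then have t2: "0 \<le> 1 - \<tau>\<^sup>2" by (simp add: abs_square_le_1)
  show "0 \<le> cap_psi \<tau>" unfolding cap_psi_def using t t2 by (intro mult_nonneg_nonneg) auto
  show "0 \<le> cap_D \<tau>" unfolding cap_D_def using \<kappa> by (intro mult_nonneg_nonneg) auto
  show "cap_psi \<tau> \<le> cap_weight d R \<tau>"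
  proof (cases "\<tau>\<^sup>2 = 1")
    case False
    then have t3: "0 < 1 - \<tau>\<^sup>2" using t2 by simp
    have "0 \<le> \<kappa> * (1 + \<tau>)" using t \<kappa> by simp
    then have "1 - \<tau>\<^sup>2 \<le> cap_q \<tau>" by (simp add: cap_q_def power2_eq_square algebra_simps)
    then have "cap_q \<tau> powr (- real d / 2) \<le> (1 - \<tau>\<^sup>2) powr (- real d / 2)"
      using t3 by (intro powr_mono2') auto
    then show ?thesis unfolding cap_psi_def cap_weight_def
      using t t2 by (intro mult_right_mono mult_left_mono mult_nonneg_nonneg) auto
  qed (simp add: cap_psi_def cap_weight_def)
qed

text \<open>Two instances of Green's formula share the same gradient term: one with derivative
  profile \<open>cap_g\<close> and factor \<open>f\<close>, the other with derivative profile
  \<open>f1\<close> and factor \<gamma>, a primitive of \<open>cap_g\<close>. Their difference moves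
  the Laplacian from \<gamma> to \<open>f\<close>. Since \<gamma> is nonnegative and vanishes
  outside the cap, the sign of the Laplacian of \<open>f\<close> matters only on the cap.\<close>

lemma cap_green:
  fixes x y :: "real^'n"
  assumes n: "norm x = 1" "norm y = 1" and dn: "CARD('n) = d + 1"
    and f: "\<And>t. t \<in> {-1..1} \<Longrightarrow> (f has_real_derivative f1 t) (at t within {-1..1})"
       "\<And>t. t \<in> {-1..1} \<Longrightarrow> (f1 has_real_derivative f2 t) (at t within {-1..1})"
    and cont: "continuous_on {-1..1} f2"
    and [measurable]: "f \<in> borel_measurable borel" "f1 \<in> borel_measurable borel" "f2 \<in> borel_measurable borel"
    and sub: "\<And>z. norm z = 1 \<Longrightarrow> 1 - R < z \<bullet> x \<Longrightarrow> 0 \<le> (1 - (z \<bullet> y)\<^sup>2) * f2 (z \<bullet> y) - real d * (z \<bullet> y) * f1 (z \<bullet> y)"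
  shows "(\<integral>z. f (z \<bullet> y) * (cap_psi (z \<bullet> x) - cap_D (z \<bullet> x)) \<partial>sphere_measure) \<ge> 0"
proof -
  have cg: "continuous_on {-1..1} cap_g" using DERIV_continuous_on[OF cap_g_deriv] by auto
  have cf1: "continuous_on {-1..1} f1" using DERIV_continuous_on[OF f(2)] by auto
  \<comment> \<open>Clamping the upper limit makes the primitive continuous, hence Borel, on the
    whole line.\<close>
  define cl where "cl t = max (-1) (min 1 (t::real))" for t
  define \<gamma> where "\<gamma> t = integral {-1..cl t} cap_g" for t
  have clid: "cl t = t" if "t \<in> {-1..1}" for t using that by (auto simp: cl_def)
  have cli: "cl t \<in> {-1..1}" for t by (auto simp: cl_def)
  have d\<gamma>0: "((\<lambda>t. integral {-1..t} cap_g) has_real_derivative cap_g t) (at t within {-1..1})" if "t \<in> {-1..1}" for t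
    by (rule integral_has_real_derivative[OF cg that])
  have d\<gamma>: "(\<gamma> has_real_derivative cap_g t) (at t within {-1..1})" if "t \<in> {-1..1}" for t
    by (rule has_field_derivative_transform_within[OF d\<gamma>0[OF that], of 1]) (use that in \<open>auto simp: \<gamma>_def clid\<close>)
  have "continuous_on UNIV \<gamma>"
    unfolding \<gamma>_def[abs_def]
    by (rule continuous_on_compose2[OF DERIV_continuous_on[OF d\<gamma>0]])
      (use cli in \<open>auto simp: cl_def[abs_def] intro!: continuous_intros\<close>)
  then have \<gamma>m[measurable]: "\<gamma> \<in> borel_measurable borel" by (rule borel_measurable_continuous_onI)
  have g0: "cap_g t \<ge> 0" for t by (simp add: cap_g_def)
  have \<gamma>0: "\<gamma> t \<ge> 0" for t
    unfolding \<gamma>_def by (intro integral_nonneg integrable_continuous_interval continuous_on_subset[OF cg])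
      (use g0 cli[of t] in auto)
  have \<gamma>z: "\<gamma> t = 0" if "t \<in> {-1..1}" "t \<le> 1 - R" for t
  proof -
    have "integral {-1..t} cap_g = integral {-1..t} (\<lambda>_. 0)"
      by (rule integral_cong) (use that in \<open>auto intro!: cap_g_0\<close>)
    then show ?thesis using that by (simp add: \<gamma>_def clid)
  qed
  have c: "real CARD('n) - 1 = real d" using dn by simp
  let ?G = "\<lambda>z. f1 (z \<bullet> y) * cap_g (z \<bullet> x) * ((y \<bullet> x) - (z \<bullet> y) * (z \<bullet> x))"
  let ?A = "\<lambda>z. f (z \<bullet> y) * (cap_psi (z \<bullet> x) - cap_D (z \<bullet> x))"
  let ?B = "\<lambda>z. \<gamma> (z \<bullet> x) * ((1 - (z \<bullet> y)\<^sup>2) * f2 (z \<bullet> y) - real d * (z \<bullet> y) * f1 (z \<bullet> y))"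
  have min[measurable]: "(\<lambda>z. z \<bullet> w) \<in> borel_measurable borel" for w :: "real^'n"
    by (intro borel_measurable_continuous_onI continuous_intros)
  have cf: "continuous_on {-1..1} f" using DERIV_continuous_on[OF f(1)] by auto
  have cpd: "continuous_on {-1..1} (\<lambda>t. cap_psi t - cap_D t)"
  proof -
    have "continuous_on {-1..1} (\<lambda>\<tau>. (1 - \<tau>\<^sup>2) * cap_g' \<tau> - real d * \<tau> * cap_g \<tau>)"
      by (intro continuous_intros cg cap_g'_cont)
    then show ?thesis by (rule continuous_on_eq) (auto simp: cap_laplace)
  qed
  have c\<gamma>: "continuous_on {-1..1} \<gamma>" using \<open>continuous_on UNIV \<gamma>\<close> continuous_on_subset by blast
  have cL: "continuous_on {-1..1} (\<lambda>t. (1 - t\<^sup>2) * f2 t - real d * t * f1 t)"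
    by (intro continuous_intros cont cf1)
  obtain B1 where B1: "B1 \<ge> 0" "\<And>t. t \<in> {-1..1} \<Longrightarrow> \<bar>f t\<bar> \<le> B1"
    using continuous_on_interval_bounded[OF cf] by blast
  obtain B2 where B2: "B2 \<ge> 0" "\<And>t. t \<in> {-1..1} \<Longrightarrow> \<bar>cap_psi t - cap_D t\<bar> \<le> B2"
    using continuous_on_interval_bounded[OF cpd] by blast
  obtain B3 where B3: "B3 \<ge> 0" "\<And>t. t \<in> {-1..1} \<Longrightarrow> \<bar>\<gamma> t\<bar> \<le> B3"
    using continuous_on_interval_bounded[OF c\<gamma>] by blast
  obtain B4 where B4: "B4 \<ge> 0" "\<And>t. t \<in> {-1..1} \<Longrightarrow> \<bar>(1 - t\<^sup>2) * f2 t - real d * t * f1 t\<bar> \<le> B4"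
    using continuous_on_interval_bounded[OF cL] by blast
  obtain B5 where B5: "B5 \<ge> 0" "\<And>t. t \<in> {-1..1} \<Longrightarrow> \<bar>f1 t\<bar> \<le> B5"
    using continuous_on_interval_bounded[OF cf1] by blast
  obtain B6 where B6: "B6 \<ge> 0" "\<And>t. t \<in> {-1..1} \<Longrightarrow> \<bar>cap_g t\<bar> \<le> B6"
    using continuous_on_interval_bounded[OF cg] by blast
  note B = B1(2) B2(2) B3(2) B4(2) B5(2) B6(2)
  note B0 = B1(1) B2(1) B3(1) B4(1) B5(1) B6(1)
  have inn: "z \<bullet> w \<in> {-1..1}" if "norm z = 1" "norm w = 1" for z w :: "real^'n"
    using inner_sphere_bounds that by blast
  have iA: "integrable sphere_measure ?A"
  proof (rule integrable_sphere_bounded[of _ "B1 * B2"])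
    fix z :: "real^'n" assume z: "norm z = 1"
    show "\<bar>?A z\<bar> \<le> B1 * B2"
      unfolding abs_mult by (intro mult_mono B inn z n B0 abs_ge_zero)
  qed measurable
  have iB: "integrable sphere_measure ?B"
  proof (rule integrable_sphere_bounded[of _ "B3 * B4"])
    fix z :: "real^'n" assume z: "norm z = 1"
    show "\<bar>?B z\<bar> \<le> B3 * B4"
      unfolding abs_mult by (intro mult_mono B inn z n B0 abs_ge_zero)
  qed measurable
  have iG: "integrable sphere_measure ?G"
  proof (rule integrable_sphere_bounded[of _ "B5 * B6 * 2"])
    fix z :: "real^'n" assume z: "norm z = 1"
    have "\<bar>(z \<bullet> y) * (z \<bullet> x)\<bar> \<le> 1 * 1"
      unfolding abs_mult by (intro mult_mono) (use inn[OF z n(1)] inn[OF z n(2)] in auto)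
    then have "\<bar>(y \<bullet> x) - (z \<bullet> y) * (z \<bullet> x)\<bar> \<le> 2" using inn[OF n(2,1)] by (auto simp: abs_le_iff)
    then show "\<bar>?G z\<bar> \<le> B5 * B6 * 2"
      unfolding abs_mult by (intro mult_mono B inn z n mult_nonneg_nonneg B0) auto
  qed measurable
  have 1: "(\<integral>z. ?G z + ?A z \<partial>sphere_measure) = 0"
  proof -
    have "(\<integral>z. ?G z + ?A z \<partial>sphere_measure) = (\<integral>z. ?G z + f (z \<bullet> y) * ((1 - (z \<bullet> x)\<^sup>2) * cap_g' (z \<bullet> x)
        - (real CARD('n) - 1) * (z \<bullet> x) * cap_g (z \<bullet> x)) \<partial>sphere_measure)"
    proof (rule integral_cong_AE)
      show "AE z in sphere_measure. ?G z + ?A z = ?G z + f (z \<bullet> y) * ((1 - (z \<bullet> x)\<^sup>2) * cap_g' (z \<bullet> x)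
        - (real CARD('n) - 1) * (z \<bullet> x) * cap_g (z \<bullet> x))"
        using AE_sphere_measure[where 'a="real^'n"]
      proof eventually_elim
        case (elim z)
        then show ?case using cap_laplace[of "z \<bullet> x"] inn[of z x] n c by (auto simp: abs_le_iff)
      qed
    qed (auto simp: measurable_cong_sets[OF sets_sphere_measure])
    also have "\<dots> = 0"
      by (rule green_zonal[OF n(2,1) f(1) cap_g_deriv cf1 cap_g'_cont]) measurable
    finally show ?thesis .
  qed
  have 2: "(\<integral>z. ?G z + ?B z \<partial>sphere_measure) = 0"
    using green_zonal[OF n d\<gamma> f(2) cg cont]
    by (simp add: c inner_commute[of x y] mult.commute mult.left_commute)
  have "0 \<le> (\<integral>z. ?B z \<partial>sphere_measure)"
  proof (rule integral_nonneg_AE)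
    show "AE z in sphere_measure. 0 \<le> ?B z"
      using AE_sphere_measure[where 'a="real^'n"]
    proof eventually_elim
      case (elim z)
      then show ?case using sub[of z] \<gamma>0 \<gamma>z[of "z \<bullet> x"] inn[of z x] n by (cases "1 - R < z \<bullet> x") auto
    qed
  qed
  then show ?thesis using 1 2 iA iB iG by simp
qed

end

text \<open>With \<open>u = 1 - \<tau>\<close> the spherical factor is at most
  \<open>u powr (1 - d / 2)\<close>, because \<open>2 - u \<ge> 1\<close> and the exponent is
  nonpositive; multiplied by \<open>u ^ (d - 1)\<close> it leaves
  \<open>u powr (d / 2)\<close>.\<close>

lemma cap_weight_bounds:
  assumes d: "d \<ge> 2" and R: "0 < R" "R \<le> 1" and t: "\<bar>\<tau>\<bar> \<le> 1"
  shows "0 \<le> cap_weight d R \<tau>" "cap_weight d R \<tau> \<le> 2 * real d * R ^ d * R powr (real d / 2)"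
    "\<tau> \<le> 1 - R \<Longrightarrow> cap_weight d R \<tau> = 0"
proof -
  show 0: "\<tau> \<le> 1 - R \<Longrightarrow> cap_weight d R \<tau> = 0"
    using power_mono[of R "1 - \<tau>" d] R by (simp add: cap_weight_def)
  have t2: "0 \<le> 1 - \<tau>\<^sup>2" using t by (simp add: abs_square_le_1)
  show "0 \<le> cap_weight d R \<tau>" unfolding cap_weight_def
    using t t2 by (intro mult_nonneg_nonneg) auto
  show "cap_weight d R \<tau> \<le> 2 * real d * R ^ d * R powr (real d / 2)"
  proof (cases "\<tau> \<le> 1 - R \<or> \<tau> = 1")
    case True
    then show ?thesis using 0 R by (auto simp: cap_weight_def)
  next
    case False
    define u where "u = 1 - \<tau>"
    have u: "0 < u" "u < R" "u < 1" using False t R by (auto simp: u_def)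
    have e: "1 - \<tau>\<^sup>2 = u * (2 - u)" by (simp add: u_def power2_eq_square algebra_simps)
    have "(1 - \<tau>\<^sup>2) * (1 - \<tau>\<^sup>2) powr (- real d / 2) = (u * (2 - u)) powr (1 - real d / 2)"
      unfolding e using u powr_add[of "u * (2 - u)" 1 "- real d / 2"] by simp
    also have "\<dots> = u powr (1 - real d / 2) * (2 - u) powr (1 - real d / 2)" using u by (simp add: powr_mult)
    also have "\<dots> \<le> u powr (1 - real d / 2) * 1"
    proof (intro mult_left_mono)
      have "(2 - u) powr (1 - real d / 2) \<le> 1 powr (1 - real d / 2)"
        using u d by (intro powr_mono2') auto
      then show "(2 - u) powr (1 - real d / 2) \<le> 1" by simp
    qed simp
    finally have 1: "(1 - \<tau>\<^sup>2) * (1 - \<tau>\<^sup>2) powr (- real d / 2) \<le> u powr (1 - real d / 2)" by simp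
    have 2: "max 0 (R ^ d - u ^ d) \<le> R ^ d" using u R by simp
    have "cap_weight d R \<tau> \<le> u powr (1 - real d / 2) * (2 * R ^ d * (real d * u ^ (d - 1)))"
      unfolding cap_weight_def u_def[symmetric]
      by (intro mult_mono 1 mult_left_mono 2 mult_nonneg_nonneg) (use u R t2 in auto)
    also have "u ^ (d - 1) = u powr (real d - 1)" using u d by (simp flip: powr_realpow)
    also have "u powr (1 - real d / 2) * (2 * R ^ d * (real d * u powr (real d - 1))) = 2 * real d * R ^ d * u powr (real d / 2)"
      using u powr_add[of u "1 - real d / 2" "real d - 1"] by (simp add: field_simps)
    also have "\<dots> \<le> 2 * real d * R ^ d * R powr (real d / 2)"
      using u R by (intro mult_left_mono powr_mono2) auto
    finally show ?thesis .
  qed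
qed

lemma borel_measurable_cap_weight [measurable]: "cap_weight d R \<in> borel_measurable borel"
  unfolding cap_weight_def[abs_def] by measurable

lemma borel_measurable_inner_const [measurable]: "(\<lambda>z. z \<bullet> w) \<in> borel_measurable borel" for w :: "'a::euclidean_space"
  by (intro borel_measurable_continuous_onI continuous_intros)

lemma cap_psi_limit:
  assumes d: "d \<ge> 2" and R: "0 < R" "R \<le> 1" and t: "\<bar>\<tau>\<bar> \<le> 1"
  shows "(\<lambda>n. cap_psi d R (1 / (real n + 1)) \<tau>) \<longlonglongrightarrow> cap_weight d R \<tau>"
proof (cases "\<tau>\<^sup>2 = 1")
  case True
  have p: "1 / (real n + 1) > 0" for n by simp
  show ?thesis unfolding cap_psi_def[OF d R p] cap_weight_def using True by simp
next
  case False
  have p: "1 / (real n + 1) > 0" for n by simp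
  from False t have "1 - \<tau>\<^sup>2 > 0" by (metis abs_square_le_1 diff_gt_0_iff_gt order_less_le)
  have "(\<lambda>n. 1 / (real n + 1)) \<longlonglongrightarrow> 0" by real_asymp
  then have "(\<lambda>n. (1 - \<tau> + 1 / (real n + 1)) * (1 + \<tau>)) \<longlonglongrightarrow> (1 - \<tau> + 0) * (1 + \<tau>)"
    by (intro tendsto_intros)
  also have "(1 - \<tau> + 0) * (1 + \<tau>) = 1 - \<tau>\<^sup>2" by (simp add: power2_eq_square algebra_simps)
  finally have "(\<lambda>n. cap_q (1 / (real n + 1)) \<tau>) \<longlonglongrightarrow> 1 - \<tau>\<^sup>2" by (simp add: cap_q_def[OF d R p])
  then show ?thesis unfolding cap_psi_def[OF d R p] cap_weight_def
    using \<open>1 - \<tau>\<^sup>2 > 0\<close> by (intro tendsto_intros) auto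
qed

text \<open>The kernel is normalized to vanish at the centre x. Green's formula bounds its integral
  against \<open>cap_psi\<close> from below by the one against \<open>cap_D\<close>, which has mass
  at most \<open>m0\<close> and height O(\<kappa>) away from x. Near x the function is small, far
  from x the weight is small, so the limit \<kappa> \<rightarrow> 0 is nonnegative.\<close>

lemma submean_cap_shifted:
  fixes x y :: "real^'n"
  assumes n: "norm x = 1" "norm y = 1" and dn: "CARD('n) = d + 1" and d: "d \<ge> 2" and s: "real d - 2 \<le> s"
    and R: "0 < R" "R \<le> 1" and \<epsilon>: "0 < \<epsilon>" "2 * \<epsilon> \<le> (1 - \<tau>1)\<^sup>2" and \<tau>1: "\<tau>1 < 1"
    and sep: "\<And>z. norm z = 1 \<Longrightarrow> 1 - R < z \<bullet> x \<Longrightarrow> z \<bullet> y \<le> \<tau>1"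
  shows "(\<integral>z. cap_weight d R (z \<bullet> x) \<partial>sphere_measure) * rk s (2 + 2 * \<epsilon> - 2 * (x \<bullet> y))
     \<le> (\<integral>z. cap_weight d R (z \<bullet> x) * rk s (2 + 2 * \<epsilon> - 2 * (z \<bullet> y)) \<partial>sphere_measure)"
proof -
  interpret prob_space "sphere_measure :: (real^'n) measure" by (rule prob_space_sphere_measure)
  define v0 where "v0 = rk s (2 + 2 * \<epsilon> - 2 * (x \<bullet> y))"
  define f where "f t = rk s (2 + 2 * \<epsilon> - 2 * t) - v0" for t
  define f1 where "f1 t = (2 + 2 * \<epsilon> - 2 * t) powr (- s / 2 - 1)" for t
  define f2 where "f2 t = (s + 2) * (2 + 2 * \<epsilon> - 2 * t) powr (- s / 2 - 2)" for t
  define m0 where "m0 = (\<integral>z. cap_weight d R (z \<bullet> x) \<partial>sphere_measure)"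
  define \<kappa> where "\<kappa> n = 1 / (real n + 1)" for n
  have \<kappa>0: "\<kappa> n > 0" for n by (simp add: \<kappa>_def)
  note [measurable] = cap_measurable[OF d R \<kappa>0]
  have fm[measurable]: "f \<in> borel_measurable borel" "f1 \<in> borel_measurable borel" "f2 \<in> borel_measurable borel"
    unfolding f_def[abs_def] f1_def[abs_def] f2_def[abs_def] by measurable
  have inn: "z \<bullet> w \<in> {-1..1}" "\<bar>z \<bullet> w\<bar> \<le> 1" if "norm z = 1" "norm w = 1" for z w :: "real^'n"
    using inner_sphere_bounds[OF that] by (auto simp: abs_le_iff)
  have df: "(f has_real_derivative f1 t) (at t within {-1..1})" if "t \<in> {-1..1}" for t
    unfolding f_def[abs_def] f1_def
    by (rule DERIV_subset[OF DERIV_cong[OF DERIV_diff[OF rk_affine_has_real_derivative(1) DERIV_const]]])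
      (use that \<epsilon> in auto)
  have df1: "(f1 has_real_derivative f2 t) (at t within {-1..1})" if "t \<in> {-1..1}" for t
    unfolding f1_def[abs_def] f2_def
    by (rule DERIV_subset[OF rk_affine_has_real_derivative(2)]) (use that \<epsilon> in auto)
  have cf2: "continuous_on {-1..1} f2"
    unfolding f2_def[abs_def] using \<epsilon> by (intro continuous_intros) auto
  have cf: "continuous_on {-1..1} f" using DERIV_continuous_on[OF df] by auto
  obtain B where B0: "B \<ge> 0" and B: "\<And>t. t \<in> {-1..1} \<Longrightarrow> \<bar>f t\<bar> \<le> B"
    using continuous_on_interval_bounded[OF cf] by blast
  define M where "M = 2 * real d * R ^ d * R powr (real d / 2)"
  note wb = cap_weight_bounds[OF d R]
  have M0: "M \<ge> 0" using R by (simp add: M_def)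
  have psi: "0 \<le> cap_psi d R (\<kappa> n) t" "cap_psi d R (\<kappa> n) t \<le> M" "0 \<le> cap_D d R (\<kappa> n) t" if "\<bar>t\<bar> \<le> 1" for n t
    using cap_psi_bounds[OF d R \<kappa>0 that, of n] wb(2)[OF that] by (auto simp: M_def)
  have iw: "integrable sphere_measure (\<lambda>z. cap_weight d R (z \<bullet> x))"
    by (rule integrable_sphere_bounded[of _ M]) (use wb inn n in \<open>auto simp: M_def\<close>)
  have ipsi: "integrable sphere_measure (\<lambda>z. cap_psi d R (\<kappa> n) (z \<bullet> x))" for n
    by (rule integrable_sphere_bounded[of _ M]) (use psi inn n in auto)
  have Dbd: "\<exists>B'. \<forall>t\<in>{-1..1}. \<bar>cap_D d R (\<kappa> n) t\<bar> \<le> B'" for n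
  proof -
    have "continuous_on {-1..1} (\<lambda>t. (1 - t\<^sup>2) * cap_g' d R (\<kappa> n) t - real d * t * cap_g d R (\<kappa> n) t)"
      using DERIV_continuous_on[OF cap_g_deriv[OF d R \<kappa>0[of n]]]
      by (intro continuous_intros cap_g'_cont[OF d R \<kappa>0]) auto
    then obtain B' where "\<And>t. t \<in> {-1..1} \<Longrightarrow> \<bar>(1 - t\<^sup>2) * cap_g' d R (\<kappa> n) t - real d * t * cap_g d R (\<kappa> n) t\<bar> \<le> B'"
      using continuous_on_interval_bounded by blast
    then have "\<forall>t\<in>{-1..1}. \<bar>cap_D d R (\<kappa> n) t\<bar> \<le> B' + M"
      using cap_laplace[OF d R \<kappa>0[of n]] psi[of _ n] by (force simp: abs_le_iff)
    then show ?thesis by blast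
  qed
  have iD: "integrable sphere_measure (\<lambda>z. cap_D d R (\<kappa> n) (z \<bullet> x))" for n
  proof -
    obtain B' where "\<forall>t\<in>{-1..1}. \<bar>cap_D d R (\<kappa> n) t\<bar> \<le> B'" using Dbd by blast
    then show ?thesis using inn n by (intro integrable_sphere_bounded[of _ B']) auto
  qed
  have ifg: "integrable sphere_measure (\<lambda>z. f (z \<bullet> y) * g z)" if "integrable sphere_measure g" for g :: "real^'n \<Rightarrow> real"
  proof (rule Bochner_Integration.integrable_bound[of _ "\<lambda>z. B * g z"])
    show "AE z in sphere_measure. norm (f (z \<bullet> y) * g z) \<le> norm (B * g z)"
      using AE_sphere_measure[where 'a="real^'n"]
      by eventually_elim (use B inn n B0 in \<open>auto simp: abs_mult intro!: mult_right_mono\<close>)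
  qed (use that in \<open>auto intro!: borel_measurable_times simp: measurable_cong_sets[OF sets_sphere_measure]\<close>)
  have D_le: "(\<integral>z. cap_D d R (\<kappa> n) (z \<bullet> x) \<partial>sphere_measure) \<le> m0" for n
  proof -
    have "0 \<le> (\<integral>z. 1 * (cap_psi d R (\<kappa> n) (z \<bullet> x) - cap_D d R (\<kappa> n) (z \<bullet> x)) \<partial>sphere_measure)"
      by (rule cap_green[OF d R \<kappa>0[of n] n dn, of "\<lambda>_. 1" "\<lambda>_. 0" "\<lambda>_. 0"]) auto
    then have "(\<integral>z. cap_D d R (\<kappa> n) (z \<bullet> x) \<partial>sphere_measure) \<le> (\<integral>z. cap_psi d R (\<kappa> n) (z \<bullet> x) \<partial>sphere_measure)"
      using ipsi iD by simp
    also have "\<dots> \<le> m0" unfolding m0_def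
    proof (rule integral_mono_AE[OF ipsi iw])
      show "AE z in sphere_measure. cap_psi d R (\<kappa> n) (z \<bullet> x) \<le> cap_weight d R (z \<bullet> x)"
        using AE_sphere_measure[where 'a="real^'n"]
        by eventually_elim (use cap_psi_bounds(2)[OF d R \<kappa>0] inn n in auto)
    qed
    finally show ?thesis .
  qed
  have key: "0 \<le> (\<integral>z. f (z \<bullet> y) * (cap_psi d R (\<kappa> n) (z \<bullet> x) - cap_D d R (\<kappa> n) (z \<bullet> x)) \<partial>sphere_measure)" for n
  proof (rule cap_green[OF d R \<kappa>0 n dn df df1 cf2 fm])
    fix z :: "real^'n" assume z: "norm z = 1" "1 - R < z \<bullet> x"
    show "0 \<le> (1 - (z \<bullet> y)\<^sup>2) * f2 (z \<bullet> y) - real d * (z \<bullet> y) * f1 (z \<bullet> y)"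
      unfolding f1_def f2_def
      by (rule rk_zonal_subharmonic[OF s sep[OF z] _ \<tau>1 \<epsilon>]) (use inn z n in auto)
  qed
  have lim: "(\<lambda>k. \<integral>z. f (z \<bullet> y) * cap_psi d R (\<kappa> k) (z \<bullet> x) \<partial>sphere_measure) \<longlonglongrightarrow> (\<integral>z. f (z \<bullet> y) * cap_weight d R (z \<bullet> x) \<partial>sphere_measure)"
  proof (rule integral_dominated_convergence[of _ _ _ "\<lambda>_. B * M"])
    show "AE z in sphere_measure. (\<lambda>k. f (z \<bullet> y) * cap_psi d R (\<kappa> k) (z \<bullet> x)) \<longlonglongrightarrow> f (z \<bullet> y) * cap_weight d R (z \<bullet> x)"
      using AE_sphere_measure[where 'a="real^'n"]
      by eventually_elim (use inn n in \<open>auto simp: \<kappa>_def intro!: tendsto_intros cap_psi_limit[OF d R]\<close>)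
    show "AE z in sphere_measure. norm (f (z \<bullet> y) * cap_psi d R (\<kappa> k) (z \<bullet> x)) \<le> B * M" for k
      using AE_sphere_measure[where 'a="real^'n"]
      by eventually_elim (use inn n B psi B0 M0 in \<open>auto simp: abs_mult intro!: mult_mono\<close>)
  qed (auto simp: measurable_cong_sets[OF sets_sphere_measure])
  have low: "- \<delta> * m0 \<le> (\<integral>z. f (z \<bullet> y) * cap_weight d R (z \<bullet> x) \<partial>sphere_measure)" if \<delta>: "\<delta> > 0" for \<delta>
  proof -
    have "f (x \<bullet> y) = 0" by (simp add: f_def v0_def)
    then obtain \<eta>1 where \<eta>1: "\<eta>1 > 0" "\<And>t. t \<in> {-1..1} \<Longrightarrow> \<bar>t - x \<bullet> y\<bar> < \<eta>1 \<Longrightarrow> \<bar>f t\<bar> < \<delta>"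
      using cf inn(1)[OF n] \<delta> unfolding continuous_on_iff dist_real_def by (metis diff_zero)
    \<comment> \<open>Heights above \<open>1 - \<eta>\<close> correspond to distances from x below
      \<open>\<eta>1\<close>, where continuity makes \<open>f\<close> smaller than \<delta>.\<close>
    define \<eta> where "\<eta> = \<eta>1\<^sup>2 / 2"
    have \<eta>: "\<eta> > 0" using \<eta>1 by (simp add: \<eta>_def)
    have near: "\<bar>f (z \<bullet> y)\<bar> < \<delta>" if z: "norm z = 1" "1 - \<eta> < z \<bullet> x" for z
    proof (rule \<eta>1(2)[OF inn(1)[OF z(1) n(2)]])
      have sq: "(norm (z - x))\<^sup>2 < \<eta>1\<^sup>2" using norm_diff_sphere[OF z(1) n(1)] z(2) by (simp add: \<eta>_def)
      have "norm (z - x) < \<eta>1" by (rule power2_less_imp_less[OF sq less_imp_le[OF \<eta>1(1)]])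
      moreover have "\<bar>(z - x) \<bullet> y\<bar> \<le> norm (z - x) * norm y" by (rule Cauchy_Schwarz_ineq2)
      ultimately show "\<bar>z \<bullet> y - x \<bullet> y\<bar> < \<eta>1" unfolding n(2) inner_diff_left by linarith
    qed
    define C where "C = 2 * real d * \<eta> powr (- real d / 2 - 1)"
    have C0: "C \<ge> 0" by (simp add: C_def)
    have far: "cap_D d R (\<kappa> k) t \<le> C * \<kappa> k" if t: "\<bar>t\<bar> \<le> 1" "t \<le> 1 - \<eta>" for t k
    proof (cases "t \<le> 1 - R")
      case True
      then show ?thesis using cap_max_0[OF d R \<kappa>0[of k]] C0 \<kappa>0[of k] by (simp add: cap_D_def[OF d R \<kappa>0])
    next
      case False
      have "\<eta> * 1 \<le> cap_q (\<kappa> k) t"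
        unfolding cap_q_def[OF d R \<kappa>0] using False R t \<kappa>0[of k] \<eta> by (intro mult_mono) auto
      then have q: "cap_q (\<kappa> k) t powr (- real d / 2 - 1) \<le> \<eta> powr (- real d / 2 - 1)"
        using \<eta> by (intro powr_mono2') auto
      have m: "(max 0 (R ^ d - (1 - t) ^ d))\<^sup>2 \<le> 1"
      proof -
        have "R ^ d \<le> 1" using R by (simp add: power_le_one)
        moreover have "0 \<le> (1 - t) ^ d" using t by simp
        ultimately have "max 0 (R ^ d - (1 - t) ^ d) \<le> 1" by simp
        then show ?thesis by (simp add: power_le_one)
      qed
      have p: "(1 + t)\<^sup>2 \<le> 2\<^sup>2" using t by (intro power_mono) auto
      have "cap_D d R (\<kappa> k) t \<le> real d / 2 * \<kappa> k * 2\<^sup>2 * \<eta> powr (- real d / 2 - 1) * 1"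
        unfolding cap_D_def[OF d R \<kappa>0]
        by (intro mult_mono q m p mult_left_mono mult_nonneg_nonneg) (use \<kappa>0[of k] in auto)
      then show ?thesis by (simp add: C_def mult_ac)
    qed
    have "- \<delta> * m0 - B * C * \<kappa> k \<le> (\<integral>z. f (z \<bullet> y) * cap_psi d R (\<kappa> k) (z \<bullet> x) \<partial>sphere_measure)" for k
    proof -
      have "- \<delta> * m0 - B * C * \<kappa> k \<le> (\<integral>z. - \<delta> * cap_D d R (\<kappa> k) (z \<bullet> x) - B * C * \<kappa> k \<partial>sphere_measure)"
        using iD[of k] D_le[of k] \<delta> by simp
      also have "\<dots> \<le> (\<integral>z. f (z \<bullet> y) * cap_D d R (\<kappa> k) (z \<bullet> x) \<partial>sphere_measure)"
      proof (rule integral_mono_AE)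
        show "AE z in sphere_measure. - \<delta> * cap_D d R (\<kappa> k) (z \<bullet> x) - B * C * \<kappa> k \<le> f (z \<bullet> y) * cap_D d R (\<kappa> k) (z \<bullet> x)"
          using AE_sphere_measure[where 'a="real^'n"]
        proof eventually_elim
          case (elim z)
          then have z: "norm z = 1" by simp
          note D0 = psi(3)[OF inn(2)[OF z n(1)], of k]
          show ?case
          proof (cases "1 - \<eta> < z \<bullet> x")
            case True
            have "- \<delta> * cap_D d R (\<kappa> k) (z \<bullet> x) \<le> f (z \<bullet> y) * cap_D d R (\<kappa> k) (z \<bullet> x)"
              using near[OF z True] D0 by (intro mult_right_mono) auto
            moreover have "0 \<le> B * C * \<kappa> k" using B0 C0 \<kappa>0[of k] by simp
            ultimately show ?thesis by linarith
          next
            case False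
            have "- f (z \<bullet> y) * cap_D d R (\<kappa> k) (z \<bullet> x) \<le> B * (C * \<kappa> k)"
              using B[OF inn(1)[OF z n(2)]] D0 far[OF inn(2)[OF z n(1)]] False B0
              by (intro mult_mono) (auto simp: abs_le_iff)
            moreover have "0 \<le> \<delta> * cap_D d R (\<kappa> k) (z \<bullet> x)" using \<delta> D0 by simp
            ultimately show ?thesis by (simp add: mult.assoc)
          qed
        qed
      qed (use iD ifg in auto)
      also have "\<dots> \<le> (\<integral>z. f (z \<bullet> y) * cap_psi d R (\<kappa> k) (z \<bullet> x) \<partial>sphere_measure)"
        using key[of k] ifg[OF iD[of k]] ifg[OF ipsi[of k]] by (simp add: right_diff_distrib)
      finally show ?thesis .
    qed
    moreover have "(\<lambda>k. - \<delta> * m0 - B * C * \<kappa> k) \<longlonglongrightarrow> - \<delta> * m0 - B * C * 0"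
      unfolding \<kappa>_def by (intro tendsto_intros) real_asymp
    ultimately show ?thesis using LIMSEQ_le[OF _ lim] by (simp; blast)
  qed
  have m00: "m0 \<ge> 0" unfolding m0_def
    by (intro integral_nonneg_AE AE_sphereI wb(1) inn n)
  have "0 \<le> (\<integral>z. f (z \<bullet> y) * cap_weight d R (z \<bullet> x) \<partial>sphere_measure)"
  proof (rule field_le_epsilon)
    fix e :: real assume e: "e > 0"
    have "e / (m0 + 1) * m0 \<le> e" using e m00 by (simp add: field_simps)
    then show "0 \<le> (\<integral>z. f (z \<bullet> y) * cap_weight d R (z \<bullet> x) \<partial>sphere_measure) + e"
      using low[of "e / (m0 + 1)"] e m00 by simp
  qed
  also have "\<dots> = (\<integral>z. cap_weight d R (z \<bullet> x) * rk s (2 + 2 * \<epsilon> - 2 * (z \<bullet> y)) - v0 * cap_weight d R (z \<bullet> x) \<partial>sphere_measure)"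
    by (simp add: f_def algebra_simps)
  also have "\<dots> = (\<integral>z. cap_weight d R (z \<bullet> x) * rk s (2 + 2 * \<epsilon> - 2 * (z \<bullet> y)) \<partial>sphere_measure) - v0 * m0"
  proof -
    have "integrable sphere_measure (\<lambda>z. f (z \<bullet> y) * cap_weight d R (z \<bullet> x) + v0 * cap_weight d R (z \<bullet> x))"
      using iw ifg by auto
    then have "integrable sphere_measure (\<lambda>z. cap_weight d R (z \<bullet> x) * rk s (2 + 2 * \<epsilon> - 2 * (z \<bullet> y)))"
      by (simp add: f_def algebra_simps)
    then show ?thesis using iw by (simp add: m0_def)
  qed
  finally show ?thesis by (simp add: m0_def v0_def mult.commute)
qed

text \<open>Removes the shift: the shifted kernel lies below the kernel wherever the weight is
  nonzero, so only the value at the centre needs a limit, and the kernel is continuous there because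
  the cap stays away from y.\<close>

lemma submean_cap:
  fixes x y :: "real^'n"
  assumes n: "norm x = 1" "norm y = 1" and dn: "CARD('n) = d + 1" and d: "d \<ge> 2" and s: "real d - 2 \<le> s"
    and R: "0 < R" "R \<le> 1" and \<tau>1: "\<tau>1 < 1"
    and sep: "\<And>z. norm z = 1 \<Longrightarrow> 1 - R < z \<bullet> x \<Longrightarrow> z \<bullet> y \<le> \<tau>1"
  shows "integrable sphere_measure (\<lambda>z. cap_weight d R (z \<bullet> x) * rk s (2 - 2 * (z \<bullet> y)))"
    "(\<integral>z. cap_weight d R (z \<bullet> x) \<partial>sphere_measure) * rk s (2 - 2 * (x \<bullet> y))
     \<le> (\<integral>z. cap_weight d R (z \<bullet> x) * rk s (2 - 2 * (z \<bullet> y)) \<partial>sphere_measure)"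
proof -
  interpret prob_space "sphere_measure :: (real^'n) measure" by (rule prob_space_sphere_measure)
  define M where "M = 2 * real d * R ^ d * R powr (real d / 2)"
  have M0: "M \<ge> 0" using R by (simp add: M_def)
  note wb = cap_weight_bounds[OF d R, folded M_def]
  have inn: "z \<bullet> w \<in> {-1..1}" "\<bar>z \<bullet> w\<bar> \<le> 1" if "norm z = 1" "norm w = 1" for z w :: "real^'n"
    using inner_sphere_bounds[OF that] by (auto simp: abs_le_iff)
  \<comment> \<open>For \<epsilon> \<le> 1 the shifted squared distance is at most 6 and, on the
    cap, at least \<open>2 - 2 * \<tau>1\<close>.\<close>
  define L where "L = max \<bar>rk s 6\<bar> \<bar>rk s (2 - 2 * \<tau>1)\<bar>"
  have bound: "\<bar>cap_weight d R (z \<bullet> x) * rk s (2 + 2 * \<epsilon> - 2 * (z \<bullet> y))\<bar> \<le> M * L"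
    if z: "norm z = 1" and e: "0 \<le> \<epsilon>" "\<epsilon> \<le> 1" for z \<epsilon>
  proof (cases "1 - R < z \<bullet> x")
    case True
    have "rk s 6 \<le> rk s (2 + 2 * \<epsilon> - 2 * (z \<bullet> y))" "rk s (2 + 2 * \<epsilon> - 2 * (z \<bullet> y)) \<le> rk s (2 - 2 * \<tau>1)"
      using sep[OF z True] inn(1)[OF z n(2)] e \<tau>1 by (auto intro!: rk_antimono)
    then have "\<bar>rk s (2 + 2 * \<epsilon> - 2 * (z \<bullet> y))\<bar> \<le> L" by (auto simp: L_def)
    then show ?thesis unfolding abs_mult using wb(1,2)[OF inn(2)[OF z n(1)]] M0 by (intro mult_mono) auto
  next
    case False
    then show ?thesis using wb(3)[OF inn(2)[OF z n(1)]] M0 by (simp add: L_def)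
  qed
  have int: "integrable sphere_measure (\<lambda>z. cap_weight d R (z \<bullet> x) * rk s (2 + 2 * \<epsilon> - 2 * (z \<bullet> y)))" if "0 \<le> \<epsilon>" "\<epsilon> \<le> 1" for \<epsilon>
    by (rule integrable_sphere_bounded[of _ "M * L"]) (measurable, use bound that in auto)
  from int[of 0] show i0: "integrable sphere_measure (\<lambda>z. cap_weight d R (z \<bullet> x) * rk s (2 - 2 * (z \<bullet> y)))" by simp
  define \<epsilon>0 where "\<epsilon>0 = min 1 ((1 - \<tau>1)\<^sup>2 / 2)"
  have \<epsilon>0: "\<epsilon>0 > 0" using \<tau>1 by (simp add: \<epsilon>0_def)
  let ?m = "\<integral>z. cap_weight d R (z \<bullet> x) \<partial>sphere_measure"
  let ?I = "\<integral>z. cap_weight d R (z \<bullet> x) * rk s (2 - 2 * (z \<bullet> y)) \<partial>sphere_measure"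
  have le: "?m * rk s (2 + 2 * \<epsilon> - 2 * (x \<bullet> y)) \<le> ?I" if e: "0 < \<epsilon>" "\<epsilon> < \<epsilon>0" for \<epsilon>
  proof -
    have e': "2 * \<epsilon> \<le> (1 - \<tau>1)\<^sup>2" "\<epsilon> \<le> 1" using e by (auto simp: \<epsilon>0_def)
    have "?m * rk s (2 + 2 * \<epsilon> - 2 * (x \<bullet> y)) \<le> (\<integral>z. cap_weight d R (z \<bullet> x) * rk s (2 + 2 * \<epsilon> - 2 * (z \<bullet> y)) \<partial>sphere_measure)"
      by (rule submean_cap_shifted[OF n dn d s R e(1) e'(1) \<tau>1 sep])
    also have "\<dots> \<le> ?I"
    proof (rule integral_mono_AE[OF int i0])
      show "AE z in sphere_measure. cap_weight d R (z \<bullet> x) * rk s (2 + 2 * \<epsilon> - 2 * (z \<bullet> y)) \<le> cap_weight d R (z \<bullet> x) * rk s (2 - 2 * (z \<bullet> y))"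
        using AE_sphere_measure[where 'a="real^'n"]
      proof eventually_elim
        case (elim z)
        then have z: "norm z = 1" by simp
        show ?case
        proof (cases "1 - R < z \<bullet> x")
          case True
          then show ?thesis using sep[OF z True] \<tau>1 e wb(1)[OF inn(2)[OF z n(1)]]
            by (intro mult_left_mono rk_antimono) auto
        qed (use wb(3)[OF inn(2)[OF z n(1)]] in simp)
      qed
    qed (use e e' in auto)
    finally show ?thesis .
  qed
  have xy: "x \<bullet> y < 1" using sep[of x] n R \<tau>1 by (simp add: dot_square_norm)
  have "((\<lambda>\<epsilon>. ?m * rk s (2 + 2 * \<epsilon> - 2 * (x \<bullet> y))) \<longlongrightarrow> ?m * rk s (2 + 2 * 0 - 2 * (x \<bullet> y))) (at_right 0)"
    by (intro tendsto_intros isCont_tendsto_compose[OF isCont_rk]) (use xy in auto)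
  moreover have "\<forall>\<^sub>F \<epsilon> in at_right 0. ?m * rk s (2 + 2 * \<epsilon> - 2 * (x \<bullet> y)) \<le> ?I"
    using eventually_at_right_real[OF \<epsilon>0] by eventually_elim (use le in auto)
  ultimately show "?m * rk s (2 - 2 * (x \<bullet> y)) \<le> ?I"
    by (intro tendsto_upperbound[of _ _ "at_right 0"]) auto
qed

section \<open>Integrals of the kernel and lower bounds for the energy\<close>

lemma ennreal_le_suminf: "h k \<le> (\<Sum>k. h k)" for h :: "nat \<Rightarrow> ennreal"
  using sum_le_suminf[OF summableI, of "{k}" h] by simp

lemma ennreal_mult_add:
  assumes "0 \<le> a" "0 \<le> b" "0 \<le> c" "0 \<le> e"
  shows "ennreal a * ennreal b + ennreal c * ennreal e = ennreal (a * b + c * e)"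
  using assms by (simp add: ennreal_mult)

text \<open>Dyadic caps of radius \<open>R / 2 ^ k\<close>: the one of index k contributes at most a
  constant times \<open>R powr (d - p) * q ^ k\<close> with \<open>q = 2 powr (p - d) < 1\<close>.
  The centre causes no trouble since \<open>0 powr (- p) = 0\<close>.\<close>

lemma nn_integral_power_near:
  assumes d: "DIM('a::euclidean_space) = d + 1" and p: "0 \<le> p" "p < real d"
  obtains C where "C > 0" "\<And>(x::'a) R. norm x = 1 \<Longrightarrow> R > 0 \<Longrightarrow>
    (\<integral>\<^sup>+z. indicator {z. norm (z - x) < R} z * ennreal (norm (z - x) powr (- p)) \<partial>sphere_measure) \<le> ennreal (C * R powr (real d - p))"
proof -
  interpret prob_space "sphere_measure :: 'a measure" by (rule prob_space_sphere_measure)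
  obtain C1 where C1: "C1 > 0" "\<And>(x::'a) r. norm x = 1 \<Longrightarrow> r > 0 \<Longrightarrow> measure sphere_measure {z. norm (z - x) < r} \<le> C1 * r ^ d"
    using measure_cap_le[OF d] by blast
  define q where "q = 2 powr (p - real d)"
  have q: "0 < q" "q < 1" using p powr_less_mono[of "p - real d" 0 2] by (auto simp: q_def)
  define C where "C = C1 * 2 powr p / (1 - q)"
  have main: "(\<integral>\<^sup>+z. indicator {z. norm (z - x) < R} z * ennreal (norm (z - x) powr (- p)) \<partial>sphere_measure) \<le> ennreal (C * R powr (real d - p))"
    if x: "norm (x::'a) = 1" and R: "R > 0" for x R
  proof -
    define S where "S k = {z::'a. norm (z - x) < R / 2 ^ k}" for k :: nat
    have Sm[measurable]: "S k \<in> sets borel" for k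
      unfolding S_def by (intro borel_open open_Collect_less continuous_intros)
    define c where "c k = (R / 2 ^ Suc k) powr (- p)" for k
    have pt: "indicator {z. norm (z - x) < R} z * ennreal (norm (z - x) powr (- p)) \<le> (\<Sum>k. ennreal (c k) * indicator (S k) z)" for z
    proof (cases "norm (z - x) < R \<and> z \<noteq> x")
      case True
      then have r: "0 < norm (z - x)" "norm (z - x) < R" by auto
      obtain n where "(1/2) ^ n < norm (z - x) / R" using r real_arch_pow_inv[of "norm (z - x) / R" "1/2"] R by auto
      then have "R < norm (z - x) * 2 ^ n" using R by (simp add: field_simps power_one_over)
      also have "\<dots> \<le> norm (z - x) * 2 ^ Suc n" by simp
      finally have ex: "R / 2 ^ Suc n \<le> norm (z - x)" by (simp add: field_simps)
      define k where "k = (LEAST k. R / 2 ^ Suc k \<le> norm (z - x))"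
      have k1: "R / 2 ^ Suc k \<le> norm (z - x)" unfolding k_def using ex by (rule LeastI)
      have k2: "norm (z - x) < R / 2 ^ k"
      proof (cases k)
        case (Suc m)
        then have "\<not> R / 2 ^ Suc m \<le> norm (z - x)" using not_less_Least[of m "\<lambda>k. R / 2 ^ Suc k \<le> norm (z - x)"] by (simp add: k_def)
        then show ?thesis by (simp add: Suc)
      qed (use r in simp)
      have "norm (z - x) powr (- p) \<le> c k"
        unfolding c_def using k1 R p by (intro powr_mono2') auto
      then have "indicator {z. norm (z - x) < R} z * ennreal (norm (z - x) powr (- p)) \<le> ennreal (c k) * indicator (S k) z"
        using r k2 by (simp add: S_def ennreal_leI)
      also have "\<dots> \<le> (\<Sum>k. ennreal (c k) * indicator (S k) z)" by (rule ennreal_le_suminf)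
      finally show ?thesis .
    qed (auto simp: indicator_def)
    have "(\<integral>\<^sup>+z. indicator {z. norm (z - x) < R} z * ennreal (norm (z - x) powr (- p)) \<partial>sphere_measure)
        \<le> (\<integral>\<^sup>+z. (\<Sum>k. ennreal (c k) * indicator (S k) z) \<partial>sphere_measure)"
      by (intro nn_integral_mono pt)
    also have "\<dots> = (\<Sum>k. \<integral>\<^sup>+z. ennreal (c k) * indicator (S k) z \<partial>sphere_measure)"
      by (rule nn_integral_suminf) (simp add: measurable_cong_sets[OF sets_sphere_measure])
    also have "\<dots> = (\<Sum>k. ennreal (c k) * emeasure sphere_measure (S k))"
      by (simp add: nn_integral_cmult_indicator)
    also have "\<dots> \<le> (\<Sum>k. ennreal (C1 * 2 powr p * R powr (real d - p) * q ^ k))"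
    proof (intro suminf_le summableI)
      fix k
      have "ennreal (c k) * emeasure sphere_measure (S k) = ennreal (c k * measure sphere_measure (S k))"
        by (simp add: emeasure_eq_measure c_def ennreal_mult)
      also have "c k * measure sphere_measure (S k) \<le> c k * (C1 * (R / 2 ^ k) ^ d)"
        unfolding S_def using R x by (intro mult_left_mono C1) (auto simp: c_def)
      also have "c k * (C1 * (R / 2 ^ k) ^ d) = C1 * 2 powr p * R powr (real d - p) * q ^ k"
      proof -
        have 2: "(2::real) ^ m = 2 powr real m" for m by (simp add: powr_realpow)
        have "c k = R powr (-p) * 2 powr (p * (real k + 1))"
          unfolding c_def 2 using R by (simp add: powr_divide powr_powr powr_minus_divide algebra_simps)
        moreover have "(R / 2 ^ k) ^ d = R powr real d * 2 powr (- real d * real k)"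
          using R by (simp add: power_divide powr_realpow powr_minus_divide flip: power_mult) (simp add: powr_realpow[symmetric] mult.commute)
        moreover have "q ^ k = 2 powr ((p - real d) * real k)"
          unfolding q_def by (simp add: powr_powr flip: powr_realpow)
        ultimately show ?thesis
          by (simp add: powr_add powr_diff powr_minus_divide algebra_simps)
      qed
      finally show "ennreal (c k) * emeasure sphere_measure (S k) \<le> ennreal (C1 * 2 powr p * R powr (real d - p) * q ^ k)"
        by (simp add: ennreal_leI)
    qed
    also have "\<dots> = ennreal (\<Sum>k. C1 * 2 powr p * R powr (real d - p) * q ^ k)"
      using C1 q by (intro suminf_ennreal2 summable_mult summable_geometric) auto
    also have "(\<Sum>k. C1 * 2 powr p * R powr (real d - p) * q ^ k) = C * R powr (real d - p)"
      using q by (subst suminf_mult) (auto simp: summable_geometric suminf_geometric C_def)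
    finally show ?thesis .
  qed
  show ?thesis by (rule that[of C]) (use main C1 q in \<open>auto simp: C_def\<close>)
qed

text \<open>The same geometric sum with caps that double in radius; now p > d makes the ratio
  smaller than 1.\<close>

lemma nn_integral_power_far:
  assumes d: "DIM('a::euclidean_space) = d + 1" and p: "real d < p"
  obtains C where "C > 0" "\<And>(x::'a) R. norm x = 1 \<Longrightarrow> R > 0 \<Longrightarrow>
    (\<integral>\<^sup>+z. indicator {z. R \<le> norm (z - x)} z * ennreal (norm (z - x) powr (- p)) \<partial>sphere_measure) \<le> ennreal (C * R powr (real d - p))"
proof -
  interpret prob_space "sphere_measure :: 'a measure" by (rule prob_space_sphere_measure)
  obtain C1 where C1: "C1 > 0" "\<And>(x::'a) r. norm x = 1 \<Longrightarrow> r > 0 \<Longrightarrow> measure sphere_measure {z. norm (z - x) < r} \<le> C1 * r ^ d"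
    using measure_cap_le[OF d] by blast
  define q where "q = 2 powr (real d - p)"
  have q: "0 < q" "q < 1" using p powr_less_mono[of "real d - p" 0 2] by (auto simp: q_def)
  define C where "C = C1 * 2 ^ d / (1 - q)"
  have main: "(\<integral>\<^sup>+z. indicator {z. R \<le> norm (z - x)} z * ennreal (norm (z - x) powr (- p)) \<partial>sphere_measure) \<le> ennreal (C * R powr (real d - p))"
    if x: "norm (x::'a) = 1" and R: "R > 0" for x R
  proof -
    define S where "S k = {z::'a. norm (z - x) < R * 2 ^ Suc k}" for k :: nat
    have Sm[measurable]: "S k \<in> sets borel" for k
      unfolding S_def by (intro borel_open open_Collect_less continuous_intros)
    define c where "c k = (R * 2 ^ k) powr (- p)" for k :: nat
    have pt: "indicator {z. R \<le> norm (z - x)} z * ennreal (norm (z - x) powr (- p)) \<le> (\<Sum>k. ennreal (c k) * indicator (S k) z)" for z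
    proof (cases "R \<le> norm (z - x)")
      case True
      obtain n where n: "norm (z - x) / R < 2 ^ n" using real_arch_pow[of 2 "norm (z - x) / R"] by auto
      have "norm (z - x) < R * 2 ^ n" using n R by (simp add: field_simps)
      also have "\<dots> \<le> R * 2 ^ Suc n" using R by simp
      finally have ex: "norm (z - x) < R * 2 ^ Suc n" .
      define k where "k = (LEAST k. norm (z - x) < R * 2 ^ Suc k)"
      have k1: "norm (z - x) < R * 2 ^ Suc k" unfolding k_def using ex by (rule LeastI)
      have k2: "R * 2 ^ k \<le> norm (z - x)"
      proof (cases k)
        case (Suc m)
        then have "\<not> norm (z - x) < R * 2 ^ Suc m" using not_less_Least[of m "\<lambda>k. norm (z - x) < R * 2 ^ Suc k"] by (simp add: k_def)
        then show ?thesis by (simp add: Suc)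
      qed (use True in simp)
      have "norm (z - x) powr (- p) \<le> c k"
        unfolding c_def using k2 R p by (intro powr_mono2') auto
      then have "indicator {z. R \<le> norm (z - x)} z * ennreal (norm (z - x) powr (- p)) \<le> ennreal (c k) * indicator (S k) z"
        using True k1 by (simp add: S_def ennreal_leI)
      also have "\<dots> \<le> (\<Sum>k. ennreal (c k) * indicator (S k) z)" by (rule ennreal_le_suminf)
      finally show ?thesis .
    qed auto
    have "(\<integral>\<^sup>+z. indicator {z. R \<le> norm (z - x)} z * ennreal (norm (z - x) powr (- p)) \<partial>sphere_measure)
        \<le> (\<integral>\<^sup>+z. (\<Sum>k. ennreal (c k) * indicator (S k) z) \<partial>sphere_measure)"
      by (intro nn_integral_mono pt)
    also have "\<dots> = (\<Sum>k. \<integral>\<^sup>+z. ennreal (c k) * indicator (S k) z \<partial>sphere_measure)"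
      by (rule nn_integral_suminf) (simp add: measurable_cong_sets[OF sets_sphere_measure])
    also have "\<dots> = (\<Sum>k. ennreal (c k) * emeasure sphere_measure (S k))"
      by (simp add: nn_integral_cmult_indicator)
    also have "\<dots> \<le> (\<Sum>k. ennreal (C1 * 2 ^ d * R powr (real d - p) * q ^ k))"
    proof (intro suminf_le summableI)
      fix k
      have "ennreal (c k) * emeasure sphere_measure (S k) = ennreal (c k * measure sphere_measure (S k))"
        by (simp add: emeasure_eq_measure c_def ennreal_mult)
      also have "c k * measure sphere_measure (S k) \<le> c k * (C1 * (R * 2 ^ Suc k) ^ d)"
        unfolding S_def using R x by (intro mult_left_mono C1) (auto simp: c_def)
      also have "c k * (C1 * (R * 2 ^ Suc k) ^ d) = C1 * 2 ^ d * R powr (real d - p) * q ^ k"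
      proof -
        have 2: "(2::real) ^ m = 2 powr real m" for m by (simp add: powr_realpow)
        have "c k = R powr (-p) * 2 powr (- p * real k)"
          unfolding c_def 2 using R by (simp add: powr_mult powr_powr algebra_simps)
        moreover have "(R * 2 ^ Suc k) ^ d = 2 ^ d * (R powr real d * 2 powr (real d * real k))"
          using R by (simp add: power_mult_distrib powr_realpow flip: power_mult) (simp add: powr_realpow[symmetric] mult.commute)
        moreover have "q ^ k = 2 powr ((real d - p) * real k)"
          unfolding q_def by (simp add: powr_powr flip: powr_realpow)
        ultimately show ?thesis
          by (simp add: powr_add powr_diff powr_minus_divide algebra_simps)
      qed
      finally show "ennreal (c k) * emeasure sphere_measure (S k) \<le> ennreal (C1 * 2 ^ d * R powr (real d - p) * q ^ k)"
        by (simp add: ennreal_leI)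
    qed
    also have "\<dots> = ennreal (\<Sum>k. C1 * 2 ^ d * R powr (real d - p) * q ^ k)"
      using C1 q by (intro suminf_ennreal2 summable_mult summable_geometric) auto
    also have "(\<Sum>k. C1 * 2 ^ d * R powr (real d - p) * q ^ k) = C * R powr (real d - p)"
      using q by (subst suminf_mult) (auto simp: summable_geometric suminf_geometric C_def)
    finally show ?thesis .
  qed
  show ?thesis by (rule that[of C]) (use main C1 q in \<open>auto simp: C_def\<close>)
qed

lemma AE_sphere_neq:
  fixes x :: "'a::euclidean_space"
  assumes x: "norm x = 1" and d: "DIM('a) = d + 1" "d \<ge> 1"
  shows "AE z in sphere_measure. z \<noteq> x"
proof -
  interpret prob_space "sphere_measure :: 'a measure" by (rule prob_space_sphere_measure)
  obtain C1 where C1: "C1 > 0" "\<And>(x::'a) r. norm x = 1 \<Longrightarrow> r > 0 \<Longrightarrow> measure sphere_measure {z. norm (z - x) < r} \<le> C1 * r ^ d"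
    using measure_cap_le[OF d(1)] by blast
  have le: "measure sphere_measure {x} \<le> C1 * (1 / (real n + 1)) ^ d" for n
  proof -
    have "measure sphere_measure {x} \<le> measure sphere_measure {z. norm (z - x) < 1 / (real n + 1)}"
      by (intro finite_measure_mono) (auto intro!: borel_open open_Collect_less continuous_intros)
    also have "\<dots> \<le> C1 * (1 / (real n + 1)) ^ d" by (rule C1) (use x in auto)
    finally show ?thesis .
  qed
  have "(\<lambda>n. C1 * (1 / (real n + 1)) ^ d) \<longlonglongrightarrow> C1 * 0 ^ d"
    by (intro tendsto_intros) real_asymp
  then have "measure sphere_measure {x} \<le> 0"
    using LIMSEQ_le_const[of _ _ "measure sphere_measure {x}"] le d(2) by (auto simp: power_0_left)
  then have "measure sphere_measure {x} = 0" by (simp add: measure_le_0_iff)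
  then have "{x} \<in> null_sets sphere_measure" by (simp add: null_sets_def emeasure_eq_measure)
  then show ?thesis by (rule AE_I') auto
qed

lemma rk_gap_measurable [measurable]: "rk_gap s \<epsilon> \<in> borel_measurable borel"
  unfolding rk_gap_def[abs_def] by measurable

text \<open>The sphere is split at distance \<open>sqrt \<epsilon>\<close> from x. Inside, the
  exponent \<open>s + 2 * \<theta>\<close> stays below d; outside, \<open>s + 4\<close> exceeds d
  because \<open>s \<ge> d - 2\<close>. Both pieces scale to the same power of \<epsilon>.\<close>

lemma rk_gap_integral:
  assumes d: "DIM('a::euclidean_space) = d + 1" and s: "0 \<le> s" "real d - 2 \<le> s" "s < real d"
  obtains C where "C > 0" "\<And>(x::'a) \<epsilon>. norm x = 1 \<Longrightarrow> \<epsilon> > 0 \<Longrightarrow>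
      integrable sphere_measure (\<lambda>z. rk_gap s \<epsilon> (2 - 2 * (z \<bullet> x))) \<and>
      (\<integral>z. rk_gap s \<epsilon> (2 - 2 * (z \<bullet> x)) \<partial>sphere_measure) \<le> C * \<epsilon> powr ((real d - s) / 2)"
proof -
  interpret prob_space "sphere_measure :: 'a measure" by (rule prob_space_sphere_measure)
  \<comment> \<open>The middle of the admissible range: \<open>s + 2 * \<theta> < d\<close> requires
    \<open>\<theta> < (d - s) / 2\<close>.\<close>
  define \<theta> where "\<theta> = (real d - s) / 4"
  have \<theta>: "\<theta> > 0" using s by (simp add: \<theta>_def)
  have d1: "d \<ge> 1" using s by simp
  obtain C0 where C0: "C0 > 0" "\<And>\<epsilon> t. 0 < t \<Longrightarrow> t \<le> \<epsilon> \<Longrightarrow> rk_gap s \<epsilon> t \<le> C0 * \<epsilon> powr \<theta> * t powr (- s / 2 - \<theta>)"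
    using rk_gap_small[OF s(1) \<theta>] by blast
  have p1: "0 \<le> s + 2 * \<theta>" "s + 2 * \<theta> < real d" "real d < s + 4" using s by (auto simp: \<theta>_def field_simps)
  obtain C1 where C1: "C1 > 0" "\<And>(x::'a) R. norm x = 1 \<Longrightarrow> R > 0 \<Longrightarrow>
    (\<integral>\<^sup>+z. indicator {z. norm (z - x) < R} z * ennreal (norm (z - x) powr (- (s + 2 * \<theta>))) \<partial>sphere_measure) \<le> ennreal (C1 * R powr (real d - (s + 2 * \<theta>)))"
    using nn_integral_power_near[OF d p1(1,2)] by blast
  obtain C2 where C2: "C2 > 0" "\<And>(x::'a) R. norm x = 1 \<Longrightarrow> R > 0 \<Longrightarrow>
    (\<integral>\<^sup>+z. indicator {z. R \<le> norm (z - x)} z * ennreal (norm (z - x) powr (- (s + 4))) \<partial>sphere_measure) \<le> ennreal (C2 * R powr (real d - (s + 4)))"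
    using nn_integral_power_far[OF d p1(3)] by blast
  define C where "C = C0 * C1 + (s + 2) / 4 * C2"
  have C: "C > 0" using C0 C1 C2 s by (simp add: C_def add_pos_nonneg)
  have main: "(\<integral>\<^sup>+z. ennreal (rk_gap s \<epsilon> (2 - 2 * (z \<bullet> x))) \<partial>sphere_measure) \<le> ennreal (C * \<epsilon> powr ((real d - s) / 2))"
    if x: "norm (x::'a) = 1" and e: "\<epsilon> > 0" for x \<epsilon>
  proof -
    define R where "R = sqrt \<epsilon>"
    have R: "R > 0" "R\<^sup>2 = \<epsilon>" "R = \<epsilon> powr (1/2)" using e by (auto simp: R_def powr_half_sqrt)
    have [measurable]: "{z. norm (z - x) < R} \<in> sets borel" "{z. R \<le> norm (z - x)} \<in> sets borel"
      by (auto intro!: borel_open borel_closed open_Collect_less closed_Collect_le continuous_intros)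
    let ?A = "\<lambda>z. ennreal (C0 * \<epsilon> powr \<theta>) * (indicator {z. norm (z - x) < R} z * ennreal (norm (z - x) powr (- (s + 2 * \<theta>))))"
    let ?B = "\<lambda>z. ennreal ((s + 2) / 4 * \<epsilon>\<^sup>2) * (indicator {z. R \<le> norm (z - x)} z * ennreal (norm (z - x) powr (- (s + 4))))"
    have "(\<integral>\<^sup>+z. ennreal (rk_gap s \<epsilon> (2 - 2 * (z \<bullet> x))) \<partial>sphere_measure) \<le> (\<integral>\<^sup>+z. ?A z + ?B z \<partial>sphere_measure)"
    proof (rule nn_integral_mono_AE)
      show "AE z in sphere_measure. ennreal (rk_gap s \<epsilon> (2 - 2 * (z \<bullet> x))) \<le> ?A z + ?B z"
        using AE_sphere_measure[where 'a='a] AE_sphere_neq[OF x d d1]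
      proof eventually_elim
        case (elim z)
        then have z: "norm z = 1" and zx: "norm (z - x) > 0" by auto
        define \<rho> where "\<rho> = norm (z - x)"
        have t: "2 - 2 * (z \<bullet> x) = \<rho>\<^sup>2" using norm_diff_sphere[OF z x] by (simp add: \<rho>_def)
        have pw: "(\<rho>\<^sup>2) powr a = \<rho> powr (2 * a)" for a
          using zx powr_powr[of \<rho> 2 a] by (simp add: \<rho>_def)
        show ?case
        proof (cases "\<rho> < R")
          case True
          then have "\<rho>\<^sup>2 \<le> \<epsilon>" using R zx power_mono[of \<rho> R 2] by (simp add: \<rho>_def)
          then have "rk_gap s \<epsilon> (\<rho>\<^sup>2) \<le> C0 * \<epsilon> powr \<theta> * (\<rho>\<^sup>2) powr (- s / 2 - \<theta>)"
            using zx by (intro C0) (auto simp: \<rho>_def)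
          also have "\<dots> = C0 * \<epsilon> powr \<theta> * \<rho> powr (- (s + 2 * \<theta>))" by (simp add: pw algebra_simps)
          finally show ?thesis using True C0 unfolding t
            by (simp add: \<rho>_def[symmetric] ennreal_leI flip: ennreal_mult)
        next
          case False
          have "rk_gap s \<epsilon> (\<rho>\<^sup>2) \<le> (s + 2) / 4 * \<epsilon>\<^sup>2 * (\<rho>\<^sup>2) powr (- s / 2 - 2)"
            using zx s e by (intro rk_gap_bounds) (auto simp: \<rho>_def)
          also have "\<dots> = (s + 2) / 4 * \<epsilon>\<^sup>2 * \<rho> powr (- (s + 4))" by (simp add: pw algebra_simps)
          finally show ?thesis using False s unfolding t
            by (simp add: \<rho>_def[symmetric] ennreal_leI flip: ennreal_mult)
        qed
      qed
    qed
    also have "\<dots> = (\<integral>\<^sup>+z. ?A z \<partial>sphere_measure) + (\<integral>\<^sup>+z. ?B z \<partial>sphere_measure)"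
      by (rule nn_integral_add) (simp_all add: measurable_cong_sets[OF sets_sphere_measure])
    also have "\<dots> = ennreal (C0 * \<epsilon> powr \<theta>) * (\<integral>\<^sup>+z. indicator {z. norm (z - x) < R} z * ennreal (norm (z - x) powr (- (s + 2 * \<theta>))) \<partial>sphere_measure)
       + ennreal ((s + 2) / 4 * \<epsilon>\<^sup>2) * (\<integral>\<^sup>+z. indicator {z. R \<le> norm (z - x)} z * ennreal (norm (z - x) powr (- (s + 4))) \<partial>sphere_measure)"
      by (intro arg_cong2[of _ _ _ _ "(+)"] nn_integral_cmult) (simp_all add: measurable_cong_sets[OF sets_sphere_measure])
    also have "\<dots> \<le> ennreal (C0 * \<epsilon> powr \<theta>) * ennreal (C1 * R powr (real d - (s + 2 * \<theta>)))
       + ennreal ((s + 2) / 4 * \<epsilon>\<^sup>2) * ennreal (C2 * R powr (real d - (s + 4)))"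
      by (intro add_mono mult_left_mono C1 C2 x R) auto
    also have "\<dots> = ennreal (C0 * \<epsilon> powr \<theta> * (C1 * R powr (real d - (s + 2 * \<theta>))) + (s + 2) / 4 * \<epsilon>\<^sup>2 * (C2 * R powr (real d - (s + 4))))"
      by (rule ennreal_mult_add) (use C0(1) C1(1) C2(1) s in auto)
    also have "C0 * \<epsilon> powr \<theta> * (C1 * R powr (real d - (s + 2 * \<theta>))) = C0 * C1 * (\<epsilon> powr (\<theta> + (1/2) * (real d - (s + 2 * \<theta>))))"
      unfolding R(3) powr_powr powr_add by simp
    also have "\<theta> + (1/2) * (real d - (s + 2 * \<theta>)) = (real d - s) / 2" by (simp add: field_simps)
    also have "(s + 2) / 4 * \<epsilon>\<^sup>2 * (C2 * R powr (real d - (s + 4))) = (s + 2) / 4 * C2 * (\<epsilon> powr (2 + (1/2) * (real d - (s + 4))))"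
      unfolding R(3) powr_powr powr_add using e by simp
    also have "2 + (1/2) * (real d - (s + 4)) = (real d - s) / 2" by (simp add: field_simps)
    also have "C0 * C1 * \<epsilon> powr ((real d - s) / 2) + (s + 2) / 4 * C2 * \<epsilon> powr ((real d - s) / 2) = C * \<epsilon> powr ((real d - s) / 2)"
      by (simp add: C_def algebra_simps)
    finally show ?thesis .
  qed
  show ?thesis
  proof (rule that[OF C], intro conjI)
    fix x :: 'a and \<epsilon> :: real assume x: "norm x = 1" and e: "\<epsilon> > 0"
    have nn: "AE z in sphere_measure. 0 \<le> rk_gap s \<epsilon> (2 - 2 * (z \<bullet> x))"
      using AE_sphere_measure[where 'a='a] AE_sphere_neq[OF x d d1]
    proof eventually_elim
      case (elim z)
      then show ?case using inner_sphere_less_1[of z x] x s e by (intro rk_gap_bounds) auto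
    qed
    have m: "(\<lambda>z. rk_gap s \<epsilon> (2 - 2 * (z \<bullet> x))) \<in> borel_measurable sphere_measure"
      by (simp add: measurable_cong_sets[OF sets_sphere_measure])
    show int: "integrable sphere_measure (\<lambda>z. rk_gap s \<epsilon> (2 - 2 * (z \<bullet> x)))"
      using main[OF x e] nn m by (intro integrableI_nonneg) (auto intro: le_less_trans)
    have "ennreal (\<integral>z. rk_gap s \<epsilon> (2 - 2 * (z \<bullet> x)) \<partial>sphere_measure) = (\<integral>\<^sup>+z. ennreal (rk_gap s \<epsilon> (2 - 2 * (z \<bullet> x))) \<partial>sphere_measure)"
      by (rule nn_integral_eq_integral[symmetric, OF int nn])
    then have "ennreal (\<integral>z. rk_gap s \<epsilon> (2 - 2 * (z \<bullet> x)) \<partial>sphere_measure) \<le> ennreal (C * \<epsilon> powr ((real d - s) / 2))"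
      using main[OF x e] by (simp only:)
    then show "(\<integral>z. rk_gap s \<epsilon> (2 - 2 * (z \<bullet> x)) \<partial>sphere_measure) \<le> C * \<epsilon> powr ((real d - s) / 2)"
      by (rule ennreal_le_iff[THEN iffD1, rotated]) (use C in simp)
  qed
qed

lemma rk_shift_bounded:
  assumes "\<epsilon> > 0" "t \<in> {0..4}"
  shows "\<bar>rk s (t + \<epsilon>)\<bar> \<le> max \<bar>rk s (4 + \<epsilon>)\<bar> \<bar>rk s \<epsilon>\<bar>"
  using rk_antimono[of "t + \<epsilon>" "4 + \<epsilon>" s] rk_antimono[of \<epsilon> "t + \<epsilon>" s] assms by auto

lemma integrable_rk_shift:
  fixes x :: "'a::euclidean_space"
  assumes "norm x = 1" "\<epsilon> > 0"
  shows "integrable sphere_measure (\<lambda>z. rk s (2 - 2 * (z \<bullet> x) + \<epsilon>))"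
proof (rule integrable_sphere_bounded)
  fix z :: 'a assume "norm z = 1"
  then have "2 - 2 * (z \<bullet> x) \<in> {0..4}" using inner_sphere_bounds[of z x] assms by auto
  then show "\<bar>rk s (2 - 2 * (z \<bullet> x) + \<epsilon>)\<bar> \<le> max \<bar>rk s (4 + \<epsilon>)\<bar> \<bar>rk s \<epsilon>\<bar>"
    using rk_shift_bounded assms(2) by blast
qed measurable

text \<open>At \<epsilon> = 1 the kernel differs from \<open>rk_gap\<close> only by bounded
  functions.\<close>

lemma integrable_rk:
  fixes x :: "'a::euclidean_space"
  assumes d: "DIM('a) = d + 1" and s: "0 \<le> s" "real d - 2 \<le> s" "s < real d" and x: "norm x = 1"
  shows "integrable sphere_measure (\<lambda>z. rk s (2 - 2 * (z \<bullet> x)))"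
proof -
  have g: "integrable sphere_measure (\<lambda>z. rk_gap s 1 (2 - 2 * (z \<bullet> x)))"
    using rk_gap_integral[OF d s] x by (metis zero_less_one)
  have i1: "integrable sphere_measure (\<lambda>z. rk s (2 - 2 * (z \<bullet> x) + 1))"
    and i2: "integrable sphere_measure (\<lambda>z. rk s (2 - 2 * (z \<bullet> x) + 2 * 1))"
    by (rule integrable_rk_shift[OF x]; simp)+
  show ?thesis
    using Bochner_Integration.integrable_diff[OF Bochner_Integration.integrable_add[OF g integrable_mult_right[OF i1, of 2]] i2]
    unfolding rk_gap_def by simp
qed

text \<open>By rotation invariance the inner integral is the same for every unit vector, so the
  outer one averages a constant; the altered value on the diagonal affects a null set only.\<close>

lemma riesz_integral_eq:
  fixes x :: "real^'n"
  assumes d: "CARD('n) = d + 1" "d \<ge> 1" and s: "0 \<le> s" and x: "norm x = 1"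
  shows "riesz_integral TYPE(real^'n) s = (\<integral>z. rk s (2 - 2 * (z \<bullet> x)) \<partial>sphere_measure)"
proof -
  interpret prob_space "sphere_measure :: (real^'n) measure" by (rule prob_space_sphere_measure)
  have D: "DIM(real^'n) = d + 1" using d by simp
  define I where "I = (\<integral>z. rk s (2 - 2 * (z \<bullet> x)) \<partial>sphere_measure)"
  have inner: "(\<integral>z. real_of_ereal (riesz_kernel s y z) \<partial>sphere_measure) = I" if y: "norm y = 1" for y :: "real^'n"
  proof -
    have m[measurable]: "(\<lambda>z. norm (y - z)) \<in> borel_measurable borel" by measurable
    have "(\<integral>z. real_of_ereal (riesz_kernel s y z) \<partial>sphere_measure) = (\<integral>z. rk s (2 - 2 * (y \<bullet> z)) \<partial>sphere_measure)"
    proof (rule integral_cong_AE)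
      have "(\<lambda>z. real_of_ereal (riesz_kernel s y z)) = (\<lambda>z. if y = z then 0 else rk s ((norm (y - z))\<^sup>2))"
        using s by (auto simp: riesz_kernel_eq fun_eq_iff)
      also have "\<dots> \<in> borel_measurable borel" by measurable
      finally show "(\<lambda>z. real_of_ereal (riesz_kernel s y z)) \<in> borel_measurable sphere_measure"
        by (simp add: measurable_cong_sets[OF sets_sphere_measure])
      show "(\<lambda>z. rk s (2 - 2 * (y \<bullet> z))) \<in> borel_measurable sphere_measure"
        by (simp add: measurable_cong_sets[OF sets_sphere_measure])
      show "AE z in sphere_measure. real_of_ereal (riesz_kernel s y z) = rk s (2 - 2 * (y \<bullet> z))"
        using AE_sphere_measure[where 'a="real^'n"] AE_sphere_neq[OF y D d(2)]
        by eventually_elim (use s y in \<open>auto simp: riesz_kernel_eq norm_diff_sphere\<close>)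
    qed
    also have "\<dots> = (\<integral>z. rk s (2 - 2 * (x \<bullet> z)) \<partial>sphere_measure)"
      by (rule zonal_integral_eq[OF y x, of "\<lambda>t. rk s (2 - 2 * t)"]) measurable
    finally show ?thesis by (simp add: I_def inner_commute)
  qed
  have "riesz_integral TYPE(real^'n) s = (\<integral>y. I \<partial>(sphere_measure :: (real^'n) measure))"
    unfolding riesz_integral_def
  proof (rule integral_cong_AE)
    show "AE y in (sphere_measure :: (real^'n) measure). (\<integral>z. real_of_ereal (riesz_kernel s y z) \<partial>sphere_measure) = I"
      using AE_sphere_measure[where 'a="real^'n"] by eventually_elim (use inner in auto)
    have "(\<lambda>(y, z). real_of_ereal (riesz_kernel s y z)) = (\<lambda>(y, z :: real^'n). if y = z then 0 else rk s ((norm (y - z))\<^sup>2))"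
      using s by (auto simp: riesz_kernel_eq fun_eq_iff)
    also have "\<dots> \<in> borel_measurable (borel \<Otimes>\<^sub>M borel)" by measurable
    finally have "(\<lambda>(y, z :: real^'n). real_of_ereal (riesz_kernel s y z)) \<in> borel_measurable (sphere_measure \<Otimes>\<^sub>M sphere_measure)"
      by (simp cong: measurable_cong_sets sets_pair_measure_cong)
    then show "(\<lambda>y. \<integral>z. real_of_ereal (riesz_kernel s y z) \<partial>sphere_measure) \<in> borel_measurable (sphere_measure :: (real^'n) measure)"
      by (intro borel_measurable_lebesgue_integral) simp
  qed simp
  then show ?thesis by (simp add: I_def)
qed

text \<open>Expanding \<open>(y \<bullet> z) ^ k\<close> over index words of length k writes it as
  an inner product of feature vectors \<phi>, those of the k-th tensor power. The inequality says
  that the summed features, minus \<open>card A\<close> times their mean \<open>M\<close> over the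
  sphere, have nonnegative squared norm; rotation invariance makes the pairing of \<open>M\<close>
  with each feature vector, and with itself, equal to \<open>J\<close>.\<close>

lemma power_kernel_pd:
  fixes x :: "'k \<Rightarrow> real^'n" and e :: "real^'n"
  assumes fin: "finite A" and x: "\<And>i. i \<in> A \<Longrightarrow> norm (x i) = 1" and e: "norm e = 1"
  shows "(real (card A))\<^sup>2 * (\<integral>z. (e \<bullet> z) ^ k \<partial>sphere_measure) \<le> (\<Sum>i\<in>A. \<Sum>j\<in>A. (x i \<bullet> x j) ^ k)"
proof -
  interpret prob_space "sphere_measure :: (real^'n) measure" by (rule prob_space_sphere_measure)
  define T where "T = (PiE {..<k} (\<lambda>_. UNIV :: 'n set))"
  have finT: "finite T" unfolding T_def by (intro finite_PiE) auto
  define \<phi> where "\<phi> f z = (\<Prod>l<k. z $ f l)" for f and z :: "real^'n"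
  have pw: "(y \<bullet> z) ^ k = (\<Sum>f\<in>T. \<phi> f y * \<phi> f z)" for y z
  proof -
    have "(y \<bullet> z) ^ k = (\<Prod>l<k. \<Sum>i\<in>UNIV. y $ i * z $ i)" by (simp add: inner_vec_def)
    also have "\<dots> = (\<Sum>f\<in>T. \<Prod>l<k. y $ f l * z $ f l)" unfolding T_def by (rule prod_sum_PiE) auto
    finally show ?thesis by (simp add: \<phi>_def prod.distrib)
  qed
  have \<phi>m[measurable]: "\<phi> f \<in> borel_measurable borel" for f
    unfolding \<phi>_def by (intro borel_measurable_continuous_onI continuous_intros)
  have \<phi>i: "integrable sphere_measure (\<phi> f)" for f
  proof (rule integrable_sphere_bounded[OF \<phi>m])
    fix z :: "real^'n" assume z: "norm z = 1"
    have "\<bar>\<phi> f z\<bar> = (\<Prod>l<k. \<bar>z $ f l\<bar>)" by (simp add: \<phi>_def abs_prod)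
    also have "\<dots> \<le> 1" using component_le_norm_cart[of z] z by (intro prod_le_1) auto
    finally show "\<bar>\<phi> f z\<bar> \<le> 1" .
  qed
  define J where "J = (\<integral>z. (e \<bullet> z) ^ k \<partial>sphere_measure)"
  define M where "M f = (\<integral>z. \<phi> f z \<partial>sphere_measure)" for f
  have J: "(\<Sum>f\<in>T. \<phi> f y * M f) = J" if "norm y = 1" for y
  proof -
    have "(\<Sum>f\<in>T. \<phi> f y * M f) = (\<integral>z. (\<Sum>f\<in>T. \<phi> f y * \<phi> f z) \<partial>sphere_measure)"
      using \<phi>i by (simp add: M_def)
    also have "\<dots> = (\<integral>z. (y \<bullet> z) ^ k \<partial>sphere_measure)" by (simp add: pw)
    also have "\<dots> = J" unfolding J_def by (rule zonal_integral_eq[OF that e, of "\<lambda>t. t ^ k"]) measurable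
    finally show ?thesis .
  qed
  have MM: "(\<Sum>f\<in>T. M f * M f) = J"
  proof -
    have "(\<Sum>f\<in>T. M f * M f) = (\<integral>z. (\<Sum>f\<in>T. \<phi> f z * M f) \<partial>sphere_measure)"
      using \<phi>i by (simp add: M_def)
    also have "\<dots> = (\<integral>z. J \<partial>(sphere_measure :: (real^'n) measure))"
    proof (rule integral_cong_AE)
      show "AE z in sphere_measure. (\<Sum>f\<in>T. \<phi> f z * M f) = J"
        using AE_sphere_measure[where 'a="real^'n"] by eventually_elim (use J in auto)
    qed (simp_all add: measurable_cong_sets[OF sets_sphere_measure])
    also have "\<dots> = J" by simp
    finally show ?thesis .
  qed
  define a where "a f = (\<Sum>i\<in>A. \<phi> f (x i))" for f
  define N where "N = real (card A)"
  have aa: "(\<Sum>f\<in>T. a f * a f) = (\<Sum>i\<in>A. \<Sum>j\<in>A. (x i \<bullet> x j) ^ k)"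
  proof -
    have "(\<Sum>f\<in>T. a f * a f) = (\<Sum>f\<in>T. \<Sum>i\<in>A. \<Sum>j\<in>A. \<phi> f (x i) * \<phi> f (x j))"
      by (simp add: a_def sum_product)
    also have "\<dots> = (\<Sum>i\<in>A. \<Sum>j\<in>A. \<Sum>f\<in>T. \<phi> f (x i) * \<phi> f (x j))"
      by (subst sum.swap, intro sum.cong refl, rule sum.swap)
    finally show ?thesis by (simp add: pw)
  qed
  have aM: "(\<Sum>f\<in>T. a f * M f) = N * J"
  proof -
    have "(\<Sum>f\<in>T. a f * M f) = (\<Sum>i\<in>A. \<Sum>f\<in>T. \<phi> f (x i) * M f)"
      by (simp add: a_def sum_distrib_right) (rule sum.swap)
    also have "\<dots> = (\<Sum>i\<in>A. J)" by (intro sum.cong refl J x)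
    finally show ?thesis by (simp add: N_def)
  qed
  have "0 \<le> (\<Sum>f\<in>T. (a f - N * M f)\<^sup>2)" by (intro sum_nonneg) auto
  also have "\<dots> = (\<Sum>f\<in>T. a f * a f) - 2 * N * (\<Sum>f\<in>T. a f * M f) + N\<^sup>2 * (\<Sum>f\<in>T. M f * M f)"
    by (simp add: power2_eq_square algebra_simps sum.distrib sum_subtractf sum_distrib_left)
  also have "\<dots> = (\<Sum>i\<in>A. \<Sum>j\<in>A. (x i \<bullet> x j) ^ k) - N\<^sup>2 * J"
    unfolding aa aM MM by (simp add: power2_eq_square algebra_simps)
  finally show ?thesis by (simp add: N_def J_def)
qed

text \<open>Nonnegative coefficients allow the monomial inequalities to be added up and passed to
  the limit. The constant term \<open>c0\<close> is kept apart because its sign is free: it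
  contributes \<open>(card A)\<^sup>2 * c0\<close> to both sides.\<close>

lemma series_kernel_pd:
  fixes x :: "'k \<Rightarrow> real^'n" and e :: "real^'n"
  assumes fin: "finite A" and x: "\<And>i. i \<in> A \<Longrightarrow> norm (x i) = 1" and e: "norm e = 1"
    and ser: "\<And>\<tau>. \<bar>\<tau>\<bar> \<le> 1 \<Longrightarrow> (\<lambda>k. c k * \<tau> ^ Suc k) sums (f \<tau> - c0)" and c: "\<And>k. 0 \<le> c k"
    and fm: "f \<in> borel_measurable borel"
  shows "(real (card A))\<^sup>2 * (\<integral>z. f (e \<bullet> z) \<partial>sphere_measure) \<le> (\<Sum>i\<in>A. \<Sum>j\<in>A. f (x i \<bullet> x j))"
proof -
  interpret prob_space "sphere_measure :: (real^'n) measure" by (rule prob_space_sphere_measure)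
  define g where "g n \<tau> = c0 + (\<Sum>k<n. c k * \<tau> ^ Suc k)" for n and \<tau> :: real
  have gm[measurable]: "g n \<in> borel_measurable borel" for n unfolding g_def[abs_def] by measurable
  note fm[measurable]
  have glim: "(\<lambda>n. g n \<tau>) \<longlonglongrightarrow> f \<tau>" if "\<bar>\<tau>\<bar> \<le> 1" for \<tau>
    using tendsto_add[OF tendsto_const[of c0] ser[OF that, unfolded sums_def]] by (simp add: g_def)
  have sc: "summable c" using ser[of 1] by (auto simp: sums_iff)
  have gb: "\<bar>g n \<tau>\<bar> \<le> \<bar>c0\<bar> + suminf c" if t: "\<bar>\<tau>\<bar> \<le> 1" for n \<tau>
  proof -
    have "\<bar>\<Sum>k<n. c k * \<tau> ^ Suc k\<bar> \<le> (\<Sum>k<n. \<bar>c k * \<tau> ^ Suc k\<bar>)" by (rule sum_abs)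
    also have "\<dots> \<le> (\<Sum>k<n. c k)"
    proof (rule sum_mono)
      fix k
      have "\<bar>\<tau> ^ Suc k\<bar> \<le> 1" using t by (simp add: power_abs power_le_one del: power_Suc)
      then show "\<bar>c k * \<tau> ^ Suc k\<bar> \<le> c k" using c[of k] mult_left_mono[of "\<bar>\<tau> ^ Suc k\<bar>" 1 "c k"] by (simp add: abs_mult)
    qed
    also have "\<dots> \<le> suminf c" using sc c by (intro sum_le_suminf) auto
    finally show ?thesis unfolding g_def using abs_triangle_ineq[of c0 "\<Sum>k<n. c k * \<tau> ^ Suc k"] by linarith
  qed
  have inn: "\<bar>y \<bullet> z\<bar> \<le> 1" if "norm y = 1" "norm z = 1" for y z :: "real^'n"
    using inner_sphere_bounds[OF that] by (auto simp: abs_le_iff)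
  have gi: "(real (card A))\<^sup>2 * (\<integral>z. g n (e \<bullet> z) \<partial>sphere_measure) \<le> (\<Sum>i\<in>A. \<Sum>j\<in>A. g n (x i \<bullet> x j))" for n
  proof -
    have ip: "integrable sphere_measure (\<lambda>z. (e \<bullet> z) ^ k)" for k
      by (rule integrable_sphere_bounded[of _ 1]) (use inn[OF e] in \<open>auto simp: power_abs power_le_one\<close>)
    have "(real (card A))\<^sup>2 * (\<integral>z. g n (e \<bullet> z) \<partial>sphere_measure)
      = (real (card A))\<^sup>2 * c0 + (\<Sum>k<n. c k * ((real (card A))\<^sup>2 * (\<integral>z. (e \<bullet> z) ^ Suc k \<partial>sphere_measure)))"
      unfolding g_def using ip by (simp add: algebra_simps sum_distrib_left del: power_Suc)
    also have "\<dots> \<le> (real (card A))\<^sup>2 * c0 + (\<Sum>k<n. c k * (\<Sum>i\<in>A. \<Sum>j\<in>A. (x i \<bullet> x j) ^ Suc k))"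
      by (intro add_left_mono sum_mono mult_left_mono c power_kernel_pd fin x e)
    also have "\<dots> = (\<Sum>i\<in>A. \<Sum>j\<in>A. g n (x i \<bullet> x j))"
    proof -
      have "(\<Sum>k<n. c k * (\<Sum>i\<in>A. \<Sum>j\<in>A. (x i \<bullet> x j) ^ Suc k)) = (\<Sum>i\<in>A. \<Sum>j\<in>A. \<Sum>k<n. c k * (x i \<bullet> x j) ^ Suc k)"
        unfolding sum_distrib_left by (subst sum.swap, intro sum.cong refl, rule sum.swap)
      then show ?thesis by (simp add: g_def sum.distrib power2_eq_square)
    qed
    finally show ?thesis .
  qed
  have l1: "(\<lambda>n. \<integral>z. g n (e \<bullet> z) \<partial>sphere_measure) \<longlonglongrightarrow> (\<integral>z. f (e \<bullet> z) \<partial>sphere_measure)"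
  proof (rule integral_dominated_convergence[of _ _ _ "\<lambda>_. \<bar>c0\<bar> + suminf c"])
    show "AE z in sphere_measure. (\<lambda>n. g n (e \<bullet> z)) \<longlonglongrightarrow> f (e \<bullet> z)"
      using AE_sphere_measure[where 'a="real^'n"] by eventually_elim (use inn[OF e] glim in auto)
    show "AE z in sphere_measure. norm (g n (e \<bullet> z)) \<le> \<bar>c0\<bar> + suminf c" for n
      using AE_sphere_measure[where 'a="real^'n"] by eventually_elim (use inn[OF e] gb in auto)
  qed (simp_all add: measurable_cong_sets[OF sets_sphere_measure])
  have l2: "(\<lambda>n. \<Sum>i\<in>A. \<Sum>j\<in>A. g n (x i \<bullet> x j)) \<longlonglongrightarrow> (\<Sum>i\<in>A. \<Sum>j\<in>A. f (x i \<bullet> x j))"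
    by (intro tendsto_sum glim inn x)
  show ?thesis
    by (rule LIMSEQ_le[OF tendsto_mult_left[OF l1] l2]) (use gi in blast)
qed

text \<open>Binomial series for s > 0 and logarithmic series for s = 0, in the variable
  \<open>2 * \<tau> / c\<close>. The numbers \<open>b k\<close> do not depend on the shift c, so the
  coefficients for two shifts can be compared.\<close>

lemma rk_series:
  assumes s: "s \<ge> 0"
  obtains b where "\<And>k. 0 \<le> b k"
    "\<And>c \<tau>. 2 < c \<Longrightarrow> \<bar>\<tau>\<bar> \<le> 1 \<Longrightarrow> (\<lambda>k. b k * c powr (- s / 2) * (2 / c) ^ Suc k * \<tau> ^ Suc k) sums (rk s (c - 2 * \<tau>) - rk s c)"
proof (cases "s = 0")
  case True
  define b where "b k = 1 / (2 * real (Suc k))" for k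
  show ?thesis
  proof (rule that[of b])
    fix c \<tau> :: real assume c: "2 < c" and t: "\<bar>\<tau>\<bar> \<le> 1"
    define y where "y = 2 / c * \<tau>"
    have "\<bar>y\<bar> \<le> 2 / c * 1" unfolding y_def abs_mult using c t by (intro mult_mono) auto
    also have "\<dots> < 1" using c by simp
    finally have y: "\<bar>y\<bar> < 1" .
    have "(\<lambda>n. - (y ^ n) / of_nat n) sums ln (1 - y)" using ln_series'[of "-y"] y by simp
    then have "(\<lambda>n. - (y ^ Suc n) / of_nat (Suc n)) sums ln (1 - y)"
      using sums_Suc_iff[of "\<lambda>n. - (y ^ n) / real n" "ln (1 - y)"] by simp
    then have "(\<lambda>n. - 1 / 2 * (- (y ^ Suc n) / of_nat (Suc n))) sums (- 1 / 2 * ln (1 - y))" by (rule sums_mult)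
    moreover have "- 1 / 2 * (- (y ^ Suc n) / of_nat (Suc n)) = b n * c powr (- s / 2) * (2 / c) ^ Suc n * \<tau> ^ Suc n" for n
    proof -
      have yp: "y ^ Suc n = (2 / c) ^ Suc n * \<tau> ^ Suc n" unfolding y_def by (rule power_mult_distrib)
      show ?thesis unfolding yp using True c by (simp add: b_def del: power_Suc of_nat_Suc)
    qed
    moreover have "- 1 / 2 * ln (1 - y) = rk s (c - 2 * \<tau>) - rk s c"
    proof -
      have "c - 2 * \<tau> = c * (1 - y)" using c by (simp add: y_def field_simps)
      moreover have "y \<noteq> 1" "y < 1" using y by auto
      ultimately have "ln (c - 2 * \<tau>) = ln c + ln (1 - y)" using c by (simp add: ln_mult)
      then show ?thesis unfolding rk_def using True by (simp only: if_True) argo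
    qed
    ultimately show "(\<lambda>k. b k * c powr (- s / 2) * (2 / c) ^ Suc k * \<tau> ^ Suc k) sums (rk s (c - 2 * \<tau>) - rk s c)" by simp
  qed (simp add: b_def)
next
  case False
  with s have s0: "s > 0" by simp
  define b where "b k = pochhammer (s / 2) (Suc k) / fact (Suc k) / s" for k
  show ?thesis
  proof (rule that[of b])
    fix k show "0 \<le> b k" using s0 by (simp add: b_def pochhammer_nonneg del: pochhammer_Suc fact_Suc)
  next
    fix c \<tau> :: real assume c: "2 < c" and t: "\<bar>\<tau>\<bar> \<le> 1"
    define y where "y = 2 / c * \<tau>"
    have "\<bar>y\<bar> \<le> 2 / c * 1" unfolding y_def abs_mult using c t by (intro mult_mono) auto
    also have "\<dots> < 1" using c by simp
    finally have y: "\<bar>y\<bar> < 1" .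
    have "(\<lambda>n. (- s / 2 gchoose n) * (- y) ^ n) sums (1 + (- y)) powr (- s / 2)"
      using y by (intro gen_binomial_real) auto
    moreover have "(- s / 2 gchoose n) * (- y) ^ n = pochhammer (s / 2) n / fact n * y ^ n" for n
      by (simp add: gbinomial_pochhammer flip: power_mult_distrib)
    ultimately have "(\<lambda>n. pochhammer (s / 2) n / fact n * y ^ n) sums (1 - y) powr (- s / 2)" by simp
    then have "(\<lambda>n. pochhammer (s / 2) (Suc n) / fact (Suc n) * y ^ Suc n) sums ((1 - y) powr (- s / 2) - 1)"
      by (subst sums_Suc_iff) simp
    then have "(\<lambda>n. c powr (- s / 2) / s * (pochhammer (s / 2) (Suc n) / fact (Suc n) * y ^ Suc n)) sums (c powr (- s / 2) / s * ((1 - y) powr (- s / 2) - 1))"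
      by (rule sums_mult)
    moreover have "c powr (- s / 2) / s * (pochhammer (s / 2) (Suc n) / fact (Suc n) * y ^ Suc n) = b n * c powr (- s / 2) * (2 / c) ^ Suc n * \<tau> ^ Suc n" for n
    proof -
      have yp: "y ^ Suc n = (2 / c) ^ Suc n * \<tau> ^ Suc n" unfolding y_def by (rule power_mult_distrib)
      show ?thesis unfolding yp by (simp add: b_def mult_ac del: power_Suc pochhammer_Suc fact_Suc)
    qed
    moreover have "c powr (- s / 2) / s * ((1 - y) powr (- s / 2) - 1) = rk s (c - 2 * \<tau>) - rk s c"
    proof -
      have "c - 2 * \<tau> = c * (1 - y)" using c by (simp add: y_def field_simps)
      then have "(c - 2 * \<tau>) powr (- s / 2) = c powr (- s / 2) * (1 - y) powr (- s / 2)"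
        using c y by (simp add: powr_mult)
      then show ?thesis unfolding rk_def using False by (simp add: right_diff_distrib diff_divide_distrib)
    qed
    ultimately show "(\<lambda>k. b k * c powr (- s / 2) * (2 / c) ^ Suc k * \<tau> ^ Suc k) sums (rk s (c - 2 * \<tau>) - rk s c)" by simp
  qed
qed

definition renergy :: "real \<Rightarrow> nat \<Rightarrow> (nat \<Rightarrow> 'a::euclidean_space) \<Rightarrow> real" where
  "renergy s N x = (\<Sum>i\<in>{1..N}. \<Sum>j\<in>{1..N} - {i}. rk s (2 - 2 * (x i \<bullet> x j)))"

text \<open>The kernel \<open>2 * k (t + \<epsilon>) - k (t + 2 * \<epsilon>)\<close> lies below \<open>k\<close> by convexity and is positive definite up to a constant,
  since its power series in \<open>x \<bullet> y\<close> has nonnegative coefficients; the loss \<open>rk_gap\<close> is of second order.\<close>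

lemma renergy_ge_regularized:
  assumes d: "CARD('n::finite) = d + 1" and s: "0 \<le> s" "real d - 2 \<le> s" "s < real d"
  obtains C where "C > 0" "\<And>(x :: nat \<Rightarrow> real^'n) N (\<epsilon> :: real). (\<And>i. i \<in> {1..N} \<Longrightarrow> norm (x i) = 1) \<Longrightarrow> inj_on x {1..N} \<Longrightarrow> \<epsilon> > 0 \<Longrightarrow>
     riesz_integral TYPE(real^'n) s * (real N)\<^sup>2 - C * \<epsilon> powr ((real d - s) / 2) * (real N)\<^sup>2 - real N * (2 * rk s \<epsilon> - rk s (2 * \<epsilon>)) \<le> renergy s N x"
proof -
  have D: "DIM(real^'n) = d + 1" using d by simp
  have d1: "d \<ge> 1" using s by simp
  obtain C where C: "C > 0" "\<And>(x::real^'n) \<epsilon>. norm x = 1 \<Longrightarrow> \<epsilon> > 0 \<Longrightarrow>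
      integrable sphere_measure (\<lambda>z. rk_gap s \<epsilon> (2 - 2 * (z \<bullet> x))) \<and>
      (\<integral>z. rk_gap s \<epsilon> (2 - 2 * (z \<bullet> x)) \<partial>sphere_measure) \<le> C * \<epsilon> powr ((real d - s) / 2)"
    using rk_gap_integral[OF D s] by blast
  obtain b where b: "\<And>k. 0 \<le> b k"
    "\<And>c \<tau>. 2 < c \<Longrightarrow> \<bar>\<tau>\<bar> \<le> 1 \<Longrightarrow> (\<lambda>k. b k * c powr (- s / 2) * (2 / c) ^ Suc k * \<tau> ^ Suc k) sums (rk s (c - 2 * \<tau>) - rk s c)"
    using rk_series[OF s(1)] by blast
  show ?thesis
  proof (rule that[OF C(1)])
    fix x :: "nat \<Rightarrow> real^'n" and N \<epsilon>
    assume x: "\<And>i. i \<in> {1..N} \<Longrightarrow> norm (x i) = 1" and inj: "inj_on x {1..N}" and e: "(\<epsilon>::real) > 0"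
    obtain e1 :: "real^'n" where e1: "norm e1 = 1" using norm_axis_1 by blast
    define g where "g t = 2 * rk s ((2 + \<epsilon>) - 2 * t) - rk s ((2 + 2 * \<epsilon>) - 2 * t)" for t
    have gm: "g \<in> borel_measurable borel" unfolding g_def[abs_def] by measurable
    define c where "c k = b k * (2 * ((2 + \<epsilon>) powr (- s / 2) * (2 / (2 + \<epsilon>)) ^ Suc k) - (2 + 2 * \<epsilon>) powr (- s / 2) * (2 / (2 + 2 * \<epsilon>)) ^ Suc k)" for k
    have cs: "(\<lambda>k. c k * \<tau> ^ Suc k) sums (g \<tau> - (2 * rk s (2 + \<epsilon>) - rk s (2 + 2 * \<epsilon>)))" if t: "\<bar>\<tau>\<bar> \<le> 1" for \<tau>
      using sums_diff[OF sums_mult[OF b(2)[of "2 + \<epsilon>" \<tau>], of 2] b(2)[of "2 + 2 * \<epsilon>" \<tau>]] e t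
      by (simp add: c_def g_def algebra_simps del: power_Suc)
    \<comment> \<open>Both the power of the shifted constant and the powers of its reciprocal
      decrease with the shift, so the larger shift has the smaller coefficients.\<close>
    have c0: "0 \<le> c k" for k
    proof -
      have "(2 + 2 * \<epsilon>) powr (- s / 2) * (2 / (2 + 2 * \<epsilon>)) ^ Suc k \<le> (2 + \<epsilon>) powr (- s / 2) * (2 / (2 + \<epsilon>)) ^ Suc k"
        using e s by (intro mult_mono power_mono powr_mono2' divide_left_mono) auto
      moreover have "0 \<le> (2 + \<epsilon>) powr (- s / 2) * (2 / (2 + \<epsilon>)) ^ Suc k" using e by simp
      ultimately show ?thesis unfolding c_def using b(1)[of k] by (intro mult_nonneg_nonneg) auto
    qed
    have "(real N)\<^sup>2 * (\<integral>z. g (e1 \<bullet> z) \<partial>sphere_measure) \<le> (\<Sum>i\<in>{1..N}. \<Sum>j\<in>{1..N}. g (x i \<bullet> x j))"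
      using series_kernel_pd[of "{1..N}" x, OF _ x e1 cs c0 gm] by simp
    also have "(\<Sum>i\<in>{1..N}. \<Sum>j\<in>{1..N}. g (x i \<bullet> x j)) = (\<Sum>i\<in>{1..N}. g (x i \<bullet> x i) + (\<Sum>j\<in>{1..N} - {i}. g (x i \<bullet> x j)))"
      by (intro sum.cong refl sum.remove) auto
    also have "\<dots> \<le> (\<Sum>i\<in>{1..N}. (2 * rk s \<epsilon> - rk s (2 * \<epsilon>)) + (\<Sum>j\<in>{1..N} - {i}. rk s (2 - 2 * (x i \<bullet> x j))))"
    proof (intro sum_mono add_mono)
      fix i assume i: "i \<in> {1..N}"
      \<comment> \<open>The regularized kernel is finite on the diagonal; completing the double sum
        by these N terms is what makes positive definiteness applicable.\<close>
      show "g (x i \<bullet> x i) \<le> 2 * rk s \<epsilon> - rk s (2 * \<epsilon>)" using x[OF i] by (simp add: g_def dot_square_norm)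
      fix j assume j: "j \<in> {1..N} - {i}"
      have "x i \<noteq> x j" using inj_onD[OF inj, of i j] i j by blast
      then have "x i \<bullet> x j < 1" using inner_sphere_less_1[OF x[OF i] x[of j]] j by blast
      then have "0 \<le> rk_gap s \<epsilon> (2 - 2 * (x i \<bullet> x j))" using s e by (intro rk_gap_bounds) auto
      then show "g (x i \<bullet> x j) \<le> rk s (2 - 2 * (x i \<bullet> x j))" by (simp add: g_def rk_gap_def algebra_simps)
    qed
    also have "\<dots> = real N * (2 * rk s \<epsilon> - rk s (2 * \<epsilon>)) + renergy s N x"
      by (simp add: renergy_def sum.distrib)
    finally have 1: "(real N)\<^sup>2 * (\<integral>z. g (e1 \<bullet> z) \<partial>sphere_measure) \<le> real N * (2 * rk s \<epsilon> - rk s (2 * \<epsilon>)) + renergy s N x" .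
    have "(\<integral>z. g (e1 \<bullet> z) \<partial>sphere_measure) = (\<integral>z. rk s (2 - 2 * (z \<bullet> e1)) - rk_gap s \<epsilon> (2 - 2 * (z \<bullet> e1)) \<partial>sphere_measure)"
      by (intro Bochner_Integration.integral_cong refl) (simp add: g_def rk_gap_def inner_commute algebra_simps)
    also have "\<dots> = riesz_integral TYPE(real^'n) s - (\<integral>z. rk_gap s \<epsilon> (2 - 2 * (z \<bullet> e1)) \<partial>sphere_measure)"
      using integrable_rk[OF D s e1] C(2)[OF e1 e] riesz_integral_eq[OF d d1 s(1) e1] by simp
    also have "\<dots> \<ge> riesz_integral TYPE(real^'n) s - C * \<epsilon> powr ((real d - s) / 2)" using C(2)[OF e1 e] by simp
    finally have "(real N)\<^sup>2 * (riesz_integral TYPE(real^'n) s - C * \<epsilon> powr ((real d - s) / 2)) \<le> (real N)\<^sup>2 * (\<integral>z. g (e1 \<bullet> z) \<partial>sphere_measure)"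
      by (intro mult_left_mono) auto
    with 1 show "riesz_integral TYPE(real^'n) s * (real N)\<^sup>2 - C * \<epsilon> powr ((real d - s) / 2) * (real N)\<^sup>2 - real N * (2 * rk s \<epsilon> - rk s (2 * \<epsilon>)) \<le> renergy s N x"
      by (simp add: algebra_simps)
  qed
qed

section \<open>The polarization inequality for separated points\<close>

text \<open>Real-valued counterpart of \<open>riesz_potential\<close>. At a configuration point one
  summand is the junk value of \<open>rk\<close>, so statements about minima exclude these
  points.\<close>

definition rpot :: "real \<Rightarrow> nat \<Rightarrow> (nat \<Rightarrow> 'a::euclidean_space) \<Rightarrow> 'a \<Rightarrow> real" where
  "rpot s N x z = (\<Sum>j=1..N. rk s (2 - 2 * (z \<bullet> x j)))"

lemma riesz_kernel_sphere:
  assumes "s \<ge> 0" "norm x = 1" "norm y = 1"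
  shows "riesz_kernel s x y = (if x = y then \<infinity> else ereal (rk s (2 - 2 * (x \<bullet> y))))"
  using assms by (simp add: riesz_kernel_eq norm_diff_sphere)

lemma riesz_potential_eq:
  assumes "s \<ge> 0" "norm z = 1" "\<And>i. i \<in> {1..N} \<Longrightarrow> norm (x i) = 1" "z \<notin> x ` {1..N}"
  shows "riesz_potential s N x z = ereal (rpot s N x z)"
proof -
  have "riesz_potential s N x z = (\<Sum>j=1..N. ereal (rk s (2 - 2 * (z \<bullet> x j))))"
    unfolding riesz_potential_def using assms by (intro sum.cong refl) (auto simp: riesz_kernel_sphere)
  then show ?thesis by (simp add: rpot_def)
qed

lemma riesz_energy_eq:
  assumes "s \<ge> 0" "\<And>i. i \<in> {1..N} \<Longrightarrow> norm (x i) = 1" "inj_on x {1..N}"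
  shows "riesz_energy s N x = ereal (renergy s N x)"
proof -
  have "riesz_energy s N x = (\<Sum>i\<in>{1..N}. \<Sum>j\<in>{1..N} - {i}. ereal (rk s (2 - 2 * (x i \<bullet> x j))))"
    unfolding riesz_energy_def
  proof (intro sum.cong refl)
    fix i j assume ij: "i \<in> {1..N}" "j \<in> {1..N} - {i}"
    then have "x i \<noteq> x j" using inj_onD[OF assms(3), of i j] by blast
    then show "riesz_kernel s (x i) (x j) = ereal (rk s (2 - 2 * (x i \<bullet> x j)))"
      using assms(1,2) ij by (simp add: riesz_kernel_sphere)
  qed
  then show ?thesis by (simp add: renergy_def)
qed

lemma rk_ge_rk_4:
  fixes x y :: "'a::euclidean_space"
  assumes "norm x = 1" "norm y = 1" "x \<noteq> y"
  shows "rk s 4 \<le> rk s (2 - 2 * (x \<bullet> y))"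
  using inner_sphere_less_1[OF assms] inner_sphere_bounds[OF assms(1,2)] by (intro rk_antimono) auto

lemma sphere_avoid_finite:
  fixes x :: "nat \<Rightarrow> 'a::euclidean_space"
  assumes d: "DIM('a) = d + 1" "d \<ge> 1" and x: "\<And>i. i \<in> {1..N} \<Longrightarrow> norm (x i) = 1"
  shows "AE z in sphere_measure. norm z = 1 \<and> z \<notin> x ` {1..N}"
proof -
  have "AE z in sphere_measure. \<forall>i\<in>{1..N}. z \<noteq> x i"
    by (subst AE_ball_countable) (use AE_sphere_neq[OF x d] in auto)
  with AE_sphere_measure[where 'a='a] show ?thesis by eventually_elim auto
qed

lemma ex_sphere_avoid:
  fixes x :: "nat \<Rightarrow> 'a::euclidean_space"
  assumes d: "DIM('a) = d + 1" "d \<ge> 1" and x: "\<And>i. i \<in> {1..N} \<Longrightarrow> norm (x i) = 1"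
  obtains z where "norm z = 1" "z \<notin> x ` {1..N}"
proof -
  interpret prob_space "sphere_measure :: 'a measure" by (rule prob_space_sphere_measure)
  have "\<exists>z. norm z = 1 \<and> z \<notin> x ` {1..N}"
  proof (rule ccontr)
    assume nex: "\<nexists>z. norm z = 1 \<and> z \<notin> x ` {1..N}"
    have "AE z in (sphere_measure :: 'a measure). norm z = 1 \<and> z \<notin> x ` {1..N}"
      by (rule sphere_avoid_finite[OF d x])
    then have "AE z in (sphere_measure :: 'a measure). False" by eventually_elim (use nex in blast)
    then show False by simp
  qed
  then show ?thesis using that by blast
qed

text \<open>Four is the largest squared distance, so every potential is at least
  \<open>N * rk s 4\<close>; a point off the configuration bounds the infimum from above.\<close>

lemma polarization_real:
  fixes x :: "nat \<Rightarrow> 'a::euclidean_space"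
  assumes d: "DIM('a) = d + 1" "d \<ge> 1" and s: "s \<ge> 0" and x: "\<And>i. i \<in> {1..N} \<Longrightarrow> norm (x i) = 1"
  obtains P where "polarization s N x = ereal P" "\<And>z. norm z = 1 \<Longrightarrow> z \<notin> x ` {1..N} \<Longrightarrow> P \<le> rpot s N x z"
proof -
  obtain z0 where z0: "norm z0 = 1" "z0 \<notin> x ` {1..N}"
    using ex_sphere_avoid[OF d, of N x] x by blast
  have le: "polarization s N x \<le> ereal (rpot s N x z)" if "norm z = 1" "z \<notin> x ` {1..N}" for z
    unfolding polarization_def using that riesz_potential_eq[OF s that(1) x that(2)] by (intro INF_lower2[of z]) auto
  have ge: "ereal (real N * rk s 4) \<le> polarization s N x"
    unfolding polarization_def
  proof (rule INF_greatest)
    fix z :: 'a assume "z \<in> sphere 0 1"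
    then have z: "norm z = 1" by simp
    have "ereal (real N * rk s 4) = (\<Sum>j=1..N. ereal (rk s 4))" by simp
    also have "\<dots> \<le> riesz_potential s N x z"
      unfolding riesz_potential_def
      by (intro sum_mono) (use rk_ge_rk_4[OF z x] in \<open>auto simp: riesz_kernel_sphere[OF s z x]\<close>)
    finally show "ereal (real N * rk s 4) \<le> riesz_potential s N x z" .
  qed
  obtain P where P: "polarization s N x = ereal P"
    using le[OF z0] ge by (cases "polarization s N x") auto
  show ?thesis using that[OF P] le unfolding P by simp
qed

lemma integral_rpot:
  fixes x :: "nat \<Rightarrow> real^'n"
  assumes d: "CARD('n) = d + 1" and s: "0 \<le> s" "real d - 2 \<le> s" "s < real d"
    and x: "\<And>i. i \<in> {1..N} \<Longrightarrow> norm (x i) = 1"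
  shows "integrable sphere_measure (rpot s N x)"
    "(\<integral>z. rpot s N x z \<partial>sphere_measure) = riesz_integral TYPE(real^'n) s * real N"
proof -
  have D: "DIM(real^'n) = d + 1" "d \<ge> 1" using d s by auto
  have i: "integrable sphere_measure (\<lambda>z. rk s (2 - 2 * (z \<bullet> x j)))" if "j \<in> {1..N}" for j
    by (rule integrable_rk[OF D(1) s x[OF that]])
  show "integrable sphere_measure (rpot s N x)"
    unfolding rpot_def[abs_def] using i by (intro Bochner_Integration.integrable_sum) auto
  have "(\<integral>z. rpot s N x z \<partial>sphere_measure) = (\<Sum>j=1..N. \<integral>z. rk s (2 - 2 * (z \<bullet> x j)) \<partial>sphere_measure)"
    unfolding rpot_def[abs_def] using i by (intro Bochner_Integration.integral_sum) auto
  also have "\<dots> = (\<Sum>j=1..N. riesz_integral TYPE(real^'n) s)"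
    by (intro sum.cong refl riesz_integral_eq[OF d D(2) s(1) x, symmetric]) auto
  finally show "(\<integral>z. rpot s N x z \<partial>sphere_measure) = riesz_integral TYPE(real^'n) s * real N" by simp
qed

lemma lower_bound_le_average:
  fixes x :: "nat \<Rightarrow> real^'n"
  assumes d: "CARD('n) = d + 1" and s: "0 \<le> s" "real d - 2 \<le> s" "s < real d"
    and x: "\<And>i. i \<in> {1..N} \<Longrightarrow> norm (x i) = 1"
    and P: "\<And>z. norm z = 1 \<Longrightarrow> z \<notin> x ` {1..N} \<Longrightarrow> P \<le> rpot s N x z"
  shows "P \<le> riesz_integral TYPE(real^'n) s * real N"
proof -
  interpret prob_space "sphere_measure :: (real^'n) measure" by (rule prob_space_sphere_measure)
  have D: "DIM(real^'n) = d + 1" "d \<ge> 1" using d s by auto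
  have av: "AE z in sphere_measure. norm z = 1 \<and> z \<notin> x ` {1..N}"
    by (rule sphere_avoid_finite[OF D x])
  have "P = (\<integral>z. P \<partial>(sphere_measure :: (real^'n) measure))" by simp
  also have "\<dots> \<le> (\<integral>z. rpot s N x z \<partial>sphere_measure)"
  proof (rule integral_mono_AE)
    show "AE z in sphere_measure. P \<le> rpot s N x z"
      using av by eventually_elim (use P in auto)
  qed (use integral_rpot(1)[OF d s x] in auto)
  finally show ?thesis using integral_rpot(2)[OF d s x] by simp
qed

text \<open>The axis is an arbitrary unit vector; rotation invariance makes the choice
  immaterial.\<close>

definition cap_mass :: "'n::finite itself \<Rightarrow> nat \<Rightarrow> real \<Rightarrow> real" where
  "cap_mass _ d R = (\<integral>z. cap_weight d R (z \<bullet> (axis undefined 1 :: real^'n)) \<partial>sphere_measure)"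

lemma cap_mass_eq:
  fixes x :: "real^'n"
  assumes "norm x = 1"
  shows "(\<integral>z. cap_weight d R (z \<bullet> x) \<partial>sphere_measure) = cap_mass TYPE('n) d R"
  using zonal_integral_eq[OF assms norm_axis_1[of "undefined :: 'n"], of "cap_weight d R"]
  by (simp add: cap_mass_def inner_commute)

text \<open>Green's formula for the constant 1 shows that the weight has at least the mass of
  \<open>cap_D\<close>, taken here with \<kappa> = R. On the cap of radius \<open>sqrt R\<close>,
  whose measure is at least of order \<open>R powr (d / 2)\<close>, \<open>cap_q\<close> is at most
  \<open>4 * R\<close> and the cut-off at least \<open>R ^ d / 2\<close>, so \<open>cap_D\<close> is
  at least \<open>b\<close> there.\<close>

lemma cap_mass_ge:
  assumes dn: "CARD('n::finite) = d + 1" and d: "d \<ge> 2"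
  obtains c where "c > 0" "\<And>R. 0 < R \<Longrightarrow> R \<le> 1 \<Longrightarrow> c * R ^ (2 * d) \<le> cap_mass TYPE('n) d R"
proof -
  interpret prob_space "sphere_measure :: (real^'n) measure" by (rule prob_space_sphere_measure)
  have D: "DIM(real^'n) = d + 1" using dn by simp
  obtain c1 where c1: "c1 > 0" "\<And>(x::real^'n) r. norm x = 1 \<Longrightarrow> 0 < r \<Longrightarrow> r \<le> 1 \<Longrightarrow> c1 * r ^ d \<le> measure sphere_measure {z. norm (z - x) < r}"
    using measure_cap_ge[OF D] by blast
  define c where "c = real d / 2 * 4 powr (- real d / 2 - 1) / 4 * c1"
  have c: "c > 0" using d c1 by (simp add: c_def)
  show ?thesis
  proof (rule that[OF c])
    fix R :: real assume R: "0 < R" "R \<le> 1"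
    define x where "x = (axis (undefined :: 'n) 1 :: real^'n)"
    have x: "norm x = 1" by (simp add: x_def)
    have inn: "z \<bullet> x \<in> {-1..1}" "\<bar>z \<bullet> x\<bar> \<le> 1" if "norm z = 1" for z
      using inner_sphere_bounds[OF that x] by (auto simp: abs_le_iff)
    note psi = cap_psi_bounds[OF d R R(1)] and wb = cap_weight_bounds[OF d R]
    note [measurable] = cap_measurable[OF d R R(1)]
    define M where "M = 2 * real d * R ^ d * R powr (real d / 2)"
    have iw: "integrable sphere_measure (\<lambda>z. cap_weight d R (z \<bullet> x))"
      by (rule integrable_sphere_bounded[of _ M]) (use wb inn in \<open>auto simp: M_def\<close>)
    have ipsi: "integrable sphere_measure (\<lambda>z. cap_psi d R R (z \<bullet> x))"
      by (rule integrable_sphere_bounded[of _ M]) (use psi wb inn in \<open>fastforce simp: M_def\<close>)+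
    have cD: "continuous_on {-1..1} (\<lambda>t. (1 - t\<^sup>2) * cap_g' d R R t - real d * t * cap_g d R R t)"
      using DERIV_continuous_on[OF cap_g_deriv[OF d R R(1)]]
      by (intro continuous_intros cap_g'_cont[OF d R R(1)]) auto
    obtain B where B: "\<And>t. t \<in> {-1..1} \<Longrightarrow> \<bar>(1 - t\<^sup>2) * cap_g' d R R t - real d * t * cap_g d R R t\<bar> \<le> B"
      using continuous_on_interval_bounded[OF cD] by blast
    have iPD: "integrable sphere_measure (\<lambda>z. cap_psi d R R (z \<bullet> x) - cap_D d R R (z \<bullet> x))"
    proof (rule integrable_sphere_bounded[of _ B])
      fix z :: "real^'n" assume z: "norm z = 1"
      show "\<bar>cap_psi d R R (z \<bullet> x) - cap_D d R R (z \<bullet> x)\<bar> \<le> B"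
        using B[OF inn(1)[OF z]] cap_laplace[OF d R R(1) inn(2)[OF z]] by simp
    qed measurable
    have iD: "integrable sphere_measure (\<lambda>z. cap_D d R R (z \<bullet> x))"
      using Bochner_Integration.integrable_diff[OF ipsi iPD] by simp
    define S where "S = {z. norm (z - x) < sqrt R}"
    have Sm[measurable]: "S \<in> sets borel"
      unfolding S_def by (intro borel_open open_Collect_less continuous_intros)
    define b where "b = real d / 2 * R * (4 * R) powr (- real d / 2 - 1) * (R ^ d / 2)\<^sup>2"
    have "c * R ^ (2 * d) = b * (c1 * sqrt R ^ d)"
    proof -
      have "sqrt R ^ d = R powr (real d / 2)"
        using R by (simp add: powr_half_sqrt[symmetric] powr_realpow[symmetric] powr_powr)
      moreover have "(4 * R) powr (- real d / 2 - 1) = 4 powr (- real d / 2 - 1) * R powr (- real d / 2 - 1)"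
        using R by (simp add: powr_mult)
      moreover have "R * R powr (- real d / 2 - 1) * R powr (real d / 2) = 1"
        using R by (simp add: powr_mult_base flip: powr_add)
      ultimately have "b * (c1 * sqrt R ^ d) = real d / 2 * 4 powr (- real d / 2 - 1) * (R ^ d / 2)\<^sup>2 * c1 * (R * R powr (- real d / 2 - 1) * R powr (real d / 2))"
        by (simp add: b_def algebra_simps)
      also have "\<dots> = real d / 2 * 4 powr (- real d / 2 - 1) * (R ^ d / 2)\<^sup>2 * c1"
        using \<open>R * R powr (- real d / 2 - 1) * R powr (real d / 2) = 1\<close> by simp
      also have "\<dots> = c * R ^ (2 * d)" by (simp add: c_def power_divide power_mult[symmetric] power_even_eq mult.commute)
      finally show ?thesis by simp
    qed
    also have "\<dots> \<le> b * measure sphere_measure S"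
      unfolding S_def using R x by (intro mult_left_mono c1) (auto simp: b_def)
    also have "\<dots> = (\<integral>z. b * indicator S z \<partial>sphere_measure)" by simp
    also have "\<dots> \<le> (\<integral>z. cap_D d R R (z \<bullet> x) \<partial>sphere_measure)"
    proof (rule integral_mono_AE)
      show "AE z in sphere_measure. b * indicator S z \<le> cap_D d R R (z \<bullet> x)"
      proof (rule AE_sphereI)
        fix z :: "real^'n" assume z: "norm z = 1"
        show "b * indicator S z \<le> cap_D d R R (z \<bullet> x)"
        proof (cases "z \<in> S")
          case True
          define t where "t = z \<bullet> x"
          have "(norm (z - x))\<^sup>2 < (sqrt R)\<^sup>2" using True by (intro power_strict_mono) (auto simp: S_def)
          then have t: "1 - t < R / 2" using norm_diff_sphere[OF z x] R by (simp add: t_def)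
          have t1: "t \<le> 1" "0 \<le> t" using inn[OF z] t R by (auto simp: t_def)
          have q: "0 < cap_q R t" "cap_q R t \<le> 4 * R"
          proof -
            show "0 < cap_q R t" using cap_q_pos[OF d R R(1), of t] t1 by simp
            have "(1 - t + R) * (1 + t) \<le> (2 * R) * 2" using t t1 R by (intro mult_mono) auto
            then show "cap_q R t \<le> 4 * R" by (simp add: cap_q_def[OF d R R(1)])
          qed
          have "(1 - t) ^ d \<le> (R / 2) ^ d" using t t1 by (intro power_mono) auto
          also have "\<dots> \<le> R ^ d / 2" using d R power_increasing[of 1 d "2::real"] by (simp add: power_divide field_simps)
          finally have m: "R ^ d / 2 \<le> max 0 (R ^ d - (1 - t) ^ d)" by linarith
          have "b = real d / 2 * R * 1\<^sup>2 * (4 * R) powr (- real d / 2 - 1) * (R ^ d / 2)\<^sup>2" by (simp add: b_def)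
          also have "\<dots> \<le> real d / 2 * R * (1 + t)\<^sup>2 * cap_q R t powr (- real d / 2 - 1) * (max 0 (R ^ d - (1 - t) ^ d))\<^sup>2"
            using R q t1 m by (intro mult_mono power_mono powr_mono2' mult_left_mono mult_nonneg_nonneg) auto
          also have "\<dots> = cap_D d R R t" by (simp add: cap_D_def[OF d R R(1)])
          finally show ?thesis using True by (simp add: t_def)
        qed (use psi(3) inn[OF z] in simp)
      qed
    qed (use iD in \<open>auto simp: emeasure_eq_measure\<close>)
    also have "\<dots> \<le> (\<integral>z. cap_psi d R R (z \<bullet> x) \<partial>sphere_measure)"
    proof -
      have "0 \<le> (\<integral>z. 1 * (cap_psi d R R (z \<bullet> x) - cap_D d R R (z \<bullet> x)) \<partial>sphere_measure)"
        by (rule cap_green[OF d R R(1) x x dn, of "\<lambda>_. 1" "\<lambda>_. 0" "\<lambda>_. 0"]) auto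
      then show ?thesis using ipsi iD by simp
    qed
    also have "\<dots> \<le> (\<integral>z. cap_weight d R (z \<bullet> x) \<partial>sphere_measure)"
      by (intro integral_mono_AE ipsi iw AE_sphereI) (use psi(2) inn in auto)
    also have "\<dots> = cap_mass TYPE('n) d R" by (rule cap_mass_eq[OF x])
    finally show "c * R ^ (2 * d) \<le> cap_mass TYPE('n) d R" .
  qed
qed

text \<open>The caps are disjoint, so at most one weight is active at a time and the sum
  \<open>W\<close> stays below \<open>M\<close>; nonnegativity of \<open>1 - W / M\<close> lets the
  pointwise bound on the potential be integrated against it. In the integral of \<open>W\<close>
  times the potential, cross terms are means over caps that avoid the pole, and in a diagonal term
  the kernel is seen at distances below \<open>r\<close>.\<close>

lemma cap_inequality:
  fixes x :: "nat \<Rightarrow> real^'n"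
  assumes dn: "CARD('n) = d + 1" and d: "d \<ge> 2" and s: "real d - 2 \<le> s" "s < real d"
    and x: "\<And>i. i \<in> {1..N} \<Longrightarrow> norm (x i) = 1"
    and sep: "\<And>i j. i \<in> {1..N} \<Longrightarrow> j \<in> {1..N} \<Longrightarrow> i \<noteq> j \<Longrightarrow> 2 * r \<le> norm (x i - x j)"
    and r: "0 < r" "r\<^sup>2 \<le> 2"
    and M: "M > 0" "\<And>\<tau>. \<bar>\<tau>\<bar> \<le> 1 \<Longrightarrow> cap_weight d (r\<^sup>2 / 2) \<tau> \<le> M"
    and P: "\<And>z. norm z = 1 \<Longrightarrow> z \<notin> x ` {1..N} \<Longrightarrow> P \<le> rpot s N x z"
    and m: "m = cap_mass TYPE('n) d (r\<^sup>2 / 2)"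
  shows "real N * m \<le> M"
    "P * (1 - real N * m / M) \<le> riesz_integral TYPE(real^'n) s * real N - m / M * (real N * rk s (r\<^sup>2) + renergy s N x)"
proof -
  interpret prob_space "sphere_measure :: (real^'n) measure" by (rule prob_space_sphere_measure)
  \<comment> \<open>For unit vectors, distance below \<open>r\<close> means height above
    \<open>1 - R\<close>.\<close>
  define R where "R = r\<^sup>2 / 2"
  have R: "0 < R" "R \<le> 1" using r by (auto simp: R_def)
  have s0: "0 \<le> s" using s d by simp
  have D: "DIM(real^'n) = d + 1" "d \<ge> 1" using dn d by auto
  note wb = cap_weight_bounds[OF d R]
  note M2 = M(2)[folded R_def]
  have inn: "z \<bullet> w \<in> {-1..1}" "\<bar>z \<bullet> w\<bar> \<le> 1" if "norm z = 1" "norm w = 1" for z w :: "real^'n"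
    using inner_sphere_bounds[OF that] by (auto simp: abs_le_iff)
  have av: "AE z in sphere_measure. norm z = 1 \<and> z \<notin> x ` {1..N}"
    by (rule sphere_avoid_finite[OF D x])
  define W where "W z = (\<Sum>i=1..N. cap_weight d R (z \<bullet> x i))" for z
  have cap: "norm (z - y) < r \<longleftrightarrow> 1 - R < z \<bullet> y" if "norm z = 1" "norm y = 1" for z y :: "real^'n"
  proof -
    have "norm (z - y) < r \<longleftrightarrow> (norm (z - y))\<^sup>2 < r\<^sup>2"
      using r by (metis abs_of_nonneg abs_of_pos norm_ge_zero power2_less_imp_less less_imp_le power_strict_mono pos2)
    then show ?thesis using norm_diff_sphere[OF that] by (auto simp: R_def)
  qed
  have disj: "\<not> 1 - R < z \<bullet> x j" if "norm z = 1" "1 - R < z \<bullet> x i" "i \<in> {1..N}" "j \<in> {1..N}" "i \<noteq> j" for z i j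
  proof
    assume "1 - R < z \<bullet> x j"
    then have "norm (z - x j) < r" "norm (z - x i) < r" using cap that x by auto
    then have "norm (x i - x j) < 2 * r" using norm_triangle_sub[of "x i - x j" "z - x j"] norm_triangle_ineq4[of "z - x j" "z - x i"] by simp
    with sep that show False by force
  qed
  have iw: "integrable sphere_measure (\<lambda>z. cap_weight d R (z \<bullet> x i))" if "i \<in> {1..N}" for i
    by (rule integrable_sphere_bounded[of _ M]) (use wb M2 inn x that in auto)
  have iW: "integrable sphere_measure W"
    unfolding W_def[abs_def] using iw by (intro Bochner_Integration.integrable_sum) auto
  have W_int: "(\<integral>z. W z \<partial>sphere_measure) = real N * m"
  proof -
    have "(\<integral>z. W z \<partial>sphere_measure) = (\<Sum>i=1..N. \<integral>z. cap_weight d R (z \<bullet> x i) \<partial>sphere_measure)"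
      unfolding W_def using iw by (intro Bochner_Integration.integral_sum) auto
    also have "\<dots> = (\<Sum>i=1..N. m)" by (intro sum.cong refl) (use x in \<open>auto simp: m cap_mass_eq R_def\<close>)
    finally show ?thesis by simp
  qed
  have W0: "0 \<le> W z" "W z \<le> M" if z: "norm z = 1" for z
  proof -
    show "0 \<le> W z" unfolding W_def by (intro sum_nonneg wb(1)) (use inn z x in auto)
    show "W z \<le> M"
    proof (cases "\<exists>i\<in>{1..N}. 1 - R < z \<bullet> x i")
      case True
      then obtain i where i: "i \<in> {1..N}" "1 - R < z \<bullet> x i" by blast
      have "W z = cap_weight d R (z \<bullet> x i) + (\<Sum>j\<in>{1..N} - {i}. cap_weight d R (z \<bullet> x j))"
        unfolding W_def using i by (intro sum.remove) auto
      also have "(\<Sum>j\<in>{1..N} - {i}. cap_weight d R (z \<bullet> x j)) = 0"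
        by (intro sum.neutral ballI wb(3)) (use disj[OF z i(2,1)] inn z x in force)+
      finally show ?thesis using M2 inn z x i by auto
    next
      case False
      then have "W z = 0" unfolding W_def by (intro sum.neutral ballI wb(3)) (use inn z x in force)+
      then show ?thesis using M by simp
    qed
  qed
  show "real N * m \<le> M"
  proof -
    have "(\<integral>z. W z \<partial>sphere_measure) \<le> (\<integral>z. M \<partial>(sphere_measure :: (real^'n) measure))"
      by (intro integral_mono_AE iW AE_sphereI) (use W0 in auto)
    then show ?thesis by (simp add: W_int)
  qed
  note ik = integrable_rk[OF D(1) s0 s x]
  have cw: "integrable sphere_measure (\<lambda>z. cap_weight d R (z \<bullet> x i) * rk s (2 - 2 * (z \<bullet> x j)))" if "i \<in> {1..N}" "j \<in> {1..N}" for i j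
  proof (rule Bochner_Integration.integrable_bound[OF integrable_mult_right[OF ik[OF that(2)], of M]])
    show "AE z in sphere_measure. norm (cap_weight d R (z \<bullet> x i) * rk s (2 - 2 * (z \<bullet> x j))) \<le> norm (M * rk s (2 - 2 * (z \<bullet> x j)))"
      by (rule AE_sphereI) (use wb(1) M2 inn x that M(1) in \<open>auto simp: abs_mult intro!: mult_right_mono\<close>)
  qed (simp add: measurable_cong_sets[OF sets_sphere_measure])
  have low: "m * rk s (r\<^sup>2) \<le> (\<integral>z. cap_weight d R (z \<bullet> x i) * rk s (2 - 2 * (z \<bullet> x i)) \<partial>sphere_measure)" if i: "i \<in> {1..N}" for i
  proof -
    have "m * rk s (r\<^sup>2) = (\<integral>z. cap_weight d R (z \<bullet> x i) * rk s (r\<^sup>2) \<partial>sphere_measure)"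
      using x[OF i] by (simp add: m cap_mass_eq R_def)
    also have "\<dots> \<le> (\<integral>z. cap_weight d R (z \<bullet> x i) * rk s (2 - 2 * (z \<bullet> x i)) \<partial>sphere_measure)"
    proof (rule integral_mono_AE)
      show "AE z in sphere_measure. cap_weight d R (z \<bullet> x i) * rk s (r\<^sup>2) \<le> cap_weight d R (z \<bullet> x i) * rk s (2 - 2 * (z \<bullet> x i))"
        using AE_sphere_measure[where 'a="real^'n"] AE_sphere_neq[OF x[OF i] D]
      proof eventually_elim
        case (elim z)
        then have z: "norm z = 1" "z \<bullet> x i < 1" using inner_sphere_less_1[OF _ x[OF i]] by auto
        show ?case
        proof (cases "z \<bullet> x i \<le> 1 - R")
          case True
          then show ?thesis using wb(3)[OF inn(2)[OF z(1) x[OF i]]] by simp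
        next
          case False
          then have "2 - 2 * (z \<bullet> x i) \<le> r\<^sup>2" by (simp add: R_def)
          then show ?thesis using z wb(1)[OF inn(2)[OF z(1) x[OF i]]] by (intro mult_left_mono rk_antimono) auto
        qed
      qed
    qed (use iw[OF i] cw[OF i i] in auto)
    finally show ?thesis .
  qed
  have sub: "m * rk s (2 - 2 * (x i \<bullet> x j)) \<le> (\<integral>z. cap_weight d R (z \<bullet> x i) * rk s (2 - 2 * (z \<bullet> x j)) \<partial>sphere_measure)"
    if i: "i \<in> {1..N}" and j: "j \<in> {1..N} - {i}" for i j
  proof -
    have "(\<integral>z. cap_weight d R (z \<bullet> x i) \<partial>sphere_measure) * rk s (2 - 2 * (x i \<bullet> x j))
       \<le> (\<integral>z. cap_weight d R (z \<bullet> x i) * rk s (2 - 2 * (z \<bullet> x j)) \<partial>sphere_measure)"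
    proof (rule submean_cap(2)[OF x[OF i] x dn d s(1) R, of _ "1 - R"])
      fix z :: "real^'n" assume "norm z = 1" "1 - R < z \<bullet> x i"
      then show "z \<bullet> x j \<le> 1 - R" using disj[of z i j] i j by auto
    qed (use j R in auto)
    then show ?thesis using x[OF i] by (simp add: m cap_mass_eq R_def)
  qed
  have WU: "integrable sphere_measure (\<lambda>z. W z * rpot s N x z)"
    "m * (real N * rk s (r\<^sup>2) + renergy s N x) \<le> (\<integral>z. W z * rpot s N x z \<partial>sphere_measure)"
  proof -
    have e: "W z * rpot s N x z = (\<Sum>i=1..N. \<Sum>j=1..N. cap_weight d R (z \<bullet> x i) * rk s (2 - 2 * (z \<bullet> x j)))" for z
      by (simp add: W_def rpot_def sum_product)
    show "integrable sphere_measure (\<lambda>z. W z * rpot s N x z)"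
      unfolding e using cw by (intro Bochner_Integration.integrable_sum) auto
    have "m * (real N * rk s (r\<^sup>2) + renergy s N x) = (\<Sum>i=1..N. m * rk s (r\<^sup>2) + (\<Sum>j\<in>{1..N} - {i}. m * rk s (2 - 2 * (x i \<bullet> x j))))"
      by (simp add: renergy_def sum.distrib sum_distrib_left distrib_left)
    also have "\<dots> \<le> (\<Sum>i=1..N. (\<integral>z. cap_weight d R (z \<bullet> x i) * rk s (2 - 2 * (z \<bullet> x i)) \<partial>sphere_measure)
        + (\<Sum>j\<in>{1..N} - {i}. \<integral>z. cap_weight d R (z \<bullet> x i) * rk s (2 - 2 * (z \<bullet> x j)) \<partial>sphere_measure))"
      by (intro sum_mono add_mono low sub) auto
    also have "\<dots> = (\<Sum>i=1..N. \<Sum>j=1..N. \<integral>z. cap_weight d R (z \<bullet> x i) * rk s (2 - 2 * (z \<bullet> x j)) \<partial>sphere_measure)"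
      by (intro sum.cong refl sum.remove[symmetric]) auto
    also have "\<dots> = (\<integral>z. W z * rpot s N x z \<partial>sphere_measure)"
      unfolding e using cw by (subst Bochner_Integration.integral_sum) (auto intro!: sum.cong Bochner_Integration.integrable_sum simp: Bochner_Integration.integral_sum)
    finally show "m * (real N * rk s (r\<^sup>2) + renergy s N x) \<le> (\<integral>z. W z * rpot s N x z \<partial>sphere_measure)" .
  qed
  note iU = integral_rpot[OF dn s0 s x]
  have "P * (1 - real N * m / M) = (\<integral>z. P * (1 - W z / M) \<partial>sphere_measure)"
    using iW W_int by (simp add: right_diff_distrib)
  also have "\<dots> \<le> (\<integral>z. rpot s N x z - W z * rpot s N x z / M \<partial>sphere_measure)"
  proof (rule integral_mono_AE)
    show "AE z in sphere_measure. P * (1 - W z / M) \<le> rpot s N x z - W z * rpot s N x z / M"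
      using av
    proof eventually_elim
      case (elim z)
      have "P * (1 - W z / M) \<le> rpot s N x z * (1 - W z / M)"
        using P[of z] W0[of z] elim M by (intro mult_right_mono) auto
      then show ?case by (simp add: algebra_simps)
    qed
  qed (use iW WU iU in auto)
  also have "\<dots> = riesz_integral TYPE(real^'n) s * real N - (\<integral>z. W z * rpot s N x z \<partial>sphere_measure) / M"
    using iU WU(1) by simp
  also have "\<dots> \<le> riesz_integral TYPE(real^'n) s * real N - m * (real N * rk s (r\<^sup>2) + renergy s N x) / M"
    using WU(2) M by (intro diff_left_mono divide_right_mono) auto
  finally show "P * (1 - real N * m / M) \<le> riesz_integral TYPE(real^'n) s * real N - m / M * (real N * rk s (r\<^sup>2) + renergy s N x)"
    by simp
qed

text \<open>The choice \<open>\<epsilon> = N powr (- 2 / d)\<close>, the square of the typical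
  spacing, balances the regularization loss against the N diagonal terms: both are of order
  \<open>N powr (1 + s / d)\<close>.\<close>

lemma renergy_ge_pos:
  assumes d: "CARD('n::finite) = d + 1" and s: "0 < s" "real d - 2 \<le> s" "s < real d"
  obtains C where "C > 0" "\<And>(x :: nat \<Rightarrow> real^'n) N. N \<ge> 1 \<Longrightarrow> (\<And>i. i \<in> {1..N} \<Longrightarrow> norm (x i) = 1) \<Longrightarrow> inj_on x {1..N} \<Longrightarrow>
     riesz_integral TYPE(real^'n) s * (real N)\<^sup>2 - C * real N powr (1 + s / real d) \<le> renergy s N x"
proof -
  have d0: "real d > 0" using s by linarith
  obtain C where C: "C > 0" "\<And>(x :: nat \<Rightarrow> real^'n) N (\<epsilon> :: real). (\<And>i. i \<in> {1..N} \<Longrightarrow> norm (x i) = 1) \<Longrightarrow> inj_on x {1..N} \<Longrightarrow> \<epsilon> > 0 \<Longrightarrow>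
     riesz_integral TYPE(real^'n) s * (real N)\<^sup>2 - C * \<epsilon> powr ((real d - s) / 2) * (real N)\<^sup>2 - real N * (2 * rk s \<epsilon> - rk s (2 * \<epsilon>)) \<le> renergy s N x"
    using renergy_ge_regularized[OF d less_imp_le[OF s(1)] s(2,3)] by blast
  show ?thesis
  proof (rule that[of "C + 2 / s"])
    show "C + 2 / s > 0" using C s by (simp add: add_pos_pos)
    fix x :: "nat \<Rightarrow> real^'n" and N :: nat
    assume N: "N \<ge> 1" and x: "\<And>i. i \<in> {1..N} \<Longrightarrow> norm (x i) = 1" "inj_on x {1..N}"
    define \<epsilon> where "\<epsilon> = real N powr (- 2 / real d)"
    have e: "\<epsilon> > 0" using N by (simp add: \<epsilon>_def)
    have N0: "real N > 0" using N by simp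
    have 1: "\<epsilon> powr ((real d - s) / 2) * (real N)\<^sup>2 = real N powr (1 + s / real d)"
    proof -
      have "\<epsilon> powr ((real d - s) / 2) * (real N)\<^sup>2 = real N powr ((- 2 / real d) * ((real d - s) / 2)) * real N powr 2"
        using N0 by (simp add: \<epsilon>_def powr_powr)
      also have "\<dots> = real N powr ((- 2 / real d) * ((real d - s) / 2) + 2)" by (simp only: powr_add)
      also have "(- 2 / real d) * ((real d - s) / 2) + 2 = 1 + s / real d" using d0 by (simp add: field_simps)
      finally show ?thesis .
    qed
    have 2: "real N * (2 * rk s \<epsilon> - rk s (2 * \<epsilon>)) \<le> 2 / s * real N powr (1 + s / real d)"
    proof -
      have "rk s (2 * \<epsilon>) \<ge> 0" using s by (simp add: rk_def)
      then have "real N * (2 * rk s \<epsilon> - rk s (2 * \<epsilon>)) \<le> real N * (2 * rk s \<epsilon>)" using N0 by (intro mult_left_mono) auto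
      also have "\<dots> = 2 / s * (real N powr (1 + s / real d))"
      proof -
        have "rk s \<epsilon> = real N powr ((- 2 / real d) * (- s / 2)) / s" using s by (simp add: rk_def \<epsilon>_def powr_powr)
        also have "(- 2 / real d) * (- s / 2) = s / real d" by simp
        finally show ?thesis using N0 by (simp add: powr_add)
      qed
      finally show ?thesis .
    qed
    show "riesz_integral TYPE(real^'n) s * (real N)\<^sup>2 - (C + 2 / s) * real N powr (1 + s / real d) \<le> renergy s N x"
      using C(2)[OF x e] 1 2 by (simp add: algebra_simps)
  qed
qed

text \<open>At \<epsilon> = 1 / N the diagonal terms amount to \<open>N * (ln N + ln 2) / 2\<close>,
  the origin of the coefficient 1/2, while the regularization loss is linear in N.\<close>

lemma renergy_ge_log:
  assumes d: "CARD('n::finite) = 3"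
  obtains C where "C > 0" "\<And>(x :: nat \<Rightarrow> real^'n) N. N \<ge> 1 \<Longrightarrow> (\<And>i. i \<in> {1..N} \<Longrightarrow> norm (x i) = 1) \<Longrightarrow> inj_on x {1..N} \<Longrightarrow>
     riesz_integral TYPE(real^'n) 0 * (real N)\<^sup>2 - real N * ln (real N) / 2 - C * real N \<le> renergy 0 N x"
proof -
  have d3: "CARD('n) = 2 + 1" using d by simp
  obtain C where C: "C > 0" "\<And>(x :: nat \<Rightarrow> real^'n) N (\<epsilon> :: real). (\<And>i. i \<in> {1..N} \<Longrightarrow> norm (x i) = 1) \<Longrightarrow> inj_on x {1..N} \<Longrightarrow> \<epsilon> > 0 \<Longrightarrow>
     riesz_integral TYPE(real^'n) 0 * (real N)\<^sup>2 - C * \<epsilon> powr ((real 2 - 0) / 2) * (real N)\<^sup>2 - real N * (2 * rk 0 \<epsilon> - rk 0 (2 * \<epsilon>)) \<le> renergy 0 N x"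
    by (rule renergy_ge_regularized[OF d3, of 0]) auto
  show ?thesis
  proof (rule that[of "C + ln 2 / 2"])
    show "C + ln 2 / 2 > 0" using C by (simp add: add_pos_pos)
    fix x :: "nat \<Rightarrow> real^'n" and N :: nat
    assume N: "N \<ge> 1" and x: "\<And>i. i \<in> {1..N} \<Longrightarrow> norm (x i) = 1" "inj_on x {1..N}"
    have N0: "real N > 0" using N by simp
    have a: "(1 / real N) powr ((real 2 - 0) / 2) * (real N)\<^sup>2 = real N"
      using N0 by (simp add: power2_eq_square)
    have b: "2 * rk 0 (1 / real N) - rk 0 (2 * (1 / real N)) = ln (real N) / 2 + ln 2 / 2"
      using N0 by (simp add: rk_def ln_div field_simps)
    show "riesz_integral TYPE(real^'n) 0 * (real N)\<^sup>2 - real N * ln (real N) / 2 - (C + ln 2 / 2) * real N \<le> renergy 0 N x"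
      using C(2)[OF x, of "1 / real N"] N0 unfolding b mult.assoc[of C] a by (simp add: algebra_simps)
  qed
qed

section \<open>Polarization bounds for separated configurations\<close>

lemma inj_on_separated:
  assumes "\<And>i j. i \<in> A \<Longrightarrow> j \<in> A \<Longrightarrow> i \<noteq> j \<Longrightarrow> \<delta> \<le> norm (x i - x j)" "\<delta> > 0"
  shows "inj_on x A"
  using assms by (force simp: inj_on_def)

lemma riesz_integral_nonneg:
  assumes d: "CARD('n::finite) = d + 1" and s: "0 < s" "real d - 2 \<le> s" "s < real d"
  shows "riesz_integral TYPE(real^'n) s \<ge> 0"
proof -
  have d1: "d \<ge> 1" using s by simp
  obtain e1 :: "real^'n" where e1: "norm e1 = 1" using norm_axis_1 by blast
  have "0 \<le> (\<integral>z. rk s (2 - 2 * (z \<bullet> e1)) \<partial>sphere_measure)"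
    using s by (intro integral_nonneg_AE AE_sphereI) (simp add: rk_def)
  then show ?thesis using riesz_integral_eq[OF d d1 less_imp_le[OF s(1)] e1] by simp
qed

text \<open>A mass of order at least \<open>R ^ (2 * d)\<close> is divided by twice the height bound
  of \<open>cap_weight_bounds\<close>, which is of order \<open>R powr (3 * d / 2)\<close>.\<close>

lemma cap_fraction:
  assumes dn: "CARD('n::finite) = d + 1" and d: "d \<ge> 2"
  obtains c where "c > 0" "\<And>R. 0 < R \<Longrightarrow> R \<le> 1 \<Longrightarrow> c * R powr (real d / 2) \<le> cap_mass TYPE('n) d R / (4 * real d * R ^ d * R powr (real d / 2))"
proof -
  obtain c where c: "c > 0" "\<And>R. 0 < R \<Longrightarrow> R \<le> 1 \<Longrightarrow> c * R ^ (2 * d) \<le> cap_mass TYPE('n) d R"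
    using cap_mass_ge[OF dn d] by blast
  show ?thesis
  proof (rule that[of "c / (4 * real d)"])
    show "c / (4 * real d) > 0" using c d by simp
    fix R :: real assume R: "0 < R" "R \<le> 1"
    have p: "0 < 4 * real d * R ^ d * R powr (real d / 2)" using R d by simp
    have pp: "R powr (real d / 2) * R powr (real d / 2) = R ^ d" using R by (simp add: powr_realpow flip: powr_add)
    have "c / (4 * real d) * R powr (real d / 2) * (4 * real d * R ^ d * R powr (real d / 2))
        = c * (R ^ d * (R powr (real d / 2) * R powr (real d / 2)))" using d by (simp add: field_simps)
    also have "\<dots> = c * R ^ (2 * d)" unfolding pp by (simp add: mult_2 power_add)
    finally have "c / (4 * real d) * R powr (real d / 2) * (4 * real d * R ^ d * R powr (real d / 2)) = c * R ^ (2 * d)" .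
    with c(2)[OF R] have "c / (4 * real d) * R powr (real d / 2) * (4 * real d * R ^ d * R powr (real d / 2)) \<le> cap_mass TYPE('n) d R" by simp
    then show "c / (4 * real d) * R powr (real d / 2) \<le> cap_mass TYPE('n) d R / (4 * real d * R ^ d * R powr (real d / 2))"
      by (subst pos_le_divide_eq[OF p])
  qed
qed

text \<open>Here \<open>\<delta> = N * m / M\<close> is the share of the weights in
  \<open>M * \<sigma>\<close>. Taking \<open>M\<close> as twice the height bound keeps \<delta> at
  most 1/2, so that \<open>1 - \<delta>\<close> can be cancelled later. Since R is of order
  \<open>\<epsilon>\<^sup>2 * N powr (- 2 / d)\<close>, the factor N drops out and
  \<open>\<epsilon> ^ d\<close> remains.\<close>

lemma cap_inequality_normalized:
  assumes dn: "CARD('n::finite) = d + 1" and d: "d \<ge> 2" and s: "real d - 2 \<le> s" "s < real d"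
  obtains \<kappa> where "\<kappa> > 0" "\<And>(x :: nat \<Rightarrow> real^'n) N \<epsilon> P. N \<ge> 1 \<Longrightarrow> 0 < \<epsilon> \<Longrightarrow> \<epsilon> \<le> 1 \<Longrightarrow> (\<And>i. i \<in> {1..N} \<Longrightarrow> norm (x i) = 1) \<Longrightarrow>
     (\<And>i j. i \<in> {1..N} \<Longrightarrow> j \<in> {1..N} \<Longrightarrow> i \<noteq> j \<Longrightarrow> 2 * \<epsilon> * real N powr (- 1 / real d) \<le> norm (x i - x j)) \<Longrightarrow>
     (\<And>z. norm z = 1 \<Longrightarrow> z \<notin> x ` {1..N} \<Longrightarrow> P \<le> rpot s N x z) \<Longrightarrow>
     \<exists>\<delta>. \<kappa> * \<epsilon> ^ d \<le> \<delta> \<and> \<delta> \<le> 1 / 2 \<and>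
       P * (1 - \<delta>) \<le> riesz_integral TYPE(real^'n) s * real N - \<delta> * (rk s (\<epsilon>\<^sup>2 * real N powr (- 2 / real d)) + renergy s N x / real N)"
proof -
  obtain c where c: "c > 0" "\<And>R. 0 < R \<Longrightarrow> R \<le> 1 \<Longrightarrow> c * R powr (real d / 2) \<le> cap_mass TYPE('n) d R / (4 * real d * R ^ d * R powr (real d / 2))"
    using cap_fraction[OF dn d] by blast
  define \<kappa> where "\<kappa> = c / 2 powr (real d / 2)"
  show ?thesis
  proof (rule that[of \<kappa>])
    show "\<kappa> > 0" using c by (simp add: \<kappa>_def)
    fix x :: "nat \<Rightarrow> real^'n" and N :: nat and \<epsilon> P :: real
    assume N: "N \<ge> 1" and e: "0 < \<epsilon>" "\<epsilon> \<le> 1" and x: "\<And>i. i \<in> {1..N} \<Longrightarrow> norm (x i) = 1"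
      and sep: "\<And>i j. i \<in> {1..N} \<Longrightarrow> j \<in> {1..N} \<Longrightarrow> i \<noteq> j \<Longrightarrow> 2 * \<epsilon> * real N powr (- 1 / real d) \<le> norm (x i - x j)"
      and P: "\<And>z. norm z = 1 \<Longrightarrow> z \<notin> x ` {1..N} \<Longrightarrow> P \<le> rpot s N x z"
    have N0: "real N > 0" using N by simp
    define r where "r = \<epsilon> * real N powr (- 1 / real d)"
    define R where "R = r\<^sup>2 / 2"
    have Nle: "real N powr (- 1 / real d) \<le> 1" using N powr_mono[of "- 1 / real d" 0 "real N"] by simp
    have r: "0 < r" "r \<le> 1" using e N0 mult_mono[OF e(2) Nle] by (auto simp: r_def)
    have r2: "r\<^sup>2 \<le> 1" using r by (simp add: power_le_one)
    have R: "0 < R" "R \<le> 1" using r r2 by (auto simp: R_def)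
    define M where "M = 4 * real d * R ^ d * R powr (real d / 2)"
    have M0: "M > 0" using R d by (simp add: M_def)
    have half: "cap_weight d R \<tau> \<le> M / 2" if "\<bar>\<tau>\<bar> \<le> 1" for \<tau>
      using cap_weight_bounds(2)[OF d R that] by (simp add: M_def)
    define m where "m = cap_mass TYPE('n) d R"
    have sep': "2 * r \<le> norm (x i - x j)" if "i \<in> {1..N}" "j \<in> {1..N}" "i \<noteq> j" for i j
      using sep[OF that] by (simp add: r_def)
    have le: "real N * m \<le> M / 2"
      by (rule cap_inequality(1)[OF dn d s x sep' r(1) _ _ _ P]) (use r2 M0 half in \<open>auto simp: R_def m_def\<close>)
    have ineq: "P * (1 - real N * m / M) \<le> riesz_integral TYPE(real^'n) s * real N - m / M * (real N * rk s (r\<^sup>2) + renergy s N x)"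
      by (rule cap_inequality(2)[OF dn d s x sep' r(1) _ M0 _ P]) (use r2 M0 half in \<open>force simp: R_def m_def\<close>)+
    show "\<exists>\<delta>. \<kappa> * \<epsilon> ^ d \<le> \<delta> \<and> \<delta> \<le> 1 / 2 \<and>
       P * (1 - \<delta>) \<le> riesz_integral TYPE(real^'n) s * real N - \<delta> * (rk s (\<epsilon>\<^sup>2 * real N powr (- 2 / real d)) + renergy s N x / real N)"
    proof (intro exI[of _ "real N * m / M"] conjI)
      have "r ^ d = \<epsilon> ^ d * (1 / real N)"
      proof -
        have "(real N powr (- 1 / real d)) ^ d = real N powr (- 1 / real d * real d)"
          using N0 by (simp add: powr_realpow[symmetric] powr_powr)
        also have "\<dots> = 1 / real N" using d N0 by (simp add: powr_minus_divide)
        finally show ?thesis by (simp add: r_def power_mult_distrib)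
      qed
      moreover have "R powr (real d / 2) = r ^ d / 2 powr (real d / 2)"
      proof -
        have "R powr (real d / 2) = (r powr 2) powr (real d / 2) / 2 powr (real d / 2)"
          using r unfolding R_def by (subst powr_divide) auto
        moreover have "(r powr 2) powr (real d / 2) = r ^ d"
          using powr_powr[of r 2 "real d / 2"] powr_realpow[of r d] r by simp
        ultimately show ?thesis by (simp only:)
      qed
      ultimately have "\<kappa> * \<epsilon> ^ d = real N * (c * R powr (real d / 2))"
        using N0 by (simp add: \<kappa>_def)
      also have "\<dots> \<le> real N * (m / M)"
        unfolding m_def M_def using N0 by (intro mult_left_mono c R) auto
      finally show "\<kappa> * \<epsilon> ^ d \<le> real N * m / M" by simp
      show "real N * m / M \<le> 1 / 2" using le M0 by (simp add: field_simps)
      have "r\<^sup>2 = \<epsilon>\<^sup>2 * real N powr (- 2 / real d)"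
        by (simp add: r_def power_mult_distrib power2_eq_square flip: powr_add)
      moreover have "m / M * (real N * rk s (r\<^sup>2) + renergy s N x) = real N * m / M * (rk s (r\<^sup>2) + renergy s N x / real N)"
      proof -
        have e: "real N * (rk s (r\<^sup>2) + renergy s N x / real N) = real N * rk s (r\<^sup>2) + renergy s N x"
          using N0 by (simp add: distrib_left)
        show ?thesis unfolding e[symmetric] by simp
      qed
      ultimately show "P * (1 - real N * m / M) \<le> riesz_integral TYPE(real^'n) s * real N - real N * m / M * (rk s (\<epsilon>\<^sup>2 * real N powr (- 2 / real d)) + renergy s N x / real N)"
        using ineq by (simp only:)
    qed
  qed
qed

lemma polarization_bound_pos:
  assumes dn: "CARD('n::finite) = d + 1" and d: "d \<ge> 2" and s: "0 < s" "real d - 2 \<le> s" "s < real d" and c: "c > 0"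
  obtains C where "C > 0" "\<And>(x :: nat \<Rightarrow> real^'n) N. N \<ge> 1 \<Longrightarrow> (\<And>i. i \<in> {1..N} \<Longrightarrow> norm (x i) = 1) \<Longrightarrow>
     (\<And>i j. i \<in> {1..N} \<Longrightarrow> j \<in> {1..N} \<Longrightarrow> i \<noteq> j \<Longrightarrow> c * real N powr (- 1 / real d) \<le> norm (x i - x j)) \<Longrightarrow>
     polarization s N x \<le> ereal (riesz_integral TYPE(real^'n) s * real N - C * real N powr (s / real d))"
proof -
  have D: "DIM(real^'n) = d + 1" "d \<ge> 1" using dn d by auto
  obtain CE where CE: "CE > 0" "\<And>(x :: nat \<Rightarrow> real^'n) N. N \<ge> 1 \<Longrightarrow> (\<And>i. i \<in> {1..N} \<Longrightarrow> norm (x i) = 1) \<Longrightarrow> inj_on x {1..N} \<Longrightarrow>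
     riesz_integral TYPE(real^'n) s * (real N)\<^sup>2 - CE * real N powr (1 + s / real d) \<le> renergy s N x"
    using renergy_ge_pos[OF dn s] by blast
  obtain \<kappa> where \<kappa>: "\<kappa> > 0" "\<And>(x :: nat \<Rightarrow> real^'n) N \<epsilon> P. N \<ge> 1 \<Longrightarrow> 0 < \<epsilon> \<Longrightarrow> \<epsilon> \<le> 1 \<Longrightarrow> (\<And>i. i \<in> {1..N} \<Longrightarrow> norm (x i) = 1) \<Longrightarrow>
     (\<And>i j. i \<in> {1..N} \<Longrightarrow> j \<in> {1..N} \<Longrightarrow> i \<noteq> j \<Longrightarrow> 2 * \<epsilon> * real N powr (- 1 / real d) \<le> norm (x i - x j)) \<Longrightarrow>
     (\<And>z. norm z = 1 \<Longrightarrow> z \<notin> x ` {1..N} \<Longrightarrow> P \<le> rpot s N x z) \<Longrightarrow>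
     \<exists>\<delta>. \<kappa> * \<epsilon> ^ d \<le> \<delta> \<and> \<delta> \<le> 1 / 2 \<and>
       P * (1 - \<delta>) \<le> riesz_integral TYPE(real^'n) s * real N - \<delta> * (rk s (\<epsilon>\<^sup>2 * real N powr (- 2 / real d)) + renergy s N x / real N)"
    using cap_inequality_normalized[OF dn d s(2,3)] by blast
  \<comment> \<open>The bound \<open>c / 2\<close> makes the caps disjoint; the last one gives
    \<open>\<epsilon> powr (- s) / s \<ge> CE + 1\<close>, so the self-interaction outweighs the
    energy deficit by a full \<open>N powr (s / d)\<close>.\<close>
  define \<epsilon> where "\<epsilon> = min 1 (min (c / 2) (((CE + 1) * s) powr (- 1 / s)))"
  have e: "0 < \<epsilon>" "\<epsilon> \<le> 1" "\<epsilon> \<le> c / 2" "\<epsilon> \<le> ((CE + 1) * s) powr (- 1 / s)"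
    using c CE s by (auto simp: \<epsilon>_def)
  have e': "CE + 1 \<le> \<epsilon> powr (- s) / s"
  proof -
    have "(((CE + 1) * s) powr (- 1 / s)) powr (- s) \<le> \<epsilon> powr (- s)"
      using e s by (intro powr_mono2') auto
    then have "(CE + 1) * s \<le> \<epsilon> powr (- s)" using CE s by (simp add: powr_powr)
    then show ?thesis using s by (simp add: field_simps)
  qed
  define C where "C = \<kappa> * \<epsilon> ^ d"
  let ?I = "riesz_integral TYPE(real^'n) s"
  show ?thesis
  proof (rule that[of C])
    show "C > 0" using \<kappa> e by (simp add: C_def)
    fix x :: "nat \<Rightarrow> real^'n" and N :: nat
    assume N: "N \<ge> 1" and x: "\<And>i. i \<in> {1..N} \<Longrightarrow> norm (x i) = 1"
      and sep: "\<And>i j. i \<in> {1..N} \<Longrightarrow> j \<in> {1..N} \<Longrightarrow> i \<noteq> j \<Longrightarrow> c * real N powr (- 1 / real d) \<le> norm (x i - x j)"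
    have N0: "real N > 0" using N by simp
    define A where "A = real N powr (s / real d)"
    have A: "A > 0" using N0 by (simp add: A_def)
    have inj: "inj_on x {1..N}" using c N0 by (intro inj_on_separated[OF sep]) auto
    obtain P where P: "polarization s N x = ereal P" "\<And>z. norm z = 1 \<Longrightarrow> z \<notin> x ` {1..N} \<Longrightarrow> P \<le> rpot s N x z"
      using polarization_real[OF D less_imp_le[OF s(1)], of N x] x by blast
    have sep2: "2 * \<epsilon> * real N powr (- 1 / real d) \<le> norm (x i - x j)" if "i \<in> {1..N}" "j \<in> {1..N}" "i \<noteq> j" for i j
    proof -
      have "2 * \<epsilon> * real N powr (- 1 / real d) \<le> c * real N powr (- 1 / real d)"
        using e by (intro mult_right_mono) auto
      with sep[OF that] show ?thesis by simp
    qed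
    obtain \<delta> where \<delta>: "C \<le> \<delta>" "\<delta> \<le> 1 / 2"
      "P * (1 - \<delta>) \<le> ?I * real N - \<delta> * (rk s (\<epsilon>\<^sup>2 * real N powr (- 2 / real d)) + renergy s N x / real N)"
      using \<kappa>(2)[OF N e(1,2) x sep2 P(2)] by (auto simp: C_def)
    have \<delta>0: "\<delta> > 0" using \<delta>(1) \<open>C > 0\<close> by simp
    have "rk s (\<epsilon>\<^sup>2 * real N powr (- 2 / real d)) = \<epsilon> powr (- s) / s * A"
    proof -
      have "(\<epsilon>\<^sup>2 * real N powr (- 2 / real d)) powr (- s / 2) = (\<epsilon> powr 2) powr (- s / 2) * (real N powr (- 2 / real d)) powr (- s / 2)"
        using e by (subst powr_mult) auto
      also have "\<dots> = \<epsilon> powr (- s) * A" using d by (simp add: powr_powr A_def)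
      finally show ?thesis using s by (simp add: rk_def)
    qed
    also have "\<dots> \<ge> (CE + 1) * A" using e' A by (intro mult_right_mono) auto
    finally have k: "(CE + 1) * A \<le> rk s (\<epsilon>\<^sup>2 * real N powr (- 2 / real d))" .
    have "?I * (real N)\<^sup>2 - CE * (real N * A) \<le> renergy s N x"
      using CE(2)[OF N x inj] N0 by (simp add: A_def powr_add)
    then have en: "?I * real N - CE * A \<le> renergy s N x / real N"
      using N0 by (simp add: field_simps power2_eq_square)
    have "\<delta> * (?I * real N + A) \<le> \<delta> * (rk s (\<epsilon>\<^sup>2 * real N powr (- 2 / real d)) + renergy s N x / real N)"
      using k en \<delta>0 by (intro mult_left_mono) (auto simp: algebra_simps)
    with \<delta>(3) have "P * (1 - \<delta>) \<le> (?I * real N) * (1 - \<delta>) - \<delta> * A" by (simp add: algebra_simps)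
    \<comment> \<open>The gain is shrunk by the factor 1 - \<delta> so that this factor can be
      cancelled from both sides.\<close>
    also have "\<dots> \<le> (?I * real N) * (1 - \<delta>) - \<delta> * A * (1 - \<delta>)"
      using \<delta>0 A \<delta>(2) by (simp add: algebra_simps)
    finally have "P * (1 - \<delta>) \<le> (?I * real N - \<delta> * A) * (1 - \<delta>)" by (simp add: algebra_simps)
    then have "P \<le> ?I * real N - \<delta> * A" using \<delta>(2) by (simp add: mult_le_cancel_right)
    also have "\<dots> \<le> ?I * real N - C * A" using \<delta>(1) A by (simp add: mult_right_mono)
    finally show "polarization s N x \<le> ereal (?I * real N - C * real N powr (s / real d))"
      by (simp add: P(1) A_def)
  qed
qed

lemma polarization_bound_log:
  assumes dn: "CARD('n::finite) = 3" and c: "c > 0"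
  obtains C where "C > 0" "\<And>(x :: nat \<Rightarrow> real^'n) N Dn. N \<ge> 1 \<Longrightarrow> (\<And>i. i \<in> {1..N} \<Longrightarrow> norm (x i) = 1) \<Longrightarrow>
     (\<And>i j. i \<in> {1..N} \<Longrightarrow> j \<in> {1..N} \<Longrightarrow> i \<noteq> j \<Longrightarrow> c * real N powr (- 1 / 2) \<le> norm (x i - x j)) \<Longrightarrow>
     renergy 0 N x = riesz_integral TYPE(real^'n) 0 * real N ^ 2 - Dn * real N * ln (real N) \<Longrightarrow>
     polarization 0 N x \<le> ereal (riesz_integral TYPE(real^'n) 0 * real N + C * (- 1 / 2 + Dn) * ln (real N))"
proof -
  have d3: "CARD('n) = 2 + 1" using dn by simp
  have D: "DIM(real^'n) = 2 + 1" "(2::nat) \<ge> 1" using dn by auto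
  obtain \<kappa> where \<kappa>: "\<kappa> > 0" "\<And>(x :: nat \<Rightarrow> real^'n) N \<epsilon> P. N \<ge> 1 \<Longrightarrow> 0 < \<epsilon> \<Longrightarrow> \<epsilon> \<le> 1 \<Longrightarrow> (\<And>i. i \<in> {1..N} \<Longrightarrow> norm (x i) = 1) \<Longrightarrow>
     (\<And>i j. i \<in> {1..N} \<Longrightarrow> j \<in> {1..N} \<Longrightarrow> i \<noteq> j \<Longrightarrow> 2 * \<epsilon> * real N powr (- 1 / real 2) \<le> norm (x i - x j)) \<Longrightarrow>
     (\<And>z. norm z = 1 \<Longrightarrow> z \<notin> x ` {1..N} \<Longrightarrow> P \<le> rpot 0 N x z) \<Longrightarrow>
     \<exists>\<delta>. \<kappa> * \<epsilon> ^ 2 \<le> \<delta> \<and> \<delta> \<le> 1 / 2 \<and>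
       P * (1 - \<delta>) \<le> riesz_integral TYPE(real^'n) 0 * real N - \<delta> * (rk 0 (\<epsilon>\<^sup>2 * real N powr (- 2 / real 2)) + renergy 0 N x / real N)"
    by (rule cap_inequality_normalized[OF d3, of 0]) auto
  define \<epsilon> where "\<epsilon> = min 1 (c / 2)"
  have e: "0 < \<epsilon>" "\<epsilon> \<le> 1" "\<epsilon> \<le> c / 2" using c by (auto simp: \<epsilon>_def)
  define C where "C = \<kappa> * \<epsilon> ^ 2"
  let ?I = "riesz_integral TYPE(real^'n) 0"
  show ?thesis
  proof (rule that[of C])
    show C0: "C > 0" using \<kappa> e by (simp add: C_def)
    fix x :: "nat \<Rightarrow> real^'n" and N :: nat and Dn :: real
    assume N: "N \<ge> 1" and x: "\<And>i. i \<in> {1..N} \<Longrightarrow> norm (x i) = 1"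
      and sep: "\<And>i j. i \<in> {1..N} \<Longrightarrow> j \<in> {1..N} \<Longrightarrow> i \<noteq> j \<Longrightarrow> c * real N powr (- 1 / 2) \<le> norm (x i - x j)"
      and Dn: "renergy 0 N x = ?I * real N ^ 2 - Dn * real N * ln (real N)"
    have N0: "real N > 0" using N by simp
    define A where "A = ln (real N)"
    have A: "A \<ge> 0" using N by (simp add: A_def)
    obtain P where P: "polarization 0 N x = ereal P" "\<And>z. norm z = 1 \<Longrightarrow> z \<notin> x ` {1..N} \<Longrightarrow> P \<le> rpot 0 N x z"
      using polarization_real[OF D order_refl, of N x] x by blast
    have "P \<le> ?I * real N + C * (- 1 / 2 + Dn) * A"
    \<comment> \<open>For Dn \<ge> 1/2 the correction is nonnegative and averaging suffices.
      Otherwise \<open>1 / 2 - Dn\<close> is a genuine gain, and \<delta> may be replaced by its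
      lower bound \<open>C\<close>.\<close>
    proof (cases "Dn \<ge> 1 / 2")
      case True
      have "P \<le> ?I * real N"
        by (rule lower_bound_le_average[OF d3 _ _ _ x P(2)]) auto
      moreover have "0 \<le> C * (- 1 / 2 + Dn) * A" using True A C0 by simp
      ultimately show ?thesis by simp
    next
      case False
      have sep2: "2 * \<epsilon> * real N powr (- 1 / real 2) \<le> norm (x i - x j)" if "i \<in> {1..N}" "j \<in> {1..N}" "i \<noteq> j" for i j
      proof -
        have "2 * \<epsilon> * real N powr (- 1 / 2) \<le> c * real N powr (- 1 / 2)"
          using e by (intro mult_right_mono) auto
        with sep[OF that] show ?thesis by simp
      qed
      obtain \<delta> where \<delta>: "C \<le> \<delta>" "\<delta> \<le> 1 / 2"
        "P * (1 - \<delta>) \<le> ?I * real N - \<delta> * (rk 0 (\<epsilon>\<^sup>2 * real N powr (- 2 / real 2)) + renergy 0 N x / real N)"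
        using \<kappa>(2)[OF N e(1,2) x sep2 P(2)] by (auto simp: C_def)
      have "rk 0 (\<epsilon>\<^sup>2 * real N powr (- 2 / real 2)) = - ln \<epsilon> + A / 2"
        using e N0 by (simp add: rk_def ln_mult ln_realpow powr_minus_divide ln_div A_def field_simps)
      moreover have "ln \<epsilon> \<le> 0" using e by simp
      ultimately have k: "A / 2 \<le> rk 0 (\<epsilon>\<^sup>2 * real N powr (- 2 / real 2))" by simp
      have en: "renergy 0 N x / real N = ?I * real N - Dn * A"
        using N0 by (simp add: Dn A_def field_simps power2_eq_square)
      have "\<delta> * (?I * real N + (1 / 2 - Dn) * A) \<le> \<delta> * (rk 0 (\<epsilon>\<^sup>2 * real N powr (- 2 / real 2)) + renergy 0 N x / real N)"
        using k en \<delta>(1) C0 by (intro mult_left_mono) (auto simp: algebra_simps)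
      with \<delta>(3) have 1: "P * (1 - \<delta>) \<le> (?I * real N) * (1 - \<delta>) - \<delta> * ((1 / 2 - Dn) * A)" by (simp add: algebra_simps)
      define X where "X = (1 / 2 - Dn) * A"
      have X: "X \<ge> 0" using False A by (simp add: X_def)
      have "\<delta> * X * (1 - \<delta>) \<le> \<delta> * X" using \<delta>(1,2) C0 X by (intro mult_left_le) auto
      with 1[folded X_def] have "P * (1 - \<delta>) \<le> (?I * real N - \<delta> * X) * (1 - \<delta>)" by (simp add: algebra_simps)
      then have "P \<le> ?I * real N - \<delta> * X" using \<delta>(2) by (simp add: mult_le_cancel_right)
      also have "\<dots> \<le> ?I * real N - C * X" using \<delta>(1) X by (simp add: mult_right_mono)
      finally show ?thesis by (simp add: X_def algebra_simps)
    qed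
    then show "polarization 0 N x \<le> ereal (?I * real N + C * (- 1 / 2 + Dn) * ln (real N))"
      by (simp add: P(1) A_def)
  qed
qed

section \<open>Separation of greedy points\<close>

lemma rk_unbounded:
  assumes "s \<ge> 0"
  obtains \<epsilon>0 where "\<epsilon>0 > 0" "\<And>\<epsilon>. 0 < \<epsilon> \<Longrightarrow> \<epsilon> \<le> \<epsilon>0 \<Longrightarrow> L < rk s \<epsilon>"
proof -
  have "\<exists>\<epsilon>0>0. L < rk s \<epsilon>0"
  proof (cases "s = 0")
    case True
    then show ?thesis by (intro exI[of _ "exp (- 2 * L - 2)"]) (simp add: rk_def)
  next
    case False
    with assms have s: "s > 0" by simp
    define e where "e = (s * (\<bar>L\<bar> + 1)) powr (- 2 / s)"
    have p: "s * (\<bar>L\<bar> + 1) > 0" using s by (intro mult_pos_pos) auto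
    have "e powr (- s / 2) = s * (\<bar>L\<bar> + 1)" 
    proof -
      have "a powr ((- 2 / s) * (- s / 2)) = a" if "a > 0" for a :: real using that s by simp
      then show ?thesis using p unfolding e_def powr_powr by blast
    qed
    then have "rk s e = \<bar>L\<bar> + 1" using s by (simp add: rk_def)
    moreover have "e > 0" using p by (metis e_def less_irrefl powr_gt_zero)
    ultimately show ?thesis by (intro exI[of _ e]) auto
  qed
  then obtain \<epsilon>0 where "\<epsilon>0 > 0" "L < rk s \<epsilon>0" by blast
  then show ?thesis using rk_antimono[of _ \<epsilon>0 s] by (intro that[of \<epsilon>0]) (auto intro: less_le_trans)
qed

text \<open>Truncating the argument away from 0 makes the kernel continuous, so that minima over
  compact sets exist; in each use the truncation turns out to be inactive at the minimum.\<close>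

lemma continuous_on_rk_max:
  assumes "\<epsilon> > 0"
  shows "continuous_on A (\<lambda>t. rk s (max t \<epsilon>))"
proof (rule continuous_on_compose2[of "{\<epsilon>..}" "rk s"])
  show "continuous_on {\<epsilon>..} (rk s)"
    using assms by (intro continuous_at_imp_continuous_on ballI isCont_rk) auto
qed (auto intro!: continuous_intros)

lemma rk_ge_minus:
  assumes "0 < t" "t \<le> 4"
  shows "- \<bar>rk s 4\<bar> \<le> rk s t"
  using rk_antimono[of t 4 s] assms by linarith

lemma min_gap_pos:
  assumes "finite J" "\<And>i. i \<in> J \<Longrightarrow> (0::real) < f i"
  obtains \<delta> where "\<delta> > 0" "\<And>i. i \<in> J \<Longrightarrow> \<delta> \<le> f i"
proof -
  have "0 < Min (insert 1 (f ` J))" using assms by (subst Min_gr_iff) auto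
  moreover have "Min (insert 1 (f ` J)) \<le> f i" if "i \<in> J" for i using assms that by (intro Min_le) auto
  ultimately show ?thesis by (rule that)
qed

text \<open>With \<open>Q = 2 - 2 * \<tau>\<close> the derivative terms combine to \<open>d * ((1 -
  \<tau>\<^sup>2) - \<tau> * Q) = d * (1 - \<tau>)\<^sup>2 = d * Q\<^sup>2 / 4\<close>, so only a
  term of order zero is left.\<close>

lemma rk_laplace_harmonic:
  assumes "real d = s + 2" "\<tau> < 1"
  shows "(1 - \<tau>\<^sup>2) * ((s + 2) * (2 - 2 * \<tau>) powr (- s / 2 - 2)) - real d * \<tau> * (2 - 2 * \<tau>) powr (- s / 2 - 1)
     = real d / 4 * (2 - 2 * \<tau>) powr (- s / 2)"
proof -
  define Q where "Q = 2 - 2 * \<tau>"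
  have Q: "Q > 0" using assms by (simp add: Q_def)
  have e: "- s / 2 - 1 = (- s / 2 - 2) + 1" "- s / 2 = (- s / 2 - 2) + 1 + 1" by simp_all
  have 1: "Q powr (- s / 2 - 1) = Q powr (- s / 2 - 2) * Q"
    unfolding e(1) powr_add using Q by simp
  have 2: "Q powr (- s / 2) = Q powr (- s / 2 - 2) * Q * Q"
    by (subst e(2), simp only: powr_add) (use Q in simp)
  have t: "\<tau> = 1 - Q / 2" unfolding Q_def by (simp add: field_simps)
  show ?thesis unfolding Q_def[symmetric] 1 2 assms(1)[symmetric] unfolding t
    by (simp add: power2_eq_square algebra_simps)
qed

text \<open>Here the kernel has Laplacian \<open>d / 4 * t powr (- s / 2)\<close>, which a multiple of \<open>z \<bullet> x j\<close> dominates on the cap around \<open>x j\<close>;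
  the minimum principle on that cap compares the potential at \<open>y\<close> with its values on the boundary.\<close>

lemma separation_harmonic:
  fixes x :: "nat \<Rightarrow> real^'n"
  assumes dn: "CARD('n) = d + 1" and d: "d \<ge> 2" and s: "real d = s + 2"
    and x: "\<And>i. i \<in> {1..N} \<Longrightarrow> norm (x i) = 1" and y: "norm y = 1" "y \<notin> x ` {1..N}"
    and min: "\<And>z. norm z = 1 \<Longrightarrow> z \<notin> x ` {1..N} \<Longrightarrow> rpot s N x y \<le> rpot s N x z"
    and j: "j \<in> {1..N}" and R: "0 < R" "R \<le> 1" and B: "0 < B"
    and H: "(if s = 0 then (real N - 1) / 4 else s / 4 * (rpot s N x y + B * R)) \<le> (1 - R) * B"
  shows "rk s (2 - 2 * (y \<bullet> x j)) \<le> rk s (2 * R) + B * R"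
proof (cases "1 - R \<le> y \<bullet> x j")
  case False
  then have "rk s (2 - 2 * (y \<bullet> x j)) \<le> rk s (2 * R)" using R by (intro rk_antimono) auto
  then show ?thesis using B R by (simp add: add_increasing2)
next
  case True
  have s0: "s \<ge> 0" using s d by simp
  define J where "J = {1..N} - {j}"
  have finJ: "finite J" and JN: "card J = N - 1" using j by (auto simp: J_def)
  define hy where "hy = (\<Sum>i\<in>J. rk s (2 - 2 * (y \<bullet> x i)))"
  have split: "rpot s N x z = rk s (2 - 2 * (z \<bullet> x j)) + (\<Sum>i\<in>J. rk s (2 - 2 * (z \<bullet> x i)))" for z
    unfolding rpot_def J_def using j by (intro sum.remove) auto
  have yx: "0 < 2 - 2 * (y \<bullet> x i)" if "i \<in> J" for i
    using inner_sphere_less_1[OF y(1) x[of i]] y(2) that by (cases "y = x i") (auto simp: J_def)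
  obtain \<delta> where \<delta>: "\<delta> > 0" "\<And>i. i \<in> J \<Longrightarrow> \<delta> \<le> 2 - 2 * (y \<bullet> x i)"
    using min_gap_pos[OF finJ, of "\<lambda>i. 2 - 2 * (y \<bullet> x i)"] yx by blast
  \<comment> \<open>A kernel value above \<open>L\<close> at one point forces \<open>G\<close> above
    \<open>G y\<close>, even if all the other kernels and the linear term are as small as
    possible.\<close>
  define L where "L = hy + 2 * B + real N * \<bar>rk s 4\<bar>"
  obtain \<epsilon>0 where \<epsilon>0: "\<epsilon>0 > 0" "\<And>\<epsilon>. 0 < \<epsilon> \<Longrightarrow> \<epsilon> \<le> \<epsilon>0 \<Longrightarrow> L < rk s \<epsilon>"
    using rk_unbounded[OF s0] by blast
  define \<epsilon> where "\<epsilon> = min 4 (min \<epsilon>0 \<delta>)"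
  have e: "\<epsilon> > 0" "\<epsilon> \<le> 4" "\<epsilon> \<le> \<delta>" "L < rk s \<epsilon>" using \<epsilon>0 \<delta> by (auto simp: \<epsilon>_def)
  define G where "G z = (\<Sum>i\<in>J. rk s (max (2 - 2 * (z \<bullet> x i)) \<epsilon>)) + B * (z \<bullet> x j)" for z
  define K where "K = sphere 0 1 \<inter> {z. 1 - R \<le> z \<bullet> x j}"
  have "compact K" unfolding K_def
    by (intro compact_Int_closed compact_sphere closed_Collect_le continuous_intros)
  moreover have yK: "y \<in> K" using y True by (simp add: K_def)
  moreover have "continuous_on K G"
    unfolding G_def[abs_def]
    by (intro continuous_intros continuous_on_compose2[OF continuous_on_rk_max[OF e(1), of UNIV]]) auto
  ultimately obtain z0 where z0: "z0 \<in> K" "\<And>z. z \<in> K \<Longrightarrow> G z0 \<le> G z"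
    using continuous_attains_inf[of K G] by blast
  have n0: "norm z0 = 1" "1 - R \<le> z0 \<bullet> x j" using z0(1) by (auto simp: K_def)
  have inn: "z \<bullet> x i \<le> 1" "-1 \<le> z \<bullet> x i" if "norm z = 1" "i \<in> {1..N}" for z i
    using inner_sphere_bounds[OF that(1) x[OF that(2)]] by auto
  have Gy: "G y = hy + B * (y \<bullet> x j)"
  proof -
    have "max (2 - 2 * (y \<bullet> x i)) \<epsilon> = 2 - 2 * (y \<bullet> x i)" if "i \<in> J" for i
      using e(3) \<delta>(2)[OF that] by (intro max_absorb1) linarith
    then show ?thesis by (simp add: G_def hy_def)
  qed
  have Gle: "G z0 \<le> hy + B * (y \<bullet> x j)" using z0(2)[OF yK] Gy by simp
  have gt: "\<epsilon> < 2 - 2 * (z0 \<bullet> x i)" if i: "i \<in> J" for i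
  proof (rule ccontr)
    assume "\<not> \<epsilon> < 2 - 2 * (z0 \<bullet> x i)"
    then have t: "rk s (max (2 - 2 * (z0 \<bullet> x i)) \<epsilon>) = rk s \<epsilon>" by (simp add: max_def)
    have "(\<Sum>i\<in>J. rk s (max (2 - 2 * (z0 \<bullet> x i)) \<epsilon>)) = rk s \<epsilon> + (\<Sum>k\<in>J - {i}. rk s (max (2 - 2 * (z0 \<bullet> x k)) \<epsilon>))"
      using finJ i t by (simp add: sum.remove)
    moreover have "(\<Sum>k\<in>J - {i}. - \<bar>rk s 4\<bar>) \<le> (\<Sum>k\<in>J - {i}. rk s (max (2 - 2 * (z0 \<bullet> x k)) \<epsilon>))"
    proof (intro sum_mono rk_ge_minus)
      fix k assume "k \<in> J - {i}"
      then show "max (2 - 2 * (z0 \<bullet> x k)) \<epsilon> \<le> 4" using e(2) inn(2)[OF n0(1), of k] by (auto simp: J_def)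
    qed (use e(1) in auto)
    moreover have "real (card (J - {i})) * \<bar>rk s 4\<bar> \<le> real N * \<bar>rk s 4\<bar>"
      using finJ i JN by (intro mult_right_mono) auto
    moreover have "B * (-1) \<le> B * (z0 \<bullet> x j)" "B * (y \<bullet> x j) \<le> B * 1"
      using B inn(2)[OF n0(1) j] inn(1)[OF y(1) j] by (intro mult_left_mono; linarith)+
    ultimately show False using Gle e(4) by (simp add: G_def L_def)
  qed
  define h0 where "h0 = (\<Sum>i\<in>J. rk s (2 - 2 * (z0 \<bullet> x i)))"
  have G0: "G z0 = h0 + B * (z0 \<bullet> x j)"
  proof -
    have "max (2 - 2 * (z0 \<bullet> x i)) \<epsilon> = 2 - 2 * (z0 \<bullet> x i)" if "i \<in> J" for i
      using gt[OF that] by (intro max_absorb1) linarith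
    then show ?thesis by (simp add: G_def h0_def)
  qed
  \<comment> \<open>An interior minimum would need a nonnegative Laplacian, but by \<open>H\<close>
    the linear term outweighs the kernels on the open cap. So the minimum lies at height exactly 1 -
    R.\<close>
  have nlt: "\<not> 1 - R < z0 \<bullet> x j"
  proof
    assume int: "1 - R < z0 \<bullet> x j"
    define F where "F k t = (if k = j then B * t else rk s (2 - 2 * t))" for k t
    define F1 where "F1 k t = (if k = j then B else (2 - 2 * t) powr (- s / 2 - 1))" for k t
    define F2 where "F2 k = (if k = j then 0 else (s + 2) * (2 - 2 * (z0 \<bullet> x k)) powr (- s / 2 - 2))" for k
    have evJ: "\<forall>\<^sub>F w in nhds z0. \<forall>i\<in>J. \<epsilon> < 2 - 2 * (w \<bullet> x i)"
    proof (rule eventually_ball_finite[OF finJ], intro ballI)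
      fix i assume i: "i \<in> J"
      have "open {w. \<epsilon> < 2 - 2 * (w \<bullet> x i)}" by (intro open_Collect_less continuous_intros)
      then show "\<forall>\<^sub>F w in nhds z0. \<epsilon> < 2 - 2 * (w \<bullet> x i)"
        using eventually_nhds_in_open[of "{w. \<epsilon> < 2 - 2 * (w \<bullet> x i)}" z0] gt[OF i] by simp
    qed
    have evj: "\<forall>\<^sub>F w in nhds z0. 1 - R < w \<bullet> x j"
    proof -
      have "open {w. 1 - R < w \<bullet> x j}" by (intro open_Collect_less continuous_intros)
      then show ?thesis using eventually_nhds_in_open[of "{w. 1 - R < w \<bullet> x j}" z0] int by simp
    qed
    have sumF: "(\<Sum>k\<in>{1..N}. F k (w \<bullet> x k)) = G w" if "\<forall>i\<in>J. \<epsilon> < 2 - 2 * (w \<bullet> x i)" for w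
    proof -
      have "(\<Sum>k\<in>{1..N}. F k (w \<bullet> x k)) = F j (w \<bullet> x j) + (\<Sum>k\<in>J. F k (w \<bullet> x k))"
        unfolding J_def using j by (intro sum.remove) auto
      also have "(\<Sum>k\<in>J. F k (w \<bullet> x k)) = (\<Sum>i\<in>J. rk s (max (2 - 2 * (w \<bullet> x i)) \<epsilon>))"
        using that by (intro sum.cong refl) (force simp: F_def J_def max_def)
      finally show ?thesis by (simp add: F_def G_def)
    qed
    have "0 \<le> (\<Sum>k\<in>{1..N}. (1 - (z0 \<bullet> x k)\<^sup>2) * F2 k - (real CARD('n) - 1) * (z0 \<bullet> x k) * F1 k (z0 \<bullet> x k))"
    proof (rule sphere_local_min_laplace_nonneg[of "{1..N}" z0 x F F1 F2])
      show "\<forall>\<^sub>F w in nhds z0. norm w = 1 \<longrightarrow> (\<Sum>k\<in>{1..N}. F k (z0 \<bullet> x k)) \<le> (\<Sum>k\<in>{1..N}. F k (w \<bullet> x k))"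
        using evJ evj
      proof eventually_elim
        case (elim w)
        then show ?case using z0(2)[of w] sumF[of w] sumF[of z0] gt by (auto simp: K_def)
      qed
      fix k assume k: "k \<in> {1..N}"
      show "\<forall>\<^sub>F t in nhds (z0 \<bullet> x k). (F k has_real_derivative F1 k t) (at t)"
      proof (cases "k = j")
        case True
        then have "F k = (\<lambda>t. B * t)" "F1 k = (\<lambda>_. B)" by (auto simp: F_def F1_def fun_eq_iff)
        then show ?thesis by (auto intro!: always_eventually derivative_eq_intros)
      next
        case False
        then have "F k = (\<lambda>t. rk s (2 - 2 * t))" "F1 k = (\<lambda>t. (2 - 2 * t) powr (- s / 2 - 1))" by (auto simp: F_def F1_def fun_eq_iff)
        moreover have "\<forall>\<^sub>F t in nhds (z0 \<bullet> x k). t < 1"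
          using eventually_nhds_in_open[of "{..<1}" "z0 \<bullet> x k"] gt[of k] e(1) k False by (auto simp: J_def)
        ultimately show ?thesis by (auto elim!: eventually_mono intro!: rk_affine_has_real_derivative(1)[where c = 2, simplified])
      qed
      show "(F1 k has_real_derivative F2 k) (at (z0 \<bullet> x k))"
      proof (cases "k = j")
        case True
        then have "F1 k = (\<lambda>_. B)" by (auto simp: F1_def fun_eq_iff)
        then show ?thesis using True by (simp add: F2_def)
      next
        case False
        then have "F1 k = (\<lambda>t. (2 - 2 * t) powr (- s / 2 - 1))" by (auto simp: F1_def fun_eq_iff)
        then show ?thesis using False gt[of k] e(1) k unfolding F2_def
          by (auto intro!: rk_affine_has_real_derivative(2)[where c = 2, simplified] simp: J_def)
      qed
    qed (use n0 x in auto)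
    also have "\<dots> = - real d * (z0 \<bullet> x j) * B + (\<Sum>k\<in>J. (1 - (z0 \<bullet> x k)\<^sup>2) * F2 k - (real CARD('n) - 1) * (z0 \<bullet> x k) * F1 k (z0 \<bullet> x k))"
      unfolding J_def using j dn by (subst sum.remove[of _ j]) (auto simp: F1_def F2_def)
    also have "(\<Sum>k\<in>J. (1 - (z0 \<bullet> x k)\<^sup>2) * F2 k - (real CARD('n) - 1) * (z0 \<bullet> x k) * F1 k (z0 \<bullet> x k))
       = (\<Sum>k\<in>J. real d / 4 * (2 - 2 * (z0 \<bullet> x k)) powr (- s / 2))"
    proof (rule sum.cong[OF refl])
      fix k assume k: "k \<in> J"
      have kj: "k \<noteq> j" "z0 \<bullet> x k < 1" using k gt[OF k] e(1) by (auto simp: J_def)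
      show "(1 - (z0 \<bullet> x k)\<^sup>2) * F2 k - (real CARD('n) - 1) * (z0 \<bullet> x k) * F1 k (z0 \<bullet> x k) = real d / 4 * (2 - 2 * (z0 \<bullet> x k)) powr (- s / 2)"
        using rk_laplace_harmonic[OF s kj(2)] kj(1) dn by (simp add: F1_def F2_def)
    qed
    finally have lap: "real d * (z0 \<bullet> x j) * B \<le> real d / 4 * (\<Sum>k\<in>J. (2 - 2 * (z0 \<bullet> x k)) powr (- s / 2))"
      by (simp add: sum_distrib_left)
    \<comment> \<open>For s = 0 all powers are 1 and the sum counts points. For s > 0 they are s
      times kernel values, so the sum is controlled by the potential itself; this accounts for the
      two cases in \<open>H\<close>.\<close>
    have "(\<Sum>k\<in>J. (2 - 2 * (z0 \<bullet> x k)) powr (- s / 2)) \<le> 4 * ((1 - R) * B)"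
    proof (cases "s = 0")
      case True
      have "(\<Sum>k\<in>J. (2 - 2 * (z0 \<bullet> x k)) powr (- s / 2)) \<le> (\<Sum>k\<in>J. 1)"
        using True by (intro sum_mono) (simp add: powr_def)
      then show ?thesis using H True JN j by (simp add: of_nat_diff)
    next
      case False
      have sp: "s > 0" using s0 False by simp
      have sh: "(\<Sum>k\<in>J. (2 - 2 * (z0 \<bullet> x k)) powr (- s / 2)) = s * h0"
        using False by (simp add: h0_def rk_def sum_distrib_left)
      have "h0 \<le> rpot s N x y + B * R"
      proof -
        have "h0 \<le> hy + B * (y \<bullet> x j - z0 \<bullet> x j)" using Gle G0 by (simp add: right_diff_distrib)
        also have "B * (y \<bullet> x j - z0 \<bullet> x j) \<le> B * R"
          using B inn[OF y(1) j] n0 by (intro mult_left_mono) auto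
        also have "hy \<le> rpot s N x y" using sp by (simp add: split hy_def rk_def)
        finally show ?thesis by simp
      qed
      then have "s * h0 \<le> s * (rpot s N x y + B * R)" using sp by (intro mult_left_mono) auto
      also have "\<dots> \<le> 4 * ((1 - R) * B)" using H False by (simp add: mult_ac)
      finally show ?thesis unfolding sh .
    qed
    then have "real d * (z0 \<bullet> x j) * B \<le> real d / 4 * (4 * ((1 - R) * B))"
      using lap d by (meson mult_left_mono order_trans divide_nonneg_nonneg of_nat_0_le_iff zero_le_numeral)
    then have "real d * B * (z0 \<bullet> x j) \<le> real d * B * (1 - R)" by (simp add: algebra_simps)
    then show False using int B d by (simp add: mult_le_cancel_left)
  qed
  then have eq: "z0 \<bullet> x j = 1 - R" using n0 by simp
  have "z0 \<notin> x ` {1..N}"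
  proof
    assume "z0 \<in> x ` {1..N}"
    then obtain i where i: "i \<in> {1..N}" "z0 = x i" by blast
    show False
    proof (cases "i = j")
      case True
      then show ?thesis using eq i x[OF i(1)] R by (simp add: dot_square_norm)
    next
      case False
      then show ?thesis using gt[of i] i x[OF i(1)] e(1) by (simp add: dot_square_norm J_def)
    qed
  qed
  \<comment> \<open>The minimality of y enters at this boundary point, where the kernel of
    \<open>x j\<close> is exactly \<open>rk s (2 * R)\<close>.\<close>
  then have "rpot s N x y \<le> rk s (2 * R) + h0" using min[of z0] n0(1) split[of z0] eq by (simp add: h0_def)
  moreover have "h0 + B * (1 - R) \<le> hy + B * 1"
  proof -
    have "B * (y \<bullet> x j) \<le> B * 1" using B inn(1)[OF y(1) j] by (intro mult_left_mono) auto
    moreover have "h0 + B * (1 - R) \<le> hy + B * (y \<bullet> x j)" using Gle G0 eq by simp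
    ultimately show ?thesis by linarith
  qed
  ultimately show ?thesis using split[of y] by (simp add: hy_def algebra_simps)
qed

section \<open>A barrier in an extra variable for s > d - 2\<close>

lemma sinh_ge_self: "0 \<le> x \<Longrightarrow> x \<le> sinh x" for x :: real
proof -
  assume x: "0 \<le> x"
  have "sinh 0 - 0 \<le> sinh x - x"
  proof (rule DERIV_nonneg_imp_nondecreasing[OF x])
    fix y :: real
    show "\<exists>z. DERIV (\<lambda>x. sinh x - x) y :> z \<and> 0 \<le> z"
      by (intro exI[of _ "cosh y - 1"] conjI) (auto intro!: derivative_eq_intros cosh_real_ge_1)
  qed
  then show ?thesis by simp
qed

lemma cosh_ge_quadratic: "x\<^sup>2 \<le> 2 * cosh x - 2" if "0 \<le> x" for x :: real
proof -
  have "cosh x = 1 + 2 * (sinh (x / 2))\<^sup>2" using cosh_double[of "x / 2"] cosh_square_eq[of "x / 2"] by simp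
  moreover have "(x / 2)\<^sup>2 \<le> (sinh (x / 2))\<^sup>2" using sinh_ge_self[of "x / 2"] that by (intro power_mono) auto
  ultimately show ?thesis by (simp add: power_divide)
qed

lemma cosh_le_quadratic: "cosh x \<le> 1 + x\<^sup>2" if "0 \<le> x" "x \<le> 1" for x :: real
proof -
  have "exp x \<le> 1 + x + x\<^sup>2" using exp_bound[of x] that by simp
  moreover have "exp (- x) \<le> 1 - x + x\<^sup>2"
  proof -
    have "exp (- x) = 1 / exp x" by (simp add: exp_minus field_simps)
    also have "\<dots> \<le> 1 / (1 + x)" using that exp_ge_add_one_self[of x] by (intro divide_left_mono mult_pos_pos) auto
    also have "\<dots> \<le> 1 - x + x\<^sup>2"
    proof -
      have "(1 - x + x\<^sup>2) * (1 + x) = 1 + x ^ 3" by (simp add: power2_eq_square power3_eq_cube algebra_simps)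
      then have "1 \<le> (1 - x + x\<^sup>2) * (1 + x)" using that by simp
      then show ?thesis using that by (simp add: pos_divide_le_eq)
    qed
    finally show ?thesis .
  qed
  ultimately show ?thesis by (simp add: cosh_def)
qed

text \<open>Near 0 the operator \<open>w'' + (1 - \<alpha>) * coth \<eta> * w'\<close> almost
  annihilates \<open>\<eta> powr \<alpha>\<close>, as
  \<open>\<alpha> * (\<alpha> - 1) + (1 - \<alpha>) * \<alpha> = 0\<close>; the remainder carries
  the factor \<open>\<eta> * coth \<eta> - 1\<close>, which is at most
  \<open>\<eta>\<^sup>2\<close>. The quadratic term supplies the surplus that dominates
  \<open>c * w\<close>. The constants give \<open>E * \<eta>1\<^sup>2 = 1\<close> and
  \<open>B * \<eta>1 powr \<alpha> = 2\<close>, so the barrier falls from 1 at 0 to the value 0 at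
  \<open>\<eta>1\<close>.\<close>

lemma barrier_inequality:
  fixes \<alpha> c \<eta> :: real
  assumes \<alpha>: "0 < \<alpha>" "\<alpha> < 2" and c: "0 \<le> c" and E: "E = (1 + c) / ((2 - \<alpha>) / 2)" and \<eta>1: "\<eta>1 = 1 / sqrt E"
    and B: "B = 2 / \<eta>1 powr \<alpha>" and \<eta>: "0 < \<eta>" "\<eta> < \<eta>1"
  shows "c * (1 - B * \<eta> powr \<alpha> + E * \<eta>\<^sup>2) \<le> (- B * \<alpha> * (\<alpha> - 1) * \<eta> powr (\<alpha> - 2) + 2 * E)
     + (1 - \<alpha>) * (cosh \<eta> / sinh \<eta>) * (- B * \<alpha> * \<eta> powr (\<alpha> - 1) + 2 * E * \<eta>)"
proof -
  define \<beta> where "\<beta> = (2 - \<alpha>) / 2"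
  have \<beta>: "0 < \<beta>" "\<beta> < 1" using \<alpha> by (auto simp: \<beta>_def)
  have E': "E = (1 + c) / \<beta>" by (simp add: E \<beta>_def)
  have E1: "E > 1" using \<beta> c unfolding E' by (simp add: less_divide_eq)
  have h1: "\<eta>1 > 0" "\<eta>1\<^sup>2 = 1 / E" using E1 by (auto simp: \<eta>1 power_divide)
  have "\<eta>\<^sup>2 \<le> \<eta>1\<^sup>2" using \<eta> by (intro power_mono) auto
  then have E2: "E * \<eta>\<^sup>2 \<le> 1" using h1 E1 by (simp add: field_simps)
  have b2: "\<eta>\<^sup>2 \<le> \<beta>"
  proof -
    have "1 / E \<le> \<beta>" using \<beta> c unfolding E' by (simp add: divide_le_eq field_simps)
    with \<open>\<eta>\<^sup>2 \<le> \<eta>1\<^sup>2\<close> h1 show ?thesis by simp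
  qed
  have "\<eta>\<^sup>2 \<le> 1\<^sup>2" using b2 \<beta> by simp
  then have \<eta>le: "\<eta> \<le> 1" by (rule power2_le_imp_le) simp
  have B0: "B > 0" using h1 by (simp add: B)
  define X where "X = B * \<eta> powr \<alpha>"
  have X: "0 \<le> X" "X \<le> 2"
  proof -
    show "0 \<le> X" using B0 by (simp add: X_def)
    have "\<eta> powr \<alpha> \<le> \<eta>1 powr \<alpha>" using \<eta> \<alpha> by (intro powr_mono2) auto
    then show "X \<le> 2" using h1 by (simp add: X_def B field_simps)
  qed
  define k where "k = \<eta> * cosh \<eta> / sinh \<eta>"
  have sp: "sinh \<eta> > 0" using \<eta> by simp
  have sg: "\<eta> \<le> sinh \<eta>" using \<eta> by (intro sinh_ge_self) auto
  have k1: "1 \<le> k"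
  proof -
    have "0 * cosh 0 - sinh 0 \<le> \<eta> * cosh \<eta> - sinh \<eta>"
    proof (rule DERIV_nonneg_imp_nondecreasing[of 0 \<eta>])
      fix y :: real assume y: "0 \<le> y" "y \<le> \<eta>"
      show "\<exists>z. DERIV (\<lambda>x. x * cosh x - sinh x) y :> z \<and> 0 \<le> z"
        by (intro exI[of _ "y * sinh y"] conjI) (use y in \<open>auto intro!: derivative_eq_intros\<close>)
    qed (use \<eta> in auto)
    then show ?thesis using sp by (simp add: k_def)
  qed
  have k2: "k - 1 \<le> \<eta>\<^sup>2"
  proof -
    have "\<eta> * cosh \<eta> \<le> \<eta> * (1 + \<eta>\<^sup>2)" using \<eta> \<eta>le by (intro mult_left_mono cosh_le_quadratic) auto
    also have "\<dots> \<le> sinh \<eta> * (1 + \<eta>\<^sup>2)" using sg by (intro mult_right_mono) auto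
    finally have "k \<le> 1 + \<eta>\<^sup>2" using sp by (simp add: k_def field_simps)
    then show ?thesis by simp
  qed
  have ct: "cosh \<eta> / sinh \<eta> = k / \<eta>" using \<eta> by (simp add: k_def)
  have p1: "\<eta> powr (\<alpha> - 1) = \<eta> powr (\<alpha> - 2) * \<eta>"
    using powr_add[of \<eta> "\<alpha> - 2" 1] \<eta> by simp
  have "\<eta> powr ((\<alpha> - 2) + 2) = \<eta> powr (\<alpha> - 2) * \<eta> powr 2" by (rule powr_add)
  then have p2: "\<eta> powr \<alpha> = \<eta> powr (\<alpha> - 2) * \<eta>\<^sup>2" using \<eta> by simp
  define p where "p = \<eta> powr (\<alpha> - 2)"
  have p0: "p \<ge> 0" by (simp add: p_def)
  have "(- B * \<alpha> * (\<alpha> - 1) * \<eta> powr (\<alpha> - 2) + 2 * E)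
     + (1 - \<alpha>) * (cosh \<eta> / sinh \<eta>) * (- B * \<alpha> * \<eta> powr (\<alpha> - 1) + 2 * E * \<eta>)
    = (- B * \<alpha> * (\<alpha> - 1) * p + 2 * E) + (1 - \<alpha>) * k * (- B * \<alpha> * p + 2 * E)"
    unfolding ct p1 p_def[symmetric] using \<eta> by (simp add: field_simps)
  also have "\<dots> = B * \<alpha> * (\<alpha> - 1) * ((k - 1) * p) + 2 * E * (1 + (1 - \<alpha>) * k)" by (simp add: algebra_simps)
  finally have rhs: "(- B * \<alpha> * (\<alpha> - 1) * \<eta> powr (\<alpha> - 2) + 2 * E)
     + (1 - \<alpha>) * (cosh \<eta> / sinh \<eta>) * (- B * \<alpha> * \<eta> powr (\<alpha> - 1) + 2 * E * \<eta>)
     = B * \<alpha> * (\<alpha> - 1) * ((k - 1) * p) + 2 * E * (1 + (1 - \<alpha>) * k)" .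
  \<comment> \<open>The term is negative only for \<alpha> < 1, and there
    \<open>\<alpha> * (1 - \<alpha>) \<le> 1 / 4\<close> and \<open>X \<le> 2\<close> limit
    it.\<close>
  have T1: "- 1 \<le> B * \<alpha> * (\<alpha> - 1) * ((k - 1) * p)"
  proof (cases "\<alpha> \<ge> 1")
    case True
    then have "0 \<le> B * \<alpha> * (\<alpha> - 1) * ((k - 1) * p)" using B0 k1 p0 by simp
    then show ?thesis by simp
  next
    case False
    have q: "\<alpha> * (1 - \<alpha>) \<le> 1 / 4" using zero_le_power2[of "\<alpha> - 1 / 2"] by (simp add: power2_eq_square algebra_simps)
    have "(k - 1) * p \<le> \<eta>\<^sup>2 * p" using k2 p0 by (intro mult_right_mono) auto
    then have "B * ((k - 1) * p) \<le> X" using B0 by (simp add: X_def p2 p_def mult_left_mono mult.commute)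
    then have "(\<alpha> * (1 - \<alpha>)) * (B * ((k - 1) * p)) \<le> 1 / 4 * X"
      using q False \<alpha> k1 p0 B0 by (intro mult_mono) auto
    then have "(\<alpha> * (1 - \<alpha>)) * (B * ((k - 1) * p)) \<le> 1" using X by simp
    then show ?thesis by (simp add: algebra_simps)
  qed
  have T2: "\<beta> \<le> 1 + (1 - \<alpha>) * k"
  proof (cases "\<alpha> \<ge> 1")
    case True
    have "(\<alpha> - 1) * k \<le> (\<alpha> - 1) * (1 + \<beta>)" using True k2 b2 by (intro mult_left_mono) auto
    also have "\<dots> \<le> (\<alpha> - 1) + \<beta>" using True \<alpha> \<beta> mult_right_mono[of "\<alpha> - 1" 1 \<beta>] by (simp add: algebra_simps)
    finally have "(\<alpha> - 1) * k \<le> \<alpha> - 1 + \<beta>" .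
    moreover have "2 * \<beta> = 2 - \<alpha>" by (simp add: \<beta>_def)
    ultimately show ?thesis unfolding left_diff_distrib by linarith
  next
    case False
    then have "0 \<le> (1 - \<alpha>) * k" using k1 by simp
    then show ?thesis using \<beta> by simp
  qed
  have "2 * E * \<beta> \<le> 2 * E * (1 + (1 - \<alpha>) * k)" using T2 E1 by (intro mult_left_mono) auto
  then have "- 1 + 2 * E * \<beta> \<le> B * \<alpha> * (\<alpha> - 1) * ((k - 1) * p) + 2 * E * (1 + (1 - \<alpha>) * k)"
    using T1 by (intro add_mono)
  moreover have "2 * E * \<beta> = 2 * (1 + c)" using \<beta> by (simp add: E')
  then have "c * 2 \<le> - 1 + 2 * E * \<beta>" by simp
  moreover have "c * (1 - X + E * \<eta>\<^sup>2) \<le> c * 2" using c X E2 by (intro mult_left_mono) auto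
  ultimately show ?thesis unfolding rhs X_def[symmetric] by (blast intro: order_trans)
qed

text \<open>With \<open>ch\<close> and \<open>sh\<close> for cosh \<eta> and sinh \<eta>, the
  function \<open>rk s (2 * cosh \<eta> - 2 * \<tau>)\<close> extends the kernel to \<eta> > 0 as an
  eigenfunction of an operator made of the second \<eta>-derivative, the spherical Laplacian and a
  coth-weighted first \<eta>-derivative. This is a spherical analogue of the extension that
  represents a fractional Laplacian by a degenerate elliptic operator. Up to one common power of Q
  the identity is polynomial.\<close>

lemma rk_extension_identity:
  fixes ch sh \<tau> s :: real
  assumes Q: "2 * ch - 2 * \<tau> > 0" and cs: "ch\<^sup>2 - sh\<^sup>2 = 1" and sh: "sh \<noteq> 0" and s: "s \<noteq> 0"
  shows "((s + 2) * (2 * ch - 2 * \<tau>) powr (- s / 2 - 2) * sh\<^sup>2 - ch * (2 * ch - 2 * \<tau>) powr (- s / 2 - 1))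
    + ((1 - \<tau>\<^sup>2) * ((s + 2) * (2 * ch - 2 * \<tau>) powr (- s / 2 - 2)) - d * \<tau> * (2 * ch - 2 * \<tau>) powr (- s / 2 - 1))
    + (s + 1 - d) * (ch / sh) * (- sh * (2 * ch - 2 * \<tau>) powr (- s / 2 - 1))
    = s / 2 * (d - 1 - s / 2) * rk s (2 * ch - 2 * \<tau>)"
proof -
  define Q where "Q = 2 * ch - 2 * \<tau>"
  have Q: "Q > 0" using assms by (simp add: Q_def)
  define q where "q = Q powr (- s / 2 - 2)"
  have e: "- s / 2 - 1 = (- s / 2 - 2) + 1" "- s / 2 = (- s / 2 - 2) + 1 + 1" by simp_all
  have 1: "Q powr (- s / 2 - 1) = q * Q"
    unfolding e(1) powr_add q_def using Q by simp
  have "Q powr (- s / 2) = q * Q * Q"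
    unfolding q_def by (subst e(2), simp only: powr_add) (use Q in simp)
  then have 2: "rk s Q = q * Q * Q / s" using s by (simp add: rk_def)
  have t: "\<tau> = ch - Q / 2" unfolding Q_def by (simp add: field_simps)
  have c2: "sh\<^sup>2 = ch\<^sup>2 - 1" using cs by simp
  have "((s + 2) * q * sh\<^sup>2 - ch * (q * Q)) + ((1 - \<tau>\<^sup>2) * ((s + 2) * q) - d * \<tau> * (q * Q)) + (s + 1 - d) * (- ch * (q * Q))
     = 1 / 2 * (d - 1 - s / 2) * (q * Q * Q)"
    unfolding c2 t by (simp add: power2_eq_square algebra_simps)
  moreover have "(s + 1 - d) * (ch / sh) * (- sh * (q * Q)) = (s + 1 - d) * (- ch * (q * Q))" using sh by simp
  moreover have "s / 2 * (d - 1 - s / 2) * (q * Q * Q / s) = 1 / 2 * (d - 1 - s / 2) * (q * Q * Q)" using s by simp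
  ultimately show ?thesis unfolding Q_def[symmetric] 1 2 q_def[symmetric] by simp
qed

text \<open>The sum is an extension of the potential to \<open>\<eta> \<ge> 0\<close> solving the elliptic equation of \<open>rk_extension_identity\<close>.
  At an interior minimum of its difference with the barrier, the second derivatives contradict \<open>barrier_inequality\<close>.\<close>

lemma barrier_le_hyperbolic_potential:
  fixes x :: "nat \<Rightarrow> real^'n"
  assumes dn: "CARD('n) = d + 1" and d: "d \<ge> 2" and s: "0 < s" "real d - 2 < s" "s < real d"
    and x: "\<And>i. i \<in> {1..N} \<Longrightarrow> norm (x i) = 1" and P: "0 \<le> P"
    and min: "\<And>z. norm z = 1 \<Longrightarrow> z \<notin> x ` {1..N} \<Longrightarrow> P \<le> rpot s N x z"
    and \<alpha>: "\<alpha> = real d - s" and c: "c = s / 2 * (real d - 1 - s / 2)"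
    and E: "E = (1 + c) / ((2 - \<alpha>) / 2)" and \<eta>1: "\<eta>1 = 1 / sqrt E" and B: "B = 2 / \<eta>1 powr \<alpha>"
    and \<eta>: "0 < \<eta>" "\<eta> \<le> \<eta>1" and y: "norm y = 1"
  shows "P * (1 - B * \<eta> powr \<alpha> + E * \<eta>\<^sup>2) \<le> (\<Sum>i\<in>{1..N}. rk s (2 * cosh \<eta> - 2 * (y \<bullet> x i)))"
proof (rule ccontr)
  define w where "w t = 1 - B * t powr \<alpha> + E * t\<^sup>2" for t
  assume "\<not> ?thesis"
  then have neg: "(\<Sum>i\<in>{1..N}. rk s (2 * cosh \<eta> - 2 * (y \<bullet> x i))) < P * w \<eta>" by (simp add: w_def)
  have \<alpha>2: "0 < \<alpha>" "\<alpha> < 2" using s by (auto simp: \<alpha>)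
  have c0: "c > 0" using s d unfolding c by (intro mult_pos_pos) (auto simp: field_simps)
  have E0: "E > 0" unfolding E using c0 \<alpha>2 by (intro divide_pos_pos) auto
  have h1: "\<eta>1 > 0" "E * \<eta>1\<^sup>2 = 1" using E0 by (auto simp: \<eta>1 power_divide)
  have B0: "B > 0" using h1 by (simp add: B)
  have rk0: "0 \<le> rk s t" for t using s by (simp add: rk_def)
  have w2: "w t \<le> 2" if "0 \<le> t" "t \<le> \<eta>1" for t
  proof -
    have "E * t\<^sup>2 \<le> E * \<eta>1\<^sup>2" using E0 that by (intro mult_left_mono power_mono) auto
    then have "E * t\<^sup>2 \<le> 1" using h1(2) by simp
    moreover have "0 \<le> B * t powr \<alpha>" using B0 by simp
    ultimately show ?thesis unfolding w_def by linarith
  qed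
  have inn: "z \<bullet> x i \<le> 1" if "norm z = 1" "i \<in> {1..N}" for z i
    using inner_sphere_bounds[OF that(1) x[OF that(2)]] by auto
  have cg: "0 < 2 * cosh \<eta> - 2" using cosh_ge_quadratic[of \<eta>] \<eta> zero_less_power[of \<eta> 2] by linarith
  obtain \<epsilon>0 where \<epsilon>0: "\<epsilon>0 > 0" "\<And>\<epsilon>. 0 < \<epsilon> \<Longrightarrow> \<epsilon> \<le> \<epsilon>0 \<Longrightarrow> 2 * P < rk s \<epsilon>"
    using rk_unbounded[of s "2 * P"] s by auto
  define \<epsilon> where "\<epsilon> = min \<epsilon>0 (2 * cosh \<eta> - 2)"
  have e: "\<epsilon> > 0" "\<epsilon> \<le> 2 * cosh \<eta> - 2" "2 * P < rk s \<epsilon>" using \<epsilon>0 cg by (auto simp: \<epsilon>_def)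
  define \<Phi> where "\<Phi> p = (\<Sum>i\<in>{1..N}. rk s (max (2 * cosh (fst p) - 2 * (snd p \<bullet> x i)) \<epsilon>)) - P * w (fst p)" for p
  define K where "K = {0..\<eta>1} \<times> sphere (0::real^'n) 1"
  have "compact K" unfolding K_def by (intro compact_Times compact_Icc compact_sphere)
  moreover have yK: "(\<eta>, y) \<in> K" using y \<eta> by (simp add: K_def)
  moreover have "continuous_on K \<Phi>"
  proof -
    have "continuous_on {0..\<eta>1} w"
      unfolding w_def[abs_def] using \<alpha>2 by (intro continuous_intros continuous_on_powr') auto
    then have "continuous_on K (\<lambda>p. w (fst p))"
      by (rule continuous_on_compose2) (auto intro!: continuous_intros simp: K_def)
    then show ?thesis
      unfolding \<Phi>_def[abs_def]
      by (intro continuous_intros continuous_on_compose2[OF continuous_on_rk_max[OF e(1), of UNIV]]) auto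
  qed
  ultimately obtain p0 where p0: "p0 \<in> K" "\<And>p. p \<in> K \<Longrightarrow> \<Phi> p0 \<le> \<Phi> p"
    using continuous_attains_inf[of K \<Phi>] by blast
  obtain a z where az: "p0 = (a, z)" by (cases p0)
  have n0: "norm z = 1" "0 \<le> a" "a \<le> \<eta>1" using p0(1) by (auto simp: K_def az)
  have "\<Phi> (\<eta>, y) < 0"
  proof -
    have "max (2 * cosh \<eta> - 2 * (y \<bullet> x i)) \<epsilon> = 2 * cosh \<eta> - 2 * (y \<bullet> x i)" if "i \<in> {1..N}" for i
      using inn[OF y that] e(2) by (intro max_absorb1) linarith
    then show ?thesis using neg by (simp add: \<Phi>_def)
  qed
  then have neg0: "(\<Sum>i\<in>{1..N}. rk s (max (2 * cosh a - 2 * (z \<bullet> x i)) \<epsilon>)) < P * w a"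
    using p0(2)[OF yK] by (simp add: \<Phi>_def az)
  have gt: "\<epsilon> < 2 * cosh a - 2 * (z \<bullet> x i)" if i: "i \<in> {1..N}" for i
  proof (rule ccontr)
    assume "\<not> \<epsilon> < 2 * cosh a - 2 * (z \<bullet> x i)"
    then have "max (2 * cosh a - 2 * (z \<bullet> x i)) \<epsilon> = \<epsilon>" by (simp add: max_def)
    then have "rk s \<epsilon> \<le> (\<Sum>i\<in>{1..N}. rk s (max (2 * cosh a - 2 * (z \<bullet> x i)) \<epsilon>))"
      using member_le_sum[of i "{1..N}" "\<lambda>i. rk s (max (2 * cosh a - 2 * (z \<bullet> x i)) \<epsilon>)"] i rk0 by simp
    also have "\<dots> < P * w a" by (rule neg0)
    also have "\<dots> \<le> P * 2" using P w2 n0 by (intro mult_left_mono) auto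
    finally show False using e(3) by simp
  qed
  have mx: "(\<Sum>i\<in>{1..N}. rk s (max (2 * cosh b - 2 * (v \<bullet> x i)) \<epsilon>)) = (\<Sum>i\<in>{1..N}. rk s (2 * cosh b - 2 * (v \<bullet> x i)))"
    if "\<forall>i\<in>{1..N}. \<epsilon> < 2 * cosh b - 2 * (v \<bullet> x i)" for b v
    using that by (intro sum.cong refl arg_cong[of _ _ "rk s"] max_absorb1) fastforce
  have neg1: "(\<Sum>i\<in>{1..N}. rk s (2 * cosh a - 2 * (z \<bullet> x i))) < P * w a"
    using neg0 mx[of a z] gt by simp
  \<comment> \<open>At the outer end the barrier vanishes while the kernels are nonnegative; at
    \<eta> = 0 the sum is the potential, which is at least P, the value of the barrier there. So the
    minimum is interior in \<eta>.\<close>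
  have a1: "a \<noteq> \<eta>1"
  proof
    assume "a = \<eta>1"
    then have "w a = 0" using h1 by (simp add: w_def B)
    then show False using neg1 sum_nonneg[of "{1..N}" "\<lambda>i. rk s (2 * cosh a - 2 * (z \<bullet> x i))"] rk0 by simp
  qed
  have a2: "a \<noteq> 0"
  proof
    assume a: "a = 0"
    have "z \<notin> x ` {1..N}"
      using gt a e(1) x by (force simp: dot_square_norm)
    then show False using min[of z] n0 neg1 a \<alpha>2 by (simp add: rpot_def w_def)
  qed
  have a: "0 < a" "a < \<eta>1" using a1 a2 n0 by auto
  define Q where "Q i = 2 * cosh a - 2 * (z \<bullet> x i)" for i
  have Q: "Q i > 0" if "i \<in> {1..N}" for i using gt[OF that] e(1) by (simp add: Q_def)
  have "0 \<le> (\<Sum>k\<in>{1..N}. (1 - (z \<bullet> x k)\<^sup>2) * ((s + 2) * Q k powr (- s / 2 - 2)) - (real CARD('n) - 1) * (z \<bullet> x k) * (2 * cosh a - 2 * (z \<bullet> x k)) powr (- s / 2 - 1))"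
  proof (rule sphere_local_min_laplace_nonneg[of "{1..N}" z x "\<lambda>k t. rk s (2 * cosh a - 2 * t)" "\<lambda>k t. (2 * cosh a - 2 * t) powr (- s / 2 - 1)"])
    have "\<forall>\<^sub>F v in nhds z. \<forall>i\<in>{1..N}. \<epsilon> < 2 * cosh a - 2 * (v \<bullet> x i)"
    proof (rule eventually_ball_finite, simp, intro ballI)
      fix i assume i: "i \<in> {1..N}"
      have "open {v. \<epsilon> < 2 * cosh a - 2 * (v \<bullet> x i)}" by (intro open_Collect_less continuous_intros)
      then show "\<forall>\<^sub>F v in nhds z. \<epsilon> < 2 * cosh a - 2 * (v \<bullet> x i)"
        using eventually_nhds_in_open[of "{v. \<epsilon> < 2 * cosh a - 2 * (v \<bullet> x i)}" z] gt[OF i] by simp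
    qed
    then show "\<forall>\<^sub>F v in nhds z. norm v = 1 \<longrightarrow> (\<Sum>k\<in>{1..N}. rk s (2 * cosh a - 2 * (z \<bullet> x k))) \<le> (\<Sum>k\<in>{1..N}. rk s (2 * cosh a - 2 * (v \<bullet> x k)))"
    proof eventually_elim
      case (elim v)
      show ?case
      proof
        assume "norm v = 1"
        then have "\<Phi> (a, z) \<le> \<Phi> (a, v)" using p0(2)[of "(a, v)"] n0 by (auto simp: az K_def)
        then show "(\<Sum>k\<in>{1..N}. rk s (2 * cosh a - 2 * (z \<bullet> x k))) \<le> (\<Sum>k\<in>{1..N}. rk s (2 * cosh a - 2 * (v \<bullet> x k)))"
          using mx[of a z] mx[of a v] gt elim by (simp add: \<Phi>_def)
      qed
    qed
    fix k assume k: "k \<in> {1..N}"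
    have "\<forall>\<^sub>F t in nhds (z \<bullet> x k). t < cosh a"
      using eventually_nhds_in_open[of "{..<cosh a}" "z \<bullet> x k"] Q[OF k] by (auto simp: Q_def)
    then show "\<forall>\<^sub>F t in nhds (z \<bullet> x k). ((\<lambda>t. rk s (2 * cosh a - 2 * t)) has_real_derivative (2 * cosh a - 2 * t) powr (- s / 2 - 1)) (at t)"
    proof eventually_elim
      case (elim t)
      then show ?case by (intro rk_affine_has_real_derivative(1)) simp
    qed
    show "((\<lambda>t. (2 * cosh a - 2 * t) powr (- s / 2 - 1)) has_real_derivative (s + 2) * Q k powr (- s / 2 - 2)) (at (z \<bullet> x k))"
      using Q[OF k] unfolding Q_def by (rule rk_affine_has_real_derivative(2))
  qed (use n0 x in auto)
  then have lap: "0 \<le> (\<Sum>k\<in>{1..N}. (1 - (z \<bullet> x k)\<^sup>2) * ((s + 2) * Q k powr (- s / 2 - 2)) - real d * (z \<bullet> x k) * Q k powr (- s / 2 - 1))"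
    using dn by (simp add: Q_def)
  define w1 where "w1 t = - B * \<alpha> * t powr (\<alpha> - 1) + 2 * E * t" for t
  define w2 where "w2 t = - B * \<alpha> * (\<alpha> - 1) * t powr (\<alpha> - 2) + 2 * E" for t
  have dw: "(w has_real_derivative w1 t) (at t)" if "t > 0" for t
    unfolding w_def[abs_def] w1_def using that
    by (auto intro!: derivative_eq_intros simp: power2_eq_square)
  have dw1: "(w1 has_real_derivative w2 t) (at t)" if "t > 0" for t
    unfolding w1_def[abs_def] w2_def using that
    by (auto intro!: derivative_eq_intros)
  define \<phi> where "\<phi> t = (\<Sum>i\<in>{1..N}. rk s (2 * cosh t - 2 * (z \<bullet> x i))) - P * w t" for t
  define \<phi>1 where "\<phi>1 t = (\<Sum>i\<in>{1..N}. - sinh t * (2 * cosh t - 2 * (z \<bullet> x i)) powr (- s / 2 - 1)) - P * w1 t" for t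
  define \<phi>2 where "\<phi>2 = (\<Sum>i\<in>{1..N}. (s + 2) * Q i powr (- s / 2 - 2) * (sinh a)\<^sup>2 - cosh a * Q i powr (- s / 2 - 1)) - P * w2 a"
  have "\<forall>\<^sub>F t in nhds a. \<forall>i\<in>{1..N}. \<epsilon> < 2 * cosh t - 2 * (z \<bullet> x i)"
  proof (rule eventually_ball_finite, simp, intro ballI)
    fix i assume i: "i \<in> {1..N}"
    have "open {t. \<epsilon> < 2 * cosh t - 2 * (z \<bullet> x i)}" by (intro open_Collect_less continuous_intros)
    then show "\<forall>\<^sub>F t in nhds a. \<epsilon> < 2 * cosh t - 2 * (z \<bullet> x i)"
      using eventually_nhds_in_open[of "{t. \<epsilon> < 2 * cosh t - 2 * (z \<bullet> x i)}" a] gt[OF i] by simp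
  qed
  moreover have "\<forall>\<^sub>F t in nhds a. t \<in> {0<..<\<eta>1}" using a by (intro eventually_nhds_in_open) auto
  ultimately have ev: "\<forall>\<^sub>F t in nhds a. (\<forall>i\<in>{1..N}. \<epsilon> < 2 * cosh t - 2 * (z \<bullet> x i)) \<and> 0 < t \<and> t < \<eta>1"
    by eventually_elim auto
  have dQ: "((\<lambda>t. 2 * cosh t - 2 * (z \<bullet> x i)) has_real_derivative 2 * sinh t) (at t)" for t i
    by (auto intro!: derivative_eq_intros)
  have d1: "(\<phi> has_real_derivative \<phi>1 t) (at t)"
    if t: "\<forall>i\<in>{1..N}. \<epsilon> < 2 * cosh t - 2 * (z \<bullet> x i)" "0 < t" for t
    unfolding \<phi>_def[abs_def] \<phi>1_def
  proof (intro DERIV_diff DERIV_sum DERIV_cmult dw t(2))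
    fix i assume i: "i \<in> {1..N}"
    have "0 < 2 * cosh t - 2 * (z \<bullet> x i)" using t(1) i e(1) by fastforce
    from DERIV_chain2[OF rk_has_real_derivative[OF this] dQ]
    show "((\<lambda>t. rk s (2 * cosh t - 2 * (z \<bullet> x i))) has_real_derivative - sinh t * (2 * cosh t - 2 * (z \<bullet> x i)) powr (- s / 2 - 1)) (at t)"
      by (simp add: mult.commute)
  qed
  have min\<phi>: "\<forall>\<^sub>F t in nhds a. \<phi> a \<le> \<phi> t"
    using ev
  proof eventually_elim
    case (elim t)
    then have "\<Phi> (a, z) \<le> \<Phi> (t, z)" using p0(2)[of "(t, z)"] n0 by (auto simp: az K_def)
    then show ?case using mx[of a z] mx[of t z] gt elim by (simp add: \<Phi>_def \<phi>_def)
  qed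
  have ev1: "\<forall>\<^sub>F t in nhds a. (\<phi> has_real_derivative \<phi>1 t) (at t)"
    using ev by eventually_elim (use d1 in blast)
  have "0 \<le> \<phi>2"
  proof (rule local_min_second_derivative_nonneg[OF min\<phi> ev1])
    show "(\<phi>1 has_real_derivative \<phi>2) (at a)"
      unfolding \<phi>1_def[abs_def] \<phi>2_def
    proof (intro DERIV_diff DERIV_sum DERIV_cmult dw1 a(1))
      fix i assume i: "i \<in> {1..N}"
      have q: "Q i > 0" by (rule Q[OF i])
      have "((\<lambda>t. (2 * cosh t - 2 * (z \<bullet> x i)) powr (- s / 2 - 1)) has_real_derivative
         (- s / 2 - 1) * Q i powr (- s / 2 - 1 - 1) * (2 * sinh a)) (at a)"
        using has_real_derivative_powr[OF q, of "- s / 2 - 1"] dQ[of i a] unfolding Q_def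
        by (rule DERIV_chain2)
      from DERIV_mult[OF DERIV_minus[OF has_field_derivative_sinh[OF DERIV_ident]] this]
      show "((\<lambda>t. - sinh t * (2 * cosh t - 2 * (z \<bullet> x i)) powr (- s / 2 - 1)) has_real_derivative
        (s + 2) * Q i powr (- s / 2 - 2) * (sinh a)\<^sup>2 - cosh a * Q i powr (- s / 2 - 1)) (at a)"
        by (rule back_subst[of "\<lambda>D. (_ has_real_derivative D) (at a)"]) (simp add: Q_def power2_eq_square algebra_simps)
    qed
  qed
  \<comment> \<open>An equality is required for the first derivatives, because the coefficient 1 -
    \<alpha> in front of them may have either sign.\<close>
  moreover have "\<phi>1 a = 0"
  proof -
    obtain \<delta> where "\<delta> > 0" "\<And>t. dist t a < \<delta> \<Longrightarrow> \<phi> a \<le> \<phi> t"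
      using min\<phi> unfolding eventually_nhds_metric by auto
    then show ?thesis
      using DERIV_local_min[of \<phi> "\<phi>1 a" a \<delta>] d1[of a] gt a by (auto simp: dist_real_def abs_minus_commute)
  qed
  ultimately have "P * w2 a \<le> (\<Sum>i\<in>{1..N}. (s + 2) * Q i powr (- s / 2 - 2) * (sinh a)\<^sup>2 - cosh a * Q i powr (- s / 2 - 1))"
    "P * w1 a = (\<Sum>i\<in>{1..N}. - sinh a * Q i powr (- s / 2 - 1))"
    by (simp_all add: \<phi>2_def \<phi>1_def Q_def)
  then have "P * w2 a + (1 - \<alpha>) * (cosh a / sinh a) * (P * w1 a)
     \<le> (\<Sum>i\<in>{1..N}. (s + 2) * Q i powr (- s / 2 - 2) * (sinh a)\<^sup>2 - cosh a * Q i powr (- s / 2 - 1))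
     + (\<Sum>k\<in>{1..N}. (1 - (z \<bullet> x k)\<^sup>2) * ((s + 2) * Q k powr (- s / 2 - 2)) - real d * (z \<bullet> x k) * Q k powr (- s / 2 - 1))
     + (s + 1 - real d) * (cosh a / sinh a) * (\<Sum>i\<in>{1..N}. - sinh a * Q i powr (- s / 2 - 1))"
    using lap by (simp add: \<alpha> algebra_simps)
  also have "\<dots> = (\<Sum>i\<in>{1..N}. c * rk s (Q i))"
    unfolding sum_distrib_left sum.distrib[symmetric]
  proof (rule sum.cong[OF refl])
    fix i assume i: "i \<in> {1..N}"
    show "(s + 2) * Q i powr (- s / 2 - 2) * (sinh a)\<^sup>2 - cosh a * Q i powr (- s / 2 - 1)
      + ((1 - (z \<bullet> x i)\<^sup>2) * ((s + 2) * Q i powr (- s / 2 - 2)) - real d * (z \<bullet> x i) * Q i powr (- s / 2 - 1))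
      + (s + 1 - real d) * (cosh a / sinh a) * (- sinh a * Q i powr (- s / 2 - 1)) = c * rk s (Q i)"
      unfolding Q_def c using Q[OF i] a s hyperbolic_pythagoras[of a]
      by (intro rk_extension_identity) (auto simp: Q_def)
  qed
  also have "\<dots> = c * (\<Sum>i\<in>{1..N}. rk s (Q i))" by (simp add: sum_distrib_left)
  also have "\<dots> < c * (P * w a)" using neg1 c0 by (intro mult_strict_left_mono) (simp_all add: Q_def)
  also have "\<dots> = P * (c * w a)" by simp
  also have "\<dots> \<le> P * (w2 a + (1 - \<alpha>) * (cosh a / sinh a) * w1 a)"
    using barrier_inequality[OF \<alpha>2 less_imp_le[OF c0] E \<eta>1 B a] P
    unfolding w_def w1_def w2_def by (intro mult_left_mono) auto
  finally show False by (simp add: algebra_simps)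
qed

text \<open>Raising \<eta> from 0 lowers the kernels of the other points and brings that of
  \<open>x j\<close> down to at most \<open>rk s (\<eta>\<^sup>2)\<close>. The barrier says that the
  whole sum loses at most \<open>P * B * \<eta> powr \<alpha>\<close>, which limits how large the
  kernel of \<open>x j\<close> was at \<eta> = 0.\<close>

lemma separation_superharmonic:
  fixes x :: "nat \<Rightarrow> real^'n"
  assumes dn: "CARD('n) = d + 1" and d: "d \<ge> 2" and s: "0 < s" "real d - 2 < s" "s < real d"
    and x: "\<And>i. i \<in> {1..N} \<Longrightarrow> norm (x i) = 1" and y: "norm y = 1" "y \<notin> x ` {1..N}"
    and min: "\<And>z. norm z = 1 \<Longrightarrow> z \<notin> x ` {1..N} \<Longrightarrow> rpot s N x y \<le> rpot s N x z"
    and j: "j \<in> {1..N}"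
    and \<alpha>: "\<alpha> = real d - s" and c: "c = s / 2 * (real d - 1 - s / 2)"
    and E: "E = (1 + c) / ((2 - \<alpha>) / 2)" and \<eta>1: "\<eta>1 = 1 / sqrt E" and B: "B = 2 / \<eta>1 powr \<alpha>"
    and \<eta>: "0 < \<eta>" "\<eta> \<le> \<eta>1"
  shows "rk s (2 - 2 * (y \<bullet> x j)) \<le> rpot s N x y * B * \<eta> powr \<alpha> + rk s (\<eta>\<^sup>2)"
proof -
  define P where "P = rpot s N x y"
  have rk0: "0 \<le> rk s t" for t using s by (simp add: rk_def)
  have P: "0 \<le> P" unfolding P_def rpot_def by (intro sum_nonneg rk0)
  have c0: "c \<ge> 0" using s d unfolding c by (intro mult_nonneg_nonneg) (auto simp: field_simps)
  then have E0: "E > 0" using s unfolding E by (intro divide_pos_pos) (auto simp: \<alpha>)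
  have ch: "\<eta>\<^sup>2 \<le> 2 * cosh \<eta> - 2" using cosh_ge_quadratic[of \<eta>] \<eta> by simp
  have yx: "y \<bullet> x i < 1" if "i \<in> {1..N}" for i
    using inner_sphere_less_1[OF y(1) x[OF that]] y(2) that by (cases "y = x i") auto
  have "P * (1 - B * \<eta> powr \<alpha>) \<le> P * (1 - B * \<eta> powr \<alpha> + E * \<eta>\<^sup>2)"
    using P E0 by (intro mult_left_mono) auto
  also have "\<dots> \<le> (\<Sum>i\<in>{1..N}. rk s (2 * cosh \<eta> - 2 * (y \<bullet> x i)))"
    by (rule barrier_le_hyperbolic_potential[OF dn d s x P min[folded P_def] \<alpha> c E \<eta>1 B \<eta> y(1)])
  also have "\<dots> = rk s (2 * cosh \<eta> - 2 * (y \<bullet> x j)) + (\<Sum>i\<in>{1..N} - {j}. rk s (2 * cosh \<eta> - 2 * (y \<bullet> x i)))"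
    using j by (intro sum.remove) auto
  also have "\<dots> \<le> rk s (\<eta>\<^sup>2) + (\<Sum>i\<in>{1..N} - {j}. rk s (2 - 2 * (y \<bullet> x i)))"
  proof (intro add_mono sum_mono rk_antimono)
    show "0 < \<eta>\<^sup>2" using \<eta> by simp
    show "\<eta>\<^sup>2 \<le> 2 * cosh \<eta> - 2 * (y \<bullet> x j)" using ch yx[OF j] by linarith
    fix i assume "i \<in> {1..N} - {j}"
    then show "0 < 2 - 2 * (y \<bullet> x i)" using yx[of i] by simp
    show "2 - 2 * (y \<bullet> x i) \<le> 2 * cosh \<eta> - 2 * (y \<bullet> x i)" by (simp add: cosh_real_ge_1)
  qed
  also have "(\<Sum>i\<in>{1..N} - {j}. rk s (2 - 2 * (y \<bullet> x i))) = P - rk s (2 - 2 * (y \<bullet> x j))"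
    unfolding P_def rpot_def using j by (subst sum.remove[of _ j]) auto
  finally show ?thesis unfolding P_def by (simp add: algebra_simps)
qed

section \<open>Greedy sequences are well separated\<close>

lemma greedy_norm:
  assumes "greedy_sequence s x" "N \<ge> 1"
  shows "norm (x N) = 1"
proof (cases "N = 1")
  case True
  then show ?thesis using assms by (simp add: greedy_sequence_def)
next
  case False
  then have "N - 1 \<ge> 1" "N - 1 + 1 = N" using assms by auto
  then have "is_arg_min (riesz_potential s (N - 1) x) (\<lambda>p. p \<in> sphere 0 1) (x N)"
    using assms(1) unfolding greedy_sequence_def by metis
  then show ?thesis by (simp add: is_arg_min_def)
qed

text \<open>The potential is infinite at the old points and finite elsewhere, so a minimizer is a
  new point and the minimum is a value of \<open>rpot\<close>.\<close>

lemma greedy_step: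
  fixes x :: "nat \<Rightarrow> 'a::euclidean_space"
  assumes d: "DIM('a) = d + 1" "d \<ge> 1" and s: "s \<ge> 0" and g: "greedy_sequence s x" and N: "N \<ge> 1"
  shows "x (N + 1) \<notin> x ` {1..N}"
    "\<And>z. norm z = 1 \<Longrightarrow> z \<notin> x ` {1..N} \<Longrightarrow> rpot s N x (x (N + 1)) \<le> rpot s N x z"
    "polarization s N x = ereal (rpot s N x (x (N + 1)))"
proof -
  have x: "norm (x i) = 1" if "i \<ge> 1" for i using greedy_norm[OF g] that by simp
  have am: "riesz_potential s N x (x (N + 1)) \<le> riesz_potential s N x z" if "norm z = 1" for z
    using g N that unfolding greedy_sequence_def is_arg_min_def by (auto simp: not_less)
  obtain z0 where z0: "norm z0 = 1" "z0 \<notin> x ` {1..N}"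
    using ex_sphere_avoid[OF d, of N x] x by auto
  show nin: "x (N + 1) \<notin> x ` {1..N}"
  proof
    assume "x (N + 1) \<in> x ` {1..N}"
    then obtain j where j: "j \<in> {1..N}" "x (N + 1) = x j" by blast
    have "riesz_kernel s (x (N + 1)) (x j) = \<infinity>" using j s by (simp add: riesz_kernel_def)
    then have "riesz_potential s N x (x (N + 1)) = \<infinity>"
      unfolding riesz_potential_def using j(1) by (subst sum_Pinfty) blast
    then show False using am[OF z0(1)] riesz_potential_eq[OF s z0(1) x z0(2)] by auto
  qed
  have U: "riesz_potential s N x (x (N + 1)) = ereal (rpot s N x (x (N + 1)))"
    by (rule riesz_potential_eq[OF s x x nin]) auto
  show "rpot s N x (x (N + 1)) \<le> rpot s N x z" if "norm z = 1" "z \<notin> x ` {1..N}" for z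
    using am[OF that(1)] riesz_potential_eq[OF s that(1) x that(2)] U by auto
  show "polarization s N x = ereal (rpot s N x (x (N + 1)))"
    unfolding polarization_def U[symmetric]
    by (intro antisym INF_lower INF_greatest) (use am x in auto)
qed

lemma norm_ge_if_rk_le:
  assumes s: "s > 0" and K: "K > 0" and n: "n > 0" and r: "r > 0"
    and le: "rk s (r\<^sup>2) \<le> K * n powr (s / d)"
  shows "(s * K) powr (- 1 / s) * n powr (- 1 / d) \<le> r"
proof -
  have "(r powr 2) powr (- s / 2) = r powr (- s)" by (simp add: powr_powr)
  then have "rk s (r\<^sup>2) = r powr (- s) / s" using r s by (simp add: rk_def)
  then have "r powr (- s) = s * rk s (r\<^sup>2)" using s by simp
  also have "\<dots> \<le> s * (K * n powr (s / d))" using le s by (intro mult_left_mono) auto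
  finally have "r powr (- s) \<le> (s * K) * n powr (s / d)" by simp
  then have "((s * K) * n powr (s / d)) powr (- 1 / s) \<le> (r powr (- s)) powr (- 1 / s)"
    using s r by (intro powr_mono2') auto
  also have "\<dots> = r" using s r by (simp add: powr_powr)
  also have "((s * K) * n powr (s / d)) powr (- 1 / s) = (s * K) powr (- 1 / s) * (n powr (s / d)) powr (- 1 / s)"
    by (rule powr_mult)
  also have "(n powr (s / d)) powr (- 1 / s) = n powr (- 1 / d)"
    using s by (simp add: powr_powr)
  finally show ?thesis .
qed

text \<open>By averaging, a greedy point has potential at most \<open>I * n\<close>. Fed into the
  two separation estimates at the scale \<open>n powr (- 1 / d)\<close>, this bounds every single
  kernel by the order of a nearest-neighbour interaction.\<close>

lemma greedy_rk_le:
  assumes dn: "CARD('n::finite) = d + 1" and d: "d \<ge> 2" and s: "0 < s" "real d - 2 \<le> s" "s < real d"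
  obtains K where "K > 0" "\<And>(x :: nat \<Rightarrow> real^'n) n j. greedy_sequence s x \<Longrightarrow> n \<ge> 1 \<Longrightarrow> j \<in> {1..n} \<Longrightarrow>
    rk s (2 - 2 * (x (n + 1) \<bullet> x j)) \<le> K * real n powr (s / real d)"
proof -
  have D: "DIM(real^'n) = d + 1" "d \<ge> 1" using dn d by auto
  define I where "I = riesz_integral TYPE(real^'n) s"
  have I0: "I \<ge> 0" unfolding I_def by (rule riesz_integral_nonneg[OF dn s])
  have facts: "norm (x (n + 1)) = 1" "x (n + 1) \<notin> x ` {1..n}" "rpot s n x (x (n + 1)) \<le> I * real n"
      "\<And>i. i \<in> {1..n} \<Longrightarrow> norm (x i) = 1"
      "\<And>z. norm z = 1 \<Longrightarrow> z \<notin> x ` {1..n} \<Longrightarrow> rpot s n x (x (n + 1)) \<le> rpot s n x z"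
    if g: "greedy_sequence s x" and n: "n \<ge> 1" for x :: "nat \<Rightarrow> real^'n" and n
  proof -
    note st = greedy_step[OF D less_imp_le[OF s(1)] g n]
    show "norm (x (n + 1)) = 1" by (rule greedy_norm[OF g]) simp
    show x: "norm (x i) = 1" if "i \<in> {1..n}" for i using greedy_norm[OF g] that by simp
    show "x (n + 1) \<notin> x ` {1..n}" by (rule st(1))
    show mn: "rpot s n x (x (n + 1)) \<le> rpot s n x z" if "norm z = 1" "z \<notin> x ` {1..n}" for z
      using st(2) that by blast
    show "rpot s n x (x (n + 1)) \<le> I * real n"
      unfolding I_def by (rule lower_bound_le_average[OF dn less_imp_le[OF s(1)] s(2,3) x mn])
  qed
  show ?thesis
  proof (cases "s = real d - 2")
    case True
    \<comment> \<open>Chosen so that \<open>R0 * (s + 4) \<le> 2\<close>, to which the hypothesis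
      \<open>H\<close> of \<open>separation_harmonic\<close> reduces for
      \<open>B = s / 2 * (I + 1) * n\<close>.\<close>
    define R0 where "R0 = 1 / (2 + s)"
    have R0: "R0 > 0" "R0 \<le> 1" using s by (auto simp: R0_def)
    define K where "K = (2 * R0) powr (- s / 2) / s + s / 2 * (I + 1) * R0"
    show ?thesis
    proof (rule that[of K])
      show "K > 0" unfolding K_def using R0 s I0 by (intro add_pos_nonneg) auto
      fix x :: "nat \<Rightarrow> real^'n" and n j :: nat
      assume g: "greedy_sequence s x" and n: "n \<ge> 1" and j: "j \<in> {1..n}"
      note f = facts[OF g n]
      define R where "R = R0 * real n powr (- 2 / real d)"
      define B where "B = s / 2 * (I + 1) * real n"
      have n0: "real n > 0" using n by simp
      have "real n powr (- 2 / real d) \<le> real n powr 0" using n d by (intro powr_mono) auto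
      then have RR0: "R \<le> R0" using R0 n by (simp add: R_def mult_left_le)
      then have R: "0 < R" "R \<le> 1" using R0 n0 unfolding R_def by (simp, linarith)
      have B0: "B > 0" unfolding B_def using s I0 n0 by (intro mult_pos_pos) auto
      have "(if s = 0 then (real n - 1) / 4 else s / 4 * (rpot s n x (x (n + 1)) + B * R)) \<le> (1 - R) * B"
      proof -
        have "rpot s n x (x (n + 1)) \<le> (I + 1) * real n" using f(3) n0 by (simp add: distrib_right)
        then have "s / 4 * rpot s n x (x (n + 1)) \<le> s / 4 * ((I + 1) * real n)" using s by (intro mult_left_mono) auto
        then have 1: "s / 4 * rpot s n x (x (n + 1)) \<le> B / 2" by (simp add: B_def)
        have "R0 * (s + 4) \<le> 2" using s by (simp add: R0_def divide_le_eq)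
        then have "R * (s + 4) \<le> 2" using mult_right_mono[OF RR0, of "s + 4"] s by linarith
        then have "B * (R * (s + 4)) \<le> B * 2" using B0 by (intro mult_left_mono) auto
        then show ?thesis using 1 s by (simp add: algebra_simps)
      qed
      from separation_harmonic[OF dn d _ f(4,1,2,5) j R B0 this]
      have "rk s (2 - 2 * (x (n + 1) \<bullet> x j)) \<le> rk s (2 * R) + B * R" using True by simp
      also have "rk s (2 * R) = (2 * R0) powr (- s / 2) / s * real n powr (s / real d)"
      proof -
        have "(2 * R) powr (- s / 2) = (2 * R0) powr (- s / 2) * (real n powr (- 2 / real d)) powr (- s / 2)"
          unfolding R_def mult.assoc[symmetric] by (rule powr_mult)
        then show ?thesis using s by (simp add: rk_def powr_powr)
      qed
      also have "B * R = s / 2 * (I + 1) * R0 * (real n powr 1 * real n powr (- 2 / real d))"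
        using n0 by (simp add: B_def R_def)
      also have "real n powr 1 * real n powr (- 2 / real d) = real n powr (s / real d)"
        unfolding powr_add[symmetric] using True d by (simp add: diff_divide_distrib)
      finally show "rk s (2 - 2 * (x (n + 1) \<bullet> x j)) \<le> K * real n powr (s / real d)"
        by (simp add: K_def distrib_right)
    qed
  next
    case False
    then have s2: "real d - 2 < s" using s by simp
    define \<alpha> where "\<alpha> = real d - s"
    define c where "c = s / 2 * (real d - 1 - s / 2)"
    define E where "E = (1 + c) / ((2 - \<alpha>) / 2)"
    define \<eta>1 where "\<eta>1 = 1 / sqrt E"
    define B where "B = 2 / \<eta>1 powr \<alpha>"
    have c0: "c \<ge> 0" using s d unfolding c_def by (intro mult_nonneg_nonneg) (auto simp: field_simps)
    then have E0: "E > 0" using s2 unfolding E_def by (intro divide_pos_pos) (auto simp: \<alpha>_def)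
    have h0: "\<eta>1 > 0" using E0 by (simp add: \<eta>1_def)
    define K where "K = 2 * I + \<eta>1 powr (- s) / s"
    show ?thesis
    proof (rule that[of K])
      show "K > 0" unfolding K_def using h0 s I0 by (intro add_nonneg_pos) auto
      fix x :: "nat \<Rightarrow> real^'n" and n j :: nat
      assume g: "greedy_sequence s x" and n: "n \<ge> 1" and j: "j \<in> {1..n}"
      note f = facts[OF g n]
      have n0: "real n > 0" using n by simp
      \<comment> \<open>At this height the barrier loss, of order
        \<open>n * \<eta> powr (d - s)\<close>, and the kernel \<open>rk s (\<eta>\<^sup>2)\<close>
        are both of order \<open>n powr (s / d)\<close>.\<close>
      define \<eta> where "\<eta> = \<eta>1 * real n powr (- 1 / real d)"
      have "real n powr (- 1 / real d) \<le> real n powr 0" using n d by (intro powr_mono) auto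
      then have \<eta>: "0 < \<eta>" "\<eta> \<le> \<eta>1" using h0 n0 by (auto simp: \<eta>_def mult_left_le)
      have "rk s (2 - 2 * (x (n + 1) \<bullet> x j)) \<le> rpot s n x (x (n + 1)) * B * \<eta> powr \<alpha> + rk s (\<eta>\<^sup>2)"
        by (rule separation_superharmonic[OF dn d s(1) s2 s(3) f(4,1,2,5) j \<alpha>_def c_def E_def \<eta>1_def B_def \<eta>])
      also have "rpot s n x (x (n + 1)) * B * \<eta> powr \<alpha> \<le> (I * real n) * B * \<eta> powr \<alpha>"
        using f(3) h0 by (intro mult_right_mono) (auto simp: B_def)
      also have "\<eta> powr \<alpha> = \<eta>1 powr \<alpha> * real n powr (- \<alpha> / real d)"
        using h0 n0 by (simp add: \<eta>_def powr_mult powr_powr)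
      also have "I * real n * B * (\<eta>1 powr \<alpha> * real n powr (- \<alpha> / real d)) = 2 * I * (real n powr 1 * real n powr (- \<alpha> / real d))"
        using h0 n0 by (simp add: B_def)
      also have "real n powr 1 * real n powr (- \<alpha> / real d) = real n powr (s / real d)"
        unfolding powr_add[symmetric] using d by (simp add: \<alpha>_def diff_divide_distrib)
      also have "rk s (\<eta>\<^sup>2) = \<eta>1 powr (- s) / s * real n powr (s / real d)"
      proof -
        have "(\<eta>\<^sup>2) powr (- s / 2) = (\<eta> powr 2) powr (- s / 2)" using \<eta> by simp
        also have "\<dots> = \<eta> powr (- s)" unfolding powr_powr by simp
        also have "\<dots> = \<eta>1 powr (- s) * real n powr (s / real d)"
          using h0 n0 by (simp add: \<eta>_def powr_mult powr_powr)
        finally show ?thesis using s by (simp add: rk_def)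
      qed
      finally show "rk s (2 - 2 * (x (n + 1) \<bullet> x j)) \<le> K * real n powr (s / real d)"
        by (simp add: K_def distrib_right)
    qed
  qed
qed

text \<open>Taking R = 1 / n and B = n / 4 makes the hypothesis \<open>H\<close> of
  \<open>separation_harmonic\<close> an equality. The explicit constant is used in
  \<open>greedy_gap_large\<close>.\<close>

lemma greedy_separation_log:
  fixes x :: "nat \<Rightarrow> real^'n"
  assumes dn: "CARD('n) = 3" and g: "greedy_sequence 0 x" and n: "n \<ge> 1" and j: "j \<in> {1..n}"
  shows "2 * exp (- 1 / 2) / real n \<le> (norm (x (n + 1) - x j))\<^sup>2"
proof -
  have D: "DIM(real^'n) = 2 + 1" "(2::nat) \<ge> 1" "CARD('n) = 2 + 1" using dn by auto
  note st = greedy_step[OF D(1,2) order_refl g n]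
  have x: "norm (x i) = 1" if "i \<in> {1..n}" for i using greedy_norm[OF g] that by simp
  have y: "norm (x (n + 1)) = 1" by (rule greedy_norm[OF g]) simp
  have n0: "real n > 0" using n by simp
  have "rk 0 (2 - 2 * (x (n + 1) \<bullet> x j)) \<le> rk 0 (2 * (1 / real n)) + real n / 4 * (1 / real n)"
    by (rule separation_harmonic[OF D(3) order_refl _ x y st(1) st(2) j]) (use n in \<open>auto simp: field_simps\<close>)
  then have le: "rk 0 (2 - 2 * (x (n + 1) \<bullet> x j)) \<le> - ln (2 / real n) / 2 + 1 / 4"
    using n0 by (simp add: rk_def)
  have "x j \<in> x ` {1..n}" using j by blast
  then have neq: "x (n + 1) \<noteq> x j" using st(1) by metis
  define t where "t = 2 - 2 * (x (n + 1) \<bullet> x j)"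
  have t: "t > 0" "t = (norm (x (n + 1) - x j))\<^sup>2"
    using inner_sphere_less_1[OF y x[OF j] neq] norm_diff_sphere[OF y x[OF j]] by (auto simp: t_def)
  have "ln (2 * exp (- 1 / 2) / real n) = ln (2 / real n) - 1 / 2"
    using n0 by (simp add: ln_div ln_mult)
  also have "\<dots> \<le> ln t" using le by (simp add: rk_def t_def)
  finally have "2 * exp (- 1 / 2) / real n \<le> t" using t(1) n0 by (subst (asm) ln_le_cancel_iff) auto
  then show ?thesis using t(2) by simp
qed

lemma greedy_separated:
  assumes dn: "CARD('n::finite) = d + 1" and d: "d \<ge> 2" and s: "real d - 2 \<le> s" "s < real d"
  obtains c where "c > 0" "\<And>(x :: nat \<Rightarrow> real^'n) N i j. greedy_sequence s x \<Longrightarrow> i \<in> {1..N} \<Longrightarrow> j \<in> {1..N} \<Longrightarrow> i \<noteq> j \<Longrightarrow>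
    c * real N powr (- 1 / real d) \<le> norm (x i - x j)"
proof -
  have D: "DIM(real^'n) = d + 1" "d \<ge> 1" using dn d by auto
  have s0: "s \<ge> 0" using s d by linarith
  have "\<exists>c>0. \<forall>(x :: nat \<Rightarrow> real^'n) n j. greedy_sequence s x \<longrightarrow> j \<in> {1..n} \<longrightarrow>
    c * real n powr (- 1 / real d) \<le> norm (x (n + 1) - x j)"
  proof (cases "s = 0")
    case True
    then have d2: "d = 2" using s d by simp
    show ?thesis
    proof (intro exI[of _ "sqrt (2 * exp (- 1 / 2))"] conjI allI impI)
      fix x :: "nat \<Rightarrow> real^'n" and n j :: nat
      assume g: "greedy_sequence s x" and j: "j \<in> {1..n}"
      have n: "n \<ge> 1" using j by auto
      have "sqrt (2 * exp (- 1 / 2) / real n) \<le> sqrt ((norm (x (n + 1) - x j))\<^sup>2)"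
        using greedy_separation_log[of x n j] dn d2 g True n j by (intro real_sqrt_le_mono) auto
      moreover have "real n powr (- 1 / real d) = 1 / sqrt (real n)"
        using n d2 powr_minus_divide[of "real n" "1 / 2"] by (simp add: powr_half_sqrt)
      ultimately show "sqrt (2 * exp (- 1 / 2)) * real n powr (- 1 / real d) \<le> norm (x (n + 1) - x j)"
        by (simp add: real_sqrt_divide)
    qed simp
  next
    case False
    then have sp: "s > 0" using s0 by simp
    obtain K where K: "K > 0" "\<And>(x :: nat \<Rightarrow> real^'n) n j. greedy_sequence s x \<Longrightarrow> n \<ge> 1 \<Longrightarrow> j \<in> {1..n} \<Longrightarrow>
      rk s (2 - 2 * (x (n + 1) \<bullet> x j)) \<le> K * real n powr (s / real d)"
      using greedy_rk_le[OF dn d sp s] by blast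
    show ?thesis
    proof (intro exI[of _ "(s * K) powr (- 1 / s)"] conjI allI impI)
      show "0 < (s * K) powr (- 1 / s)" using sp K by simp
      fix x :: "nat \<Rightarrow> real^'n" and n j :: nat
      assume g: "greedy_sequence s x" and j: "j \<in> {1..n}"
      have n: "n \<ge> 1" using j by auto
      have y: "norm (x (n + 1)) = 1" "norm (x j) = 1" using greedy_norm[OF g] j by auto
      have "x j \<in> x ` {1..n}" using j by blast
      then have neq: "x (n + 1) \<noteq> x j" using greedy_step(1)[OF D s0 g n] by metis
      show "(s * K) powr (- 1 / s) * real n powr (- 1 / real d) \<le> norm (x (n + 1) - x j)"
        by (rule norm_ge_if_rk_le[OF sp K(1)])
          (use n neq K(2)[OF g n j] norm_diff_sphere[OF y] in auto)
    qed
  qed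
  then obtain c where c: "c > 0" "\<And>(x :: nat \<Rightarrow> real^'n) n j. greedy_sequence s x \<Longrightarrow> j \<in> {1..n} \<Longrightarrow>
    c * real n powr (- 1 / real d) \<le> norm (x (n + 1) - x j)" by blast
  \<comment> \<open>The later of the two points was chosen when fewer than N points were present, so
    its distance from the earlier one is controlled at a coarser scale.\<close>
  have ord: "c * real N powr (- 1 / real d) \<le> norm (x i - x j)"
    if g: "greedy_sequence s x" and ij: "j \<ge> 1" "j < i" "i \<le> N" for x :: "nat \<Rightarrow> real^'n" and N i j
  proof -
    have "real N powr (- 1 / real d) \<le> real (i - 1) powr (- 1 / real d)"
      using ij by (intro powr_mono2') auto
    then have "c * real N powr (- 1 / real d) \<le> c * real (i - 1) powr (- 1 / real d)"
      using c(1) by (intro mult_left_mono) auto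
    also have "\<dots> \<le> norm (x (i - 1 + 1) - x j)" using ij by (intro c(2)[OF g]) auto
    finally show ?thesis using ij by simp
  qed
  show ?thesis
  proof (rule that[OF c(1)])
    fix x :: "nat \<Rightarrow> real^'n" and N i j :: nat
    assume g: "greedy_sequence s x" and ij: "i \<in> {1..N}" "j \<in> {1..N}" "i \<noteq> j"
    show "c * real N powr (- 1 / real d) \<le> norm (x i - x j)"
      using ord[OF g, of j i N] ord[OF g, of i j N] ij by (cases "j < i") (auto simp: norm_minus_commute)
  qed
qed

section \<open>Uniform distribution of heights on the two-dimensional sphere\<close>

lemma integrable_sphere_inner_power:
  fixes e :: "'a::euclidean_space"
  assumes "norm e = 1"
  shows "integrable sphere_measure (\<lambda>z. (z \<bullet> e) ^ k)"
proof (rule integrable_sphere_bounded[where M = 1])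
  fix z :: 'a assume "norm z = 1"
  then have "\<bar>z \<bullet> e\<bar> \<le> 1" using inner_sphere_bounds[of z e] assms by auto
  then show "\<bar>(z \<bullet> e) ^ k\<bar> \<le> 1" by (simp add: power_abs power_le_one)
qed measurable

text \<open>Green's formula with factor 1 and profile \<open>t ^ k\<close> gives the recursion
  \<open>k * m (k - 1) = (k + 2) * m (k + 1)\<close> for the moments m, which determines them from
  the first two; they are those of the uniform distribution on [-1, 1].\<close>

lemma sphere_moment:
  fixes e :: "real^'n"
  assumes dn: "CARD('n) = 3" and e: "norm e = 1"
  shows "(\<integral>z. (z \<bullet> e) ^ k \<partial>sphere_measure) = (1 - (- 1) ^ (k + 1)) / (2 * (real k + 1))"
proof -
  have rec: "real k * (\<integral>z. (z \<bullet> e) ^ (k - 1) \<partial>sphere_measure) = (real k + 2) * (\<integral>z. (z \<bullet> e) ^ (k + 1) \<partial>sphere_measure)" for k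
  proof -
    have e1: "e \<bullet> e = 1" using e by (simp add: dot_square_norm)
    have "(\<integral>z. 0 * (z \<bullet> e) ^ k * ((e \<bullet> e) - (z \<bullet> e) * (z \<bullet> e))
       + 1 * ((1 - (z \<bullet> e)\<^sup>2) * (real k * (z \<bullet> e) ^ (k - 1)) - (real CARD('n) - 1) * (z \<bullet> e) * (z \<bullet> e) ^ k) \<partial>sphere_measure) = 0"
      by (rule green_zonal[OF e e, of "\<lambda>_. 1" "\<lambda>_. 0" "\<lambda>t. t ^ k" "\<lambda>t. real k * t ^ (k - 1)"])
        (auto intro!: derivative_eq_intros continuous_intros)
    moreover have "1 * ((1 - (z \<bullet> e)\<^sup>2) * (real k * (z \<bullet> e) ^ (k - 1)) - (real CARD('n) - 1) * (z \<bullet> e) * (z \<bullet> e) ^ k)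
      = real k * (z \<bullet> e) ^ (k - 1) - (real k + 2) * (z \<bullet> e) ^ (k + 1)" for z
      using dn by (cases k) (simp_all add: power2_eq_square algebra_simps)
    ultimately have "(\<integral>z. real k * (z \<bullet> e) ^ (k - 1) - (real k + 2) * (z \<bullet> e) ^ (k + 1) \<partial>sphere_measure) = 0"
      by simp
    then show ?thesis
      by (subst (asm) Bochner_Integration.integral_diff)
        (auto intro!: integrable_mult_right integrable_sphere_inner_power[OF e] simp del: power_Suc)
  qed
  show ?thesis
  proof (induction k rule: less_induct)
    case (less k)
    consider "k = 0" | "k = 1" | j where "k = Suc (Suc j)" by (metis One_nat_def not0_implies_Suc)
    then show ?case
    proof cases
      case 1
      then show ?thesis by simp
    next
      case 2
      then show ?thesis using rec[of 0] by simp
    next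
      case 3
      have "(real j + 1) * (\<integral>z. (z \<bullet> e) ^ j \<partial>sphere_measure) = (real j + 3) * (\<integral>z. (z \<bullet> e) ^ k \<partial>sphere_measure)"
        using rec[of "Suc j"] 3 by (simp add: add_ac)
      moreover have "(\<integral>z. (z \<bullet> e) ^ j \<partial>sphere_measure) = (1 - (- 1) ^ (j + 1)) / (2 * (real j + 1))"
        using less 3 by simp
      moreover have "q * (c / (2 * q)) = c / 2" if "q \<noteq> 0" for c q :: real using that by simp
      ultimately have "(real j + 3) * (\<integral>z. (z \<bullet> e) ^ k \<partial>sphere_measure) = (1 - (- 1) ^ (j + 1)) / 2"
        by (metis add_pos_nonneg less_irrefl of_nat_0_le_iff add.commute zero_less_one)
      moreover have "p = c / (2 * q)" if "q * p = c / 2" "q > 0" for p q c :: real using that by (simp add: field_simps)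
      ultimately have "(\<integral>z. (z \<bullet> e) ^ k \<partial>sphere_measure) = (1 - (- 1) ^ (j + 1)) / (2 * (real j + 3))"
        by (metis add_nonneg_pos of_nat_0_le_iff zero_less_numeral)
      then show ?thesis unfolding 3 by (simp add: add.commute)
    qed
  qed
qed

text \<open>Archimedes' hat-box theorem. The moments settle polynomials, and Weierstrass
  approximation extends the formula to continuous \<open>h\<close>; a primitive \<open>K\<close>
  stands in for the integral over the interval.\<close>

lemma integral_sphere_inner:
  fixes e :: "real^'n" and h K :: "real \<Rightarrow> real"
  assumes dn: "CARD('n) = 3" and e: "norm e = 1" and [measurable]: "h \<in> borel_measurable borel"
    and cont: "continuous_on {-1..1} h"
    and K: "\<And>t. t \<in> {-1..1} \<Longrightarrow> (K has_real_derivative h t) (at t within {-1..1})"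
  shows "(\<integral>z. h (z \<bullet> e) \<partial>sphere_measure) = (K 1 - K (- 1)) / 2"
proof -
  interpret prob_space "sphere_measure :: (real^'n) measure" by (rule prob_space_sphere_measure)
  define D where "D = (\<integral>z. h (z \<bullet> e) \<partial>sphere_measure) - (K 1 - K (- 1)) / 2"
  have inn: "z \<bullet> e \<in> {-1..1}" if "norm z = 1" for z
    using inner_sphere_bounds[OF that e] .
  obtain Bh where Bh: "\<And>t. t \<in> {-1..1} \<Longrightarrow> \<bar>h t\<bar> \<le> Bh" using continuous_on_interval_bounded[OF cont] by blast
  have ih: "integrable sphere_measure (\<lambda>z. h (z \<bullet> e))"
    by (rule integrable_sphere_bounded[where M = Bh]) (use Bh inn in auto)
  have "\<bar>D\<bar> \<le> 0 + \<epsilon>" if \<epsilon>: "\<epsilon> > 0" for \<epsilon>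
  proof -
    obtain p where p: "real_polynomial_function p" "\<And>t. t \<in> {-1..1} \<Longrightarrow> \<bar>h t - p t\<bar> < \<epsilon> / 2"
      using Stone_Weierstrass_real_polynomial_function[OF compact_Icc cont, of "\<epsilon> / 2"] \<epsilon> by auto
    obtain a n where a: "p = (\<lambda>t. \<Sum>i\<le>n. a i * t ^ i)"
      using p(1) real_polynomial_function_iff_sum by blast
    define L where "L t = (\<Sum>i\<le>n. a i * t ^ (i + 1) / (real i + 1))" for t
    have L: "(L has_real_derivative p t) (at t within {-1..1})" for t
      unfolding L_def[abs_def] a 
    proof (rule DERIV_sum)
      fix i
      have "((\<lambda>t. a i * t ^ (i + 1) / (real i + 1)) has_real_derivative a i * (real (i + 1) * t ^ i) / (real i + 1)) (at t within {-1..1})"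
        using DERIV_pow[of "i + 1" t] by (intro DERIV_cdivide DERIV_cmult) simp
      then show "((\<lambda>t. a i * t ^ (i + 1) / (real i + 1)) has_real_derivative a i * t ^ i) (at t within {-1..1})"
        by (simp add: add.commute)
    qed
    have ip: "integrable sphere_measure (\<lambda>z. p (z \<bullet> e))"
      unfolding a by (intro Bochner_Integration.integrable_sum integrable_mult_right integrable_sphere_inner_power[OF e])
    have "(\<integral>z. p (z \<bullet> e) \<partial>sphere_measure) = (\<Sum>i\<le>n. a i * ((1 - (- 1) ^ (i + 1)) / (2 * (real i + 1))))"
      unfolding a using integrable_sphere_inner_power[OF e] sphere_moment[OF dn e]
      by (subst Bochner_Integration.integral_sum) auto
    also have "\<dots> = (L 1 - L (- 1)) / 2"
      unfolding L_def sum_subtractf[symmetric] sum_divide_distrib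
    proof (intro sum.cong refl)
      fix i
      have "b * ((1 - c) / (2 * q)) = (b * 1 / q - b * c / q) / 2" for b c q :: real
        by (cases "q = 0") (auto simp: field_simps)
      then show "a i * ((1 - (- 1) ^ (i + 1)) / (2 * (real i + 1))) = (a i * 1 ^ (i + 1) / (real i + 1) - a i * (- 1) ^ (i + 1) / (real i + 1)) / 2"
        unfolding power_one by blast
    qed
    finally have Ep: "(\<integral>z. p (z \<bullet> e) \<partial>sphere_measure) = (L 1 - L (- 1)) / 2" .
    have "norm (((\<lambda>t. K t - L t) 1) - ((\<lambda>t. K t - L t) (- 1))) \<le> \<epsilon> / 2 * norm (1 - (- 1) :: real)"
    proof (rule field_differentiable_bound[of "{-1..1}"])
      fix t :: real assume t: "t \<in> {-1..1}"
      show "((\<lambda>t. K t - L t) has_real_derivative h t - p t) (at t within {-1..1})"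
        by (intro DERIV_diff K[OF t] L)
      show "norm (h t - p t) \<le> \<epsilon> / 2" using p(2)[OF t] by simp
    qed auto
    then have 1: "\<bar>(K 1 - L 1) - (K (- 1) - L (- 1))\<bar> \<le> \<epsilon>" by simp
    have "\<bar>\<integral>z. h (z \<bullet> e) - p (z \<bullet> e) \<partial>sphere_measure\<bar> \<le> (\<integral>z. \<epsilon> / 2 \<partial>(sphere_measure :: (real^'n) measure))"
    proof (rule order_trans[OF integral_abs_bound integral_mono_AE])
      show "AE z in sphere_measure. \<bar>h (z \<bullet> e) - p (z \<bullet> e)\<bar> \<le> \<epsilon> / 2"
        by (intro AE_sphereI less_imp_le p(2) inn)
    qed (use ih ip in auto)
    then have 2: "\<bar>(\<integral>z. h (z \<bullet> e) \<partial>sphere_measure) - (L 1 - L (- 1)) / 2\<bar> \<le> \<epsilon> / 2"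
      using ih ip by (simp add: Ep)
    show ?thesis using 1 2 unfolding D_def by (simp add: abs_le_iff field_simps)
  qed
  then have "\<bar>D\<bar> \<le> 0" by (rule field_le_epsilon)
  then show ?thesis by (simp add: D_def)
qed

text \<open>For d = 2 the spherical factor is 1 except at the poles, where the weight and the
  simplified formula both vanish. The weight is then the derivative of the squared cut-off, and
  heights are uniformly distributed.\<close>

lemma cap_mass_2:
  assumes dn: "CARD('n::finite) = 3" and R: "0 < R" "R \<le> 1"
  shows "cap_mass TYPE('n) 2 R = R ^ 4 / 2"
proof -
  obtain e :: "real^'n" where e: "norm e = 1" using norm_axis_1 by blast
  define h where "h \<tau> = 2 * max 0 (R\<^sup>2 - (1 - \<tau>)\<^sup>2) * (2 * (1 - \<tau>))" for \<tau>
  have [measurable]: "h \<in> borel_measurable borel" unfolding h_def[abs_def] by measurable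
  have "cap_mass TYPE('n) 2 R = (\<integral>z. cap_weight 2 R (z \<bullet> e) \<partial>sphere_measure)" by (rule cap_mass_eq[OF e, symmetric])
  also have "\<dots> = (\<integral>z. h (z \<bullet> e) \<partial>sphere_measure)"
  proof (rule integral_cong_AE)
    show "AE z in sphere_measure. cap_weight 2 R (z \<bullet> e) = h (z \<bullet> e)"
    proof (rule AE_sphereI)
      fix z :: "real^'n" assume "norm z = 1"
      define \<tau> where "\<tau> = z \<bullet> e"
      have "\<tau> \<in> {-1..1}" using inner_sphere_bounds[OF \<open>norm z = 1\<close> e] by (simp add: \<tau>_def)
      then consider "\<tau> = 1" | "\<tau> = - 1" | "\<bar>\<tau>\<bar> < 1" by force
      then have "cap_weight 2 R \<tau> = h \<tau>"
      proof cases
        case 2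
        have "R\<^sup>2 \<le> 1\<^sup>2" using R by (intro power_mono) auto
        then show ?thesis using 2 by (simp add: cap_weight_def h_def)
      next
        case 3
        then have "\<tau>\<^sup>2 < 1" by (simp add: abs_square_less_1)
        then have "(1 - \<tau>\<^sup>2) * (1 - \<tau>\<^sup>2) powr (- real 2 / 2) = 1" by (simp add: powr_minus_divide)
        then show ?thesis unfolding cap_weight_def h_def by simp
      qed (simp add: cap_weight_def h_def)
      then show "cap_weight 2 R (z \<bullet> e) = h (z \<bullet> e)" by (simp add: \<tau>_def)
    qed
  qed measurable
  also have "\<dots> = ((\<lambda>\<tau>. (max 0 (R\<^sup>2 - (1 - \<tau>)\<^sup>2))\<^sup>2) 1 - (\<lambda>\<tau>. (max 0 (R\<^sup>2 - (1 - \<tau>)\<^sup>2))\<^sup>2) (- 1)) / 2"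
  proof (rule integral_sphere_inner[OF dn e])
    show "continuous_on {-1..1} h" unfolding h_def[abs_def] by (intro continuous_intros)
    fix t :: real
    have "((\<lambda>\<tau>. R\<^sup>2 - (1 - \<tau>)\<^sup>2) has_real_derivative 2 * (1 - t)) (at t within {-1..1})"
      by (auto intro!: derivative_eq_intros)
    from max_0_square_has_real_derivative[OF this]
    show "((\<lambda>\<tau>. (max 0 (R\<^sup>2 - (1 - \<tau>)\<^sup>2))\<^sup>2) has_real_derivative h t) (at t within {-1..1})"
      by (simp add: h_def)
  qed measurable
  also have "\<dots> = R ^ 4 / 2"
  proof -
    have "R\<^sup>2 \<le> 1\<^sup>2" using R by (intro power_mono) auto
    then have "max 0 (R\<^sup>2 - (1 - (- 1))\<^sup>2) = 0" by simp
    then show ?thesis by simp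
  qed
  finally show ?thesis .
qed

text \<open>The maximum of \<open>4 * (R\<^sup>2 - u\<^sup>2) * u\<close> lies at
  \<open>u = R / sqrt 3\<close> and equals \<open>8 / (3 * sqrt 3) * R ^ 3\<close>, slightly below
  the stated bound.\<close>

lemma cap_weight_2_le:
  assumes R: "0 < R" "R \<le> 1" and t: "\<bar>\<tau>\<bar> \<le> 1"
  shows "cap_weight 2 R \<tau> \<le> 77 / 50 * R ^ 3"
proof (cases "\<tau> \<le> 1 - R \<or> \<tau> = 1")
  case True
  then have "cap_weight 2 R \<tau> = 0" using cap_weight_bounds(3)[OF order_refl R t] by (auto simp: cap_weight_def)
  then show ?thesis using R by simp
next
  case False
  define u where "u = 1 - \<tau>"
  have u: "0 < u" "u < R" using False t by (auto simp: u_def)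
  have "\<tau> \<noteq> - 1" using False R by auto
  then have "\<bar>\<tau>\<bar> < 1" using False t by linarith
  then have "\<tau>\<^sup>2 < 1" by (simp add: abs_square_less_1)
  then have "(1 - \<tau>\<^sup>2) * (1 - \<tau>\<^sup>2) powr (- real 2 / 2) = 1" by (simp add: powr_minus_divide)
  then have "cap_weight 2 R \<tau> = 4 * (R\<^sup>2 - u\<^sup>2) * u"
    unfolding cap_weight_def using power_mono[of u R 2] u by (simp add: u_def[symmetric])
  moreover have "4 * (R\<^sup>2 - u\<^sup>2) * u \<le> 77 / 50 * R ^ 3"
  proof -
    \<comment> \<open>A rational just below \<open>1 / sqrt 3\<close>. The nonnegative cubic
      \<open>(u - a * R)\<^sup>2 * (u + 2 * a * R)\<close> touches 0 near the maximum, and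
      \<open>12 * a\<^sup>2 < 4\<close> fixes the sign of the leftover term.\<close>
    define a :: real where "a = 57735 / 100000"
    have "0 \<le> 4 * ((u - a * R)\<^sup>2 * (u + 2 * a * R))" using u R by (intro mult_nonneg_nonneg) (auto simp: a_def)
    also have "\<dots> = 4 * u ^ 3 - 12 * a\<^sup>2 * (R\<^sup>2 * u) + 8 * a ^ 3 * R ^ 3"
      by (simp add: power2_eq_square power3_eq_cube algebra_simps)
    finally have 1: "0 \<le> 4 * u ^ 3 - 12 * a\<^sup>2 * (R\<^sup>2 * u) + 8 * a ^ 3 * R ^ 3" .
    have 2: "R\<^sup>2 * u \<le> R ^ 3" using u R by (simp add: power2_eq_square power3_eq_cube)
    have "(4 - 12 * a\<^sup>2) * (R\<^sup>2 * u) \<le> (4 - 12 * a\<^sup>2) * R ^ 3"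
      using 2 by (intro mult_left_mono) (auto simp: a_def power2_eq_square)
    moreover have "(4 - 12 * a\<^sup>2 + 8 * a ^ 3) * R ^ 3 \<le> 77 / 50 * R ^ 3"
      using R by (intro mult_right_mono) (auto simp: a_def power2_eq_square power3_eq_cube)
    moreover have "4 * (R\<^sup>2 - u\<^sup>2) * u = 4 * (R\<^sup>2 * u) - 4 * u ^ 3" by (simp add: power2_eq_square power3_eq_cube algebra_simps)
    ultimately show ?thesis using 1 unfolding left_diff_distrib distrib_right by linarith
  qed
  ultimately show ?thesis by simp
qed

text \<open>The integral of the shifted kernel is explicit through the primitive of the logarithm.
  It stays below the kernel integral and tends to \<open>1 / 2 - ln 2\<close> with the
  shift.\<close>

lemma riesz_integral_log_ge:
  assumes dn: "CARD('n::finite) = 3"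
  shows "1 / 2 - ln 2 \<le> riesz_integral TYPE(real^'n) 0"
proof -
  obtain e :: "real^'n" where e: "norm e = 1" using norm_axis_1 by blast
  have D: "CARD('n) = 2 + 1" "(2::nat) \<ge> 1" "DIM(real^'n) = 2 + 1" using dn by auto
  have ge: "(\<epsilon> * ln \<epsilon> + 4 - (4 + \<epsilon>) * ln (4 + \<epsilon>)) / 8 \<le> riesz_integral TYPE(real^'n) 0" if \<epsilon>: "\<epsilon> > 0" for \<epsilon>
  proof -
    define K where "K \<tau> = ((2 - 2 * \<tau> + \<epsilon>) * ln (2 - 2 * \<tau> + \<epsilon>) - (2 - 2 * \<tau> + \<epsilon>)) / 4" for \<tau>
    have pos: "2 - 2 * t + \<epsilon> > 0" if "t \<in> {-1..1}" for t using that \<epsilon> by auto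
    have "(\<integral>z. rk 0 (2 - 2 * (z \<bullet> e) + \<epsilon>) \<partial>sphere_measure) = (K 1 - K (- 1)) / 2"
    proof (rule integral_sphere_inner[OF dn e, of "\<lambda>t. rk 0 (2 - 2 * t + \<epsilon>)"])
      show "continuous_on {-1..1} (\<lambda>t. rk 0 (2 - 2 * t + \<epsilon>))"
        unfolding rk_def using pos by (auto intro!: continuous_intros simp: less_imp_neq[symmetric])
      fix t :: real assume t: "t \<in> {-1..1}"
      show "(K has_real_derivative rk 0 (2 - 2 * t + \<epsilon>)) (at t within {-1..1})"
      proof -
        have "((\<lambda>q. (q * ln q - q) / 4) has_real_derivative ln q / 4) (at q)" if "q > 0" for q :: real
          using that by (auto intro!: derivative_eq_intros)
        moreover have "((\<lambda>\<tau>. 2 - 2 * \<tau> + \<epsilon>) has_real_derivative - 2) (at t within {-1..1})"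
          by (auto intro!: derivative_eq_intros)
        ultimately show ?thesis
          using DERIV_chain2[of "\<lambda>q. (q * ln q - q) / 4" _ "\<lambda>\<tau>. 2 - 2 * \<tau> + \<epsilon>"] pos[OF t]
          unfolding K_def[abs_def] rk_def by fastforce
      qed
    qed measurable
    moreover have "(\<integral>z. rk 0 (2 - 2 * (z \<bullet> e) + \<epsilon>) \<partial>sphere_measure) \<le> (\<integral>z. rk 0 (2 - 2 * (z \<bullet> e)) \<partial>sphere_measure)"
    proof (rule integral_mono_AE)
      show "integrable sphere_measure (\<lambda>z. rk 0 (2 - 2 * (z \<bullet> e) + \<epsilon>))" by (rule integrable_rk_shift[OF e \<epsilon>])
      show "integrable sphere_measure (\<lambda>z. rk 0 (2 - 2 * (z \<bullet> e)))" by (rule integrable_rk[OF D(3) _ _ _ e]) auto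
      show "AE z in sphere_measure. rk 0 (2 - 2 * (z \<bullet> e) + \<epsilon>) \<le> rk 0 (2 - 2 * (z \<bullet> e))"
        using AE_sphere_neq[OF e D(3,2)] AE_sphere_measure
      proof eventually_elim
        case (elim z)
        then show ?case using inner_sphere_less_1[of z e] e \<epsilon> by (intro rk_antimono) auto
      qed
    qed
    moreover have "(K 1 - K (- 1)) / 2 = (\<epsilon> * ln \<epsilon> + 4 - (4 + \<epsilon>) * ln (4 + \<epsilon>)) / 8"
      by (simp add: K_def add.commute field_simps)
    ultimately show ?thesis using riesz_integral_eq[OF D(1,2) order_refl e] by simp
  qed
  have "((\<lambda>\<epsilon>::real. (\<epsilon> * ln \<epsilon> + 4 - (4 + \<epsilon>) * ln (4 + \<epsilon>)) / 8) \<longlongrightarrow> (0 + 4 - (4 + 0) * ln (4 + 0)) / 8) (at_right 0)"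
    by real_asymp
  then have "(0 + 4 - (4 + 0) * ln (4 + 0)) / 8 \<le> riesz_integral TYPE(real^'n) 0"
  proof (rule tendsto_upperbound)
    show "\<forall>\<^sub>F \<epsilon> in at_right 0. (\<epsilon> * ln \<epsilon> + 4 - (4 + \<epsilon>) * ln (4 + \<epsilon>)) / 8 \<le> riesz_integral TYPE(real^'n) 0"
      using eventually_at_right_less[of "0::real"] by eventually_elim (rule ge)
  qed simp
  moreover have "ln 4 = 2 * ln (2::real)" using ln_mult[of 2 2] by simp
  ultimately show ?thesis by simp
qed

section \<open>Greedy logarithmic energy on the two-dimensional sphere\<close>

lemma renergy_Suc: "renergy s (Suc N) x = renergy s N x + 2 * rpot s N x (x (Suc N))"
proof -
  define f where "f i j = rk s (2 - 2 * (x i \<bullet> x j))" for i j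
  have "(\<Sum>i\<in>{1..N}. \<Sum>j\<in>{1..Suc N} - {i}. f i j) = (\<Sum>i\<in>{1..N}. f i (Suc N) + (\<Sum>j\<in>{1..N} - {i}. f i j))"
  proof (rule sum.cong[OF refl])
    fix i assume "i \<in> {1..N}"
    then have "{1..Suc N} - {i} = insert (Suc N) ({1..N} - {i})" by auto
    then show "(\<Sum>j\<in>{1..Suc N} - {i}. f i j) = f i (Suc N) + (\<Sum>j\<in>{1..N} - {i}. f i j)" by simp
  qed
  moreover have "{1..Suc N} - {Suc N} = {1..N}" by auto
  moreover have "(\<Sum>i=1..N. f i (Suc N)) = (\<Sum>j=1..N. f (Suc N) j)"
    by (simp add: f_def inner_commute)
  ultimately show ?thesis
    unfolding renergy_def rpot_def f_def[symmetric] by (simp add: sum.distrib)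
qed

text \<open>The second point must be antipodal to the first. The third does at least as well as any
  point orthogonal to both, the fourth at least as well as the antipode of the third.\<close>

lemma greedy_first_energies:
  fixes x :: "nat \<Rightarrow> real^'n"
  assumes dn: "CARD('n) = 3" and g: "greedy_sequence 0 x"
  shows "renergy 0 2 x \<le> - 2 * ln 2" "renergy 0 3 x \<le> - 4 * ln 2" "renergy 0 4 x \<le> - 8 * ln 2"
proof -
  have D: "DIM(real^'n) = 2 + 1" "(2::nat) \<ge> 1" using dn by auto
  note st = greedy_step[OF D order_refl g]
  have x: "norm (x i) = 1" if "i \<ge> 1" for i by (rule greedy_norm[OF g that])
  have xx: "x i \<bullet> x i = 1" if "i \<ge> 1" for i using x[OF that] by (simp add: dot_square_norm)
  have r: "rpot 0 1 x z = rk 0 (2 - 2 * (z \<bullet> x 1))"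
    "rpot 0 2 x z = rk 0 (2 - 2 * (z \<bullet> x 1)) + rk 0 (2 - 2 * (z \<bullet> x 2))"
    "rpot 0 3 x z = rk 0 (2 - 2 * (z \<bullet> x 1)) + rk 0 (2 - 2 * (z \<bullet> x 2)) + rk 0 (2 - 2 * (z \<bullet> x 3))" for z
    by (simp_all add: rpot_def eval_nat_numeral)
  have im: "x ` {1..1} = {x 1}" "x ` {1..2} = {x 1, x 2}" "x ` {1..3} = {x 1, x 2, x 3}"
    by (auto simp: eval_nat_numeral atLeastAtMostSuc_conv)
  have ln4: "ln 4 = 2 * ln (2::real)" using ln_mult[of 2 2] by simp
  then have k4: "rk 0 4 = - ln 2" and k2: "rk 0 2 + rk 0 2 = - ln 2" by (simp_all add: rk_def)
  have ne: "- x i \<noteq> x i" if "i \<ge> 1" for i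
    using xx[OF that] by (metis inner_minus_left equal_neg_zero zero_neq_one)
  have P1: "rpot 0 1 x (x 2) \<le> - ln 2"
    using st(2)[of 1 "- x 1"] ne[of 1] x[of 1] xx[of 1] im r(1) k4 by (simp add: numeral_2_eq_2)
  have x2: "x 2 = - x 1"
  proof -
    have nn: "norm (x 2) = 1" "norm (- x 1) = 1" using x by auto
    have "x 2 \<noteq> x 1" using st(1)[of 1] im by (simp add: numeral_2_eq_2)
    then have "0 < 2 - 2 * (x 2 \<bullet> x 1)" using inner_sphere_less_1[of "x 2" "x 1"] x by simp
    moreover have "ln 4 \<le> ln (2 - 2 * (x 2 \<bullet> x 1))" using P1 ln4 unfolding r(1) by (simp add: rk_def)
    ultimately have "4 \<le> 2 - 2 * (x 2 \<bullet> x 1)" by (subst (asm) ln_le_cancel_iff) auto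
    then have "(norm (x 2 - (- x 1)))\<^sup>2 \<le> 0" unfolding norm_diff_sphere[OF nn] by simp
    then show ?thesis by (simp add: eq_neg_iff_add_eq_0)
  qed
  have P2: "rpot 0 2 x (x 3) \<le> - ln 2"
  proof -
    obtain y :: "real^'n" where y: "y \<noteq> 0" "orthogonal (x 1) y"
      using orthogonal_to_vector_exists[of "x 1"] D by auto
    define z where "z = sgn y"
    have z: "norm z = 1" "z \<bullet> x 1 = 0"
      using y by (auto simp: z_def norm_sgn sgn_div_norm orthogonal_def inner_commute)
    have "z \<notin> x ` {1..2}" using z x2 xx[of 1] unfolding im by auto
    then have "rpot 0 2 x (x (2 + 1)) \<le> rpot 0 2 x z" using st(2)[of 2 z] z by simp
    then show ?thesis unfolding r(2) using z x2 k2 by simp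
  qed
  have P3: "rpot 0 3 x (x 4) \<le> - 2 * ln 2"
  proof -
    have "x 3 \<notin> {x 1, x 2}" using st(1)[of 2] im by simp
    then have "- x 3 \<notin> x ` {1..3}" using ne[of 3] x2 unfolding im by (auto simp: minus_equation_iff)
    then have "rpot 0 3 x (x (3 + 1)) \<le> rpot 0 3 x (- x 3)" using st(2)[of 3 "- x 3"] x by simp
    also have "\<dots> = rpot 0 2 x (x 3) + rk 0 4" unfolding r using x2 xx[of 3] by simp
    finally show ?thesis using P2 k4 by simp
  qed
  have E: "renergy 0 1 x = 0" by (simp add: renergy_def)
  have E2: "renergy 0 2 x = 2 * rpot 0 1 x (x 2)" using renergy_Suc[of 0 1 x] E by (simp add: numeral_2_eq_2)
  have E3: "renergy 0 3 x = renergy 0 2 x + 2 * rpot 0 2 x (x 3)" using renergy_Suc[of 0 2 x] by (simp add: eval_nat_numeral)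
  have E4: "renergy 0 4 x = renergy 0 3 x + 2 * rpot 0 3 x (x 4)" using renergy_Suc[of 0 3 x] by (simp add: eval_nat_numeral)
  show "renergy 0 2 x \<le> - 2 * ln 2" "renergy 0 3 x \<le> - 4 * ln 2" "renergy 0 4 x \<le> - 8 * ln 2"
    using P1 P2 P3 E2 E3 E4 by linarith+
qed

lemma greedy_rpot_le:
  fixes x :: "nat \<Rightarrow> real^'n"
  assumes dn: "CARD('n) = 3" and g: "greedy_sequence 0 x" and n: "n \<ge> 1"
  shows "rpot 0 n x (x (n + 1)) \<le> riesz_integral TYPE(real^'n) 0 * real n"
proof -
  have D: "DIM(real^'n) = 2 + 1" "(2::nat) \<ge> 1" "CARD('n) = 2 + 1" using dn by auto
  show ?thesis
    by (rule lower_bound_le_average[OF D(3) order_refl _ _ _ greedy_step(2)[OF D(1,2) order_refl g n]])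
      (use greedy_norm[OF g] in auto)
qed

text \<open>A step changes the gap by \<open>I + 2 * (I * n - P)\<close>, and
  \<open>I \<ge> - 7 / 36\<close>, so a surplus of 1/10 makes the gap grow. The cap inequality
  delivers this surplus when the gap is small, since the energy is then not far below
  \<open>I * n\<^sup>2\<close>.\<close>

lemma greedy_gap_large:
  fixes x :: "nat \<Rightarrow> real^'n"
  assumes dn: "CARD('n) = 3" and g: "greedy_sequence 0 x" and n: "n \<ge> 16"
    and small: "riesz_integral TYPE(real^'n) 0 * (real n)\<^sup>2 - renergy 0 n x \<le> 23 / 100"
  shows "1 / 10 \<le> riesz_integral TYPE(real^'n) 0 * real n - rpot 0 n x (x (n + 1))"
proof -
  have D: "DIM(real^'n) = 2 + 1" "(2::nat) \<ge> 1" "CARD('n) = 2 + 1" using dn by auto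
  define I where "I = riesz_integral TYPE(real^'n) 0"
  define P where "P = rpot 0 n x (x (n + 1))"
  \<comment> \<open>Greedy points have squared distance at least
    \<open>2 * exp (- 1 / 2) / n\<close>, which is at least
    \<open>(2 * r)\<^sup>2 = 6 / (5 * n)\<close>; caps of this radius are disjoint.\<close>
  define r where "r = sqrt (3 / (10 * real n))"
  have n0: "real n \<ge> 16" using n by simp
  have r2: "r\<^sup>2 = 3 / (10 * real n)" and r0: "0 < r" using n0 by (auto simp: r_def)
  define R where "R = r\<^sup>2 / 2"
  have R: "R = 3 / (20 * real n)" "0 < R" "R \<le> 1" using n0 by (auto simp: R_def r2 divide_le_eq)
  have e12: "3 / 5 \<le> exp (- 1 / 2 :: real)"
  proof -
    have "1 / 2 \<le> ln (5 / 3 :: real)" using ln_approx_bounds[of "5 / 3" 1] by simp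
    then have "exp (1 / 2) \<le> (5 / 3 :: real)" by (subst (asm) ln_ge_iff) auto
    then have "1 / (5 / 3) \<le> 1 / exp (1 / 2 :: real)" by (intro divide_left_mono) auto
    then show ?thesis by (simp add: exp_minus inverse_eq_divide)
  qed
  have sep0: "2 * r \<le> norm (x i - x j)" if ij: "1 \<le> j" "j < i" "i \<le> n" for i j
  proof (rule power2_le_imp_le)
    have k: "real (i - 1) \<le> real n" "0 < real (i - 1)" using ij by auto
    have "(2 * r)\<^sup>2 = 2 * (3 / 5) / real n" using n0 by (simp add: power_mult_distrib r2 field_simps)
    also have "\<dots> \<le> 2 * exp (- 1 / 2) / real (i - 1)" using k n0 e12 by (intro frac_le mult_left_mono) auto
    also have "\<dots> \<le> (norm (x (i - 1 + 1) - x j))\<^sup>2" using ij by (intro greedy_separation_log[OF dn g]) auto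
    finally show "(2 * r)\<^sup>2 \<le> (norm (x i - x j))\<^sup>2" using ij by simp
  qed simp
  have sep: "2 * r \<le> norm (x i - x j)" if "i \<in> {1..n}" "j \<in> {1..n}" "i \<noteq> j" for i j
    using sep0[of j i] sep0[of i j] that by (cases "j < i") (auto simp: norm_minus_commute)
  define M where "M = 77 / 50 * R ^ 3"
  have M: "M > 0" using R by (simp add: M_def)
  have ineq: "P * (1 - real n * (R ^ 4 / 2) / M) \<le> I * real n - R ^ 4 / 2 / M * (real n * rk 0 (r\<^sup>2) + renergy 0 n x)"
    unfolding I_def
  proof (rule cap_inequality(2)[OF D(3) order_refl _ _ _ sep r0])
    show "r\<^sup>2 \<le> 2" using R(3) by (simp add: R_def)
    show "cap_weight 2 (r\<^sup>2 / 2) \<tau> \<le> M" if "\<bar>\<tau>\<bar> \<le> 1" for \<tau>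
      unfolding R_def[symmetric] M_def by (rule cap_weight_2_le[OF R(2,3) that])
    show "P \<le> rpot 0 n x z" if "norm z = 1" "z \<notin> x ` {1..n}" for z
      unfolding P_def using greedy_step(2)[OF D(1,2) order_refl g _ that] n by simp
    show "R ^ 4 / 2 = cap_mass TYPE('n) 2 (r\<^sup>2 / 2)"
      unfolding R_def[symmetric] using cap_mass_2[OF dn R(2,3)] by simp
  qed (use M greedy_norm[OF g] in auto)
  have mM: "R ^ 4 / 2 / M = 25 / 77 * R" using R by (simp add: M_def power_numeral_reduce)
  have nmM: "real n * (R ^ 4 / 2) / M = 15 / 308"
  proof -
    have "real n * (R ^ 4 / 2) / M = real n * (R ^ 4 / 2 / M)" by simp
    also have "\<dots> = 15 / 308" unfolding mM unfolding R(1) using n0 by simp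
    finally show ?thesis .
  qed
  \<comment> \<open>Uses \<open>160 / 3 = 2 ^ 5 * (5 / 3)\<close>, the reciprocal of
    \<open>r\<^sup>2\<close> at n = 16, where the lower bound for the self-interaction is
    weakest.\<close>
  have lnb: "793 / 200 \<le> ln (160 / 3 :: real)"
  proof -
    have 1: "307 / 443 \<le> ln (2 :: real)" using ln_approx_bounds[of 2 3] by (simp add: eval_nat_numeral)
    have 2: "1 / 2 \<le> ln (5 / 3 :: real)" using ln_approx_bounds[of "5 / 3" 1] by simp
    have "ln (160 / 3 :: real) = ln (2 ^ 5 * (5 / 3))" by simp
    also have "\<dots> = 5 * ln 2 + ln (5 / 3)" using ln_realpow[of 2 5] by (subst ln_mult) auto
    finally show ?thesis using 1 2 by simp
  qed
  have k: "793 / 400 \<le> rk 0 (r\<^sup>2)"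
  proof -
    have "r\<^sup>2 \<le> 3 / 160" unfolding r2 using n0 by (simp add: field_simps)
    then have "rk 0 (3 / 160) \<le> rk 0 (r\<^sup>2)" using r0 by (intro rk_antimono) auto
    moreover have "ln (3 / 160) = - ln (160 / 3 :: real)" using ln_div[of 3 160] ln_div[of 160 3] by simp
    ultimately show ?thesis using lnb by (simp add: rk_def)
  qed
  define a where "a = I * (real n)\<^sup>2 - renergy 0 n x"
  have a: "a / real n \<le> 23 / 1600"
  proof -
    have "a / real n \<le> 23 / 100 / real n" using small n0 by (intro divide_right_mono) (auto simp: a_def I_def)
    also have "\<dots> \<le> 23 / 100 / 16" using n0 by (intro divide_left_mono) auto
    finally show ?thesis by simp
  qed
  have eq: "R ^ 4 / 2 / M * (real n * rk 0 (r\<^sup>2) + renergy 0 n x) = 15 / 308 * (rk 0 (r\<^sup>2) + I * real n - a / real n)"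
    unfolding mM unfolding R(1) a_def using n0 by (simp add: field_simps power2_eq_square)
  have "P * (1 - 15 / 308) \<le> I * real n - 15 / 308 * (rk 0 (r\<^sup>2) + I * real n - a / real n)"
    using ineq unfolding nmM eq .
  moreover have "15 / 308 * (k - b) \<le> 293 / 308 * (y - p)" if "p * (1 - 15 / 308) \<le> y - 15 / 308 * (k + y - b)" for k b y p :: real
    using that by (simp add: field_simps)
  ultimately have "15 / 308 * (rk 0 (r\<^sup>2) - a / real n) \<le> (293 / 308) * (I * real n - P)" by blast
  \<comment> \<open>After division by 293/308 this leaves
    \<open>15 * (793 / 400 - 23 / 1600) / 293\<close>, only slightly more than 1/10.\<close>
  moreover have "15 / 308 * (793 / 400 - 23 / 1600) \<le> 15 / 308 * (rk 0 (r\<^sup>2) - a / real n)"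
    using k a by (intro mult_left_mono diff_mono) auto
  ultimately show ?thesis unfolding I_def P_def by simp
qed

text \<open>The first four points are explicit enough to give a gap that survives the at most linear loss up to \<open>n = 16\<close>;
  from then on, \<open>greedy_gap_large\<close> restores the gap whenever it is small.\<close>

lemma greedy_energy_gap:
  fixes x :: "nat \<Rightarrow> real^'n"
  assumes dn: "CARD('n) = 3" and g: "greedy_sequence 0 x" and n: "n \<ge> 2"
  shows "3 / 100 \<le> riesz_integral TYPE(real^'n) 0 * (real n)\<^sup>2 - renergy 0 n x"
proof -
  define I where "I = riesz_integral TYPE(real^'n) 0"
  define a where "a n = I * (real n)\<^sup>2 - renergy 0 n x" for n
  \<comment> \<open>This yields \<open>I \<ge> - 7 / 36\<close>, so the gap loses at most 7/36 in
    one step.\<close>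
  have l2: "ln (2::real) \<le> 25 / 36" by (rule ln2_le_25_over_36)
  have I: "1 / 2 - ln 2 \<le> I" "- 7 / 36 \<le> I" using riesz_integral_log_ge[OF dn] l2 by (auto simp: I_def)
  have rec: "a (Suc n) = a n + I + 2 * (I * real n - rpot 0 n x (x (n + 1)))" for n
    by (simp add: a_def renergy_Suc power2_eq_square algebra_simps)
  have mono: "a n + I \<le> a (Suc n)" if "n \<ge> 1" for n
    using rec[of n] greedy_rpot_le[OF dn g that] by (simp add: I_def)
  note E = greedy_first_energies[OF dn g]
  have a2: "3 / 100 \<le> a 2" using E(1) I l2 by (simp add: a_def)
  have a3: "3 / 100 \<le> a 3" using E(2) I l2 by (simp add: a_def)
  have a4: "22 / 9 \<le> a 4" using E(3) I l2 by (simp add: a_def)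
  have lin: "22 / 9 + (real n - 4) * I \<le> a n" if "4 \<le> n" for n
    using that
  proof (induction n rule: dec_induct)
    case base
    then show ?case using a4 by simp
  next
    case (step n)
    then show ?case using mono[of n] by (simp add: algebra_simps)
  qed
  \<comment> \<open>At n = 16 the linear bound still leaves
    \<open>22 / 9 - 12 * (7 / 36) = 1 / 9\<close>.\<close>
  have mid: "3 / 100 \<le> a n" if "4 \<le> n" "n \<le> 16" for n
  proof -
    have "(real n - 4) * (- 7 / 36) \<le> (real n - 4) * I" using I that by (intro mult_left_mono) auto
    moreover have "12 * (- 7 / 36) \<le> (real n - 4) * (- 7 / 36)" using that by (intro mult_right_mono_neg) auto
    ultimately show ?thesis using lin[OF that(1)] by linarith
  qed
  have large: "3 / 100 \<le> a n" if "16 \<le> n" for n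
    using that
  proof (induction n rule: dec_induct)
    case base
    then show ?case using mid by simp
  next
    case (step n)
    show ?case
    \<comment> \<open>Below the threshold a step gains at least \<open>2 / 10 - 7 / 36 > 0\<close>;
      above it, \<open>23 / 100 - 7 / 36\<close> is still more than 3/100.\<close>
    proof (cases "a n \<le> 23 / 100")
      case True
      then have "1 / 10 \<le> I * real n - rpot 0 n x (x (n + 1))"
        unfolding I_def a_def using step by (intro greedy_gap_large[OF dn g])
      then show ?thesis using rec[of n] step.IH I by simp
    next
      case False
      then show ?thesis using mono[of n] step I by simp
    qed
  qed
  have "n = 2 \<or> n = 3 \<or> (4 \<le> n \<and> n \<le> 16) \<or> 16 \<le> n" using n by auto
  then show ?thesis using a2 a3 mid[of n] large[of n] unfolding a_def I_def by blast
qed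

text \<open>Inserting \<open>D = a n / (n * ln n)\<close> into the polarization bound gives
  \<open>a (n + 1) \<ge> a n * (1 - 2 * C / n) + C * ln n + I\<close>. At
  \<open>a n = c * n * ln n\<close> with small c the product loses only a fraction of
  \<open>C * ln n\<close>, and the rest covers the growth of \<open>c * n * ln n\<close> and the
  negative constant.\<close>

lemma greedy_energy_gap_log:
  assumes dn: "CARD('n::finite) = 3"
  obtains C where "C > 0" "\<And>(x :: nat \<Rightarrow> real^'n) n. greedy_sequence 0 x \<Longrightarrow> n \<ge> 2 \<Longrightarrow>
    C * real n * ln (real n) \<le> riesz_integral TYPE(real^'n) 0 * (real n)\<^sup>2 - renergy 0 n x"
proof -
  have D: "DIM(real^'n) = 2 + 1" "(2::nat) \<ge> 1" "CARD('n) = 2 + 1" using dn by auto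
  define I where "I = riesz_integral TYPE(real^'n) 0"
  obtain c0 where c0: "c0 > 0" "\<And>(x :: nat \<Rightarrow> real^'n) N i j. greedy_sequence 0 x \<Longrightarrow> i \<in> {1..N} \<Longrightarrow> j \<in> {1..N} \<Longrightarrow> i \<noteq> j \<Longrightarrow>
    c0 * real N powr (- 1 / real 2) \<le> norm (x i - x j)"
    by (rule greedy_separated[OF D(3) order_refl, of 0]) auto
  obtain C where C: "C > 0" "\<And>(x :: nat \<Rightarrow> real^'n) N Dn. N \<ge> 1 \<Longrightarrow> (\<And>i. i \<in> {1..N} \<Longrightarrow> norm (x i) = 1) \<Longrightarrow>
     (\<And>i j. i \<in> {1..N} \<Longrightarrow> j \<in> {1..N} \<Longrightarrow> i \<noteq> j \<Longrightarrow> c0 * real N powr (- 1 / 2) \<le> norm (x i - x j)) \<Longrightarrow>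
     renergy 0 N x = riesz_integral TYPE(real^'n) 0 * real N ^ 2 - Dn * real N * ln (real N) \<Longrightarrow>
     polarization 0 N x \<le> ereal (riesz_integral TYPE(real^'n) 0 * real N + C * (- 1 / 2 + Dn) * ln (real N))"
    using polarization_bound_log[OF dn c0(1)] by blast
  have "\<forall>\<^sub>F n in sequentially. 2 \<le> n \<and> 2 * C \<le> real n \<and> 1 - I \<le> C / 2 * ln (real n)"
  proof (intro eventually_conj)
    have "filterlim (\<lambda>n. C / 2 * ln (real n)) at_top sequentially" using C(1) by real_asymp
    then show "\<forall>\<^sub>F n in sequentially. 1 - I \<le> C / 2 * ln (real n)" unfolding filterlim_at_top by blast
    show "\<forall>\<^sub>F n in sequentially. 2 * C \<le> real n"
      using filterlim_real_sequentially by (simp add: filterlim_at_top)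
  qed (rule eventually_ge_at_top)
  then obtain n1 where n1: "\<And>n. n \<ge> n1 \<Longrightarrow> 2 \<le> n \<and> 2 * C \<le> real n \<and> 1 - I \<le> C / 2 * ln (real n)"
    unfolding eventually_sequentially by blast
  have n1': "2 \<le> n1" using n1 by blast
  then have l1: "ln (real n1) > 0" by simp
  \<comment> \<open>The bound 1/8 limits both the loss \<open>2 * c * (C * ln n)\<close> and the
    constant \<open>2 * c\<close>; C/4 limits the increase \<open>c * ln n\<close>; the last bound
    starts the induction, where the gap is only known to be at least 3/100.\<close>
  define c where "c = min (1 / 8) (min (C / 4) (3 / 100 / (real n1 * ln (real n1))))"
  have c: "c > 0" "c \<le> 1 / 8" "c \<le> C / 4" "c \<le> 3 / 100 / (real n1 * ln (real n1))"
    using C(1) l1 n1' by (auto simp: c_def)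
  show ?thesis
  proof (rule that[OF c(1)])
    fix x :: "nat \<Rightarrow> real^'n" and n :: nat
    assume g: "greedy_sequence 0 x" and n: "n \<ge> 2"
    define a where "a n = I * (real n)\<^sup>2 - renergy 0 n x" for n
    have rec: "a (Suc n) = a n + I + 2 * (I * real n - rpot 0 n x (x (n + 1)))" for n
      by (simp add: a_def renergy_Suc power2_eq_square algebra_simps)
    have small: "c * real n * ln (real n) \<le> a n" if "2 \<le> n" "n \<le> n1" for n
    proof -
      have "real n * ln (real n) \<le> real n1 * ln (real n1)" using that by (intro mult_mono) auto
      then have "c * (real n * ln (real n)) \<le> c * (real n1 * ln (real n1))" using c(1) by (intro mult_left_mono) auto
      also have "\<dots> \<le> 3 / 100" using c(4) l1 n1' by (simp add: pos_le_divide_eq)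
      also have "\<dots> \<le> a n" using greedy_energy_gap[OF dn g that(1)] by (simp add: a_def I_def)
      finally show ?thesis by (simp add: mult.assoc)
    qed
    have large: "c * real n * ln (real n) \<le> a n" if "n1 \<le> n" for n
      using that
    proof (induction n rule: dec_induct)
      case base
      then show ?case using small n1' by simp
    next
      case (step n)
      note N = n1[OF step(1)]
      have n0: "real n \<ge> 2" using N by simp
      have ln0: "ln (real n) > 0" using n0 by simp
      define Dn where "Dn = a n / (real n * ln (real n))"
      have "polarization 0 n x \<le> ereal (I * real n + C * (- 1 / 2 + Dn) * ln (real n))"
        unfolding I_def
      proof (rule C(2))
        show "renergy 0 n x = riesz_integral TYPE(real^'n) 0 * real n ^ 2 - Dn * real n * ln (real n)"
          using n0 ln0 by (simp add: Dn_def a_def I_def)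
      qed (use N greedy_norm[OF g] c0(2)[OF g] in auto)
      then have "rpot 0 n x (x (n + 1)) \<le> I * real n + C * (- 1 / 2 + Dn) * ln (real n)"
        using greedy_step(3)[OF D(1,2) order_refl g, of n] N by simp
      moreover have "C * (- 1 / 2 + Dn) * ln (real n) = C * (a n / real n) - C / 2 * ln (real n)"
        using n0 ln0 by (simp add: Dn_def field_simps)
      ultimately have "C / 2 * ln (real n) - C * (a n / real n) \<le> I * real n - rpot 0 n x (x (n + 1))" by linarith
      then have "a n + I + 2 * (C / 2 * ln (real n) - C * (a n / real n)) \<le> a (Suc n)"
        unfolding rec by (intro add_left_mono mult_left_mono) auto
      then have 1: "a n * (1 - 2 * C / real n) + C * ln (real n) + I \<le> a (Suc n)"
        by (simp add: algebra_simps)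
      \<comment> \<open>The factor of \<open>a n\<close> must be nonnegative before the induction
        hypothesis can be inserted; this is one of the conditions that fix
        \<open>n1\<close>.\<close>
      have "0 \<le> 1 - 2 * C / real n" using N n0 by simp
      then have "(c * real n * ln (real n)) * (1 - 2 * C / real n) \<le> a n * (1 - 2 * C / real n)"
        using step.IH by (intro mult_right_mono)
      moreover have "(c * real n * ln (real n)) * (1 - 2 * C / real n) = c * real n * ln (real n) - 2 * c * (C * ln (real n))"
        using n0 by (simp add: field_simps)
      moreover have "2 * c * (C * ln (real n)) \<le> 1 / 4 * (C * ln (real n))"
        using c C(1) ln0 by (intro mult_right_mono) auto
      moreover have "c * ln (real n) \<le> C / 4 * ln (real n)" using c ln0 by (intro mult_right_mono) auto
      moreover have "c * (real (Suc n) * ln (real (Suc n))) \<le> c * (real n * ln (real n) + ln (real n) + 2)"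
      proof (rule mult_left_mono)
        have "real (Suc n) = real n * (1 + 1 / real n)" using n0 by (simp add: distrib_left)
        then have "ln (real (Suc n)) = ln (real n * (1 + 1 / real n))" by (simp only:)
        also have "\<dots> = ln (real n) + ln (1 + 1 / real n)" using n0 by (intro ln_mult_pos) (auto simp: add_pos_nonneg)
        also have "ln (1 + 1 / real n) \<le> 1 / real n" using n0 by (intro ln_add_one_self_le_self) auto
        finally have "real (Suc n) * ln (real (Suc n)) \<le> real (Suc n) * (ln (real n) + 1 / real n)"
          by (intro mult_left_mono) auto
        also have "\<dots> = real n * ln (real n) + ln (real n) + 1 + 1 / real n" using n0 by (simp add: field_simps)
        also have "\<dots> \<le> real n * ln (real n) + ln (real n) + 2" using n0 by (simp add: divide_le_eq)
        finally show "real (Suc n) * ln (real (Suc n)) \<le> real n * ln (real n) + ln (real n) + 2" .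
      qed (use c in simp)
      moreover have "c * (real n * ln (real n) + ln (real n) + 2) = c * real n * ln (real n) + c * ln (real n) + 2 * c"
        by (simp add: algebra_simps)
      ultimately have "c * (real (Suc n) * ln (real (Suc n))) \<le> a (Suc n)"
        using 1 N c(2) by linarith
      then show ?case by (simp add: mult.assoc)
    qed
    show "c * real n * ln (real n) \<le> riesz_integral TYPE(real^'n) 0 * (real n)\<^sup>2 - renergy 0 n x"
      using small[of n] large[of n] n unfolding a_def I_def by (cases "n \<le> n1") auto
  qed
qed

section \<open>Assembly for separated sequences and greedy sequences\<close>

theorem theorem1p3:
  fixes d :: nat and s :: real
  assumes "CARD('n::finite) = d + 1" and "d \<ge> 2" and "real d - 2 \<le> s" and "s < real d"
  defines "I \<equiv> riesz_integral TYPE(real^'n) s"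
  shows
    "(\<forall>c>0. \<exists>C>0. \<forall>\<omega> :: nat \<Rightarrow> nat \<Rightarrow> real^'n. well_separated d c \<omega> \<longrightarrow>
       ((s, d) \<noteq> (0, 2) \<longrightarrow>
         (\<forall>N\<ge>1. polarization s N (\<omega> N) \<le> ereal (I * real N - C * real N powr (s / real d)))) \<and>
       (d = 2 \<and> s = 0 \<longrightarrow>
         (\<exists>D :: nat \<Rightarrow> real. \<forall>N\<ge>2.
            riesz_energy 0 N (\<omega> N) = ereal (I * real N ^ 2 - D N * real N * ln (real N)) \<and>
            polarization 0 N (\<omega> N) \<le> ereal (I * real N + C * (- 1 / 2 + D N) * ln (real N))))) \<and>
     (\<exists>C>0. \<forall>x :: nat \<Rightarrow> real^'n. greedy_sequence s x \<longrightarrow>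
       ((s, d) \<noteq> (0, 2) \<longrightarrow>
         (\<forall>N\<ge>1. polarization s N x \<le> ereal (I * real N - C * real N powr (s / real d)))) \<and>
       (d = 2 \<and> s = 0 \<longrightarrow>
         (\<exists>D :: nat \<Rightarrow> real. \<forall>N\<ge>2.
            riesz_energy 0 N x = ereal (I * real N ^ 2 - D N * real N * ln (real N)) \<and>
            polarization 0 N x \<le> ereal (I * real N + C * (- 1 / 2 + D N) * ln (real N))))) \<and>
     (d = 2 \<and> s = 0 \<longrightarrow>
       (\<exists>C1>0. \<exists>C2>0. \<exists>C'>0. \<forall>x :: nat \<Rightarrow> real^'n. greedy_sequence 0 x \<longrightarrow>
         (\<exists>D :: nat \<Rightarrow> real. \<forall>N\<ge>2.
            riesz_energy 0 N x = ereal (I * real N ^ 2 - D N * real N * ln (real N)) \<and>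
            C1 \<le> D N \<and> D N \<le> 1 / 2 + C2 / ln (real N)) \<and>
         (\<forall>N\<ge>1. polarization 0 N x \<le> ereal (I * real N + C'))))"
proof -
  note dn = assms(1) and d = assms(2) and s = assms(3,4)
  have D: "DIM(real^'n) = d + 1" "d \<ge> 1" using dn d by auto
  have s0: "s \<ge> 0" using s d by linarith
  \<comment> \<open>In the given range s = 0 forces d = 2.\<close>
  have s2: "(s, d) \<noteq> (0, 2) \<longleftrightarrow> s > 0" using s s0 d by auto
  \<comment> \<open>Separation of a single configuration: one statement about N-point sets then
    serves both separated sequences and the initial segments of greedy sequences.\<close>
  define good where "good c x N \<longleftrightarrow> (\<forall>i\<in>{1..N}. norm (x i) = 1) \<and>
    (\<forall>i\<in>{1..N}. \<forall>j\<in>{1..N}. i \<noteq> j \<longrightarrow> c * real N powr (- 1 / real d) \<le> norm (x i - x j))"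
    for c N and x :: "nat \<Rightarrow> real^'n"
  \<comment> \<open>Solves the defining equation of D(N); the logarithm is nonzero from N = 2
    on.\<close>
  define Dn where "Dn N x = (I * real N ^ 2 - renergy 0 N x) / (real N * ln (real N))" for N and x :: "nat \<Rightarrow> real^'n"
  have ren: "renergy 0 N x = I * real N ^ 2 - Dn N x * real N * ln (real N)" if "N \<ge> 2" for N and x :: "nat \<Rightarrow> real^'n"
  proof -
    have "real N * ln (real N) \<noteq> 0" using that by simp
    then have "Dn N x * (real N * ln (real N)) = I * real N ^ 2 - renergy 0 N x" unfolding Dn_def by simp
    then show ?thesis by (simp add: mult.assoc)
  qed
  have inj: "inj_on x {1..N}" if "good c x N" "c > 0" "N \<ge> 1" for c N and x :: "nat \<Rightarrow> real^'n"
    by (rule inj_on_separated[of _ "c * real N powr (- 1 / real d)"]) (use that in \<open>auto simp: good_def\<close>)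
  define bound where "bound C x N \<longleftrightarrow>
      ((s, d) \<noteq> (0, 2) \<longrightarrow> polarization s N x \<le> ereal (I * real N - C * real N powr (s / real d))) \<and>
      (d = 2 \<and> s = 0 \<longrightarrow> N \<ge> 2 \<longrightarrow> riesz_energy 0 N x = ereal (I * real N ^ 2 - Dn N x * real N * ln (real N)) \<and>
            polarization 0 N x \<le> ereal (I * real N + C * (- 1 / 2 + Dn N x) * ln (real N)))"
    for C N and x :: "nat \<Rightarrow> real^'n"
  have main: "\<exists>C>0. \<forall>x :: nat \<Rightarrow> real^'n. \<forall>N\<ge>1. good c x N \<longrightarrow> bound C x N"
    if c: "c > 0" for c
  proof (cases "s > 0")
    case True
    obtain C where C: "C > 0" "\<And>(x :: nat \<Rightarrow> real^'n) N. N \<ge> 1 \<Longrightarrow> (\<And>i. i \<in> {1..N} \<Longrightarrow> norm (x i) = 1) \<Longrightarrow>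
     (\<And>i j. i \<in> {1..N} \<Longrightarrow> j \<in> {1..N} \<Longrightarrow> i \<noteq> j \<Longrightarrow> c * real N powr (- 1 / real d) \<le> norm (x i - x j)) \<Longrightarrow>
     polarization s N x \<le> ereal (I * real N - C * real N powr (s / real d))"
      using polarization_bound_pos[OF dn d True s c] unfolding I_def by blast
    show ?thesis
      unfolding bound_def by (intro exI[of _ C] conjI C(1) allI impI) (use True C(2) in \<open>auto simp: good_def\<close>)
  next
    case False
    then have sd: "s = 0" "d = 2" using s2 s0 by auto
    have d3: "CARD('n) = 3" using dn sd by simp
    obtain C where C: "C > 0" "\<And>(x :: nat \<Rightarrow> real^'n) N Dn. N \<ge> 1 \<Longrightarrow> (\<And>i. i \<in> {1..N} \<Longrightarrow> norm (x i) = 1) \<Longrightarrow>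
     (\<And>i j. i \<in> {1..N} \<Longrightarrow> j \<in> {1..N} \<Longrightarrow> i \<noteq> j \<Longrightarrow> c * real N powr (- 1 / 2) \<le> norm (x i - x j)) \<Longrightarrow>
     renergy 0 N x = riesz_integral TYPE(real^'n) 0 * real N ^ 2 - Dn * real N * ln (real N) \<Longrightarrow>
     polarization 0 N x \<le> ereal (riesz_integral TYPE(real^'n) 0 * real N + C * (- 1 / 2 + Dn) * ln (real N))"
      using polarization_bound_log[OF d3 c] by blast
    show ?thesis
      unfolding bound_def
    proof (intro exI[of _ C] conjI C(1) allI impI)
      fix x :: "nat \<Rightarrow> real^'n" and N :: nat
      assume N: "N \<ge> 1" "N \<ge> 2" and gd: "good c x N"
      show "riesz_energy 0 N x = ereal (I * real N ^ 2 - Dn N x * real N * ln (real N))"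
        using riesz_energy_eq[OF order_refl _ inj[OF gd c N(1)]] ren[OF N(2), of x] gd by (simp add: good_def)
      show "polarization 0 N x \<le> ereal (I * real N + C * (- 1 / 2 + Dn N x) * ln (real N))"
        using C(2)[OF N(1) _ _ ren[OF N(2), of x, unfolded I_def sd(1)]] gd unfolding I_def sd(1)
        by (simp add: good_def sd)
    qed (use sd in auto)
  qed
  obtain c0 where c0: "c0 > 0" "\<And>(x :: nat \<Rightarrow> real^'n) N i j. greedy_sequence s x \<Longrightarrow> i \<in> {1..N} \<Longrightarrow> j \<in> {1..N} \<Longrightarrow> i \<noteq> j \<Longrightarrow>
    c0 * real N powr (- 1 / real d) \<le> norm (x i - x j)"
    using greedy_separated[OF dn d s] by blast
  have gg: "good c0 x N" if "greedy_sequence s x" for x :: "nat \<Rightarrow> real^'n" and N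
    using greedy_norm[OF that] c0(2)[OF that] by (auto simp: good_def)
  have gw: "good c (\<omega> N) N" if "well_separated d c \<omega>" "N \<ge> 1" for c N and \<omega> :: "nat \<Rightarrow> nat \<Rightarrow> real^'n"
    using that by (auto simp: well_separated_def good_def)
  show ?thesis
  proof (intro conjI allI impI, goal_cases)
    case (1 c)
    from main[OF 1] obtain C where C: "C > 0" "\<And>(x :: nat \<Rightarrow> real^'n) N. N \<ge> 1 \<Longrightarrow> good c x N \<Longrightarrow> bound C x N"
      by blast
    show ?case
    proof (intro exI[of _ C] conjI C(1) allI impI, goal_cases)
      case (1 \<omega> N)
      then show ?case using C(2)[OF _ gw] by (auto simp: bound_def)
    next
      case (2 \<omega>)
      then show ?case
        using C(2)[OF _ gw[OF 2(1)]] by (intro exI[of _ "\<lambda>N. Dn N (\<omega> N)"]) (auto simp: bound_def)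
    qed
  next
    case 2
    from main[OF c0(1)] obtain C where C: "C > 0" "\<And>(x :: nat \<Rightarrow> real^'n) N. N \<ge> 1 \<Longrightarrow> good c0 x N \<Longrightarrow> bound C x N"
      by blast
    show ?case
    proof (intro exI[of _ C] conjI C(1) allI impI, goal_cases)
      case (1 x N)
      then show ?case using C(2)[OF _ gg] by (auto simp: bound_def)
    next
      case (2 x)
      then show ?case
        using C(2)[OF _ gg[OF 2(1)]] by (intro exI[of _ "\<lambda>N. Dn N x"]) (auto simp: bound_def)
    qed
  next
    case sd: 3
    then have d3: "CARD('n) = 3" and I0: "I = riesz_integral TYPE(real^'n) 0" using dn by (auto simp: I_def)
    obtain C1 where C1: "C1 > 0" "\<And>(x :: nat \<Rightarrow> real^'n) n. greedy_sequence 0 x \<Longrightarrow> n \<ge> 2 \<Longrightarrow>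
      C1 * real n * ln (real n) \<le> I * (real n)\<^sup>2 - renergy 0 n x"
      using greedy_energy_gap_log[OF d3] unfolding I0 by blast
    obtain C2 where C2: "C2 > 0" "\<And>(x :: nat \<Rightarrow> real^'n) N. N \<ge> 1 \<Longrightarrow> (\<And>i. i \<in> {1..N} \<Longrightarrow> norm (x i) = 1) \<Longrightarrow> inj_on x {1..N} \<Longrightarrow>
      I * (real N)\<^sup>2 - real N * ln (real N) / 2 - C2 * real N \<le> renergy 0 N x"
      using renergy_ge_log[OF d3] unfolding I0 by blast
    show ?case
    \<comment> \<open>Any positive \<open>C'\<close> works, here 1, since the minimum of a greedy
      potential never exceeds \<open>I * N\<close>.\<close>
    proof (rule exI[of _ C1], rule conjI[OF C1(1)], rule exI[of _ C2], rule conjI[OF C2(1)], rule exI[of _ 1], rule conjI[OF zero_less_one], intro allI impI conjI)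
      fix x :: "nat \<Rightarrow> real^'n"
      assume g: "greedy_sequence 0 x"
      show "\<exists>D :: nat \<Rightarrow> real. \<forall>N\<ge>2.
          riesz_energy 0 N x = ereal (I * real N ^ 2 - D N * real N * ln (real N)) \<and>
          C1 \<le> D N \<and> D N \<le> 1 / 2 + C2 / ln (real N)"
      proof (intro exI[of _ "\<lambda>N. Dn N x"] allI impI conjI)
        fix N :: nat assume N: "N \<ge> 2"
        have gd: "good c0 x N" using gg g sd by simp
        have N0: "real N > 0" "ln (real N) > 0" using N by auto
        have nx: "norm (x i) = 1" if "i \<in> {1..N}" for i using greedy_norm[OF g] that by simp
        have ij: "inj_on x {1..N}" using inj[OF gd c0(1)] N by simp
        show "riesz_energy 0 N x = ereal (I * real N ^ 2 - Dn N x * real N * ln (real N))"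
          using riesz_energy_eq[OF order_refl nx ij] ren[OF N, of x] by simp
        have "0 < real N * ln (real N)" using N0 by simp
        then show "C1 \<le> Dn N x" using C1(2)[OF g N] unfolding Dn_def by (simp add: pos_le_divide_eq mult.assoc)
        have "I * (real N)\<^sup>2 - renergy 0 N x \<le> (1 / 2 + C2 / ln (real N)) * (real N * ln (real N))"
        proof -
          have "(1 / 2 + C2 / ln (real N)) * (real N * ln (real N)) = real N * ln (real N) / 2 + C2 * real N"
            using N0 by (simp add: field_simps)
          then show ?thesis using C2(2)[OF _ nx ij] N by simp
        qed
        then show "Dn N x \<le> 1 / 2 + C2 / ln (real N)"
          unfolding Dn_def using \<open>0 < real N * ln (real N)\<close> by (simp only: pos_divide_le_eq)
      qed
      fix N :: nat assume N: "N \<ge> 1"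
      show "polarization 0 N x \<le> ereal (I * real N + 1)"
        using greedy_step(3)[OF D order_refl g N] greedy_rpot_le[OF d3 g N] I0 by simp
    qed
  qed
qed

end
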